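(* Let $\mathcal T$ be a big tt-category, let $\mathcal K$ be a (compactly generated) $\mathcal T$-module, and let $(\mathrm s_\Gamma,\mathrm c_\Gamma)$ be a good support--cosupport pair on $\mathcal T$ induced by a map $\Gamma\colon S\to \mathrm{Ob}(\mathcal T)$. Then: (a) $\mathcal K$ is stratified with respect to $(\mathrm s_\Gamma,\mathrm c_\Gamma)$ if and only if $\mathcal K$ satisfies the local-to-global principle and minimality. (b) $\mathcal K$ is costratified with respect to $(\mathrm s_\Gamma,\mathrm c_\Gamma)$ if and only if $\mathcal K$ satisfies the colocal-to-global principle and cominimality.
   Context: A big tt-category is a rigidly-compactly generated tensor-triangulated category $\mathcal T=(\mathcal T,\otimes,1)$: a tensor-triangulated category with arbitrary coproducts (preserved by $\otimes$ in each variable), generated as a localizing subcategory by its compact objects, whose compact objects form an essentially small tensor-triangulated subcategory $\mathcal T^c$ and coincide with the rigid objects. Its internal hom is $[-,-]\colon\mathcal T^{op}\times\mathcal T\to\mathcal T$. A $\mathcal T$-module is a compactly generated triangulated category $\mathcal K$ with an action $\ast\colon\mathcal T\times\mathcal K\to\mathcal K$, a functor that is triangulated and coproduct-preserving in each variable, with natural isomorphisms $X\ast(Y\ast A)\cong(X\otimes Y)\ast A$ and $1\ast A\cong A$ satisfying the usual coherence conditions (Stevenson). For $X\in\mathcal T$, $[X,-]_\ast\colon\mathcal K\to\mathcal K$ denotes the right adjoint of $X\ast-$ (relative internal-hom). A localizing submodule of $\mathcal K$ is a localizing subcategory (triangulated, closed under coproducts) closed under $X\ast-$ for all $X\in\mathcal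 T$; a colocalizing $\hom$-submodule is a colocalizing subcategory (triangulated, closed under products) closed under $[X,-]_\ast$ for all $X\in\mathcal T$. $\mathrm{Loc}^\ast(\mathcal K)$ and $\mathrm{Coloc}^{\hom}(\mathcal K)$ denote the collections of these, and $\mathrm{loc}^\ast(\mathcal A)$, $\mathrm{coloc}^{\hom}(\mathcal A)$ the smallest ones containing a given collection of objects $\mathcal A$. $I_{\mathcal K}$ is the product of the Brown--Comenetz duals of the compact objects of $\mathcal K$ (one for each object of a skeleton), the dual of $x$ being the object representing $\mathrm{Hom}_{\mathbb Z}(\mathrm{Hom}_{\mathcal K}(x,-),\mathbb Q/\mathbb Z)$; one has that $\mathcal K$ is the smallest colocalizing subcategory containing $I_{\mathcal K}$. Let $S$ be a topological space and $\Gamma\colon S\to\mathrm{Ob}(\mathcal T)$, $s\mapsto\Gamma_s$, a map with $\Gamma_s\neq0$ for all $s$. It induces $\mathrm s_\Gamma(X)=\{s\in S\mid\Gamma_s\otimes X\ne0\}$ and $\mathrm c_\Gamma(X)=\{s\in S\mid[\Gamma_s,X]\neq0\}$ for $X \in \mathcal T$. The pair $(\mathrm s_\Gamma,\mathrm c_\Gamma)$ is good if $\Gamma_s\otimes\Gamma_r=0$ for $s\ne r$ and $\Gamma_s\otimes\Gamma_s\cong\Gamma_s\neq0$ for all $s$. For $A\in\mathcal K$ put $\mathrm s_\Gamma^\ast(A)=\{s\mid\Gamma_s\ast A\neq0\}$ and $\mathrm c_\Gamma^\ast(A)=\{s\mid[\Gamma_s,A]_\ast\neq0\}$. Define, for $W\subseteq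 S$, $\tau_{\mathrm s}(W)=\{A\in\mathcal K\mid\mathrm s^\ast_\Gamma(A)\subseteq W\}$, $\tau_{\mathrm c}(W)=\{A\in\mathcal K\mid\mathrm c^\ast_\Gamma(A)\subseteq W\}$ and, for $\mathcal L\in\mathrm{Loc}^\ast(\mathcal K)$, $\mathcal C\in\mathrm{Coloc}^{\hom}(\mathcal K)$, $\sigma_{\mathrm s}(\mathcal L)=\bigcup_{A\in\mathcal L}\mathrm s^\ast_\Gamma(A)$, $\sigma_{\mathrm c}(\mathcal C)=\bigcup_{A\in\mathcal C}\mathrm c^\ast_\Gamma(A)$. These take values in subsets of $\mathrm c_\Gamma^\ast(I_{\mathcal K})$. $\mathcal K$ is stratified if $\tau_{\mathrm s},\sigma_{\mathrm s}$ are mutually inverse bijections between the power set of $\mathrm c_\Gamma^\ast(I_{\mathcal K})$ and $\mathrm{Loc}^\ast(\mathcal K)$; it is costratified if $\tau_{\mathrm c},\sigma_{\mathrm c}$ are mutually inverse bijections between the power set of $\mathrm c_\Gamma^\ast(I_{\mathcal K})$ and $\mathrm{Coloc}^{\hom}(\mathcal K)$. Local-to-global principle: $\mathrm{loc}^\ast(A)=\mathrm{loc}^\ast(\Gamma_s\ast A\mid s\in S)$ for all $A\in\mathcal K$. Minimality: for all $s\in S$, $\mathrm{loc}^\ast(\Gamma_s\ast A\mid A\in\mathcal K)$ contains no non-zero proper localizing submodule of $\mathcal K$ (i.e. none other than $0$ and itself). Colocal-to-global principle: $\mathrm{coloc}^{\hom}(A)=\mathrm{coloc}^{\hom}([\Gamma_s,A]_\ast\mid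 s\in S)$ for all $A\in\mathcal K$. Cominimality: for all $s\in S$, $\mathrm{coloc}^{\hom}([\Gamma_s,I_{\mathcal K}]_\ast)$ contains no colocalizing $\hom$-submodule other than $0$ and itself. *)

theory Defs
  imports "HOL-Algebra.Free_Abelian_Groups" "HOL-Analysis.Abstract_Topology"
begin

section \<open>Universes\<close>

text \<open>
  The usual set/class distinction is taken relative to a fixed set \<open>U\<close> whose cardinality is
  uncountable, strong limit and regular, i.e. strongly inaccessible.  A set of any type is small if
  it has fewer elements than \<open>U\<close>.  Small families are indexed by small subsets of \<open>U\<close>, which
  is no restriction since every small set is in bijection with such a subset.  Objects of a
  category may form an arbitrarily large set.
\<close>

definition universe :: "'u set \<Rightarrow> bool" where
  "universe U \<longleftrightarrow>
     (UNIV :: nat set) \<prec> U \<and>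
     (\<forall>A\<subseteq>U. A \<prec> U \<longrightarrow> Pow A \<prec> U) \<and>
     (\<forall>I\<subseteq>U. \<forall>F. I \<prec> U \<and> (\<forall>i\<in>I. F i \<subseteq> U \<and> F i \<prec> U) \<longrightarrow> (\<Union>i\<in>I. F i) \<prec> U)"

definition small :: "'u set \<Rightarrow> 'a set \<Rightarrow> bool" where
  "small U A \<longleftrightarrow> A \<prec> U"


section \<open>Categories\<close>

record ('o, 'm) category =
  Obj :: "'o set"
  Mor :: "'m set"
  Src :: "'m \<Rightarrow> 'o"
  Tgt :: "'m \<Rightarrow> 'o"
  Ide :: "'o \<Rightarrow> 'm"
  Cmp :: "'m \<Rightarrow> 'm \<Rightarrow> 'm"  (infixr \<open>\<cdot>\<index>\<close> 70)

definition Hom :: "('o, 'm, 'z) category_scheme \<Rightarrow> 'o \<Rightarrow> 'o \<Rightarrow> 'm set" where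
  "Hom C X Y = {f \<in> Mor C. Src C f = X \<and> Tgt C f = Y}"

locale category =
  fixes C :: "('o, 'm, 'z) category_scheme" (structure)
  assumes Src_Obj: "f \<in> Mor C \<Longrightarrow> Src C f \<in> Obj C"
    and Tgt_Obj: "f \<in> Mor C \<Longrightarrow> Tgt C f \<in> Obj C"
    and Ide_Hom: "X \<in> Obj C \<Longrightarrow> Ide C X \<in> Hom C X X"
    and Cmp_Hom: "f \<in> Hom C X Y \<Longrightarrow> g \<in> Hom C Y Z \<Longrightarrow> g \<cdot> f \<in> Hom C X Z"
    and Cmp_Ide: "f \<in> Hom C X Y \<Longrightarrow> f \<cdot> Ide C X = f"
    and Ide_Cmp: "f \<in> Hom C X Y \<Longrightarrow> Ide C Y \<cdot> f = f"
    and Cmp_assoc: "f \<in> Hom C W X \<Longrightarrow> g \<in> Hom C X Y \<Longrightarrow> h \<in> Hom C Y Z \<Longrightarrow>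
                      (h \<cdot> g) \<cdot> f = h \<cdot> (g \<cdot> f)"

definition Iso :: "('o, 'm, 'z) category_scheme \<Rightarrow> 'o \<Rightarrow> 'o \<Rightarrow> 'm set" where
  "Iso C X Y = {f \<in> Hom C X Y. \<exists>g\<in>Hom C Y X. g \<cdot>\<^bsub>C\<^esub> f = Ide C X \<and> f \<cdot>\<^bsub>C\<^esub> g = Ide C Y}"

definition Inv :: "('o, 'm, 'z) category_scheme \<Rightarrow> 'm \<Rightarrow> 'm" where
  "Inv C f = (THE g. g \<in> Hom C (Tgt C f) (Src C f) \<and>
                     g \<cdot>\<^bsub>C\<^esub> f = Ide C (Src C f) \<and> f \<cdot>\<^bsub>C\<^esub> g = Ide C (Tgt C f))"

definition isomorphic :: "('o, 'm, 'z) category_scheme \<Rightarrow> 'o \<Rightarrow> 'o \<Rightarrow> bool" where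
  "isomorphic C X Y \<longleftrightarrow> Iso C X Y \<noteq> {}"

definition zero_object :: "('o, 'm, 'z) category_scheme \<Rightarrow> 'o \<Rightarrow> bool" where
  "zero_object C Z \<longleftrightarrow>
     Z \<in> Obj C \<and> (\<forall>X\<in>Obj C. (\<exists>!f. f \<in> Hom C Z X) \<and> (\<exists>!f. f \<in> Hom C X Z))"

definition is_coproduct ::
  "('o, 'm, 'z) category_scheme \<Rightarrow> 'i set \<Rightarrow> ('i \<Rightarrow> 'o) \<Rightarrow> 'o \<Rightarrow> ('i \<Rightarrow> 'm) \<Rightarrow> bool" where
  "is_coproduct C I A P \<iota> \<longleftrightarrow>
     P \<in> Obj C \<and> (\<forall>i\<in>I. \<iota> i \<in> Hom C (A i) P) \<and>
     (\<forall>Y\<in>Obj C. \<forall>f. (\<forall>i\<in>I. f i \<in> Hom C (A i) Y) \<longrightarrow>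
        (\<exists>!h. h \<in> Hom C P Y \<and> (\<forall>i\<in>I. h \<cdot>\<^bsub>C\<^esub> \<iota> i = f i)))"

definition is_product ::
  "('o, 'm, 'z) category_scheme \<Rightarrow> 'i set \<Rightarrow> ('i \<Rightarrow> 'o) \<Rightarrow> 'o \<Rightarrow> ('i \<Rightarrow> 'm) \<Rightarrow> bool" where
  "is_product C I A P \<pi> \<longleftrightarrow>
     P \<in> Obj C \<and> (\<forall>i\<in>I. \<pi> i \<in> Hom C P (A i)) \<and>
     (\<forall>Y\<in>Obj C. \<forall>f. (\<forall>i\<in>I. f i \<in> Hom C Y (A i)) \<longrightarrow>
        (\<exists>!h. h \<in> Hom C Y P \<and> (\<forall>i\<in>I. \<pi> i \<cdot>\<^bsub>C\<^esub> h = f i)))"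

definition locally_small :: "'u set \<Rightarrow> ('o, 'm, 'z) category_scheme \<Rightarrow> bool" where
  "locally_small U C \<longleftrightarrow> (\<forall>X\<in>Obj C. \<forall>Y\<in>Obj C. small U (Hom C X Y))"

definition has_coproducts :: "'u set \<Rightarrow> ('o, 'm, 'z) category_scheme \<Rightarrow> bool" where
  "has_coproducts U C \<longleftrightarrow>
     (\<forall>I\<subseteq>U. \<forall>A. small U I \<and> (\<forall>i\<in>I. A i \<in> Obj C) \<longrightarrow> (\<exists>P \<iota>. is_coproduct C I A P \<iota>))"

definition essentially_small :: "'u set \<Rightarrow> ('o, 'm, 'z) category_scheme \<Rightarrow> 'o set \<Rightarrow> bool" where
  "essentially_small U C L \<longleftrightarrow> (\<exists>R\<subseteq>L. small U R \<and> (\<forall>X\<in>L. \<exists>Y\<in>R. isomorphic C X Y))"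

definition is_skeleton :: "('o, 'm, 'z) category_scheme \<Rightarrow> 'o set \<Rightarrow> 'o set \<Rightarrow> bool" where
  "is_skeleton C L R \<longleftrightarrow> R \<subseteq> L \<and> (\<forall>X\<in>L. \<exists>!Y. Y \<in> R \<and> isomorphic C X Y)"

locale cat_functor = C: category C + D: category D
  for C :: "('o, 'm, 'y) category_scheme" and D :: "('k, 'n, 'z) category_scheme" +
  fixes FO :: "'o \<Rightarrow> 'k" and FM :: "'m \<Rightarrow> 'n"
  assumes FO_Obj: "X \<in> Obj C \<Longrightarrow> FO X \<in> Obj D"
    and FM_Hom: "f \<in> Hom C X Y \<Longrightarrow> FM f \<in> Hom D (FO X) (FO Y)"
    and FM_Ide: "X \<in> Obj C \<Longrightarrow> FM (Ide C X) = Ide D (FO X)"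
    and FM_Cmp: "f \<in> Hom C X Y \<Longrightarrow> g \<in> Hom C Y Z \<Longrightarrow> FM (g \<cdot>\<^bsub>C\<^esub> f) = FM g \<cdot>\<^bsub>D\<^esub> FM f"

definition preserves_coproducts ::
  "'u set \<Rightarrow> ('o, 'm, 'y) category_scheme \<Rightarrow> ('k, 'n, 'z) category_scheme \<Rightarrow>
   ('o \<Rightarrow> 'k) \<Rightarrow> ('m \<Rightarrow> 'n) \<Rightarrow> bool" where
  "preserves_coproducts U C D FO FM \<longleftrightarrow>
     (\<forall>I\<subseteq>U. \<forall>A P \<iota>. small U I \<and> is_coproduct C I A P \<iota> \<longrightarrow>
        is_coproduct D I (\<lambda>i. FO (A i)) (FO P) (\<lambda>i. FM (\<iota> i)))"

definition is_right_adjoint ::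
  "('o, 'm, 'y) category_scheme \<Rightarrow> ('k, 'n, 'z) category_scheme \<Rightarrow> ('o \<Rightarrow> 'k) \<Rightarrow> ('m \<Rightarrow> 'n) \<Rightarrow>
   ('k \<Rightarrow> 'o) \<Rightarrow> ('n \<Rightarrow> 'm) \<Rightarrow> bool" where
  "is_right_adjoint C D FO FM GO GM \<longleftrightarrow>
     cat_functor D C GO GM \<and>
     (\<exists>\<phi>. (\<forall>X\<in>Obj C. \<forall>A\<in>Obj D. bij_betw (\<phi> X A) (Hom D (FO X) A) (Hom C X (GO A))) \<and>
          (\<forall>X X' A A' u v f. u \<in> Hom C X' X \<and> v \<in> Hom D A A' \<and> f \<in> Hom D (FO X) A \<longrightarrow>
             \<phi> X' A' (v \<cdot>\<^bsub>D\<^esub> f \<cdot>\<^bsub>D\<^esub> FM u) = GM v \<cdot>\<^bsub>C\<^esub> \<phi> X A f \<cdot>\<^bsub>C\<^esub> u))"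

locale bifunctor = C: category C + D: category D + E: category E
  for C :: "('o, 'm, 'x) category_scheme" and D :: "('k, 'n, 'y) category_scheme"
    and E :: "('l, 'p, 'z) category_scheme" +
  fixes FO :: "'o \<Rightarrow> 'k \<Rightarrow> 'l" and FM :: "'m \<Rightarrow> 'n \<Rightarrow> 'p"
  assumes FO_Obj: "X \<in> Obj C \<Longrightarrow> A \<in> Obj D \<Longrightarrow> FO X A \<in> Obj E"
    and FM_Hom: "f \<in> Hom C X Y \<Longrightarrow> g \<in> Hom D A B \<Longrightarrow> FM f g \<in> Hom E (FO X A) (FO Y B)"
    and FM_Ide: "X \<in> Obj C \<Longrightarrow> A \<in> Obj D \<Longrightarrow> FM (Ide C X) (Ide D A) = Ide E (FO X A)"
    and FM_Cmp: "f \<in> Hom C X Y \<Longrightarrow> f' \<in> Hom C Y Z \<Longrightarrow> g \<in> Hom D A B \<Longrightarrow> g' \<in> Hom D B B' \<Longrightarrow>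
                   FM (f' \<cdot>\<^bsub>C\<^esub> f) (g' \<cdot>\<^bsub>D\<^esub> g) = FM f' g' \<cdot>\<^bsub>E\<^esub> FM f g"

definition coproduct_preserving_bifunctor ::
  "'u set \<Rightarrow> ('o, 'm, 'x) category_scheme \<Rightarrow> ('k, 'n, 'y) category_scheme \<Rightarrow>
   ('l, 'p, 'z) category_scheme \<Rightarrow> ('o \<Rightarrow> 'k \<Rightarrow> 'l) \<Rightarrow> ('m \<Rightarrow> 'n \<Rightarrow> 'p) \<Rightarrow> bool" where
  "coproduct_preserving_bifunctor U C D E FO FM \<longleftrightarrow>
     (\<forall>X\<in>Obj C. preserves_coproducts U D E (FO X) (FM (Ide C X))) \<and>
     (\<forall>A\<in>Obj D. preserves_coproducts U C E (\<lambda>X. FO X A) (\<lambda>f. FM f (Ide D A)))"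


section \<open>Triangulated categories\<close>

record ('o, 'm) preadditive_category = "('o, 'm) category" +
  ZeroM :: "'o \<Rightarrow> 'o \<Rightarrow> 'm"
  Add :: "'m \<Rightarrow> 'm \<Rightarrow> 'm"

text \<open>Abelian groups are \<open>comm_group\<close>s of HOL-Algebra, hence written multiplicatively.\<close>

definition Hom_group :: "('o, 'm, 'z) preadditive_category_scheme \<Rightarrow> 'o \<Rightarrow> 'o \<Rightarrow> 'm monoid" where
  "Hom_group C X Y = \<lparr>carrier = Hom C X Y, monoid.mult = Add C, one = ZeroM C X Y\<rparr>"

definition Neg :: "('o, 'm, 'z) preadditive_category_scheme \<Rightarrow> 'm \<Rightarrow> 'm" where
  "Neg C f = m_inv (Hom_group C (Src C f) (Tgt C f)) f"

locale additive_category = category C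
  for C :: "('o, 'm, 'z) preadditive_category_scheme" (structure) +
  assumes Hom_comm_group: "X \<in> Obj C \<Longrightarrow> Y \<in> Obj C \<Longrightarrow> comm_group (Hom_group C X Y)"
    and Cmp_Add: "f \<in> Hom C X Y \<Longrightarrow> f' \<in> Hom C X Y \<Longrightarrow> g \<in> Hom C Y Z \<Longrightarrow>
                    g \<cdot> Add C f f' = Add C (g \<cdot> f) (g \<cdot> f')"
    and Add_Cmp: "f \<in> Hom C X Y \<Longrightarrow> g \<in> Hom C Y Z \<Longrightarrow> g' \<in> Hom C Y Z \<Longrightarrow>
                    Add C g g' \<cdot> f = Add C (g \<cdot> f) (g' \<cdot> f)"
    and ex_zero_object: "\<exists>Z. zero_object C Z"
    and ex_binary_coproduct: "X \<in> Obj C \<Longrightarrow> Y \<in> Obj C \<Longrightarrow>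
           \<exists>P \<iota>. is_coproduct C (UNIV :: bool set) (\<lambda>b. if b then X else Y) P \<iota>"

locale additive_functor = cat_functor C D FO FM + C: additive_category C + D: additive_category D
  for C :: "('o, 'm, 'y) preadditive_category_scheme"
    and D :: "('k, 'n, 'z) preadditive_category_scheme"
    and FO :: "'o \<Rightarrow> 'k" and FM :: "'m \<Rightarrow> 'n" +
  assumes FM_Add: "f \<in> Hom C X Y \<Longrightarrow> g \<in> Hom C X Y \<Longrightarrow> FM (Add C f g) = Add D (FM f) (FM g)"

text \<open>\<open>ShO\<close>, \<open>ShM\<close> are the suspension \<open>\<Sigma>\<close> on objects and morphisms; \<open>(f, g, h) \<in> Tri\<close> stands
  for a distinguished triangle \<open>X \<rightarrow> Y \<rightarrow> Z \<rightarrow> \<Sigma> X\<close>.\<close>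

record ('o, 'm) triangulated_category = "('o, 'm) preadditive_category" +
  ShO :: "'o \<Rightarrow> 'o"
  ShM :: "'m \<Rightarrow> 'm"
  Tri :: "('m \<times> 'm \<times> 'm) set"

definition candidate_triangle ::
  "('o, 'm, 'z) triangulated_category_scheme \<Rightarrow> 'm \<Rightarrow> 'm \<Rightarrow> 'm \<Rightarrow> bool" where
  "candidate_triangle C f g h \<longleftrightarrow>
     (\<exists>X Y Z. f \<in> Hom C X Y \<and> g \<in> Hom C Y Z \<and> h \<in> Hom C Z (ShO C X))"

locale triangulated_category = additive_category C
  for C :: "('o, 'm, 'z) triangulated_category_scheme" (structure) +
  assumes shift_additive: "additive_functor C C (ShO C) (ShM C)"
    and shift_fully_faithful: "X \<in> Obj C \<Longrightarrow> Y \<in> Obj C \<Longrightarrow>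
           bij_betw (ShM C) (Hom C X Y) (Hom C (ShO C X) (ShO C Y))"
    and shift_essentially_surjective: "Y \<in> Obj C \<Longrightarrow> \<exists>X\<in>Obj C. isomorphic C (ShO C X) Y"
    and Tri_candidate: "(f, g, h) \<in> Tri C \<Longrightarrow> candidate_triangle C f g h"
    and TR1_iso: "(f, g, h) \<in> Tri C \<Longrightarrow> candidate_triangle C f' g' h' \<Longrightarrow>
           a \<in> Iso C (Src C f) (Src C f') \<Longrightarrow> b \<in> Iso C (Src C g) (Src C g') \<Longrightarrow>
           c \<in> Iso C (Src C h) (Src C h') \<Longrightarrow>
           b \<cdot> f = f' \<cdot> a \<Longrightarrow> c \<cdot> g = g' \<cdot> b \<Longrightarrow> ShM C a \<cdot> h = h' \<cdot> c \<Longrightarrow> (f', g', h') \<in> Tri C"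
    and TR1_Ide: "X \<in> Obj C \<Longrightarrow> zero_object C Z \<Longrightarrow>
           (Ide C X, ZeroM C X Z, ZeroM C Z (ShO C X)) \<in> Tri C"
    and TR1_cone: "f \<in> Mor C \<Longrightarrow> \<exists>g h. (f, g, h) \<in> Tri C"
    and TR2: "candidate_triangle C f g h \<Longrightarrow>
           (f, g, h) \<in> Tri C \<longleftrightarrow> (g, h, Neg C (ShM C f)) \<in> Tri C"
    and TR3: "(f, g, h) \<in> Tri C \<Longrightarrow> (f', g', h') \<in> Tri C \<Longrightarrow>
           a \<in> Hom C (Src C f) (Src C f') \<Longrightarrow> b \<in> Hom C (Src C g) (Src C g') \<Longrightarrow>
           b \<cdot> f = f' \<cdot> a \<Longrightarrow>
           \<exists>c \<in> Hom C (Src C h) (Src C h'). c \<cdot> g = g' \<cdot> b \<and> ShM C a \<cdot> h = h' \<cdot> c"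
    and TR4: "f \<in> Hom C X Y \<Longrightarrow> g \<in> Hom C Y Z \<Longrightarrow>
           (f, i, i') \<in> Tri C \<Longrightarrow> (g, j, j') \<in> Tri C \<Longrightarrow> (g \<cdot> f, k, k') \<in> Tri C \<Longrightarrow>
           \<exists>u v. (u, v, ShM C i \<cdot> j') \<in> Tri C \<and>
                 u \<in> Hom C (Src C i') (Src C k') \<and> v \<in> Hom C (Src C k') (Src C j') \<and>
                 u \<cdot> i = k \<cdot> g \<and> k' \<cdot> u = i' \<and> v \<cdot> k = j \<and> j' \<cdot> v = ShM C f \<cdot> k'"

locale triangulated_functor =
  additive_functor C D FO FM + C: triangulated_category C + D: triangulated_category D
  for C :: "('o, 'm, 'y) triangulated_category_scheme"
    and D :: "('k, 'n, 'z) triangulated_category_scheme"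
    and FO :: "'o \<Rightarrow> 'k" and FM :: "'m \<Rightarrow> 'n" +
  fixes \<theta> :: "'o \<Rightarrow> 'n"
  assumes theta_Iso: "X \<in> Obj C \<Longrightarrow> \<theta> X \<in> Iso D (FO (ShO C X)) (ShO D (FO X))"
    and theta_natural: "f \<in> Hom C X Y \<Longrightarrow>
           \<theta> Y \<cdot>\<^bsub>D\<^esub> FM (ShM C f) = ShM D (FM f) \<cdot>\<^bsub>D\<^esub> \<theta> X"
    and FM_Tri: "(f, g, h) \<in> Tri C \<Longrightarrow> (FM f, FM g, \<theta> (Src C f) \<cdot>\<^bsub>D\<^esub> FM h) \<in> Tri D"

locale biexact_functor = bifunctor C D E FO FM +
  C: triangulated_category C + D: triangulated_category D + E: triangulated_category E
  for C :: "('o, 'm, 'x) triangulated_category_scheme"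
    and D :: "('k, 'n, 'y) triangulated_category_scheme"
    and E :: "('l, 'p, 'z) triangulated_category_scheme"
    and FO :: "'o \<Rightarrow> 'k \<Rightarrow> 'l" and FM :: "'m \<Rightarrow> 'n \<Rightarrow> 'p" +
  fixes shl :: "'o \<Rightarrow> 'k \<Rightarrow> 'p"  \<comment> \<open>\<open>F(\<Sigma> X, A) \<rightarrow> \<Sigma> F(X, A)\<close>\<close>
    and shr :: "'o \<Rightarrow> 'k \<Rightarrow> 'p"  \<comment> \<open>\<open>F(X, \<Sigma> A) \<rightarrow> \<Sigma> F(X, A)\<close>\<close>
  assumes exact_left: "A \<in> Obj D \<Longrightarrow>
           triangulated_functor C E (\<lambda>X. FO X A) (\<lambda>f. FM f (Ide D A)) (\<lambda>X. shl X A)"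
    and exact_right: "X \<in> Obj C \<Longrightarrow>
           triangulated_functor D E (FO X) (FM (Ide C X)) (shr X)"
    and shl_natural: "X \<in> Obj C \<Longrightarrow> g \<in> Hom D A B \<Longrightarrow>
           shl X B \<cdot>\<^bsub>E\<^esub> FM (Ide C (ShO C X)) g = ShM E (FM (Ide C X) g) \<cdot>\<^bsub>E\<^esub> shl X A"
    and shr_natural: "f \<in> Hom C X Y \<Longrightarrow> A \<in> Obj D \<Longrightarrow>
           shr Y A \<cdot>\<^bsub>E\<^esub> FM f (Ide D (ShO D A)) = ShM E (FM f (Ide D A)) \<cdot>\<^bsub>E\<^esub> shr X A"

definition triangulated_subcategory ::
  "('o, 'm, 'z) triangulated_category_scheme \<Rightarrow> 'o set \<Rightarrow> bool" where
  "triangulated_subcategory C L \<longleftrightarrow>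
     L \<subseteq> Obj C \<and> {X. zero_object C X} \<subseteq> L \<and>
     (\<forall>X\<in>L. \<forall>Y\<in>Obj C. isomorphic C X Y \<longrightarrow> Y \<in> L) \<and>
     (\<forall>X\<in>Obj C. ShO C X \<in> L \<longleftrightarrow> X \<in> L) \<and>
     (\<forall>(f, g, h)\<in>Tri C. Src C f \<in> L \<and> Src C g \<in> L \<longrightarrow> Src C h \<in> L)"

definition localizing_subcategory ::
  "'u set \<Rightarrow> ('o, 'm, 'z) triangulated_category_scheme \<Rightarrow> 'o set \<Rightarrow> bool" where
  "localizing_subcategory U C L \<longleftrightarrow>
     triangulated_subcategory C L \<and>
     (\<forall>I\<subseteq>U. \<forall>A P \<iota>. small U I \<and> (\<forall>i\<in>I. A i \<in> L) \<and> is_coproduct C I A P \<iota> \<longrightarrow> P \<in> L)"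

definition colocalizing_subcategory ::
  "'u set \<Rightarrow> ('o, 'm, 'z) triangulated_category_scheme \<Rightarrow> 'o set \<Rightarrow> bool" where
  "colocalizing_subcategory U C L \<longleftrightarrow>
     triangulated_subcategory C L \<and>
     (\<forall>I\<subseteq>U. \<forall>A P \<pi>. small U I \<and> (\<forall>i\<in>I. A i \<in> L) \<and> is_product C I A P \<pi> \<longrightarrow> P \<in> L)"

text \<open>\<open>X\<close> is compact if the canonical map \<open>\<Oplus>\<^sub>i Hom(X, A\<^sub>i) \<rightarrow> Hom(X, \<Coprod>\<^sub>i A\<^sub>i)\<close> is an
  isomorphism; \<open>gfinprod\<close> is the sum over the finite support.\<close>

definition compact_object ::
  "'u set \<Rightarrow> ('o, 'm, 'z) preadditive_category_scheme \<Rightarrow> 'o \<Rightarrow> bool" where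
  "compact_object U C X \<longleftrightarrow>
     X \<in> Obj C \<and>
     (\<forall>I\<subseteq>U. \<forall>A P \<iota>. small U I \<and> is_coproduct C I A P \<iota> \<longrightarrow>
        (\<lambda>f. gfinprod (Hom_group C X P) (\<lambda>i. \<iota> i \<cdot>\<^bsub>C\<^esub> f i) I)
          \<in> iso (sum_group I (\<lambda>i. Hom_group C X (A i))) (Hom_group C X P))"

locale compactly_generated = triangulated_category C
  for U :: "'u set" and C :: "('o, 'm, 'z) triangulated_category_scheme" (structure) +
  assumes locally_small: "locally_small U C"
    and has_coproducts: "has_coproducts U C"
    and compacts_essentially_small: "essentially_small U C {X. compact_object U C X}"
    and compacts_generate: "localizing_subcategory U C hull {X. compact_object U C X} = Obj C"


section \<open>Big tt-categories\<close>

text \<open>\<open>TenO\<close>, \<open>TenM\<close> are the tensor product on objects and morphisms, \<open>TenShL X Y : \<Sigma>X \<otimes> Y \<rightarrow>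
  \<Sigma>(X \<otimes> Y)\<close> and \<open>TenShR X Y : X \<otimes> \<Sigma>Y \<rightarrow> \<Sigma>(X \<otimes> Y)\<close> witness its exactness.\<close>

record ('o, 'm) tt_category = "('o, 'm) triangulated_category" +
  TenO :: "'o \<Rightarrow> 'o \<Rightarrow> 'o"  (infixr \<open>\<boxtimes>\<index>\<close> 75)
  TenM :: "'m \<Rightarrow> 'm \<Rightarrow> 'm"  (infixr \<open>\<boxdot>\<index>\<close> 75)
  Unit :: "'o"
  Assoc :: "'o \<Rightarrow> 'o \<Rightarrow> 'o \<Rightarrow> 'm"
  LUnit :: "'o \<Rightarrow> 'm"
  RUnit :: "'o \<Rightarrow> 'm"
  Braid :: "'o \<Rightarrow> 'o \<Rightarrow> 'm"
  TenShL :: "'o \<Rightarrow> 'o \<Rightarrow> 'm"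
  TenShR :: "'o \<Rightarrow> 'o \<Rightarrow> 'm"

locale symmetric_monoidal_category = bifunctor T T T "TenO T" "TenM T"
  for T :: "('o, 'm, 'z) tt_category_scheme" (structure) +
  assumes Unit_Obj: "Unit T \<in> Obj T"
    and Assoc_Iso: "X \<in> Obj T \<Longrightarrow> Y \<in> Obj T \<Longrightarrow> Z \<in> Obj T \<Longrightarrow>
           Assoc T X Y Z \<in> Iso T ((X \<boxtimes> Y) \<boxtimes> Z) (X \<boxtimes> (Y \<boxtimes> Z))"
    and Assoc_natural: "f \<in> Hom T X X' \<Longrightarrow> g \<in> Hom T Y Y' \<Longrightarrow> h \<in> Hom T Z Z' \<Longrightarrow>
           Assoc T X' Y' Z' \<cdot> ((f \<boxdot> g) \<boxdot> h) = (f \<boxdot> (g \<boxdot> h)) \<cdot> Assoc T X Y Z"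
    and LUnit_Iso: "X \<in> Obj T \<Longrightarrow> LUnit T X \<in> Iso T (Unit T \<boxtimes> X) X"
    and LUnit_natural: "f \<in> Hom T X Y \<Longrightarrow> LUnit T Y \<cdot> (Ide T (Unit T) \<boxdot> f) = f \<cdot> LUnit T X"
    and RUnit_Iso: "X \<in> Obj T \<Longrightarrow> RUnit T X \<in> Iso T (X \<boxtimes> Unit T) X"
    and RUnit_natural: "f \<in> Hom T X Y \<Longrightarrow> RUnit T Y \<cdot> (f \<boxdot> Ide T (Unit T)) = f \<cdot> RUnit T X"
    and Braid_Iso: "X \<in> Obj T \<Longrightarrow> Y \<in> Obj T \<Longrightarrow> Braid T X Y \<in> Iso T (X \<boxtimes> Y) (Y \<boxtimes> X)"
    and Braid_natural: "f \<in> Hom T X X' \<Longrightarrow> g \<in> Hom T Y Y' \<Longrightarrow>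
           Braid T X' Y' \<cdot> (f \<boxdot> g) = (g \<boxdot> f) \<cdot> Braid T X Y"
    and pentagon: "W \<in> Obj T \<Longrightarrow> X \<in> Obj T \<Longrightarrow> Y \<in> Obj T \<Longrightarrow> Z \<in> Obj T \<Longrightarrow>
           Assoc T W X (Y \<boxtimes> Z) \<cdot> Assoc T (W \<boxtimes> X) Y Z =
           (Ide T W \<boxdot> Assoc T X Y Z) \<cdot> Assoc T W (X \<boxtimes> Y) Z \<cdot> (Assoc T W X Y \<boxdot> Ide T Z)"
    and triangle: "X \<in> Obj T \<Longrightarrow> Y \<in> Obj T \<Longrightarrow>
           (Ide T X \<boxdot> LUnit T Y) \<cdot> Assoc T X (Unit T) Y = RUnit T X \<boxdot> Ide T Y"
    and symmetry: "X \<in> Obj T \<Longrightarrow> Y \<in> Obj T \<Longrightarrow> Braid T Y X \<cdot> Braid T X Y = Ide T (X \<boxtimes> Y)"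
    and hexagon: "X \<in> Obj T \<Longrightarrow> Y \<in> Obj T \<Longrightarrow> Z \<in> Obj T \<Longrightarrow>
           Assoc T Y Z X \<cdot> Braid T X (Y \<boxtimes> Z) \<cdot> Assoc T X Y Z =
           (Ide T Y \<boxdot> Braid T X Z) \<cdot> Assoc T Y X Z \<cdot> (Braid T X Y \<boxdot> Ide T Z)"

locale tt_category = triangulated_category T + symmetric_monoidal_category T +
  biexact_functor T T T "TenO T" "TenM T" "TenShL T" "TenShR T"
  for T :: "('o, 'm, 'z) tt_category_scheme" (structure)

text \<open>Rigid (strongly dualizable) objects: those with a dual \<open>Y\<close>, evaluation \<open>e : Y \<otimes> X \<rightarrow> 1\<close>
  and coevaluation \<open>c : 1 \<rightarrow> X \<otimes> Y\<close> satisfying the triangle identities.\<close>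

definition rigid_object :: "('o, 'm, 'z) tt_category_scheme \<Rightarrow> 'o \<Rightarrow> bool" where
  "rigid_object T X \<longleftrightarrow>
     X \<in> Obj T \<and>
     (\<exists>Y\<in>Obj T. \<exists>e\<in>Hom T (Y \<boxtimes>\<^bsub>T\<^esub> X) (Unit T). \<exists>c\<in>Hom T (Unit T) (X \<boxtimes>\<^bsub>T\<^esub> Y).
        RUnit T X \<cdot>\<^bsub>T\<^esub> (Ide T X \<boxdot>\<^bsub>T\<^esub> e) \<cdot>\<^bsub>T\<^esub> Assoc T X Y X \<cdot>\<^bsub>T\<^esub> (c \<boxdot>\<^bsub>T\<^esub> Ide T X)
          = LUnit T X \<and>
        LUnit T Y \<cdot>\<^bsub>T\<^esub> (e \<boxdot>\<^bsub>T\<^esub> Ide T Y) \<cdot>\<^bsub>T\<^esub> Inv T (Assoc T Y X Y) \<cdot>\<^bsub>T\<^esub> (Ide T Y \<boxdot>\<^bsub>T\<^esub> c)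
          = RUnit T Y)"

locale big_tt_category = tt_category T + compactly_generated U T
  for U :: "'u set" and T :: "('o, 'm, 'z) tt_category_scheme" (structure) +
  assumes tensor_coproducts: "coproduct_preserving_bifunctor U T T T (TenO T) (TenM T)"
    and compacts_triangulated: "triangulated_subcategory T {X. compact_object U T X}"
    and Unit_compact: "compact_object U T (Unit T)"
    and tensor_compact: "compact_object U T X \<Longrightarrow> compact_object U T Y \<Longrightarrow>
           compact_object U T (X \<boxtimes> Y)"
    and compact_iff_rigid: "compact_object U T X \<longleftrightarrow> rigid_object T X"


section \<open>Modules over a big tt-category\<close>

record ('o, 'm, 'k, 'n) tt_action =
  ActO :: "'o \<Rightarrow> 'k \<Rightarrow> 'k"  (infixr \<open>\<ast>\<index>\<close> 75)
  ActM :: "'m \<Rightarrow> 'n \<Rightarrow> 'n"  (infixr \<open>\<star>\<index>\<close> 75)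
  ActAssoc :: "'o \<Rightarrow> 'o \<Rightarrow> 'k \<Rightarrow> 'n"
  ActUnit :: "'k \<Rightarrow> 'n"
  ActShL :: "'o \<Rightarrow> 'k \<Rightarrow> 'n"
  ActShR :: "'o \<Rightarrow> 'k \<Rightarrow> 'n"

text \<open>
  Coherence in the sense of Stevenson: pentagon and unit axioms, compatibility of associator and
  unitor with the suspension isomorphisms in each variable, and the sign rule comparing the two
  isomorphisms from \<open>\<Sigma>\<^sup>r1 * \<Sigma>\<^sup>sA\<close> to \<open>\<Sigma>\<^sup>r\<^sup>+\<^sup>sA\<close>.  The sign rule is imposed for \<open>r = s = 1\<close>; the case
  of general \<open>r, s\<close> follows, since the suspension isomorphisms for powers of \<open>\<Sigma>\<close> are
  iterates of those for \<open>\<Sigma>\<close> and their inverses.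
\<close>

locale tt_module = T: big_tt_category U T + K: compactly_generated U K +
  biexact_functor T K K "ActO M" "ActM M" "ActShL M" "ActShR M"
  for U :: "'u set"
    and T :: "('o, 'm, 'y) tt_category_scheme"
    and K :: "('k, 'n, 'z) triangulated_category_scheme"
    and M :: "('o, 'm, 'k, 'n, 'x) tt_action_scheme" +
  assumes act_coproducts: "coproduct_preserving_bifunctor U T K K (ActO M) (ActM M)"
    and ActAssoc_Iso: "X \<in> Obj T \<Longrightarrow> Y \<in> Obj T \<Longrightarrow> A \<in> Obj K \<Longrightarrow>
           ActAssoc M X Y A \<in> Iso K ((X \<boxtimes>\<^bsub>T\<^esub> Y) \<ast>\<^bsub>M\<^esub> A) (X \<ast>\<^bsub>M\<^esub> (Y \<ast>\<^bsub>M\<^esub> A))"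
    and ActAssoc_natural: "f \<in> Hom T X X' \<Longrightarrow> g \<in> Hom T Y Y' \<Longrightarrow> h \<in> Hom K A A' \<Longrightarrow>
           ActAssoc M X' Y' A' \<cdot>\<^bsub>K\<^esub> ((f \<boxdot>\<^bsub>T\<^esub> g) \<star>\<^bsub>M\<^esub> h) = (f \<star>\<^bsub>M\<^esub> (g \<star>\<^bsub>M\<^esub> h)) \<cdot>\<^bsub>K\<^esub> ActAssoc M X Y A"
    and ActUnit_Iso: "A \<in> Obj K \<Longrightarrow> ActUnit M A \<in> Iso K (Unit T \<ast>\<^bsub>M\<^esub> A) A"
    and ActUnit_natural: "h \<in> Hom K A B \<Longrightarrow>
           ActUnit M B \<cdot>\<^bsub>K\<^esub> (Ide T (Unit T) \<star>\<^bsub>M\<^esub> h) = h \<cdot>\<^bsub>K\<^esub> ActUnit M A"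
    and act_pentagon: "X \<in> Obj T \<Longrightarrow> Y \<in> Obj T \<Longrightarrow> Z \<in> Obj T \<Longrightarrow> A \<in> Obj K \<Longrightarrow>
           ActAssoc M X Y (Z \<ast>\<^bsub>M\<^esub> A) \<cdot>\<^bsub>K\<^esub> ActAssoc M (X \<boxtimes>\<^bsub>T\<^esub> Y) Z A =
           (Ide T X \<star>\<^bsub>M\<^esub> ActAssoc M Y Z A) \<cdot>\<^bsub>K\<^esub> ActAssoc M X (Y \<boxtimes>\<^bsub>T\<^esub> Z) A \<cdot>\<^bsub>K\<^esub>
             (Assoc T X Y Z \<star>\<^bsub>M\<^esub> Ide K A)"
    and act_unit_right: "X \<in> Obj T \<Longrightarrow> A \<in> Obj K \<Longrightarrow>
           (Ide T X \<star>\<^bsub>M\<^esub> ActUnit M A) \<cdot>\<^bsub>K\<^esub> ActAssoc M X (Unit T) A = RUnit T X \<star>\<^bsub>M\<^esub> Ide K A"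
    and act_unit_left: "X \<in> Obj T \<Longrightarrow> A \<in> Obj K \<Longrightarrow>
           ActUnit M (X \<ast>\<^bsub>M\<^esub> A) \<cdot>\<^bsub>K\<^esub> ActAssoc M (Unit T) X A = LUnit T X \<star>\<^bsub>M\<^esub> Ide K A"
    and ActAssoc_shift_1: "X \<in> Obj T \<Longrightarrow> Y \<in> Obj T \<Longrightarrow> A \<in> Obj K \<Longrightarrow>
           ShM K (ActAssoc M X Y A) \<cdot>\<^bsub>K\<^esub> ActShL M (X \<boxtimes>\<^bsub>T\<^esub> Y) A \<cdot>\<^bsub>K\<^esub> (TenShL T X Y \<star>\<^bsub>M\<^esub> Ide K A) =
           ActShL M X (Y \<ast>\<^bsub>M\<^esub> A) \<cdot>\<^bsub>K\<^esub> ActAssoc M (ShO T X) Y A"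
    and ActAssoc_shift_2: "X \<in> Obj T \<Longrightarrow> Y \<in> Obj T \<Longrightarrow> A \<in> Obj K \<Longrightarrow>
           ShM K (ActAssoc M X Y A) \<cdot>\<^bsub>K\<^esub> ActShL M (X \<boxtimes>\<^bsub>T\<^esub> Y) A \<cdot>\<^bsub>K\<^esub> (TenShR T X Y \<star>\<^bsub>M\<^esub> Ide K A) =
           ActShR M X (Y \<ast>\<^bsub>M\<^esub> A) \<cdot>\<^bsub>K\<^esub> (Ide T X \<star>\<^bsub>M\<^esub> ActShL M Y A) \<cdot>\<^bsub>K\<^esub> ActAssoc M X (ShO T Y) A"
    and ActAssoc_shift_3: "X \<in> Obj T \<Longrightarrow> Y \<in> Obj T \<Longrightarrow> A \<in> Obj K \<Longrightarrow>
           ShM K (ActAssoc M X Y A) \<cdot>\<^bsub>K\<^esub> ActShR M (X \<boxtimes>\<^bsub>T\<^esub> Y) A =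
           ActShR M X (Y \<ast>\<^bsub>M\<^esub> A) \<cdot>\<^bsub>K\<^esub> (Ide T X \<star>\<^bsub>M\<^esub> ActShR M Y A) \<cdot>\<^bsub>K\<^esub> ActAssoc M X Y (ShO K A)"
    and ActUnit_shift: "A \<in> Obj K \<Longrightarrow>
           ShM K (ActUnit M A) \<cdot>\<^bsub>K\<^esub> ActShR M (Unit T) A = ActUnit M (ShO K A)"
    and shift_sign: "A \<in> Obj K \<Longrightarrow>
           ShM K (ActUnit M (ShO K A)) \<cdot>\<^bsub>K\<^esub> ActShL M (Unit T) (ShO K A) =
           Neg K (ShM K (ShM K (ActUnit M A)) \<cdot>\<^bsub>K\<^esub> ShM K (ActShL M (Unit T) A) \<cdot>\<^bsub>K\<^esub>
                    ActShR M (ShO T (Unit T)) A)"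

text \<open>\<open>rel_hom T K M X A\<close> is \<open>[X, A]\<^sub>*\<close>.  The right adjoint exists by Brown representability; the
  choice made by \<open>SOME\<close> is immaterial since right adjoints are unique up to isomorphism.\<close>

definition rel_hom_functor ::
  "('o, 'm) tt_category \<Rightarrow> ('k, 'n) triangulated_category \<Rightarrow> ('o, 'm, 'k, 'n) tt_action \<Rightarrow>
   'o \<Rightarrow> ('k \<Rightarrow> 'k) \<times> ('n \<Rightarrow> 'n)" where
  "rel_hom_functor T K M X =
     (SOME G. is_right_adjoint K K (ActO M X) (ActM M (Ide T X)) (fst G) (snd G))"

definition rel_hom ::
  "('o, 'm) tt_category \<Rightarrow> ('k, 'n) triangulated_category \<Rightarrow> ('o, 'm, 'k, 'n) tt_action \<Rightarrow>
   'o \<Rightarrow> 'k \<Rightarrow> 'k" where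
  "rel_hom T K M X = fst (rel_hom_functor T K M X)"

definition localizing_submodule ::
  "'u set \<Rightarrow> ('o, 'm) tt_category \<Rightarrow> ('k, 'n) triangulated_category \<Rightarrow>
   ('o, 'm, 'k, 'n) tt_action \<Rightarrow> 'k set \<Rightarrow> bool" where
  "localizing_submodule U T K M L \<longleftrightarrow>
     localizing_subcategory U K L \<and> (\<forall>X\<in>Obj T. \<forall>A\<in>L. X \<ast>\<^bsub>M\<^esub> A \<in> L)"

definition colocalizing_hom_submodule ::
  "'u set \<Rightarrow> ('o, 'm) tt_category \<Rightarrow> ('k, 'n) triangulated_category \<Rightarrow>
   ('o, 'm, 'k, 'n) tt_action \<Rightarrow> 'k set \<Rightarrow> bool" where
  "colocalizing_hom_submodule U T K M L \<longleftrightarrow>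
     colocalizing_subcategory U K L \<and> (\<forall>X\<in>Obj T. \<forall>A\<in>L. rel_hom T K M X A \<in> L)"

text \<open>\<open>loc U T K M \<A>\<close> and \<open>coloc U T K M \<A>\<close> are \<open>loc\<^sup>*(\<A>)\<close> and \<open>coloc\<^sup>h\<^sup>o\<^sup>m(\<A>)\<close>.\<close>

definition loc ::
  "'u set \<Rightarrow> ('o, 'm) tt_category \<Rightarrow> ('k, 'n) triangulated_category \<Rightarrow>
   ('o, 'm, 'k, 'n) tt_action \<Rightarrow> 'k set \<Rightarrow> 'k set" where
  "loc U T K M \<A> = localizing_submodule U T K M hull \<A>"

definition coloc ::
  "'u set \<Rightarrow> ('o, 'm) tt_category \<Rightarrow> ('k, 'n) triangulated_category \<Rightarrow>
   ('o, 'm, 'k, 'n) tt_action \<Rightarrow> 'k set \<Rightarrow> 'k set" where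
  "coloc U T K M \<A> = colocalizing_hom_submodule U T K M hull \<A>"


section \<open>The Brown--Comenetz cogenerator\<close>

definition QZ :: "rat set monoid" where
  "QZ = \<lparr>carrier = UNIV, monoid.mult = (+), one = 0\<rparr> Mod \<int>"

text \<open>\<open>Hom\<^sub>\<int>(G, \<rat>/\<int>)\<close>; its elements are made extensional so that equality is pointwise equality on
  \<open>carrier G\<close>.\<close>

definition char_group :: "('a, 'b) monoid_scheme \<Rightarrow> ('a \<Rightarrow> rat set) monoid" where
  "char_group G =
     \<lparr>carrier = hom G QZ \<inter> extensional (carrier G),
      monoid.mult = (\<lambda>\<chi> \<psi>. \<lambda>x\<in>carrier G. \<chi> x \<otimes>\<^bsub>QZ\<^esub> \<psi> x),
      one = (\<lambda>x\<in>carrier G. \<one>\<^bsub>QZ\<^esub>)\<rparr>"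

definition is_Brown_Comenetz_dual ::
  "('k, 'n, 'z) preadditive_category_scheme \<Rightarrow> 'k \<Rightarrow> 'k \<Rightarrow> bool" where
  "is_Brown_Comenetz_dual K x D \<longleftrightarrow>
     D \<in> Obj K \<and>
     (\<exists>\<phi>. (\<forall>y\<in>Obj K. \<phi> y \<in> iso (Hom_group K y D) (char_group (Hom_group K x y))) \<and>
          (\<forall>y y' f g h. g \<in> Hom K y' y \<and> f \<in> Hom K y D \<and> h \<in> Hom K x y' \<longrightarrow>
             \<phi> y' (f \<cdot>\<^bsub>K\<^esub> g) h = \<phi> y f (g \<cdot>\<^bsub>K\<^esub> h)))"

definition is_Brown_Comenetz_cogenerator ::
  "'u set \<Rightarrow> ('k, 'n, 'z) preadditive_category_scheme \<Rightarrow> 'k \<Rightarrow> bool" where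
  "is_Brown_Comenetz_cogenerator U K I \<longleftrightarrow>
     (\<exists>R D \<pi>. is_skeleton K {x. compact_object U K x} R \<and>
        (\<forall>x\<in>R. is_Brown_Comenetz_dual K x (D x)) \<and> is_product K R D I \<pi>)"

definition BC_cogenerator :: "'u set \<Rightarrow> ('k, 'n, 'z) preadditive_category_scheme \<Rightarrow> 'k" where
  "BC_cogenerator U K = (SOME I. is_Brown_Comenetz_cogenerator U K I)"


section \<open>Stratification and costratification\<close>

text \<open>\<open>\<Gamma>\<close> is only relevant on \<open>topspace S\<close>.  Goodness of the support--cosupport pair on \<open>T\<close> induced
  by \<open>\<Gamma>\<close> is a condition on \<open>\<Gamma>\<close> alone.\<close>

definition good_support_cosupport_pair ::
  "('o, 'm) tt_category \<Rightarrow> 's topology \<Rightarrow> ('s \<Rightarrow> 'o) \<Rightarrow> bool" where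
  "good_support_cosupport_pair T S \<Gamma> \<longleftrightarrow>
     (\<forall>s\<in>topspace S. \<Gamma> s \<in> Obj T \<and> \<not> zero_object T (\<Gamma> s)) \<and>
     (\<forall>s\<in>topspace S. \<forall>r\<in>topspace S. s \<noteq> r \<longrightarrow> zero_object T (\<Gamma> s \<boxtimes>\<^bsub>T\<^esub> \<Gamma> r)) \<and>
     (\<forall>s\<in>topspace S. isomorphic T (\<Gamma> s \<boxtimes>\<^bsub>T\<^esub> \<Gamma> s) (\<Gamma> s))"

definition supp ::
  "('k, 'n) triangulated_category \<Rightarrow> ('o, 'm, 'k, 'n) tt_action \<Rightarrow>
   's topology \<Rightarrow> ('s \<Rightarrow> 'o) \<Rightarrow> 'k \<Rightarrow> 's set" where
  "supp K M S \<Gamma> A = {s \<in> topspace S. \<not> zero_object K (\<Gamma> s \<ast>\<^bsub>M\<^esub> A)}"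

definition cosupp ::
  "('o, 'm) tt_category \<Rightarrow> ('k, 'n) triangulated_category \<Rightarrow> ('o, 'm, 'k, 'n) tt_action \<Rightarrow>
   's topology \<Rightarrow> ('s \<Rightarrow> 'o) \<Rightarrow> 'k \<Rightarrow> 's set" where
  "cosupp T K M S \<Gamma> A = {s \<in> topspace S. \<not> zero_object K (rel_hom T K M (\<Gamma> s) A)}"

definition tau_s ::
  "('k, 'n) triangulated_category \<Rightarrow> ('o, 'm, 'k, 'n) tt_action \<Rightarrow>
   's topology \<Rightarrow> ('s \<Rightarrow> 'o) \<Rightarrow> 's set \<Rightarrow> 'k set" where
  "tau_s K M S \<Gamma> W = {A \<in> Obj K. supp K M S \<Gamma> A \<subseteq> W}"

definition sigma_s ::
  "('k, 'n) triangulated_category \<Rightarrow> ('o, 'm, 'k, 'n) tt_action \<Rightarrow>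
   's topology \<Rightarrow> ('s \<Rightarrow> 'o) \<Rightarrow> 'k set \<Rightarrow> 's set" where
  "sigma_s K M S \<Gamma> L = (\<Union>A\<in>L. supp K M S \<Gamma> A)"

definition tau_c ::
  "('o, 'm) tt_category \<Rightarrow> ('k, 'n) triangulated_category \<Rightarrow> ('o, 'm, 'k, 'n) tt_action \<Rightarrow>
   's topology \<Rightarrow> ('s \<Rightarrow> 'o) \<Rightarrow> 's set \<Rightarrow> 'k set" where
  "tau_c T K M S \<Gamma> W = {A \<in> Obj K. cosupp T K M S \<Gamma> A \<subseteq> W}"

definition sigma_c ::
  "('o, 'm) tt_category \<Rightarrow> ('k, 'n) triangulated_category \<Rightarrow> ('o, 'm, 'k, 'n) tt_action \<Rightarrow>
   's topology \<Rightarrow> ('s \<Rightarrow> 'o) \<Rightarrow> 'k set \<Rightarrow> 's set" where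
  "sigma_c T K M S \<Gamma> L = (\<Union>A\<in>L. cosupp T K M S \<Gamma> A)"

definition mutually_inverse_bijections ::
  "'a set \<Rightarrow> 'b set \<Rightarrow> ('a \<Rightarrow> 'b) \<Rightarrow> ('b \<Rightarrow> 'a) \<Rightarrow> bool" where
  "mutually_inverse_bijections A B f g \<longleftrightarrow>
     bij_betw f A B \<and> bij_betw g B A \<and> (\<forall>x\<in>A. g (f x) = x) \<and> (\<forall>y\<in>B. f (g y) = y)"

definition stratified ::
  "'u set \<Rightarrow> ('o, 'm) tt_category \<Rightarrow> ('k, 'n) triangulated_category \<Rightarrow>
   ('o, 'm, 'k, 'n) tt_action \<Rightarrow> 's topology \<Rightarrow> ('s \<Rightarrow> 'o) \<Rightarrow> bool" where
  "stratified U T K M S \<Gamma> \<longleftrightarrow>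
     mutually_inverse_bijections
       (Pow (cosupp T K M S \<Gamma> (BC_cogenerator U K))) {L. localizing_submodule U T K M L}
       (tau_s K M S \<Gamma>) (sigma_s K M S \<Gamma>)"

definition costratified ::
  "'u set \<Rightarrow> ('o, 'm) tt_category \<Rightarrow> ('k, 'n) triangulated_category \<Rightarrow>
   ('o, 'm, 'k, 'n) tt_action \<Rightarrow> 's topology \<Rightarrow> ('s \<Rightarrow> 'o) \<Rightarrow> bool" where
  "costratified U T K M S \<Gamma> \<longleftrightarrow>
     mutually_inverse_bijections
       (Pow (cosupp T K M S \<Gamma> (BC_cogenerator U K))) {L. colocalizing_hom_submodule U T K M L}
       (tau_c T K M S \<Gamma>) (sigma_c T K M S \<Gamma>)"

definition local_to_global ::
  "'u set \<Rightarrow> ('o, 'm) tt_category \<Rightarrow> ('k, 'n) triangulated_category \<Rightarrow>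
   ('o, 'm, 'k, 'n) tt_action \<Rightarrow> 's topology \<Rightarrow> ('s \<Rightarrow> 'o) \<Rightarrow> bool" where
  "local_to_global U T K M S \<Gamma> \<longleftrightarrow>
     (\<forall>A\<in>Obj K. loc U T K M {A} = loc U T K M {\<Gamma> s \<ast>\<^bsub>M\<^esub> A | s. s \<in> topspace S})"

definition colocal_to_global ::
  "'u set \<Rightarrow> ('o, 'm) tt_category \<Rightarrow> ('k, 'n) triangulated_category \<Rightarrow>
   ('o, 'm, 'k, 'n) tt_action \<Rightarrow> 's topology \<Rightarrow> ('s \<Rightarrow> 'o) \<Rightarrow> bool" where
  "colocal_to_global U T K M S \<Gamma> \<longleftrightarrow>
     (\<forall>A\<in>Obj K. coloc U T K M {A} = coloc U T K M {rel_hom T K M (\<Gamma> s) A | s. s \<in> topspace S})"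

definition minimality ::
  "'u set \<Rightarrow> ('o, 'm) tt_category \<Rightarrow> ('k, 'n) triangulated_category \<Rightarrow>
   ('o, 'm, 'k, 'n) tt_action \<Rightarrow> 's topology \<Rightarrow> ('s \<Rightarrow> 'o) \<Rightarrow> bool" where
  "minimality U T K M S \<Gamma> \<longleftrightarrow>
     (\<forall>s\<in>topspace S. \<forall>L. localizing_submodule U T K M L \<and>
          L \<subseteq> loc U T K M {\<Gamma> s \<ast>\<^bsub>M\<^esub> A | A. A \<in> Obj K} \<longrightarrow>
        L = {Z. zero_object K Z} \<or> L = loc U T K M {\<Gamma> s \<ast>\<^bsub>M\<^esub> A | A. A \<in> Obj K})"

definition cominimality ::
  "'u set \<Rightarrow> ('o, 'm) tt_category \<Rightarrow> ('k, 'n) triangulated_category \<Rightarrow>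
   ('o, 'm, 'k, 'n) tt_action \<Rightarrow> 's topology \<Rightarrow> ('s \<Rightarrow> 'o) \<Rightarrow> bool" where
  "cominimality U T K M S \<Gamma> \<longleftrightarrow>
     (\<forall>s\<in>topspace S. \<forall>L. colocalizing_hom_submodule U T K M L \<and>
          L \<subseteq> coloc U T K M {rel_hom T K M (\<Gamma> s) (BC_cogenerator U K)} \<longrightarrow>
        L = {Z. zero_object K Z} \<or>
        L = coloc U T K M {rel_hom T K M (\<Gamma> s) (BC_cogenerator U K)})"

end

theory Submission
  imports Defs "HOL-Algebra.Multiplicative_Group"
begin

text \<open>
  Both equivalences are instances of one statement about a family of subobjects, closed under
  intersection, on a class of objects with supports (locale \<open>support_theory\<close>).  Each object \<open>A\<close> has
  pieces \<open>\<gamma> s A\<close>, where \<open>\<gamma> s A\<close> is \<open>\<Gamma>\<^sub>s * A\<close> or \<open>[\<Gamma>\<^sub>s, A]\<^sub>*\<close>, and the support of \<open>A\<close> is the set of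
  \<open>s\<close> with \<open>\<gamma> s A \<noteq> 0\<close>.  If subobjects are determined by their supports, then \<open>A\<close> and the family of its
  pieces generate the same subobject because they have the same support, and a nonzero subobject
  of the part \<open>m s\<close> generated by the pieces at \<open>s\<close> has the same support \<open>{s}\<close> as \<open>m s\<close>.  Conversely,
  an object whose support lies in that of a subobject \<open>L\<close> is built from its pieces; by
  minimality each of these lies in \<open>m s \<subseteq> L\<close>, as \<open>L\<close> meets \<open>m s\<close>.

  To have such a theory on \<open>K\<close>, one needs that orthogonality and idempotence of the \<open>\<Gamma>\<^sub>s\<close> give
  \<open>\<sigma>(\<gamma> s A) = {s} \<inter> \<sigma>(A)\<close>, that vanishing loci of \<open>\<Gamma>\<^sub>s * -\<close> and \<open>[\<Gamma>\<^sub>s, -]\<^sub>*\<close> are submodules, and that every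
  \<open>[\<Gamma>\<^sub>s, A]\<^sub>*\<close> lies in \<open>coloc\<^sup>h\<^sup>o\<^sup>m([\<Gamma>\<^sub>s, I])\<close>.  By adjunction, the vanishing loci are orthogonal
  subcategories (\<open>act_zero_iff\<close>, \<open>rel_hom_zero_iff\<close>).  The last point holds because
  \<open>[\<Gamma>\<^sub>s, -]\<^sub>*\<close> is exact (\<open>cofree_cone\<close>) and preserves products, and because \<open>I\<close> generates \<open>K\<close> as a
  colocalizing subcategory (\<open>colocalizing_BC_cogenerator\<close>).

  The adjoints \<open>[X, -]\<^sub>*\<close>, the products and the Brown--Comenetz duals exist by Brown representability
  (\<open>representable\<close>), for a set-valued functor that sends coproducts to products and is exact on
  cones of differences.  A representing object is the telescope of a sequence which first hits all
  elements of the functor on compact objects and then kills all coincidences.  For the duals,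
  exactness amounts to the injectivity of the group of rationals modulo integers.  That \<open>I\<close>
  generates uses an inverse sequence of the same kind: \<open>A\<close> is the homotopy limit of objects built
  from powers of \<open>I\<close>, since \<open>I\<close> detects all nonzero morphisms out of compact objects.
\<close>

section \<open>Categories and additive categories\<close>

context category
begin

lemma Cmp_arr [simp]:
  assumes "f \<in> Mor C" "g \<in> Mor C" "Tgt C f = Src C g"
  shows "g \<cdot> f \<in> Mor C" "Src C (g \<cdot> f) = Src C f" "Tgt C (g \<cdot> f) = Tgt C g"
  using Cmp_Hom[of f "Src C f" "Tgt C f" g "Tgt C g"] assms by (auto simp: Hom_def)

lemma Ide_arr [simp]:
  assumes "X \<in> Obj C"
  shows "Ide C X \<in> Mor C" "Src C (Ide C X) = X" "Tgt C (Ide C X) = X"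
  using Ide_Hom[OF assms] by (auto simp: Hom_def)

lemma arr_Obj [simp]:
  assumes "f \<in> Mor C"
  shows "Src C f \<in> Obj C" "Tgt C f \<in> Obj C"
  using assms Src_Obj Tgt_Obj by auto

lemma Cmp_assoc' [simp]:
  assumes "f \<in> Mor C" "g \<in> Mor C" "h \<in> Mor C" "Tgt C f = Src C g" "Tgt C g = Src C h"
  shows "(h \<cdot> g) \<cdot> f = h \<cdot> (g \<cdot> f)"
  using Cmp_assoc[of f "Src C f" "Tgt C f" g "Tgt C g" h "Tgt C h"] assms by (auto simp: Hom_def)

lemma Cmp_Ide' [simp]: "f \<in> Mor C \<Longrightarrow> Src C f = X \<Longrightarrow> f \<cdot> Ide C X = f"
  using Cmp_Ide[of f X "Tgt C f"] by (auto simp: Hom_def)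

lemma Ide_Cmp' [simp]: "f \<in> Mor C \<Longrightarrow> Tgt C f = X \<Longrightarrow> Ide C X \<cdot> f = f"
  using Ide_Cmp[of f "Src C f" X] by (auto simp: Hom_def)

lemma Hom_Obj: "f \<in> Hom C X Y \<Longrightarrow> X \<in> Obj C \<and> Y \<in> Obj C"
  by (auto simp: Hom_def)

text \<open>Composites are normalized to the right, where a composite \<open>g \<cdot> f\<close> of known value is hidden inside
  a longer one; this rule exposes it.\<close>

lemma Cmp_subst:
  assumes "g \<cdot> f = k" "x \<in> Mor C" "f \<in> Mor C" "g \<in> Mor C" "Tgt C x = Src C f" "Tgt C f = Src C g"
  shows "g \<cdot> (f \<cdot> x) = k \<cdot> x"
  using Cmp_assoc'[of x f g] assms by simp

lemma isoE:
  assumes "f \<in> Iso C X Y"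
  obtains g where "g \<in> Hom C Y X" "g \<cdot> f = Ide C X" "f \<cdot> g = Ide C Y" "f \<in> Hom C X Y"
  using assms unfolding Iso_def by auto

lemma isoI:
  assumes "f \<in> Hom C X Y" "g \<in> Hom C Y X" "g \<cdot> f = Ide C X" "f \<cdot> g = Ide C Y"
  shows "f \<in> Iso C X Y" "g \<in> Iso C Y X"
  using assms unfolding Iso_def by auto

lemma Iso_Hom: "f \<in> Iso C X Y \<Longrightarrow> f \<in> Hom C X Y"
  unfolding Iso_def by auto

lemma Ide_Iso: "X \<in> Obj C \<Longrightarrow> Ide C X \<in> Iso C X X"
  by (rule isoI(1)[where g = "Ide C X"]) (auto simp: Hom_def)

lemma Iso_Cmp:
  assumes "f \<in> Iso C X Y" "g \<in> Iso C Y Z" shows "g \<cdot> f \<in> Iso C X Z"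
proof -
  obtain f' where f': "f' \<in> Hom C Y X" "f' \<cdot> f = Ide C X" "f \<cdot> f' = Ide C Y" "f \<in> Hom C X Y"
    using isoE[OF assms(1)] .
  obtain g' where g': "g' \<in> Hom C Z Y" "g' \<cdot> g = Ide C Y" "g \<cdot> g' = Ide C Z" "g \<in> Hom C Y Z"
    using isoE[OF assms(2)] .
  have "f' \<cdot> g' \<cdot> g \<cdot> f = Ide C X"
    using f' g' Cmp_subst[OF g'(2), of f] by (simp add: Hom_def)
  moreover have "g \<cdot> f \<cdot> f' \<cdot> g' = Ide C Z"
    using f' g' Cmp_subst[OF f'(3), of g'] by (simp add: Hom_def)
  ultimately show ?thesis
    using f' g' by (intro isoI(1)[where g = "f' \<cdot> g'"]) (auto simp: Hom_def)
qed

lemma isomorphic_refl: "X \<in> Obj C \<Longrightarrow> isomorphic C X X"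
  using Ide_Iso unfolding isomorphic_def by auto

lemma isomorphic_sym: "isomorphic C X Y \<Longrightarrow> isomorphic C Y X"
  unfolding isomorphic_def Iso_def by blast

lemma isomorphic_trans: "isomorphic C X Y \<Longrightarrow> isomorphic C Y Z \<Longrightarrow> isomorphic C X Z"
  unfolding isomorphic_def using Iso_Cmp by blast

lemma isomorphic_Obj: "isomorphic C X Y \<Longrightarrow> X \<in> Obj C \<and> Y \<in> Obj C"
  unfolding isomorphic_def Iso_def by (auto simp: Hom_def)

lemma isomorphicE:
  assumes "isomorphic C X Y"
  obtains f g where "g \<in> Hom C Y X" "g \<cdot> f = Ide C X" "f \<cdot> g = Ide C Y" "f \<in> Hom C X Y"
  using assms unfolding isomorphic_def Iso_def by blast

lemma skeletonE:
  assumes R: "is_skeleton C L R" and c: "c \<in> L"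
  obtains d a b where "d \<in> R" "b \<in> Hom C c d" "b \<cdot> a = Ide C d" "a \<cdot> b = Ide C c" "a \<in> Hom C d c"
proof -
  have "\<exists>d. d \<in> R \<and> isomorphic C c d" using R c unfolding is_skeleton_def by blast
  then obtain d where d: "d \<in> R" "isomorphic C c d" by blast
  show ?thesis by (rule isomorphicE[OF d(2)]) (rule that[OF d(1)])
qed

lemma is_coproductD:
  assumes "is_coproduct C I A P \<iota>"
  shows "P \<in> Obj C" "i \<in> I \<Longrightarrow> \<iota> i \<in> Hom C (A i) P" "i \<in> I \<Longrightarrow> A i \<in> Obj C"
  using assms Hom_Obj unfolding is_coproduct_def by auto

lemma coproduct_ex:
  assumes "is_coproduct C I A P \<iota>" "Y \<in> Obj C" "\<And>i. i \<in> I \<Longrightarrow> f i \<in> Hom C (A i) Y"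
  obtains h where "h \<in> Hom C P Y" "\<And>i. i \<in> I \<Longrightarrow> h \<cdot> \<iota> i = f i"
proof -
  have "\<exists>!h. h \<in> Hom C P Y \<and> (\<forall>i\<in>I. h \<cdot> \<iota> i = f i)"
    using assms unfolding is_coproduct_def by blast
  then show ?thesis using that by blast
qed

lemma coproduct_eqI:
  assumes "is_coproduct C I A P \<iota>" "f \<in> Hom C P Y" "g \<in> Hom C P Y"
    "\<And>i. i \<in> I \<Longrightarrow> f \<cdot> \<iota> i = g \<cdot> \<iota> i"
  shows "f = g"
proof -
  have Y: "Y \<in> Obj C" using assms(2) Hom_Obj by auto
  have "f \<cdot> \<iota> i \<in> Hom C (A i) Y" if "i \<in> I" for i
    using is_coproductD(2)[OF assms(1) that] assms(2) Cmp_Hom by blast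
  then have "\<exists>!h. h \<in> Hom C P Y \<and> (\<forall>i\<in>I. h \<cdot> \<iota> i = f \<cdot> \<iota> i)"
    using assms(1)[unfolded is_coproduct_def, THEN conjunct2, THEN conjunct2, rule_format, OF Y, of "\<lambda>i. f \<cdot> \<iota> i"]
    by blast
  then obtain h where "\<And>k. k \<in> Hom C P Y \<and> (\<forall>i\<in>I. k \<cdot> \<iota> i = f \<cdot> \<iota> i) \<Longrightarrow> k = h"
    by (elim ex1E) blast
  from this[of f] this[of g] show ?thesis using assms by simp
qed

lemma is_productD:
  assumes "is_product C I A P \<pi>"
  shows "P \<in> Obj C" "i \<in> I \<Longrightarrow> \<pi> i \<in> Hom C P (A i)" "i \<in> I \<Longrightarrow> A i \<in> Obj C"
  using assms Hom_Obj unfolding is_product_def by auto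

lemma product_ex:
  assumes "is_product C I A P \<pi>" "Y \<in> Obj C" "\<And>i. i \<in> I \<Longrightarrow> f i \<in> Hom C Y (A i)"
  obtains h where "h \<in> Hom C Y P" "\<And>i. i \<in> I \<Longrightarrow> \<pi> i \<cdot> h = f i"
proof -
  have "\<exists>!h. h \<in> Hom C Y P \<and> (\<forall>i\<in>I. \<pi> i \<cdot> h = f i)"
    using assms unfolding is_product_def by blast
  then show ?thesis using that by blast
qed

lemma product_eqI:
  assumes "is_product C I A P \<pi>" "f \<in> Hom C Y P" "g \<in> Hom C Y P"
    "\<And>i. i \<in> I \<Longrightarrow> \<pi> i \<cdot> f = \<pi> i \<cdot> g"
  shows "f = g"
proof -
  have Y: "Y \<in> Obj C" using assms(2) Hom_Obj by auto
  have "\<pi> i \<cdot> f \<in> Hom C Y (A i)" if "i \<in> I" for i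
    using is_productD(2)[OF assms(1) that] assms(2) Cmp_Hom by blast
  then have "\<exists>!h. h \<in> Hom C Y P \<and> (\<forall>i\<in>I. \<pi> i \<cdot> h = \<pi> i \<cdot> f)"
    using assms(1)[unfolded is_product_def, THEN conjunct2, THEN conjunct2, rule_format, OF Y, of "\<lambda>i. \<pi> i \<cdot> f"]
    by blast
  then obtain h where "\<And>k. k \<in> Hom C Y P \<and> (\<forall>i\<in>I. \<pi> i \<cdot> k = \<pi> i \<cdot> f) \<Longrightarrow> k = h"
    by (elim ex1E) blast
  from this[of f] this[of g] show ?thesis using assms by simp
qed

lemma coproduct_reindex:
  assumes e: "bij_betw e J I" and P: "is_coproduct C I A P \<iota>"
  shows "is_coproduct C J (\<lambda>j. A (e j)) P (\<lambda>j. \<iota> (e j))"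
  unfolding is_coproduct_def
proof (intro conjI ballI allI impI)
  show "P \<in> Obj C" using P is_coproductD by blast
  show "\<iota> (e j) \<in> Hom C (A (e j)) P" if "j \<in> J" for j
    using is_coproductD(2)[OF P] bij_betwE[OF e] that by blast
  fix Y f assume Y: "Y \<in> Obj C" and f: "\<forall>j\<in>J. f j \<in> Hom C (A (e j)) Y"
  let ?d = "inv_into J e"
  have d: "?d i \<in> J" "e (?d i) = i" if "i \<in> I" for i
    using e that by (auto simp: bij_betw_def inv_into_into f_inv_into_f)
  have de: "?d (e j) = j" "e j \<in> I" if "j \<in> J" for j
    using e that by (auto simp: bij_betw_def inv_into_f_f)
  have "f (?d i) \<in> Hom C (A i) Y" if "i \<in> I" for i
    using f d[OF that] by metis
  then obtain h where h: "h \<in> Hom C P Y" "\<And>i. i \<in> I \<Longrightarrow> h \<cdot> \<iota> i = f (?d i)"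
    using coproduct_ex[OF P Y, of "\<lambda>i. f (?d i)"] by blast
  show "\<exists>!h. h \<in> Hom C P Y \<and> (\<forall>j\<in>J. h \<cdot> \<iota> (e j) = f j)"
  proof (rule ex1I[of _ h])
    show "h \<in> Hom C P Y \<and> (\<forall>j\<in>J. h \<cdot> \<iota> (e j) = f j)" using h de by simp
    fix k assume k: "k \<in> Hom C P Y \<and> (\<forall>j\<in>J. k \<cdot> \<iota> (e j) = f j)"
    show "k = h"
    proof (rule coproduct_eqI[OF P])
      show "k \<cdot> \<iota> i = h \<cdot> \<iota> i" if "i \<in> I" for i using k h d[OF that] that by metis
    qed (use k h in auto)
  qed
qed

lemma product_reindex:
  assumes e: "bij_betw e J I" and P: "is_product C I A P \<pi>"
  shows "is_product C J (\<lambda>j. A (e j)) P (\<lambda>j. \<pi> (e j))"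
  unfolding is_product_def
proof (intro conjI ballI allI impI)
  show "P \<in> Obj C" using P is_productD by blast
  show "\<pi> (e j) \<in> Hom C P (A (e j))" if "j \<in> J" for j
    using is_productD(2)[OF P] bij_betwE[OF e] that by blast
  fix Y f assume Y: "Y \<in> Obj C" and f: "\<forall>j\<in>J. f j \<in> Hom C Y (A (e j))"
  let ?d = "inv_into J e"
  have d: "?d i \<in> J" "e (?d i) = i" if "i \<in> I" for i
    using e that by (auto simp: bij_betw_def inv_into_into f_inv_into_f)
  have de: "?d (e j) = j" "e j \<in> I" if "j \<in> J" for j
    using e that by (auto simp: bij_betw_def inv_into_f_f)
  have "f (?d i) \<in> Hom C Y (A i)" if "i \<in> I" for i
    using f d[OF that] by metis
  then obtain h where h: "h \<in> Hom C Y P" "\<And>i. i \<in> I \<Longrightarrow> \<pi> i \<cdot> h = f (?d i)"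
    using product_ex[OF P Y, of "\<lambda>i. f (?d i)"] by blast
  show "\<exists>!h. h \<in> Hom C Y P \<and> (\<forall>j\<in>J. \<pi> (e j) \<cdot> h = f j)"
  proof (rule ex1I[of _ h])
    show "h \<in> Hom C Y P \<and> (\<forall>j\<in>J. \<pi> (e j) \<cdot> h = f j)" using h de by simp
    fix k assume k: "k \<in> Hom C Y P \<and> (\<forall>j\<in>J. \<pi> (e j) \<cdot> k = f j)"
    show "k = h"
    proof (rule product_eqI[OF P])
      show "\<pi> i \<cdot> k = \<pi> i \<cdot> h" if "i \<in> I" for i using k h d[OF that] that by metis
    qed (use k h in auto)
  qed
qed

end

lemma (in cat_functor) FM_Iso: "f \<in> Iso C X Y \<Longrightarrow> FM f \<in> Iso D (FO X) (FO Y)"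
  unfolding Iso_def using FM_Hom FM_Cmp FM_Ide C.Hom_Obj by simp metis

context additive_category
begin

abbreviation Diff where "Diff f g \<equiv> Add C f (Neg C g)"

lemma Hom_group_simps [simp]:
  "carrier (Hom_group C X Y) = Hom C X Y"
  "f \<otimes>\<^bsub>Hom_group C X Y\<^esub> g = Add C f g"
  "\<one>\<^bsub>Hom_group C X Y\<^esub> = ZeroM C X Y"
  by (auto simp: Hom_group_def)

lemma Add_Hom: "f \<in> Hom C X Y \<Longrightarrow> g \<in> Hom C X Y \<Longrightarrow> Add C f g \<in> Hom C X Y"
  using comm_groupE(1)[OF Hom_comm_group[of X Y]] Hom_Obj by auto

lemma ZeroM_Hom: "X \<in> Obj C \<Longrightarrow> Y \<in> Obj C \<Longrightarrow> ZeroM C X Y \<in> Hom C X Y"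
  using comm_groupE(2)[OF Hom_comm_group[of X Y]] by auto

lemma Add_assoc: "f \<in> Hom C X Y \<Longrightarrow> g \<in> Hom C X Y \<Longrightarrow> h \<in> Hom C X Y \<Longrightarrow>
    Add C (Add C f g) h = Add C f (Add C g h)"
  using comm_groupE(3)[OF Hom_comm_group[of X Y]] Hom_Obj by auto

lemma Add_comm: "f \<in> Hom C X Y \<Longrightarrow> g \<in> Hom C X Y \<Longrightarrow> Add C f g = Add C g f"
  using comm_groupE(4)[OF Hom_comm_group[of X Y]] Hom_Obj by auto

lemma Zero_Add: "f \<in> Hom C X Y \<Longrightarrow> Add C (ZeroM C X Y) f = f"
  using comm_groupE(5)[OF Hom_comm_group[of X Y]] Hom_Obj by auto

lemma Add_Zero: "f \<in> Hom C X Y \<Longrightarrow> Add C f (ZeroM C X Y) = f"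
  using Zero_Add Add_comm ZeroM_Hom Hom_Obj by metis

lemma Neg_Hom: "f \<in> Hom C X Y \<Longrightarrow> Neg C f \<in> Hom C X Y"
  using group.inv_closed[OF comm_group.axioms(2)[OF Hom_comm_group[of X Y]], of f] Hom_Obj
  by (auto simp: Neg_def) (auto simp: Hom_def)

lemma Add_Neg: "f \<in> Hom C X Y \<Longrightarrow> Add C f (Neg C f) = ZeroM C X Y"
  using group.r_inv[OF comm_group.axioms(2)[OF Hom_comm_group[of X Y]], of f] Hom_Obj
  by (auto simp: Neg_def) (auto simp: Hom_def)

lemma Neg_Add: "f \<in> Hom C X Y \<Longrightarrow> Add C (Neg C f) f = ZeroM C X Y"
  using Add_Neg Add_comm Neg_Hom by metis

lemma Diff_Hom: "f \<in> Hom C X Y \<Longrightarrow> g \<in> Hom C X Y \<Longrightarrow> Diff f g \<in> Hom C X Y"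
  using Add_Hom Neg_Hom by auto

lemma Add_cancel: 
  assumes "f \<in> Hom C X Y" "g \<in> Hom C X Y" "h \<in> Hom C X Y" "Add C f g = Add C f h"
  shows "g = h"
proof -
  have "Add C (Neg C f) (Add C f g) = Add C (Neg C f) (Add C f h)" using assms by simp
  then show ?thesis
    using assms(1-3) by (simp flip: Add_assoc[where X = X and Y = Y] add: Neg_Hom Neg_Add Zero_Add)
qed

lemma Neg_unique: "f \<in> Hom C X Y \<Longrightarrow> g \<in> Hom C X Y \<Longrightarrow> Add C f g = ZeroM C X Y \<Longrightarrow> Neg C f = g"
  using Add_cancel[of f X Y "Neg C f" g] Neg_Hom Add_Neg by metis

lemma Neg_Neg: "f \<in> Hom C X Y \<Longrightarrow> Neg C (Neg C f) = f"
  using Neg_unique Neg_Hom Neg_Add by blast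

lemma Neg_Zero: "X \<in> Obj C \<Longrightarrow> Y \<in> Obj C \<Longrightarrow> Neg C (ZeroM C X Y) = ZeroM C X Y"
  using Neg_unique ZeroM_Hom Zero_Add by blast

lemma Diff_self: "f \<in> Hom C X Y \<Longrightarrow> Diff f f = ZeroM C X Y"
  by (rule Add_Neg)

lemma Diff_eq_Zero: "f \<in> Hom C X Y \<Longrightarrow> g \<in> Hom C X Y \<Longrightarrow> Diff f g = ZeroM C X Y \<longleftrightarrow> f = g"
  using Neg_unique[of f X Y "Neg C g"] Neg_Neg Neg_Hom Add_Neg by metis

lemma Add_Diff_cancel: 
  assumes "f \<in> Hom C X Y" "g \<in> Hom C X Y"
  shows "Add C g (Diff f g) = f"
proof -
  note n = Neg_Hom[OF assms(2)]
  have "Add C g (Diff f g) = Add C g (Add C (Neg C g) f)" using Add_comm[OF assms(1) n] by simp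
  also have "\<dots> = Add C (Add C g (Neg C g)) f" using Add_assoc[OF assms(2) n assms(1)] by simp
  also have "\<dots> = f" using Add_Neg[OF assms(2)] Zero_Add[OF assms(1)] by simp
  finally show ?thesis .
qed

lemma Cmp_Zero: 
  assumes "f \<in> Hom C X Y" "Z \<in> Obj C" shows "f \<cdot> ZeroM C Z X = ZeroM C Z Y"
proof -
  have O: "X \<in> Obj C" "Y \<in> Obj C" using assms Hom_Obj by auto
  let ?z = "ZeroM C Z X"
  have z: "?z \<in> Hom C Z X" using ZeroM_Hom assms O by auto
  then have fz: "f \<cdot> ?z \<in> Hom C Z Y" using assms Cmp_Hom by blast
  have "Add C (f \<cdot> ?z) (f \<cdot> ?z) = Add C (f \<cdot> ?z) (ZeroM C Z Y)"
    using Cmp_Add[OF z z assms(1)] Zero_Add[OF z] Add_Zero[OF fz] by simp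
  then show ?thesis using Add_cancel fz ZeroM_Hom assms O by blast
qed

lemma Zero_Cmp: 
  assumes "f \<in> Hom C X Y" "Z \<in> Obj C" shows "ZeroM C Y Z \<cdot> f = ZeroM C X Z"
proof -
  have O: "X \<in> Obj C" "Y \<in> Obj C" using assms Hom_Obj by auto
  let ?z = "ZeroM C Y Z"
  have z: "?z \<in> Hom C Y Z" using ZeroM_Hom assms O by auto
  then have fz: "?z \<cdot> f \<in> Hom C X Z" using assms Cmp_Hom by blast
  have "Add C (?z \<cdot> f) (?z \<cdot> f) = Add C (?z \<cdot> f) (ZeroM C X Z)"
    using Add_Cmp[OF assms(1) z z] Zero_Add[OF z] Add_Zero[OF fz] by simp
  then show ?thesis using Add_cancel fz ZeroM_Hom assms O by blast
qed

lemma Cmp_Neg: 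
  assumes "f \<in> Hom C X Y" "g \<in> Hom C Y Z" shows "g \<cdot> Neg C f = Neg C (g \<cdot> f)"
  by (rule Neg_unique[symmetric, where X = X and Y = Z])
    (use assms Cmp_Add[OF assms(1) Neg_Hom[OF assms(1)] assms(2)] Add_Neg[OF assms(1)]
      Cmp_Zero[OF assms(2)] Cmp_Hom Neg_Hom Hom_Obj in metis)+

lemma Neg_Cmp: 
  assumes "f \<in> Hom C X Y" "g \<in> Hom C Y Z" shows "Neg C g \<cdot> f = Neg C (g \<cdot> f)"
  by (rule Neg_unique[symmetric, where X = X and Y = Z])
    (use assms Add_Cmp[OF assms(1) assms(2) Neg_Hom[OF assms(2)]] Add_Neg[OF assms(2)]
      Zero_Cmp[OF assms(1)] Cmp_Hom Neg_Hom Hom_Obj in metis)+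

lemma Cmp_Diff: 
  "f \<in> Hom C X Y \<Longrightarrow> f' \<in> Hom C X Y \<Longrightarrow> g \<in> Hom C Y Z \<Longrightarrow> g \<cdot> Diff f f' = Diff (g \<cdot> f) (g \<cdot> f')"
  using Cmp_Add[of f X Y "Neg C f'" g Z] Cmp_Neg Neg_Hom by metis

lemma Diff_Cmp: 
  "f \<in> Hom C X Y \<Longrightarrow> g \<in> Hom C Y Z \<Longrightarrow> g' \<in> Hom C Y Z \<Longrightarrow> Diff g g' \<cdot> f = Diff (g \<cdot> f) (g' \<cdot> f)"
  using Add_Cmp[of f X Y g Z "Neg C g'"] Neg_Cmp Neg_Hom by metis

lemma Neg_eq_Zero: "f \<in> Hom C X Y \<Longrightarrow> Neg C f = ZeroM C X Y \<Longrightarrow> f = ZeroM C X Y"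
  using Neg_Neg Neg_Zero Hom_Obj by metis

lemma zero_object_Hom:
  assumes "zero_object C Z"
  shows "Z \<in> Obj C" "f \<in> Hom C Z X \<Longrightarrow> f = ZeroM C Z X" "f \<in> Hom C X Z \<Longrightarrow> f = ZeroM C X Z"
proof -
  show Z: "Z \<in> Obj C" using assms unfolding zero_object_def by blast
  have u: "\<exists>!f. f \<in> Hom C Z X" "\<exists>!f. f \<in> Hom C X Z" if "X \<in> Obj C" for X
    using assms that unfolding zero_object_def by blast+
  show "f = ZeroM C Z X" if f: "f \<in> Hom C Z X"
    using u(1)[of X] f ZeroM_Hom[of Z X] Hom_Obj[OF f] by auto
  show "f = ZeroM C X Z" if f: "f \<in> Hom C X Z"
    using u(2)[of X] f ZeroM_Hom[of X Z] Hom_Obj[OF f] by auto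
qed

lemma zero_objectI:
  assumes "Z \<in> Obj C" "Ide C Z = ZeroM C Z Z"
  shows "zero_object C Z"
  unfolding zero_object_def
proof (intro conjI ballI)
  fix X assume X: "X \<in> Obj C"
  have "f = ZeroM C Z X" if f: "f \<in> Hom C Z X" for f
  proof -
    have "f = f \<cdot> Ide C Z" using f by (simp add: Cmp_Ide)
    also have "\<dots> = ZeroM C Z X" using assms(2) Cmp_Zero[OF f assms(1)] by simp
    finally show ?thesis .
  qed
  then show "\<exists>!f. f \<in> Hom C Z X" using ZeroM_Hom assms X by blast
  have "f = ZeroM C X Z" if f: "f \<in> Hom C X Z" for f
  proof -
    have "f = Ide C Z \<cdot> f" using f by (simp add: Ide_Cmp)
    also have "\<dots> = ZeroM C X Z" using assms(2) Zero_Cmp[OF f assms(1)] by simp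
    finally show ?thesis .
  qed
  then show "\<exists>!f. f \<in> Hom C X Z" using ZeroM_Hom assms X by blast
qed (rule assms)

lemma zero_object_iff: "zero_object C Z \<longleftrightarrow> Z \<in> Obj C \<and> Ide C Z = ZeroM C Z Z"
  using zero_objectI zero_object_Hom Ide_Hom by metis

lemma zero_object_iso:
  assumes "zero_object C Z" "isomorphic C Z Y" shows "zero_object C Y"
proof -
  obtain f g where g: "g \<in> Hom C Y Z" "g \<cdot> f = Ide C Z" "f \<cdot> g = Ide C Y" "f \<in> Hom C Z Y"
    using isomorphicE[OF assms(2)] .
  have Y: "Y \<in> Obj C" using g Hom_Obj by auto
  have "f = ZeroM C Z Y" using zero_object_Hom(2)[OF assms(1) g(4)] .
  then have "Ide C Y = ZeroM C Y Y" using g(3) Zero_Cmp[OF g(1) Y] by simp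
  then show ?thesis using zero_objectI Y by blast
qed

text \<open>The universal property, applied to the identity in one component and zero in all others.\<close>

lemma coproduct_projections:
  assumes P: "is_coproduct C I A P \<iota>"
  obtains \<rho> where "\<And>i. i \<in> I \<Longrightarrow> \<rho> i \<in> Hom C P (A i)"
    "\<And>i. i \<in> I \<Longrightarrow> \<rho> i \<cdot> \<iota> i = Ide C (A i)"
    "\<And>i j. i \<in> I \<Longrightarrow> j \<in> I \<Longrightarrow> i \<noteq> j \<Longrightarrow> \<rho> i \<cdot> \<iota> j = ZeroM C (A j) (A i)"
proof -
  have "\<exists>r. r \<in> Hom C P (A i) \<and> (\<forall>j\<in>I. r \<cdot> \<iota> j = (if i = j then Ide C (A i) else ZeroM C (A j) (A i)))"
    if i: "i \<in> I" for i
    using coproduct_ex[OF P, of "A i" "\<lambda>j. if i = j then Ide C (A i) else ZeroM C (A j) (A i)"]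
      is_coproductD(3)[OF P] i Ide_Hom ZeroM_Hom by (metis (full_types))
  then obtain \<rho> where r: "\<And>i. i \<in> I \<Longrightarrow> \<rho> i \<in> Hom C P (A i) \<and>
      (\<forall>j\<in>I. \<rho> i \<cdot> \<iota> j = (if i = j then Ide C (A i) else ZeroM C (A j) (A i)))"
    by metis
  show ?thesis by (rule that[of \<rho>]) (use r in auto)
qed

end

lemma (in additive_functor) FM_Zero:
  assumes "X \<in> Obj C" "Y \<in> Obj C"
  shows "FM (ZeroM C X Y) = ZeroM D (FO X) (FO Y)"
proof -
  let ?z = "ZeroM C X Y"
  have z: "?z \<in> Hom C X Y" using C.ZeroM_Hom assms by auto
  have "Add D (FM ?z) (FM ?z) = Add D (FM ?z) (ZeroM D (FO X) (FO Y))"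
    using FM_Add[OF z z] C.Zero_Add[OF z] D.Add_Zero[OF FM_Hom[OF z]] by simp
  then show ?thesis using D.Add_cancel FM_Hom[OF z] D.ZeroM_Hom assms FO_Obj by blast
qed

lemma (in additive_functor) FM_zero_object:
  assumes "zero_object C Z" shows "zero_object D (FO Z)"
  using assms FM_Zero FM_Ide FO_Obj by (metis C.zero_object_iff D.zero_objectI)

lemma (in additive_functor) FM_Neg:
  assumes "f \<in> Hom C X Y" shows "FM (Neg C f) = Neg D (FM f)"
  using D.Neg_unique[OF FM_Hom[OF assms] FM_Hom[OF C.Neg_Hom[OF assms]]]
    FM_Add[OF assms C.Neg_Hom[OF assms]] C.Add_Neg[OF assms] FM_Zero C.Hom_Obj[OF assms] by simp

section \<open>Triangulated categories\<close>

context triangulated_category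
begin

lemmas shift_functor = additive_functor.axioms(1)[OF shift_additive]

lemma ShO_Obj [simp]: "X \<in> Obj C \<Longrightarrow> ShO C X \<in> Obj C"
  using cat_functor.FO_Obj[OF shift_functor] by blast

lemma ShM_Hom: "f \<in> Hom C X Y \<Longrightarrow> ShM C f \<in> Hom C (ShO C X) (ShO C Y)"
  using cat_functor.FM_Hom[OF shift_functor] by blast

lemma ShM_Ide: "X \<in> Obj C \<Longrightarrow> ShM C (Ide C X) = Ide C (ShO C X)"
  using cat_functor.FM_Ide[OF shift_functor] by blast

lemma ShM_Cmp: "f \<in> Hom C X Y \<Longrightarrow> g \<in> Hom C Y Z \<Longrightarrow> ShM C (g \<cdot> f) = ShM C g \<cdot> ShM C f"
  using cat_functor.FM_Cmp[OF shift_functor] by blast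

lemma ShM_Zero: "X \<in> Obj C \<Longrightarrow> Y \<in> Obj C \<Longrightarrow> ShM C (ZeroM C X Y) = ZeroM C (ShO C X) (ShO C Y)"
  using additive_functor.FM_Zero[OF shift_additive] by blast

lemma ShM_Add: "f \<in> Hom C X Y \<Longrightarrow> g \<in> Hom C X Y \<Longrightarrow> ShM C (Add C f g) = Add C (ShM C f) (ShM C g)"
  using additive_functor.FM_Add[OF shift_additive] by blast

lemma ShM_full:
  assumes "f \<in> Hom C (ShO C X) (ShO C Y)" "X \<in> Obj C" "Y \<in> Obj C"
  obtains g where "g \<in> Hom C X Y" "ShM C g = f"
proof -
  have "f \<in> ShM C ` Hom C X Y"
    using shift_fully_faithful[OF assms(2,3)] assms(1) unfolding bij_betw_def by simp
  then show ?thesis using that by blast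
qed

lemma ShM_faithful:
  "f \<in> Hom C X Y \<Longrightarrow> g \<in> Hom C X Y \<Longrightarrow> ShM C f = ShM C g \<Longrightarrow> f = g"
  by (rule inj_onD[OF bij_betw_imp_inj_on[OF shift_fully_faithful[of X Y]]]) (auto dest: Hom_Obj)

lemma ShM_eq_Zero:
  "f \<in> Hom C X Y \<Longrightarrow> ShM C f = ZeroM C (ShO C X) (ShO C Y) \<Longrightarrow> f = ZeroM C X Y"
  by (rule ShM_faithful) (auto simp: ShM_Zero ZeroM_Hom dest: Hom_Obj)

lemma zero_object_ShO: "zero_object C Z \<Longrightarrow> zero_object C (ShO C Z)"
  using additive_functor.FM_zero_object[OF shift_additive] by blast

lemma TriE:
  assumes "(f, g, h) \<in> Tri C"
  obtains X Y Z where "f \<in> Hom C X Y" "g \<in> Hom C Y Z" "h \<in> Hom C Z (ShO C X)"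
  using Tri_candidate[OF assms] unfolding candidate_triangle_def by auto

lemma Tri_Hom:
  assumes "(f, g, h) \<in> Tri C" "f \<in> Hom C X Y"
  shows "g \<in> Hom C Y (Src C h)" "h \<in> Hom C (Src C h) (ShO C X)"
proof -
  obtain X' Y' Z' where h: "f \<in> Hom C X' Y'" "g \<in> Hom C Y' Z'" "h \<in> Hom C Z' (ShO C X')"
    using TriE[OF assms(1)] .
  have "X' = X" "Y' = Y" "Src C h = Z'" using h assms(2) by (simp_all add: Hom_def)
  then show "g \<in> Hom C Y (Src C h)" "h \<in> Hom C (Src C h) (ShO C X)" using h by simp_all
qed

lemma Tri_Hom_snd:
  assumes "(f, g, h) \<in> Tri C" "f \<in> Hom C X Y" "h \<in> Hom C Z W"
  shows "g \<in> Hom C Y Z"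
proof -
  have "Src C h = Z" using assms(3) by (simp add: Hom_def)
  then show ?thesis using Tri_Hom(1)[OF assms(1,2)] by simp
qed

lemma Tri_Hom_trd:
  assumes "(f, g, h) \<in> Tri C" "f \<in> Hom C X Y" "g \<in> Hom C W Z"
  shows "h \<in> Hom C Z (ShO C X)"
proof -
  have "Tgt C g = Z" using assms(3) by (simp add: Hom_def)
  then have "Src C h = Z" using Tri_Hom(1)[OF assms(1,2)] by (simp add: Hom_def)
  then show ?thesis using Tri_Hom(2)[OF assms(1,2)] by simp
qed

lemma Tri_rotate:
  assumes "(f, g, h) \<in> Tri C" shows "(g, h, Neg C (ShM C f)) \<in> Tri C"
  using TR2 assms Tri_candidate by blast

lemma cone_ex:
  assumes "f \<in> Hom C X Y"
  obtains g h Z where "(f, g, h) \<in> Tri C" "g \<in> Hom C Y Z" "h \<in> Hom C Z (ShO C X)" "Z \<in> Obj C"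
proof -
  have "f \<in> Mor C" using assms by (simp add: Hom_def)
  then obtain g h where t: "(f, g, h) \<in> Tri C" using TR1_cone by blast
  note Tri_Hom[OF t assms]
  then show ?thesis using that t Hom_Obj by blast
qed

lemma Tri_Cmp_Zero:
  assumes t: "(f, g, h) \<in> Tri C" and f: "f \<in> Hom C X Y" and g: "g \<in> Hom C Y Z"
  shows "g \<cdot> f = ZeroM C X Z"
proof -
  obtain O' where O': "zero_object C O'" using ex_zero_object by auto
  have X: "X \<in> Obj C" using f Hom_Obj by auto
  have OO: "O' \<in> Obj C" using O' zero_object_Hom by auto
  have t0: "(Ide C X, ZeroM C X O', ZeroM C O' (ShO C X)) \<in> Tri C" using TR1_Ide X O' by auto
  have h: "Src C h = Z" using Tri_Hom_trd[OF t f g] by (simp add: Hom_def)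
  have s: "Src C (Ide C X) = X" "Src C (ZeroM C X O') = X" "Src C (ZeroM C O' (ShO C X)) = O'"
    using X OO ZeroM_Hom[of X O'] ZeroM_Hom[of O' "ShO C X"] by (auto simp: Hom_def)
  have "\<exists>c\<in>Hom C O' Z. c \<cdot> ZeroM C X O' = g \<cdot> f \<and> ShM C (Ide C X) \<cdot> ZeroM C O' (ShO C X) = h \<cdot> c"
    using TR3[OF t0 t, of "Ide C X" f] f g X h s Ide_Hom by (auto simp: Hom_def)
  then obtain c where "c \<in> Hom C O' Z" "c \<cdot> ZeroM C X O' = g \<cdot> f" by blast
  then show ?thesis using Cmp_Zero[of c O' Z X] X by simp
qed

lemma Tri_Cmp_Zero':
  assumes t: "(f, g, h) \<in> Tri C" and f: "f \<in> Hom C X Y" and g: "g \<in> Hom C Y Z"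
  shows "h \<cdot> g = ZeroM C Y (ShO C X)"
  by (rule Tri_Cmp_Zero[OF Tri_rotate[OF t] g Tri_Hom_trd[OF t f g]])

lemma Tri_Cmp_Zero'':
  assumes t: "(f, g, h) \<in> Tri C" and f: "f \<in> Hom C X Y" and h: "h \<in> Hom C Z (ShO C X)"
  shows "ShM C f \<cdot> h = ZeroM C Z (ShO C Y)"
proof -
  have "Neg C (ShM C f) \<cdot> h = ZeroM C Z (ShO C Y)"
    by (rule Tri_Cmp_Zero[OF Tri_rotate[OF Tri_rotate[OF t]] h Neg_Hom[OF ShM_Hom[OF f]]])
  then show ?thesis
    using Neg_Cmp[OF h ShM_Hom[OF f]] Neg_eq_Zero Cmp_Hom[OF h ShM_Hom[OF f]] by metis
qed

text \<open>Compare with \<open>0 \<rightarrow> W \<rightarrow> W \<rightarrow> 0\<close>, which is distinguished because its rotation is the triangle on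
  the identity of \<open>W\<close>.\<close>

lemma Tri_weak_cokernel:
  assumes t: "(f, g, h) \<in> Tri C" and f: "f \<in> Hom C X Y" and g: "g \<in> Hom C Y Z"
    and z: "z \<in> Hom C Y W" and zf: "z \<cdot> f = ZeroM C X W"
  obtains w where "w \<in> Hom C Z W" "w \<cdot> g = z"
proof -
  obtain O' where O': "zero_object C O'" using ex_zero_object by auto
  have OO: "O' \<in> Obj C" "ShO C O' \<in> Obj C" using O' zero_object_Hom by auto
  have W: "W \<in> Obj C" "X \<in> Obj C" using z f Hom_Obj by auto
  have "(Ide C W, ZeroM C W (ShO C O'), ZeroM C (ShO C O') (ShO C W)) \<in> Tri C"
    using TR1_Ide W zero_object_ShO[OF O'] by auto
  moreover have "ZeroM C (ShO C O') (ShO C W) = Neg C (ShM C (ZeroM C O' W))"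
    using ShM_Zero Neg_Zero OO W by simp
  moreover have "candidate_triangle C (ZeroM C O' W) (Ide C W) (ZeroM C W (ShO C O'))"
    unfolding candidate_triangle_def using ZeroM_Hom Ide_Hom OO W by blast
  ultimately have t0: "(ZeroM C O' W, Ide C W, ZeroM C W (ShO C O')) \<in> Tri C"
    using TR2 by simp
  have s: "Src C (ZeroM C O' W) = O'" "Src C (ZeroM C W (ShO C O')) = W"
    "Src C (Ide C W) = W" "Src C f = X" "Src C g = Y" "Src C h = Z"
    using ZeroM_Hom[of O' W] ZeroM_Hom[of W "ShO C O'"] W OO f g Tri_Hom_trd[OF t f g]
    by (simp_all add: Hom_def)
  have "\<exists>c\<in>Hom C (Src C h) (Src C (ZeroM C W (ShO C O'))).
      c \<cdot> g = Ide C W \<cdot> z \<and> ShM C (ZeroM C X O') \<cdot> h = ZeroM C W (ShO C O') \<cdot> c"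
  proof (rule TR3[OF t t0])
    show "ZeroM C X O' \<in> Hom C (Src C f) (Src C (ZeroM C O' W))" using s ZeroM_Hom W OO by simp
    show "z \<in> Hom C (Src C g) (Src C (Ide C W))" using s z by simp
    show "z \<cdot> f = ZeroM C O' W \<cdot> ZeroM C X O'" using zf Zero_Cmp[of "ZeroM C X O'" X O' W] ZeroM_Hom W OO by simp
  qed
  then obtain c where "c \<in> Hom C Z W" "c \<cdot> g = Ide C W \<cdot> z" unfolding s by blast
  then show ?thesis using that Ide_Cmp[OF z] by simp
qed

text \<open>Compare \<open>W \<rightarrow> 0 \<rightarrow> \<Sigma>W\<close> with the rotated triangle.  The comparison \<open>\<Sigma>W \<rightarrow> \<Sigma>X\<close> desuspends as \<open>\<Sigma>\<close> is
  full, and gives the factorization as \<open>\<Sigma>\<close> is faithful.\<close>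

lemma Tri_weak_kernel:
  assumes t: "(f, g, h) \<in> Tri C" and f: "f \<in> Hom C X Y" and g: "g \<in> Hom C Y Z"
    and z: "z \<in> Hom C W Y" and gz: "g \<cdot> z = ZeroM C W Z"
  obtains w where "w \<in> Hom C W X" "f \<cdot> w = z"
proof -
  obtain O' where O': "zero_object C O'" using ex_zero_object by auto
  have OO: "O' \<in> Obj C" using O' zero_object_Hom by auto
  have O1: "W \<in> Obj C" "X \<in> Obj C" "Z \<in> Obj C" "Y \<in> Obj C" using z f g Hom_Obj by auto
  note t1 = Tri_rotate[OF t]
  have "(Ide C W, ZeroM C W O', ZeroM C O' (ShO C W)) \<in> Tri C" using TR1_Ide O1 O' by auto
  from Tri_rotate[OF this]
  have t0: "(ZeroM C W O', ZeroM C O' (ShO C W), Neg C (Ide C (ShO C W))) \<in> Tri C"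
    using ShM_Ide O1 by simp
  have IW: "Ide C (ShO C W) \<in> Hom C (ShO C W) (ShO C W)" using Ide_Hom O1 by simp
  have s: "Src C (ZeroM C W O') = W" "Src C (ZeroM C O' (ShO C W)) = O'"
    "Src C (Neg C (Ide C (ShO C W))) = ShO C W" "Src C g = Y" "Src C h = Z"
    "Src C (Neg C (ShM C f)) = ShO C X"
    using ZeroM_Hom[of W O'] ZeroM_Hom[of O' "ShO C W"] O1 OO f g Tri_Hom_trd[OF t f g]
      Neg_Hom[OF IW] Neg_Hom[OF ShM_Hom[OF f]]
    by (simp_all add: Hom_def)
  have "\<exists>c\<in>Hom C (Src C (Neg C (Ide C (ShO C W)))) (Src C (Neg C (ShM C f))).
     c \<cdot> ZeroM C O' (ShO C W) = h \<cdot> ZeroM C O' Z \<and> ShM C z \<cdot> Neg C (Ide C (ShO C W)) = Neg C (ShM C f) \<cdot> c"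
  proof (rule TR3[OF t0 t1])
    show "z \<in> Hom C (Src C (ZeroM C W O')) (Src C g)" using s z by simp
    show "ZeroM C O' Z \<in> Hom C (Src C (ZeroM C O' (ShO C W))) (Src C h)" using s ZeroM_Hom O1 OO by simp
    show "ZeroM C O' Z \<cdot> ZeroM C W O' = g \<cdot> z"
      using gz Zero_Cmp[of "ZeroM C W O'" W O' Z] ZeroM_Hom O1 OO by simp
  qed
  then obtain c where c: "c \<in> Hom C (ShO C W) (ShO C X)"
    "ShM C z \<cdot> Neg C (Ide C (ShO C W)) = Neg C (ShM C f) \<cdot> c" unfolding s by blast
  have "ShM C z \<cdot> Neg C (Ide C (ShO C W)) = Neg C (ShM C z)"
    using Cmp_Neg[OF IW ShM_Hom[OF z]] Cmp_Ide[OF ShM_Hom[OF z]] by simp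
  moreover have "Neg C (ShM C f) \<cdot> c = Neg C (ShM C f \<cdot> c)"
    using Neg_Cmp[OF c(1) ShM_Hom[OF f]] .
  ultimately have "ShM C z = ShM C f \<cdot> c"
    using c(2) Neg_Neg ShM_Hom[OF z] Cmp_Hom[OF c(1) ShM_Hom[OF f]] by metis
  moreover obtain w where w: "w \<in> Hom C W X" "ShM C w = c" using ShM_full[OF c(1)] O1 by blast
  ultimately have "ShM C z = ShM C (f \<cdot> w)" using ShM_Cmp[OF w(1) f] by simp
  then have "f \<cdot> w = z" using ShM_faithful z Cmp_Hom[OF w(1) f] by metis
  then show ?thesis using that w by blast
qed

lemma Tri_weak_kernel':
  assumes t: "(f, g, h) \<in> Tri C" and f: "f \<in> Hom C X Y" and g: "g \<in> Hom C Y Z"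
    and z: "z \<in> Hom C W Z" and hz: "h \<cdot> z = ZeroM C W (ShO C X)"
  obtains w where "w \<in> Hom C W Y" "g \<cdot> w = z"
  using Tri_weak_kernel[OF Tri_rotate[OF t] g Tri_Hom_trd[OF t f g] z hz] that by blast

lemma Tri_weak_kernel'':
  assumes t: "(f, g, h) \<in> Tri C" and f: "f \<in> Hom C X Y" and h: "h \<in> Hom C Z (ShO C X)"
    and z: "z \<in> Hom C W (ShO C X)" and fz: "ShM C f \<cdot> z = ZeroM C W (ShO C Y)"
  obtains w where "w \<in> Hom C W Z" "h \<cdot> w = z"
proof (rule Tri_weak_kernel'[OF Tri_rotate[OF t] _ h z])
  show "g \<in> Hom C Y Z" using Tri_Hom_snd[OF t f h] .
  show "Neg C (ShM C f) \<cdot> z = ZeroM C W (ShO C Y)"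
    using Neg_Cmp[OF z ShM_Hom[OF f]] fz Neg_Zero Hom_Obj[OF z] Hom_Obj[OF f] by simp
qed (rule that)

lemma Tri_weak_cokernel':
  assumes t: "(f, g, h) \<in> Tri C" and f: "f \<in> Hom C X Y" and g: "g \<in> Hom C Y Z"
    and z: "z \<in> Hom C Z W" and zg: "z \<cdot> g = ZeroM C Y W"
  obtains w where "w \<in> Hom C (ShO C X) W" "w \<cdot> h = z"
proof (rule Tri_weak_cokernel[OF Tri_rotate[OF t] g _ z zg])
  show "h \<in> Hom C Z (ShO C X)" using Tri_Hom_trd[OF t f g] .
qed (rule that)

text \<open>A right inverse exists since everything into \<open>Y\<close> dies in the zero cone.  It is a left inverse
  because \<open>f\<close> is monic: what \<open>f\<close> kills factors, after suspension, through the zero cone.\<close>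

lemma Iso_if_cone_zero:
  assumes t: "(f, g, h) \<in> Tri C" and f: "f \<in> Hom C X Y" and g: "g \<in> Hom C Y Z"
    and Z: "zero_object C Z"
  shows "f \<in> Iso C X Y"
proof -
  have O1: "X \<in> Obj C" "Y \<in> Obj C" using f Hom_Obj by auto
  have "g \<cdot> Ide C Y = ZeroM C Y Z" using zero_object_Hom(3)[OF Z] g Cmp_Ide by simp
  then obtain w where w: "w \<in> Hom C Y X" "f \<cdot> w = Ide C Y"
    using Tri_weak_kernel[OF t f g Ide_Hom] O1 by blast
  have h: "h \<in> Hom C Z (ShO C X)" using Tri_Hom_trd[OF t f g] .
  have mono: "x = ZeroM C X X" if x: "x \<in> Hom C X X" "f \<cdot> x = ZeroM C X Y" for x
  proof -
    have "ShM C f \<cdot> ShM C x = ZeroM C (ShO C X) (ShO C Y)"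
      using x ShM_Cmp[OF x(1) f] ShM_Zero O1 by simp
    then obtain v where v: "v \<in> Hom C (ShO C X) Z" "h \<cdot> v = ShM C x"
      using Tri_weak_kernel''[OF t f h ShM_Hom[OF x(1)]] by blast
    have "v = ZeroM C (ShO C X) Z" using zero_object_Hom(3)[OF Z] v by auto
    then have "ShM C x = ZeroM C (ShO C X) (ShO C X)" using v Cmp_Zero[OF h] O1 by simp
    then show ?thesis using ShM_eq_Zero x by blast
  qed
  have wf: "w \<cdot> f \<in> Hom C X X" using Cmp_Hom[OF f w(1)] .
  have I: "Ide C X \<in> Hom C X X" using Ide_Hom O1 by simp
  have "f \<cdot> (w \<cdot> f) = f \<cdot> Ide C X"
    using f w Cmp_subst[OF w(2), of f] by (simp add: Hom_def)
  then have "f \<cdot> Diff (w \<cdot> f) (Ide C X) = ZeroM C X Y"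
    using Cmp_Diff[OF wf I f] Diff_self[OF Cmp_Hom[OF I f]] by simp
  then have "Diff (w \<cdot> f) (Ide C X) = ZeroM C X X" using mono Diff_Hom wf I by blast
  then have "w \<cdot> f = Ide C X" using Diff_eq_Zero[OF wf I] by simp
  then show ?thesis using isoI f w by blast
qed

text \<open>The cone of \<open>g\<close> is isomorphic to some \<open>\<Sigma>X\<close>, as \<open>\<Sigma>\<close> is only an equivalence; rotating the triangle
  back gives the fibre \<open>X\<close>.\<close>

lemma fibre_ex:
  assumes g: "g \<in> Hom C Y Z"
  obtains f h X where "(f, g, h) \<in> Tri C" "f \<in> Hom C X Y" "h \<in> Hom C Z (ShO C X)" "X \<in> Obj C"
proof -
  have O1: "Y \<in> Obj C" "Z \<in> Obj C" using g Hom_Obj by auto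
  obtain h0 k0 W where t: "(g, h0, k0) \<in> Tri C" "h0 \<in> Hom C Z W" "k0 \<in> Hom C W (ShO C Y)" "W \<in> Obj C"
    using cone_ex[OF g] .
  obtain X i where X: "X \<in> Obj C" and i: "i \<in> Iso C (ShO C X) W"
    using shift_essentially_surjective[OF t(4)] unfolding isomorphic_def by auto
  obtain j where j: "j \<in> Hom C W (ShO C X)" "j \<cdot> i = Ide C (ShO C X)" "i \<cdot> j = Ide C W" "i \<in> Hom C (ShO C X) W"
    using isoE[OF i] .
  define h where "h = j \<cdot> h0"
  have h: "h \<in> Hom C Z (ShO C X)" unfolding h_def using Cmp_Hom t j by blast
  have ki: "k0 \<cdot> i \<in> Hom C (ShO C X) (ShO C Y)" using Cmp_Hom t j by blast
  obtain f where f: "f \<in> Hom C X Y" "ShM C f = Neg C (k0 \<cdot> i)"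
    using ShM_full[OF Neg_Hom[OF ki]] X O1 by blast
  have cand: "candidate_triangle C f g h" unfolding candidate_triangle_def using f g h by blast
  have nf: "Neg C (ShM C f) = k0 \<cdot> i" using f(2) Neg_Neg[OF ki] by simp
  have "(g, h, k0 \<cdot> i) \<in> Tri C"
  proof (rule TR1_iso[OF t(1)])
    show "candidate_triangle C g h (k0 \<cdot> i)" unfolding candidate_triangle_def using g h ki by blast
    show "Ide C Y \<in> Iso C (Src C g) (Src C g)" using Ide_Iso g O1 by (auto simp: Hom_def)
    show "Ide C Z \<in> Iso C (Src C h0) (Src C h)" using Ide_Iso t(2) h O1 by (auto simp: Hom_def)
    show "j \<in> Iso C (Src C k0) (Src C (k0 \<cdot> i))" using isoI(1)[OF j(1) j(4) j(3) j(2)] t(3) ki by (auto simp: Hom_def)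
    show "Ide C Z \<cdot> g = g \<cdot> Ide C Y" using g by (auto simp: Hom_def)
    show "j \<cdot> h0 = h \<cdot> Ide C Z" using h h_def by (auto simp: Hom_def)
    show "ShM C (Ide C Y) \<cdot> k0 = (k0 \<cdot> i) \<cdot> j" 
      using ShM_Ide O1 t(3) j by (auto simp: Hom_def)
  qed
  then have "(f, g, h) \<in> Tri C" using TR2[OF cand] nf by simp
  then show ?thesis using that f h X by blast
qed

definition orth :: "'o \<Rightarrow> 'o \<Rightarrow> bool" where
  "orth X Y \<longleftrightarrow> (\<forall>f\<in>Hom C X Y. f = ZeroM C X Y)"

lemma orthD: "orth X Y \<Longrightarrow> f \<in> Hom C X Y \<Longrightarrow> f = ZeroM C X Y"
  unfolding orth_def by blast

lemma zero_object_iff_orth: "zero_object C X \<longleftrightarrow> X \<in> Obj C \<and> orth X X"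
  using zero_object_iff zero_object_Hom(3) Ide_Hom unfolding orth_def by metis

lemma orth_zero: "zero_object C X \<Longrightarrow> orth X Y" "zero_object C Y \<Longrightarrow> orth X Y"
  using zero_object_Hom unfolding orth_def by blast+

lemma orth_iso_left:
  assumes "orth X Y" "isomorphic C X X'" shows "orth X' Y"
  unfolding orth_def
proof
  fix f assume f: "f \<in> Hom C X' Y"
  obtain i j where j: "j \<in> Hom C X' X" "i \<cdot> j = Ide C X'" "i \<in> Hom C X X'"
    using isomorphicE[OF assms(2)] by metis
  have "f \<cdot> i = ZeroM C X Y" using orthD[OF assms(1)] Cmp_Hom[OF j(3) f] by blast
  then have "f \<cdot> i \<cdot> j = ZeroM C X' Y"
    using f j Zero_Cmp[OF j(1)] Cmp_assoc[OF j(1,3) f] Hom_Obj[OF f] by metis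
  then show "f = ZeroM C X' Y" using j Cmp_Ide[OF f] by simp
qed

lemma orth_iso_right:
  assumes "orth X Y" "isomorphic C Y Y'" shows "orth X Y'"
  unfolding orth_def
proof
  fix f assume f: "f \<in> Hom C X Y'"
  obtain i j where j: "j \<in> Hom C Y' Y" "i \<cdot> j = Ide C Y'" "i \<in> Hom C Y Y'"
    using isomorphicE[OF assms(2)] by metis
  have "j \<cdot> f = ZeroM C X Y" using orthD[OF assms(1)] Cmp_Hom[OF f j(1)] by blast
  then have "i \<cdot> j \<cdot> f = ZeroM C X Y'"
    using f j Cmp_Zero[OF j(3)] Hom_Obj[OF f] by metis
  then show "f = ZeroM C X Y'" using j Ide_Cmp[OF f] Cmp_assoc[OF f j(1,3)] by simp
qed

lemma orth_shift_iff:
  assumes "X \<in> Obj C" "Y \<in> Obj C"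
  shows "orth (ShO C X) (ShO C Y) \<longleftrightarrow> orth X Y"
proof
  assume "orth (ShO C X) (ShO C Y)"
  then show "orth X Y" unfolding orth_def using ShM_Hom ShM_eq_Zero by metis
next
  assume a: "orth X Y"
  show "orth (ShO C X) (ShO C Y)" unfolding orth_def
  proof
    fix f assume "f \<in> Hom C (ShO C X) (ShO C Y)"
    then obtain g where "g \<in> Hom C X Y" "ShM C g = f" using ShM_full assms by blast
    then show "f = ZeroM C (ShO C X) (ShO C Y)" using orthD[OF a] ShM_Zero assms by metis
  qed
qed

end

section \<open>Small sets\<close>

lemma small_lepoll: "small U B \<Longrightarrow> A \<lesssim> B \<Longrightarrow> small U A"
  unfolding small_def by (rule lesspoll_trans1)

lemma small_subset: "small U B \<Longrightarrow> A \<subseteq> B \<Longrightarrow> small U A"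
  by (rule small_lepoll[OF _ subset_imp_lepoll])

lemma small_image: "small U A \<Longrightarrow> small U (f ` A)"
  by (rule small_lepoll[OF _ image_lepoll])

lemma small_inj: "inj_on f A \<Longrightarrow> f ` A \<subseteq> B \<Longrightarrow> small U B \<Longrightarrow> small U A"
  by (rule small_lepoll) (auto simp: lepoll_def)

text \<open>Coproducts, products and compactness only refer to index sets inside the universe; this lemma
  carries their properties over to small index sets of any type.\<close>

lemma small_index:
  assumes "small U A" 
  obtains I e where "I \<subseteq> U" "small U I" "bij_betw e I A"
proof -
  have "A \<lesssim> U" using assms unfolding small_def by (rule lesspoll_imp_lepoll)
  then obtain a where a: "inj_on a A" "a ` A \<subseteq> U" unfolding lepoll_def by auto
  have "bij_betw (inv_into A a) (a ` A) A" using a(1) by (simp add: bij_betw_inv_into inj_on_imp_bij_betw)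
  then show ?thesis using that a(2) small_image[OF assms] by blast
qed

context
  fixes U :: "'u set"
  assumes universe: "universe U"
begin

lemma small_countable: "countable A \<Longrightarrow> small U A"
  using universe unfolding universe_def small_def countable_def lepoll_def[symmetric]
  by (metis lepoll_def lesspoll_trans1 subset_UNIV)

lemma small_Pow:
  assumes "small U A" shows "small U (Pow A)"
proof -
  obtain I e where I: "I \<subseteq> U" "small U I" "bij_betw e I A" using small_index[OF assms] .
  have "small U (Pow I)" using universe I unfolding universe_def small_def by blast
  then have "small U (image e ` Pow I)" by (rule small_image)
  moreover have "image e ` Pow I = Pow A"
    using I(3) by (auto simp: bij_betw_def image_Pow_surj)
  ultimately show ?thesis by simp
qed

text \<open>Regularity bounds a union; to bound a disjoint union, its summands are made disjoint inside
  the universe by an injection of \<open>U \<times> U\<close> into \<open>U\<close>.\<close>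

lemma small_Sigma:
  assumes A: "small U A" and B: "\<And>x. x \<in> A \<Longrightarrow> small U (B x)"
  shows "small U (Sigma A B)"
proof -
  have "(UNIV :: nat set) \<prec> U" using universe unfolding universe_def by blast
  then have "infinite U" using infinite_le_lepoll lesspoll_imp_lepoll by blast
  then have "U \<times> U \<approx> U" using card_of_Times_same_infinite eqpoll_iff_card_of_ordIso by blast
  then obtain p where p: "inj_on p (U \<times> U)" "p ` (U \<times> U) = U" 
    unfolding eqpoll_def bij_betw_def by auto
  have "\<exists>b. inj_on b (B x) \<and> b ` B x \<subseteq> U" if "x \<in> A" for x
    using B[OF that] lesspoll_imp_lepoll unfolding small_def lepoll_def by blast
  then obtain b where b: "\<And>x. x \<in> A \<Longrightarrow> inj_on (b x) (B x) \<and> b x ` B x \<subseteq> U" by metis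
  obtain I e where I: "I \<subseteq> U" "small U I" "bij_betw e I A" using small_index[OF A] .
  define F where "F i = (\<lambda>y. p (i, b (e i) y)) ` B (e i)" for i
  have e: "e i \<in> A" if "i \<in> I" for i using I(3) that by (auto simp: bij_betw_def)
  have F: "F i \<subseteq> U \<and> F i \<prec> U" if i: "i \<in> I" for i
  proof
    show "F i \<subseteq> U" unfolding F_def using p(2) b[OF e[OF i]] I(1) i by blast
    show "F i \<prec> U" using small_image[OF B[OF e[OF i]]] unfolding F_def small_def by blast
  qed
  have "\<forall>I\<subseteq>U. \<forall>F. I \<prec> U \<and> (\<forall>i\<in>I. F i \<subseteq> U \<and> F i \<prec> U) \<longrightarrow> (\<Union>i\<in>I. F i) \<prec> U"
    using universe unfolding universe_def by (elim conjE)
  then have sm: "small U (\<Union>i\<in>I. F i)" using I(1,2) F unfolding small_def by simp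
  let ?d = "inv_into I e"
  have d: "?d x \<in> I" "e (?d x) = x" if "x \<in> A" for x
    using I(3) that by (auto simp: bij_betw_def inv_into_into f_inv_into_f)
  let ?f = "\<lambda>(x, y). p (?d x, b x y)"
  show ?thesis
  proof (rule small_inj[OF _ _ sm])
    show "inj_on ?f (Sigma A B)"
    proof (rule inj_onI, clarify)
      fix x y x' y' assume a: "x \<in> A" "y \<in> B x" "x' \<in> A" "y' \<in> B x'"
        and eq: "p (?d x, b x y) = p (?d x', b x' y')"
      have "(?d x, b x y) \<in> U \<times> U" "(?d x', b x' y') \<in> U \<times> U"
        using a d I(1) b by blast+
      then have "?d x = ?d x'" "b x y = b x' y'" using p(1) eq by (auto simp: inj_on_def)
      then have "x = x'" "b x y = b x y'" using d a by metis+
      then show "x = x' \<and> y = y'" using b[of x] a by (auto simp: inj_on_def)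
    qed
    show "?f ` Sigma A B \<subseteq> (\<Union>i\<in>I. F i)"
    proof clarify
      fix x y assume a: "x \<in> A" "y \<in> B x"
      have "p (?d x, b x y) \<in> F (?d x)" unfolding F_def using d[OF a(1)] a(2) by auto
      then show "p (?d x, b x y) \<in> (\<Union>i\<in>I. F i)" using d[OF a(1)] by auto
    qed
  qed
qed

text \<open>A function is its graph, a subset of the disjoint union.\<close>

lemma small_PiE:
  assumes "small U A" "\<And>x. x \<in> A \<Longrightarrow> small U (B x)"
  shows "small U (PiE A B)"
proof (rule small_inj[OF _ _ small_Pow[OF small_Sigma[OF assms]]])
  show "inj_on (\<lambda>f. (\<lambda>x. (x, f x)) ` A) (PiE A B)"
  proof (rule inj_onI)
    fix f g assume f: "f \<in> PiE A B" and g: "g \<in> PiE A B"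
      and eq: "(\<lambda>x. (x, f x)) ` A = (\<lambda>x. (x, g x)) ` A"
    show "f = g"
    proof (rule PiE_ext[OF f g])
      fix x assume "x \<in> A"
      then have "(x, f x) \<in> (\<lambda>x. (x, g x)) ` A" using eq by auto
      then show "f x = g x" by auto
    qed
  qed
  show "(\<lambda>f. (\<lambda>x. (x, f x)) ` A) ` PiE A B \<subseteq> Pow (Sigma A B)" by auto
qed

end

section \<open>Suspension and coproducts\<close>

context category
begin

lemma coproduct_transport:
  assumes P: "is_coproduct C I A P \<iota>" and b: "b \<in> Iso C P P'"
    and a: "\<And>i. i \<in> I \<Longrightarrow> a i \<in> Iso C (A' i) (A i)"
  shows "is_coproduct C I A' P' (\<lambda>i. b \<cdot> \<iota> i \<cdot> a i)"
proof -
  obtain b' where b': "b' \<in> Hom C P' P" "b' \<cdot> b = Ide C P" "b \<cdot> b' = Ide C P'" "b \<in> Hom C P P'"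
    using isoE[OF b] .
  have "\<exists>a'. a' \<in> Hom C (A i) (A' i) \<and> a' \<cdot> a i = Ide C (A' i) \<and> a i \<cdot> a' = Ide C (A i) \<and> a i \<in> Hom C (A' i) (A i)"
    if "i \<in> I" for i using isoE[OF a[OF that]] by metis
  then obtain a' where a': "\<And>i. i \<in> I \<Longrightarrow> a' i \<in> Hom C (A i) (A' i) \<and> a' i \<cdot> a i = Ide C (A' i) \<and>
      a i \<cdot> a' i = Ide C (A i) \<and> a i \<in> Hom C (A' i) (A i)" by metis
  note \<iota> = is_coproductD(2)[OF P]
  show ?thesis unfolding is_coproduct_def
  proof (intro conjI ballI allI impI)
    show "P' \<in> Obj C" using b' Hom_Obj by auto
    show "b \<cdot> \<iota> i \<cdot> a i \<in> Hom C (A' i) P'" if "i \<in> I" for i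
      using a'[OF that] b' \<iota>[OF that] Cmp_Hom by blast
    fix Y f assume Y: "Y \<in> Obj C" and f: "\<forall>i\<in>I. f i \<in> Hom C (A' i) Y"
    have "f i \<cdot> a' i \<in> Hom C (A i) Y" if "i \<in> I" for i using f a' that Cmp_Hom by blast
    then obtain h where h: "h \<in> Hom C P Y" "\<And>i. i \<in> I \<Longrightarrow> h \<cdot> \<iota> i = f i \<cdot> a' i"
      using coproduct_ex[OF P Y, of "\<lambda>i. f i \<cdot> a' i"] by blast
    show "\<exists>!h. h \<in> Hom C P' Y \<and> (\<forall>i\<in>I. h \<cdot> b \<cdot> \<iota> i \<cdot> a i = f i)"
    proof (rule ex1I[of _ "h \<cdot> b'"])
      have "(h \<cdot> b') \<cdot> b \<cdot> \<iota> i \<cdot> a i = f i" if i: "i \<in> I" for i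
      proof -
        have "(h \<cdot> b') \<cdot> b \<cdot> \<iota> i \<cdot> a i = (h \<cdot> \<iota> i) \<cdot> a i"
          using h b' a'[OF i] \<iota>[OF i] Cmp_subst[OF b'(2), of "\<iota> i \<cdot> a i"] by (simp add: Hom_def)
        also have "\<dots> = f i \<cdot> a' i \<cdot> a i" using h(2)[OF i] a'[OF i] f i by (simp add: Hom_def)
        also have "\<dots> = f i" using a'[OF i] f i by (simp add: Hom_def)
        finally show ?thesis .
      qed
      then show "h \<cdot> b' \<in> Hom C P' Y \<and> (\<forall>i\<in>I. (h \<cdot> b') \<cdot> b \<cdot> \<iota> i \<cdot> a i = f i)"
        using h b' Cmp_Hom by blast
      fix k assume k: "k \<in> Hom C P' Y \<and> (\<forall>i\<in>I. k \<cdot> b \<cdot> \<iota> i \<cdot> a i = f i)"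
      have "k \<cdot> b = h"
      proof (rule coproduct_eqI[OF P _ h(1)])
        show "k \<cdot> b \<in> Hom C P Y" using k b' Cmp_Hom by blast
        fix i assume i: "i \<in> I"
        have "(k \<cdot> b) \<cdot> \<iota> i = k \<cdot> b \<cdot> \<iota> i \<cdot> a i \<cdot> a' i"
          using k b' a'[OF i] \<iota>[OF i] by (simp add: Hom_def)
        also have "\<dots> = (k \<cdot> b \<cdot> \<iota> i \<cdot> a i) \<cdot> a' i"
          using k b' a'[OF i] \<iota>[OF i] by (simp add: Hom_def)
        also have "\<dots> = f i \<cdot> a' i" using k i by simp
        finally show "(k \<cdot> b) \<cdot> \<iota> i = h \<cdot> \<iota> i" using h(2)[OF i] by simp
      qed
      moreover have "k = (k \<cdot> b) \<cdot> b'" using k b' by (simp add: Hom_def)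
      ultimately show "k = h \<cdot> b'" by simp
    qed
  qed
qed

end

context triangulated_category
begin

text \<open>\<open>\<Sigma>\<close> is fully faithful, and every test object is isomorphic to a suspension.\<close>

lemma coproduct_ShO_iff:
  assumes A: "\<And>i. i \<in> I \<Longrightarrow> \<iota> i \<in> Hom C (A i) P" and P: "P \<in> Obj C"
  shows "is_coproduct C I (\<lambda>i. ShO C (A i)) (ShO C P) (\<lambda>i. ShM C (\<iota> i)) \<longleftrightarrow> is_coproduct C I A P \<iota>"
    (is "?L \<longleftrightarrow> ?R")
proof
  assume L: ?L
  show ?R unfolding is_coproduct_def
  proof (intro conjI ballI allI impI)
    fix Y f assume Y: "Y \<in> Obj C" and f: "\<forall>i\<in>I. f i \<in> Hom C (A i) Y"
    obtain h where h: "h \<in> Hom C (ShO C P) (ShO C Y)" "\<And>i. i \<in> I \<Longrightarrow> h \<cdot> ShM C (\<iota> i) = ShM C (f i)"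
      using coproduct_ex[OF L, of "ShO C Y" "\<lambda>i. ShM C (f i)"] f ShM_Hom Y ShO_Obj by blast
    obtain k where k: "k \<in> Hom C P Y" "ShM C k = h" using ShM_full[OF h(1) P Y] .
    show "\<exists>!h. h \<in> Hom C P Y \<and> (\<forall>i\<in>I. h \<cdot> \<iota> i = f i)"
    proof (rule ex1I[of _ k])
      have "k \<cdot> \<iota> i = f i" if i: "i \<in> I" for i
        using ShM_faithful[OF Cmp_Hom[OF A[OF i] k(1)]] f i h(2)[OF i] k(2) ShM_Cmp[OF A[OF i] k(1)] by simp
      then show "k \<in> Hom C P Y \<and> (\<forall>i\<in>I. k \<cdot> \<iota> i = f i)" using k by simp
      fix l assume l: "l \<in> Hom C P Y \<and> (\<forall>i\<in>I. l \<cdot> \<iota> i = f i)"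
      have "ShM C l = ShM C k"
      proof (rule coproduct_eqI[OF L])
        show "ShM C l \<in> Hom C (ShO C P) (ShO C Y)" "ShM C k \<in> Hom C (ShO C P) (ShO C Y)"
          using l k ShM_Hom by auto
        show "ShM C l \<cdot> ShM C (\<iota> i) = ShM C k \<cdot> ShM C (\<iota> i)" if i: "i \<in> I" for i
          using l i h(2)[OF i] k(2) ShM_Cmp[OF A[OF i], of l Y] by simp
      qed
      then show "l = k" using ShM_faithful l k by blast
    qed
  qed (use A P in auto)
next
  assume R: ?R
  show ?L unfolding is_coproduct_def
  proof (intro conjI ballI allI impI)
    fix Y f assume Y: "Y \<in> Obj C" and f: "\<forall>i\<in>I. f i \<in> Hom C (ShO C (A i)) Y"
    obtain Y' b where Y': "Y' \<in> Obj C" and b: "b \<in> Iso C (ShO C Y') Y"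
      using shift_essentially_surjective[OF Y] unfolding isomorphic_def by auto
    obtain b' where b': "b' \<in> Hom C Y (ShO C Y')" "b' \<cdot> b = Ide C (ShO C Y')" "b \<cdot> b' = Ide C Y"
        "b \<in> Hom C (ShO C Y') Y" using isoE[OF b] .
    have "\<exists>g. g \<in> Hom C (A i) Y' \<and> ShM C g = b' \<cdot> f i" if i: "i \<in> I" for i
      using ShM_full[of "b' \<cdot> f i" "A i" Y'] Cmp_Hom[of "f i" "ShO C (A i)" Y b'] f i b' Y' A[OF i] Hom_Obj
      by metis
    then obtain g where g: "\<And>i. i \<in> I \<Longrightarrow> g i \<in> Hom C (A i) Y' \<and> ShM C (g i) = b' \<cdot> f i" by metis
    obtain k where k: "k \<in> Hom C P Y'" "\<And>i. i \<in> I \<Longrightarrow> k \<cdot> \<iota> i = g i"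
      using coproduct_ex[OF R Y', of g] g by blast
    have Sk: "ShM C k \<in> Hom C (ShO C P) (ShO C Y')" using ShM_Hom k by blast
    show "\<exists>!h. h \<in> Hom C (ShO C P) Y \<and> (\<forall>i\<in>I. h \<cdot> ShM C (\<iota> i) = f i)"
    proof (rule ex1I[of _ "b \<cdot> ShM C k"])
      have "(b \<cdot> ShM C k) \<cdot> ShM C (\<iota> i) = f i" if i: "i \<in> I" for i
      proof -
        have "(b \<cdot> ShM C k) \<cdot> ShM C (\<iota> i) = b \<cdot> ShM C (k \<cdot> \<iota> i)"
          using Cmp_assoc[OF ShM_Hom[OF A[OF i]] Sk b'(4)] ShM_Cmp[OF A[OF i] k(1)] by simp
        also have "\<dots> = b \<cdot> b' \<cdot> f i" using k(2)[OF i] g[OF i] by simp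
        also have "\<dots> = f i" using Cmp_assoc[of "f i" _ Y b' _ b] b' f i Ide_Cmp by metis
        finally show ?thesis .
      qed
      then show "b \<cdot> ShM C k \<in> Hom C (ShO C P) Y \<and> (\<forall>i\<in>I. (b \<cdot> ShM C k) \<cdot> ShM C (\<iota> i) = f i)"
        using Cmp_Hom Sk b' by blast
      fix l assume l: "l \<in> Hom C (ShO C P) Y \<and> (\<forall>i\<in>I. l \<cdot> ShM C (\<iota> i) = f i)"
      have bl: "b' \<cdot> l \<in> Hom C (ShO C P) (ShO C Y')" using l b' Cmp_Hom by blast
      obtain m where m: "m \<in> Hom C P Y'" "ShM C m = b' \<cdot> l" using ShM_full[OF bl P Y'] .
      have "m = k"
      proof (rule coproduct_eqI[OF R m(1) k(1)])
        fix i assume i: "i \<in> I"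
        have "ShM C (m \<cdot> \<iota> i) = b' \<cdot> l \<cdot> ShM C (\<iota> i)"
          using ShM_Cmp[OF A[OF i] m(1)] m(2) Cmp_assoc[OF ShM_Hom[OF A[OF i]] _ b'(1)] l by metis
        also have "\<dots> = ShM C (g i)" using l i g[OF i] by simp
        finally have "m \<cdot> \<iota> i = g i" using ShM_faithful g[OF i] Cmp_Hom[OF A[OF i] m(1)] by blast
        then show "m \<cdot> \<iota> i = k \<cdot> \<iota> i" using k(2)[OF i] by simp
      qed
      then have "b \<cdot> ShM C k = b \<cdot> b' \<cdot> l" using m by simp
      also have "\<dots> = l" using Cmp_assoc[of l _ Y b' _ b] b' l Ide_Cmp by metis
      finally show "l = b \<cdot> ShM C k" by simp
    qed
  qed (use A P ShM_Hom in auto)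
qed

end

section \<open>Compact objects\<close>

context additive_category
begin

lemma Hom_group_group: "X \<in> Obj C \<Longrightarrow> Y \<in> Obj C \<Longrightarrow> group (Hom_group C X Y)"
  using Hom_comm_group comm_group.axioms(2) by blast

lemma carrier_sum_Hom:
  assumes "c \<in> Obj C" "\<And>i. i \<in> I \<Longrightarrow> A i \<in> Obj C"
  shows "carrier (sum_group I (\<lambda>i. Hom_group C c (A i))) =
    {x \<in> \<Pi>\<^sub>E i\<in>I. Hom C c (A i). finite {i \<in> I. x i \<noteq> ZeroM C c (A i)}}"
  using carrier_sum_group[of I "\<lambda>i. Hom_group C c (A i)"] Hom_group_group assms by simp

text \<open>Composition with \<open>r\<close> is additive and kills every summand but the one with index \<open>j\<close>.\<close>

lemma gfinprod_component:
  assumes P: "is_coproduct C I A P \<iota>" and c: "c \<in> Obj C"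
    and x: "x \<in> carrier (sum_group I (\<lambda>i. Hom_group C c (A i)))"
    and j: "j \<in> I" and r: "r \<in> Hom C P (A j)" "r \<cdot> \<iota> j = Ide C (A j)"
      "\<And>i. i \<in> I \<Longrightarrow> i \<noteq> j \<Longrightarrow> r \<cdot> \<iota> i = ZeroM C (A i) (A j)"
  shows "r \<cdot> gfinprod (Hom_group C c P) (\<lambda>i. \<iota> i \<cdot> x i) I = x j"
proof -
  note PD = is_coproductD[OF P]
  interpret G: comm_group "Hom_group C c P" using Hom_comm_group c PD(1) by blast
  have x': "x i \<in> Hom C c (A i)" if "i \<in> I" for i
    using x that carrier_sum_Hom[of c I A, OF c PD(3)] by auto
  have fin: "finite {i \<in> I. x i \<noteq> ZeroM C c (A i)}" 
    using x carrier_sum_Hom[of c I A, OF c PD(3)] by auto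
  let ?f = "\<lambda>i. \<iota> i \<cdot> x i"
  have fh: "?f i \<in> Hom C c P" if "i \<in> I" for i using x' PD(2) that Cmp_Hom by blast
  let ?F = "{i \<in> I. ?f i \<noteq> ZeroM C c P}"
  have finF: "finite ?F"
    by (rule finite_subset[OF _ fin]) (use Cmp_Zero[OF PD(2) c] in auto)
  have rx: "r \<cdot> ?f i = (if i = j then x j else ZeroM C c (A j))" if i: "i \<in> I" for i
  proof -
    have "r \<cdot> ?f i = (r \<cdot> \<iota> i) \<cdot> x i" using Cmp_assoc[OF x'[OF i] PD(2)[OF i] r(1)] by simp
    then show ?thesis using r i x'[OF i] Ide_Cmp[of "x j" c "A j"] Zero_Cmp[OF x'[OF i], of "A j"] PD(3)[OF j]
      by (cases "i = j") simp_all
  qed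
  have zc: "ZeroM C c (A j) \<in> Hom C c (A j)" using ZeroM_Hom c PD(3)[OF j] by blast
  have fp: "r \<cdot> finprod (Hom_group C c P) ?f F = (if j \<in> F then x j else ZeroM C c (A j))"
    if "finite F" "F \<subseteq> I" for F
    using that
  proof (induction F rule: finite_induct)
    case empty
    then show ?case using Cmp_Zero[OF r(1) c] by simp
  next
    case (insert i F)
    have fF: "?f \<in> F \<rightarrow> carrier (Hom_group C c P)" using insert.prems fh by auto
    have i: "i \<in> I" using insert.prems by auto
    have p: "finprod (Hom_group C c P) ?f F \<in> Hom C c P" using G.finprod_closed[OF fF] by simp
    have "r \<cdot> finprod (Hom_group C c P) ?f (insert i F)
        = Add C (r \<cdot> ?f i) (r \<cdot> finprod (Hom_group C c P) ?f F)"
      using G.finprod_insert[OF insert.hyps fF] fh[OF i] Cmp_Add[OF fh[OF i] p r(1)] by simp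
    also have "\<dots> = (if j \<in> insert i F then x j else ZeroM C c (A j))"
      using rx[OF i] insert Add_Zero[OF x'[OF j]] Zero_Add[OF x'[OF j]] Zero_Add[OF zc] by auto
    finally show ?case .
  qed
  have "gfinprod (Hom_group C c P) ?f I = finprod (Hom_group C c P) ?f ?F"
    using finF by (simp add: gfinprod_def)
  moreover have "x j = ZeroM C c (A j)" if "j \<notin> ?F"
  proof -
    have "?f j = ZeroM C c P" using that j by simp
    then show ?thesis using rx[OF j] Cmp_Zero[OF r(1) c] by simp
  qed
  ultimately show ?thesis using fp[OF finF] by auto
qed

lemma compact_object_sum:
  fixes U :: "'u set"
  assumes c: "compact_object U C c" and P: "is_coproduct C I A P \<iota>" and I: "small U I"
    and f: "f \<in> Hom C c P"
  obtains e and J :: "'u set" and x where "bij_betw e J I" "is_coproduct C J (\<lambda>j. A (e j)) P (\<lambda>j. \<iota> (e j))"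
    "x \<in> carrier (sum_group J (\<lambda>j. Hom_group C c (A (e j))))"
    "f = gfinprod (Hom_group C c P) (\<lambda>j. \<iota> (e j) \<cdot> x j) J"
proof -
  obtain J e where J: "J \<subseteq> U" "small U J" "bij_betw e J I" using small_index[OF I] .
  note P' = coproduct_reindex[OF J(3) P]
  have "(\<lambda>f. gfinprod (Hom_group C c P) (\<lambda>i. \<iota> (e i) \<cdot> f i) J)
          \<in> iso (sum_group J (\<lambda>i. Hom_group C c (A (e i)))) (Hom_group C c P)"
    using c J P' unfolding compact_object_def by blast
  then have "f \<in> (\<lambda>f. gfinprod (Hom_group C c P) (\<lambda>i. \<iota> (e i) \<cdot> f i) J) `
      carrier (sum_group J (\<lambda>i. Hom_group C c (A (e i))))"
    using f by (simp add: iso_def bij_betw_def)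
  then show ?thesis using that[OF J(3) P'] by blast
qed

text \<open>A morphism from a compact object is a finite sum of morphisms through summands, which makes
  compactness an induction principle.\<close>

lemma compact_object_induct:
  fixes U :: "'u set"
  assumes c: "compact_object U C c" and P: "is_coproduct C I A P \<iota>" and I: "small U I"
    and f: "f \<in> Hom C c P" and zero: "Q (ZeroM C c P)"
    and add: "\<And>g h. g \<in> Hom C c P \<Longrightarrow> h \<in> Hom C c P \<Longrightarrow> Q g \<Longrightarrow> Q h \<Longrightarrow> Q (Add C g h)"
    and inc: "\<And>i g. i \<in> I \<Longrightarrow> g \<in> Hom C c (A i) \<Longrightarrow> Q (\<iota> i \<cdot> g)"
  shows "Q f"
proof -
  obtain e and J :: "'u set" and x where J: "bij_betw e J I" and P': "is_coproduct C J (\<lambda>j. A (e j)) P (\<lambda>j. \<iota> (e j))"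
    and x: "x \<in> carrier (sum_group J (\<lambda>j. Hom_group C c (A (e j))))"
    and fx: "f = gfinprod (Hom_group C c P) (\<lambda>j. \<iota> (e j) \<cdot> x j) J"
    using compact_object_sum[OF c P I f] .
  let ?A = "\<lambda>j. A (e j)" and ?\<iota> = "\<lambda>j. \<iota> (e j)"
  note PD = is_coproductD[OF P']
  have cO: "c \<in> Obj C" using c unfolding compact_object_def by blast
  interpret G: comm_group "Hom_group C c P" using Hom_comm_group cO PD(1) by blast
  have x': "x i \<in> Hom C c (?A i)" if "i \<in> J" for i
    using x that carrier_sum_Hom[of c J ?A, OF cO PD(3)] by auto
  have fh: "?\<iota> i \<cdot> x i \<in> Hom C c P" if "i \<in> J" for i using x' PD(2) that Cmp_Hom by blast
  have "Q (finprod (Hom_group C c P) (\<lambda>i. ?\<iota> i \<cdot> x i) F)" if "finite F" "F \<subseteq> J" for F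
    using that
  proof (induction F rule: finite_induct)
    case empty
    then show ?case using zero by simp
  next
    case (insert i F)
    have fF: "(\<lambda>i. ?\<iota> i \<cdot> x i) \<in> F \<rightarrow> carrier (Hom_group C c P)" using insert.prems fh by auto
    have i: "i \<in> J" using insert.prems by auto
    have p: "finprod (Hom_group C c P) (\<lambda>i. ?\<iota> i \<cdot> x i) F \<in> Hom C c P"
      using G.finprod_closed[OF fF] by simp
    have "e i \<in> I" using J i by (auto simp: bij_betw_def)
    then have "Q (?\<iota> i \<cdot> x i)" using inc x'[OF i] by blast
    then show ?case
      using G.finprod_insert[OF insert.hyps fF] fh[OF i] add[OF fh[OF i] p] insert by simp
  qed
  then have "Q (gfinprod (Hom_group C c P) (\<lambda>i. ?\<iota> i \<cdot> x i) J)"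
    using zero by (simp add: gfinprod_def)
  then show ?thesis using fx by simp
qed

text \<open>The induction principle says that the canonical map is surjective; its injectivity is automatic,
  by the retractions onto the summands.  In this form, compactness is easily transported along
  isomorphisms and (de)suspensions.\<close>

lemma compact_objectI:
  fixes U :: "'u set"
  assumes c: "c \<in> Obj C"
    and gen: "\<And>(I :: 'u set) A P \<iota> Q f. I \<subseteq> U \<Longrightarrow> small U I \<Longrightarrow> is_coproduct C I A P \<iota> \<Longrightarrow>
      Q (ZeroM C c P) \<Longrightarrow>
      (\<And>g h. g \<in> Hom C c P \<Longrightarrow> h \<in> Hom C c P \<Longrightarrow> Q g \<Longrightarrow> Q h \<Longrightarrow> Q (Add C g h)) \<Longrightarrow>
      (\<And>i g. i \<in> I \<Longrightarrow> g \<in> Hom C c (A i) \<Longrightarrow> Q (\<iota> i \<cdot> g)) \<Longrightarrow> f \<in> Hom C c P \<Longrightarrow> Q f"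
  shows "compact_object U C c"
  unfolding compact_object_def
proof (intro conjI allI impI)
  fix I :: "'u set" and A P \<iota>
  assume IU: "I \<subseteq> U" and "small U I \<and> is_coproduct C I A P \<iota>"
  then have sm: "small U I" and P: "is_coproduct C I A P \<iota>" by auto
  note PD = is_coproductD[OF P]
  let ?H = "\<lambda>i. Hom_group C c (A i)" and ?\<Phi> = "\<lambda>f. gfinprod (Hom_group C c P) (\<lambda>i. \<iota> i \<cdot> f i) I"
  interpret G: comm_group "Hom_group C c P" using Hom_comm_group c PD(1) by blast
  have grp: "group (?H i)" if "i \<in> I" for i using Hom_group_group c PD(3) that by blast
  have "(\<lambda>g. \<iota> i \<cdot> g) \<in> hom (?H i) (Hom_group C c P)" if "i \<in> I" for i
    using PD(2)[OF that] Cmp_Hom Cmp_Add by (auto simp: hom_def)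
  then have hom: "?\<Phi> \<in> hom (sum_group I ?H) (Hom_group C c P)"
    using G.hom_group_sum[of I "\<lambda>i g. \<iota> i \<cdot> g" ?H] grp by blast
  obtain \<rho> where \<rho>: "\<And>i. i \<in> I \<Longrightarrow> \<rho> i \<in> Hom C P (A i)" "\<And>i. i \<in> I \<Longrightarrow> \<rho> i \<cdot> \<iota> i = Ide C (A i)"
    "\<And>i j. i \<in> I \<Longrightarrow> j \<in> I \<Longrightarrow> i \<noteq> j \<Longrightarrow> \<rho> i \<cdot> \<iota> j = ZeroM C (A j) (A i)"
    using coproduct_projections[OF P] by blast
  have comp: "\<rho> j \<cdot> ?\<Phi> x = x j" if "x \<in> carrier (sum_group I ?H)" "j \<in> I" for x j
    by (rule gfinprod_component[OF P c that(1,2)]) (use \<rho> that in auto)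
  have car: "carrier (sum_group I ?H) = {x \<in> \<Pi>\<^sub>E i\<in>I. Hom C c (A i). finite {i \<in> I. x i \<noteq> ZeroM C c (A i)}}"
    using carrier_sum_Hom[of c I A, OF c PD(3)] by blast
  have inj: "inj_on ?\<Phi> (carrier (sum_group I ?H))"
  proof (rule inj_onI)
    fix x y assume x: "x \<in> carrier (sum_group I ?H)" and y: "y \<in> carrier (sum_group I ?H)" and eq: "?\<Phi> x = ?\<Phi> y"
    show "x = y"
    proof (rule PiE_ext[where k = I and s = "\<lambda>i. Hom C c (A i)"])
      show "x \<in> (\<Pi>\<^sub>E i\<in>I. Hom C c (A i))" "y \<in> (\<Pi>\<^sub>E i\<in>I. Hom C c (A i))" using x y car by blast+
      show "x j = y j" if "j \<in> I" for j using comp[OF x that] comp[OF y that] eq by simp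
    qed
  qed
  define Im where "Im = ?\<Phi> ` carrier (sum_group I ?H)"
  interpret S: group "sum_group I ?H" by (rule sum_group) (rule grp)
  interpret h: group_hom "sum_group I ?H" "Hom_group C c P" ?\<Phi>
    by unfold_locales (rule hom)
  have zero: "ZeroM C c P \<in> Im"
  proof -
    have "ZeroM C c P = ?\<Phi> \<one>\<^bsub>sum_group I ?H\<^esub>" using h.hom_one by (simp only: Hom_group_simps)
    then show ?thesis unfolding Im_def by (rule image_eqI[OF _ S.one_closed])
  qed
  have add: "Add C g h \<in> Im" if gh: "g \<in> Im" "h \<in> Im" for g h
  proof -
    obtain x where x: "g = ?\<Phi> x" "x \<in> carrier (sum_group I ?H)" using gh(1) unfolding Im_def by (rule imageE)
    obtain y where y: "h = ?\<Phi> y" "y \<in> carrier (sum_group I ?H)" using gh(2) unfolding Im_def by (rule imageE)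
    have "Add C g h = ?\<Phi> (x \<otimes>\<^bsub>sum_group I ?H\<^esub> y)"
      using h.hom_mult[OF x(2) y(2)] x(1) y(1) by (simp only: Hom_group_simps)
    then show ?thesis unfolding Im_def by (rule image_eqI[OF _ S.m_closed[OF x(2) y(2)]])
  qed
  have inc: "\<iota> i \<cdot> g \<in> Im" if i: "i \<in> I" and g: "g \<in> Hom C c (A i)" for i g
  proof -
    let ?x = "\<lambda>j\<in>I. if j = i then g else ZeroM C c (A j)"
    have "{j \<in> I. ?x j \<noteq> ZeroM C c (A j)} \<subseteq> {i}" by auto
    then have fx: "finite {j \<in> I. ?x j \<noteq> ZeroM C c (A j)}" using finite_subset by blast
    have "?x \<in> (\<Pi>\<^sub>E i\<in>I. Hom C c (A i))" using g ZeroM_Hom c PD(3) by auto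
    then have x: "?x \<in> carrier (sum_group I ?H)" using fx unfolding car by (intro CollectI conjI)
    have z: "\<iota> j \<cdot> ?x j = ZeroM C c P" if "j \<in> I" "j \<noteq> i" for j
      using that Cmp_Zero[OF PD(2) c] by simp
    have ig: "\<iota> i \<cdot> g \<in> Hom C c P" using PD(2)[OF i] g Cmp_Hom by blast
    have "?\<Phi> ?x = gfinprod (Hom_group C c P) (\<lambda>j. \<iota> j \<cdot> ?x j) {i}"
      by (rule G.gfinprod_mono_neutral_cong_right) (use i z ig ZeroM_Hom[OF c PD(1)] in auto)
    also have "\<dots> = \<iota> i \<cdot> g" using ig i by (subst G.gfinprod_eq_finprod) (auto simp: Add_Zero[OF ig])
    finally have "\<iota> i \<cdot> g = ?\<Phi> ?x" by (rule sym)
    then show ?thesis unfolding Im_def by (rule image_eqI[OF _ x])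
  qed
  have "f \<in> Im" if f: "f \<in> Hom C c P" for f
    by (rule gen[where Q = "\<lambda>f. f \<in> Im", OF IU sm P zero _ _ f]) (rule add inc, assumption+)+
  then have "?\<Phi> ` carrier (sum_group I ?H) = Hom C c P"
    using hom unfolding Im_def hom_def by auto
  then show "?\<Phi> \<in> iso (sum_group I ?H) (Hom_group C c P)"
    using hom inj by (simp add: iso_def bij_betw_def)
qed (rule c)

text \<open>The summands of \<open>f\<close> are recovered from its components, so they vanish too.\<close>

lemma compact_component_zero:
  fixes U :: "'u set"
  assumes c: "compact_object U C c" and P: "is_coproduct C I A P \<iota>" and I: "small U I"
    and f: "f \<in> Hom C c P"
    and \<rho>: "\<And>i. i \<in> I \<Longrightarrow> \<rho> i \<in> Hom C P (A i)" "\<And>i. i \<in> I \<Longrightarrow> \<rho> i \<cdot> \<iota> i = Ide C (A i)"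
    "\<And>i j. i \<in> I \<Longrightarrow> j \<in> I \<Longrightarrow> i \<noteq> j \<Longrightarrow> \<rho> i \<cdot> \<iota> j = ZeroM C (A j) (A i)"
    and z: "\<And>i. i \<in> I \<Longrightarrow> \<rho> i \<cdot> f = ZeroM C c (A i)"
  shows "f = ZeroM C c P"
proof -
  obtain e and J :: "'u set" and x where J: "bij_betw e J I" and P': "is_coproduct C J (\<lambda>j. A (e j)) P (\<lambda>j. \<iota> (e j))"
    and x: "x \<in> carrier (sum_group J (\<lambda>j. Hom_group C c (A (e j))))"
    and fx: "f = gfinprod (Hom_group C c P) (\<lambda>j. \<iota> (e j) \<cdot> x j) J"
    using compact_object_sum[OF c P I f] .
  let ?A = "\<lambda>j. A (e j)" and ?\<iota> = "\<lambda>j. \<iota> (e j)"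
  have e: "e j \<in> I" if "j \<in> J" for j using J that by (auto simp: bij_betw_def)
  have einj: "e i \<noteq> e j" if "i \<in> J" "j \<in> J" "i \<noteq> j" for i j
    using J that by (auto simp: bij_betw_def inj_on_def)
  note PD = is_coproductD[OF P']
  have cO: "c \<in> Obj C" using c unfolding compact_object_def by blast
  interpret G: comm_group "Hom_group C c P" using Hom_comm_group cO PD(1) by blast
  have x': "x j = ZeroM C c (?A j)" if "j \<in> J" for j
  proof -
    have "\<rho> (e j) \<cdot> f = x j" unfolding fx
      by (rule gfinprod_component[OF P' cO x that]) (use \<rho> e einj that in auto)
    then show ?thesis using z[OF e[OF that]] by simp
  qed
  have "?\<iota> j \<cdot> x j = ZeroM C c P" if "j \<in> J" for j
    using x'[OF that] Cmp_Zero[OF PD(2)[OF that] cO] by simp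
  then have e: "{j \<in> J. ?\<iota> j \<cdot> x j \<noteq> ZeroM C c P} = {}" by blast
  show ?thesis unfolding fx gfinprod_def Hom_group_simps e by simp
qed

lemma compact_object_iso:
  fixes U :: "'u set"
  assumes c: "compact_object U C c" and i: "isomorphic C c d"
  shows "compact_object U C d"
proof (rule compact_objectI)
  show d: "d \<in> Obj C" using isomorphic_Obj i by blast
  obtain a b where b: "b \<in> Hom C d c" "b \<cdot> a = Ide C c" "a \<cdot> b = Ide C d" "a \<in> Hom C c d"
    using isomorphicE[OF i] .
  fix I :: "'u set" and A P \<iota> Q f
  assume I: "small U I" and P: "is_coproduct C I A P \<iota>" and f: "f \<in> Hom C d P"
    and zero: "Q (ZeroM C d P)"
    and add: "\<And>g h. g \<in> Hom C d P \<Longrightarrow> h \<in> Hom C d P \<Longrightarrow> Q g \<Longrightarrow> Q h \<Longrightarrow> Q (Add C g h)"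
    and inc: "\<And>i g. i \<in> I \<Longrightarrow> g \<in> Hom C d (A i) \<Longrightarrow> Q (\<iota> i \<cdot> g)"
  note PD = is_coproductD[OF P]
  have "Q ((f \<cdot> a) \<cdot> b)"
  proof (rule compact_object_induct[where Q = "\<lambda>g. Q (g \<cdot> b)", OF c P I])
    show "f \<cdot> a \<in> Hom C c P" using Cmp_Hom b f by blast
    show "Q (ZeroM C c P \<cdot> b)" using Zero_Cmp[OF b(1)] PD(1) zero by simp
    show "Q (Add C g h \<cdot> b)" if "g \<in> Hom C c P" "h \<in> Hom C c P" "Q (g \<cdot> b)" "Q (h \<cdot> b)" for g h
      using Add_Cmp[OF b(1) that(1,2)] add Cmp_Hom[OF b(1)] that by metis
    show "Q ((\<iota> i \<cdot> g) \<cdot> b)" if "i \<in> I" "g \<in> Hom C c (A i)" for i g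
      using Cmp_assoc[OF b(1) that(2) PD(2)[OF that(1)]] inc[OF that(1) Cmp_Hom[OF b(1) that(2)]] by simp
  qed
  then show "Q f" using f b by (simp add: Hom_def)
qed

end

context triangulated_category
begin

lemma compact_object_ShO:
  fixes U :: "'u set"
  assumes c: "compact_object U C c" shows "compact_object U C (ShO C c)"
proof (rule compact_objectI)
  have cO: "c \<in> Obj C" using c unfolding compact_object_def by blast
  then show "ShO C c \<in> Obj C" by simp
  fix I :: "'u set" and A P \<iota> Q f
  assume I: "small U I" and P: "is_coproduct C I A P \<iota>" and f: "f \<in> Hom C (ShO C c) P"
    and zero: "Q (ZeroM C (ShO C c) P)"
    and add: "\<And>g h. g \<in> Hom C (ShO C c) P \<Longrightarrow> h \<in> Hom C (ShO C c) P \<Longrightarrow> Q g \<Longrightarrow> Q h \<Longrightarrow> Q (Add C g h)"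
    and inc: "\<And>i g. i \<in> I \<Longrightarrow> g \<in> Hom C (ShO C c) (A i) \<Longrightarrow> Q (\<iota> i \<cdot> g)"
  note PD = is_coproductD[OF P]
  obtain P' b where P': "P' \<in> Obj C" and b: "b \<in> Iso C (ShO C P') P"
    using shift_essentially_surjective[OF PD(1)] unfolding isomorphic_def by auto
  obtain b' where b': "b' \<in> Hom C P (ShO C P')" "b' \<cdot> b = Ide C (ShO C P')" "b \<cdot> b' = Ide C P"
      "b \<in> Hom C (ShO C P') P" using isoE[OF b] .
  have b'I: "b' \<in> Iso C P (ShO C P')" using isoI(2)[OF b'(4,1,2,3)] .
  have "\<exists>A' a. A' \<in> Obj C \<and> a \<in> Iso C (ShO C A') (A i)" if "i \<in> I" for i
    using shift_essentially_surjective[OF PD(3)[OF that]] unfolding isomorphic_def by auto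
  then obtain A' a where A': "\<And>i. i \<in> I \<Longrightarrow> A' i \<in> Obj C" and a: "\<And>i. i \<in> I \<Longrightarrow> a i \<in> Iso C (ShO C (A' i)) (A i)"
    by metis
  have ah: "\<And>i. i \<in> I \<Longrightarrow> a i \<in> Hom C (ShO C (A' i)) (A i)" using a Iso_Hom by blast
  have "\<exists>j. j \<in> Hom C (A' i) P' \<and> ShM C j = b' \<cdot> \<iota> i \<cdot> a i" if i: "i \<in> I" for i
    using ShM_full[of "b' \<cdot> \<iota> i \<cdot> a i" "A' i" P'] Cmp_Hom[OF Cmp_Hom[OF ah[OF i] PD(2)[OF i]] b'(1)] A'[OF i] P' by metis
  then obtain j where j: "\<And>i. i \<in> I \<Longrightarrow> j i \<in> Hom C (A' i) P'" "\<And>i. i \<in> I \<Longrightarrow> ShM C (j i) = b' \<cdot> \<iota> i \<cdot> a i" by metis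
  have "is_coproduct C I (\<lambda>i. ShO C (A' i)) (ShO C P') (\<lambda>i. b' \<cdot> \<iota> i \<cdot> a i)"
    by (rule coproduct_transport[OF P b'I a])
  then have "is_coproduct C I (\<lambda>i. ShO C (A' i)) (ShO C P') (\<lambda>i. ShM C (j i))"
    using j(2) unfolding is_coproduct_def by simp
  then have cop: "is_coproduct C I A' P' j" using coproduct_ShO_iff[of I j A' P'] j(1) P' by blast
  have bf: "b' \<cdot> f \<in> Hom C (ShO C c) (ShO C P')" using Cmp_Hom f b' by blast
  obtain f' where f': "f' \<in> Hom C c P'" "ShM C f' = b' \<cdot> f" using ShM_full[OF bf cO P'] .
  have "Q (b \<cdot> ShM C f')"
  proof (rule compact_object_induct[where Q = "\<lambda>g. Q (b \<cdot> ShM C g)", OF c cop I f'(1)])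
    show "Q (b \<cdot> ShM C (ZeroM C c P'))" using ShM_Zero Cmp_Zero[OF b'(4)] zero cO P' by simp
    show "Q (b \<cdot> ShM C (Add C g h))" if "g \<in> Hom C c P'" "h \<in> Hom C c P'" "Q (b \<cdot> ShM C g)" "Q (b \<cdot> ShM C h)" for g h
      using ShM_Add[OF that(1,2)] Cmp_Add[OF ShM_Hom[OF that(1)] ShM_Hom[OF that(2)] b'(4)]
        add[OF Cmp_Hom[OF ShM_Hom[OF that(1)] b'(4)] Cmp_Hom[OF ShM_Hom[OF that(2)] b'(4)] that(3,4)] by simp
    fix i g assume i: "i \<in> I" and g: "g \<in> Hom C c (A' i)"
    note tys = PD(2)[OF i] ah[OF i] b'(1,4) ShM_Hom[OF g]
    have "b \<cdot> ShM C (j i \<cdot> g) = b \<cdot> ((b' \<cdot> \<iota> i \<cdot> a i) \<cdot> ShM C g)" using ShM_Cmp[OF g j(1)[OF i]] j(2)[OF i] by simp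
    also have "\<dots> = b \<cdot> (b' \<cdot> (\<iota> i \<cdot> a i \<cdot> ShM C g))" using tys by (simp add: Hom_def)
    also have "\<dots> = \<iota> i \<cdot> a i \<cdot> ShM C g"
      using tys Cmp_subst[OF b'(3), of "\<iota> i \<cdot> a i \<cdot> ShM C g"] by (simp add: Hom_def)
    finally show "Q (b \<cdot> ShM C (j i \<cdot> g))" using inc[OF i Cmp_Hom[OF ShM_Hom[OF g] ah[OF i]]] by simp
  qed
  moreover have "b \<cdot> ShM C f' = f" using f'(2) Cmp_assoc[OF f b'(1,4)] b'(3) Ide_Cmp[OF f] by simp
  ultimately show "Q f" by simp
qed

lemma compact_object_desuspend:
  fixes U :: "'u set"
  assumes c: "compact_object U C (ShO C c)" and cO: "c \<in> Obj C" shows "compact_object U C c"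
proof (rule compact_objectI[OF cO])
  fix I :: "'u set" and A P \<iota> Q f
  assume I: "small U I" and P: "is_coproduct C I A P \<iota>" and f: "f \<in> Hom C c P"
    and zero: "Q (ZeroM C c P)"
    and add: "\<And>g h. g \<in> Hom C c P \<Longrightarrow> h \<in> Hom C c P \<Longrightarrow> Q g \<Longrightarrow> Q h \<Longrightarrow> Q (Add C g h)"
    and inc: "\<And>i g. i \<in> I \<Longrightarrow> g \<in> Hom C c (A i) \<Longrightarrow> Q (\<iota> i \<cdot> g)"
  note PD = is_coproductD[OF P]
  have cop: "is_coproduct C I (\<lambda>i. ShO C (A i)) (ShO C P) (\<lambda>i. ShM C (\<iota> i))"
    using coproduct_ShO_iff[of I \<iota> A P] P PD by blast
  have "\<exists>f'. f' \<in> Hom C c P \<and> ShM C f = ShM C f' \<and> Q f'"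
  proof (rule compact_object_induct[where Q = "\<lambda>g. \<exists>f'. f' \<in> Hom C c P \<and> g = ShM C f' \<and> Q f'", OF c cop I ShM_Hom[OF f]])
    show "\<exists>f'. f' \<in> Hom C c P \<and> ZeroM C (ShO C c) (ShO C P) = ShM C f' \<and> Q f'"
      using zero ZeroM_Hom ShM_Zero cO PD(1) by metis
    show "\<exists>f'. f' \<in> Hom C c P \<and> Add C g h = ShM C f' \<and> Q f'"
      if gh: "\<exists>f'. f' \<in> Hom C c P \<and> g = ShM C f' \<and> Q f'" "\<exists>f'. f' \<in> Hom C c P \<and> h = ShM C f' \<and> Q f'" for g h
    proof -
      obtain g' h' where "g' \<in> Hom C c P" "g = ShM C g'" "Q g'" "h' \<in> Hom C c P" "h = ShM C h'" "Q h'"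
        using gh by blast
      then show ?thesis using add Add_Hom ShM_Add by (intro exI[of _ "Add C g' h'"]) auto
    qed
    fix i g assume i: "i \<in> I" and g: "g \<in> Hom C (ShO C c) (ShO C (A i))"
    obtain g' where g': "g' \<in> Hom C c (A i)" "ShM C g' = g" using ShM_full[OF g cO PD(3)[OF i]] .
    show "\<exists>f'. f' \<in> Hom C c P \<and> ShM C (\<iota> i) \<cdot> g = ShM C f' \<and> Q f'"
      using ShM_Cmp[OF g'(1) PD(2)[OF i]] g'(2) inc[OF i g'(1)] Cmp_Hom[OF g'(1) PD(2)[OF i]] by auto
  qed
  then obtain f' where "f' \<in> Hom C c P" "ShM C f = ShM C f'" "Q f'" by blast
  then show "Q f" using ShM_faithful f by blast
qed

section \<open>Orthogonal subcategories\<close>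

lemma orth_cone_left:
  assumes t: "(f, g, h) \<in> Tri C" and "orth (Src C g) Y" and "orth (ShO C (Src C f)) Y"
  shows "orth (Src C h) Y"
  unfolding orth_def
proof
  fix z assume z: "z \<in> Hom C (Src C h) Y"
  obtain A B D where T: "f \<in> Hom C A B" "g \<in> Hom C B D" "h \<in> Hom C D (ShO C A)" using TriE[OF t] .
  have s: "Src C f = A" "Src C g = B" "Src C h = D" using T by (simp_all add: Hom_def)
  have z: "z \<in> Hom C D Y" using z s by simp
  have "z \<cdot> g = ZeroM C B Y" using assms(2) Cmp_Hom[OF T(2) z] s orthD by simp
  then obtain w where w: "w \<in> Hom C (ShO C A) Y" "w \<cdot> h = z" using Tri_weak_cokernel'[OF t T(1,2) z] by blast
  have "w = ZeroM C (ShO C A) Y" using assms(3) w s orthD by simp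
  then show "z = ZeroM C (Src C h) Y" using w Zero_Cmp[OF T(3)] Hom_Obj[OF z] s by simp
qed

lemma orth_cone_right:
  assumes t: "(f, g, h) \<in> Tri C" and "orth X (Src C g)" and "orth X (ShO C (Src C f))"
  shows "orth X (Src C h)"
  unfolding orth_def
proof
  fix z assume z: "z \<in> Hom C X (Src C h)"
  obtain A B D where T: "f \<in> Hom C A B" "g \<in> Hom C B D" "h \<in> Hom C D (ShO C A)" using TriE[OF t] .
  have s: "Src C f = A" "Src C g = B" "Src C h = D" using T by (simp_all add: Hom_def)
  have z: "z \<in> Hom C X D" using z s by simp
  have "h \<cdot> z = ZeroM C X (ShO C A)" using assms(3) Cmp_Hom[OF z T(3)] s orthD by simp
  then obtain w where w: "w \<in> Hom C X B" "g \<cdot> w = z" using Tri_weak_kernel'[OF t T(1,2) z] by blast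
  have "w = ZeroM C X B" using assms(2) w s orthD by simp
  then show "z = ZeroM C X (Src C h)" using w Cmp_Zero[OF T(2)] Hom_Obj[OF z] s by simp
qed

lemma orth_coproduct:
  assumes P: "is_coproduct C I A P \<iota>" and "\<And>i. i \<in> I \<Longrightarrow> orth (A i) Y" shows "orth P Y"
  unfolding orth_def
proof
  fix f assume f: "f \<in> Hom C P Y"
  have O1: "P \<in> Obj C" "Y \<in> Obj C" using Hom_Obj f by auto
  show "f = ZeroM C P Y"
  proof (rule coproduct_eqI[OF P f])
    show "ZeroM C P Y \<in> Hom C P Y" using ZeroM_Hom O1 by blast
    fix i assume i: "i \<in> I"
    show "f \<cdot> \<iota> i = ZeroM C P Y \<cdot> \<iota> i"
      using orthD[OF assms(2)[OF i] Cmp_Hom[OF is_coproductD(2)[OF P i] f]]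
        Zero_Cmp[OF is_coproductD(2)[OF P i]] O1 by simp
  qed
qed

lemma orth_product:
  assumes P: "is_product C I A P \<pi>" and "\<And>i. i \<in> I \<Longrightarrow> orth X (A i)" shows "orth X P"
  unfolding orth_def
proof
  fix f assume f: "f \<in> Hom C X P"
  have O1: "P \<in> Obj C" "X \<in> Obj C" using Hom_Obj f by auto
  show "f = ZeroM C X P"
  proof (rule product_eqI[OF P f])
    show "ZeroM C X P \<in> Hom C X P" using ZeroM_Hom O1 by blast
    fix i assume i: "i \<in> I"
    show "\<pi> i \<cdot> f = \<pi> i \<cdot> ZeroM C X P"
      using orthD[OF assms(2)[OF i] Cmp_Hom[OF f is_productD(2)[OF P i]]]
        Cmp_Zero[OF is_productD(2)[OF P i]] O1 by simp
  qed
qed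

text \<open>Stability under \<open>\<Sigma>\<close> and its inverse is required up to isomorphism only, so that it holds for the
  images of the functors \<open>X * -\<close> and \<open>[X, -]\<^sub>*\<close>.\<close>

definition shift_stable :: "'o set \<Rightarrow> bool" where
  "shift_stable E \<longleftrightarrow> E \<subseteq> Obj C \<and>
     (\<forall>X\<in>E. (\<exists>X'\<in>E. isomorphic C X' (ShO C X)) \<and> (\<exists>X'\<in>E. isomorphic C (ShO C X') X))"

lemma right_orthogonal_colocalizing:
  assumes E: "shift_stable E"
  shows "colocalizing_subcategory U C {Y \<in> Obj C. \<forall>X\<in>E. orth X Y}" (is "colocalizing_subcategory U C ?L")
proof -
  have sh: "ShO C Y \<in> ?L \<longleftrightarrow> Y \<in> ?L" if Y: "Y \<in> Obj C" for Y
  proof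
    assume L: "ShO C Y \<in> ?L"
    have "orth X Y" if "X \<in> E" for X
    proof -
      obtain X' where X': "X' \<in> E" "isomorphic C X' (ShO C X)" using E \<open>X \<in> E\<close> unfolding shift_stable_def by blast
      have "X \<in> Obj C" using E that unfolding shift_stable_def by blast
      then show ?thesis using L X' orth_iso_left orth_shift_iff Y by blast
    qed
    then show "Y \<in> ?L" using Y by blast
  next
    assume L: "Y \<in> ?L"
    have "orth X (ShO C Y)" if "X \<in> E" for X
    proof -
      obtain X' where X': "X' \<in> E" "isomorphic C (ShO C X') X" using E \<open>X \<in> E\<close> unfolding shift_stable_def by blast
      have "X' \<in> Obj C" using E X' unfolding shift_stable_def by blast
      then show ?thesis using L X' orth_iso_left orth_shift_iff Y by blast
    qed
    then show "ShO C Y \<in> ?L" using Y by simp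
  qed
  have "Src C h \<in> ?L" if t: "(f, g, h) \<in> Tri C" "Src C f \<in> ?L" "Src C g \<in> ?L" for f g h
  proof -
    have "ShO C (Src C f) \<in> ?L" using sh t(2) by blast
    moreover have "Src C h \<in> Obj C" using TriE[OF t(1)] arr_Obj(1)[of h] by (metis (no_types, lifting) Hom_def mem_Collect_eq)
    ultimately show ?thesis using orth_cone_right[OF t(1)] t(3) by blast
  qed
  then have "triangulated_subcategory C ?L"
    unfolding triangulated_subcategory_def
    using sh orth_zero(2) orth_iso_right zero_object_Hom(1) by (intro conjI) blast+
  then show ?thesis unfolding colocalizing_subcategory_def
    using orth_product is_productD(1) by blast
qed

lemma left_orthogonal_localizing:
  assumes E: "shift_stable E"
  shows "localizing_subcategory U C {X \<in> Obj C. \<forall>Y\<in>E. orth X Y}" (is "localizing_subcategory U C ?L")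
proof -
  have sh: "ShO C X \<in> ?L \<longleftrightarrow> X \<in> ?L" if X: "X \<in> Obj C" for X
  proof
    assume L: "ShO C X \<in> ?L"
    have "orth X Y" if "Y \<in> E" for Y
    proof -
      obtain Y' where Y': "Y' \<in> E" "isomorphic C Y' (ShO C Y)" using E \<open>Y \<in> E\<close> unfolding shift_stable_def by blast
      have "Y \<in> Obj C" using E that unfolding shift_stable_def by blast
      then show ?thesis using L Y' orth_iso_right orth_shift_iff X by blast
    qed
    then show "X \<in> ?L" using X by blast
  next
    assume L: "X \<in> ?L"
    have "orth (ShO C X) Y" if "Y \<in> E" for Y
    proof -
      obtain Y' where Y': "Y' \<in> E" "isomorphic C (ShO C Y') Y" using E \<open>Y \<in> E\<close> unfolding shift_stable_def by blast
      have "Y' \<in> Obj C" using E Y' unfolding shift_stable_def by blast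
      then show ?thesis using L Y' orth_iso_right orth_shift_iff X by blast
    qed
    then show "ShO C X \<in> ?L" using X by simp
  qed
  have "Src C h \<in> ?L" if t: "(f, g, h) \<in> Tri C" "Src C f \<in> ?L" "Src C g \<in> ?L" for f g h
  proof -
    have "ShO C (Src C f) \<in> ?L" using sh t(2) by blast
    moreover have "Src C h \<in> Obj C" using TriE[OF t(1)] arr_Obj(1)[of h] by (metis (no_types, lifting) Hom_def mem_Collect_eq)
    ultimately show ?thesis using orth_cone_left[OF t(1)] t(3) by blast
  qed
  then have "triangulated_subcategory C ?L"
    unfolding triangulated_subcategory_def
    using sh orth_zero(1) orth_iso_left zero_object_Hom(1) by (intro conjI) blast+
  then show ?thesis unfolding localizing_subcategory_def
    using orth_coproduct is_coproductD(1) by blast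
qed

end

section \<open>Compactly generated triangulated categories\<close>

locale small_compactly_generated = compactly_generated U C
  for U :: "'u set" and C :: "('o, 'm, 'z) triangulated_category_scheme" (structure) +
  assumes universe: "universe U"
begin

lemma coproduct_exists:
  assumes "small U I" "\<And>i. i \<in> I \<Longrightarrow> A i \<in> Obj C"
  obtains P \<iota> where "is_coproduct C I A P \<iota>"
proof -
  obtain J e where J: "J \<subseteq> U" "small U J" "bij_betw e J I" using small_index[OF assms(1)] .
  have "\<forall>j\<in>J. A (e j) \<in> Obj C" using assms(2) J(3) by (auto simp: bij_betw_def)
  then obtain P \<iota> where P: "is_coproduct C J (\<lambda>j. A (e j)) P \<iota>"
    using has_coproducts[unfolded has_coproducts_def, rule_format, OF J(1), of "\<lambda>j. A (e j)"] J(2) by auto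
  let ?d = "inv_into J e"
  have "is_coproduct C I (\<lambda>i. A (e (?d i))) P (\<lambda>i. \<iota> (?d i))"
    using coproduct_reindex[OF bij_betw_inv_into[OF J(3)] P] .
  moreover have "e (?d i) = i" if "i \<in> I" for i
    using J(3) that by (auto simp: bij_betw_def f_inv_into_f)
  ultimately have "is_coproduct C I A P (\<lambda>i. \<iota> (?d i))"
    unfolding is_coproduct_def by (simp cong: ball_cong)
  then show ?thesis using that by blast
qed

lemma shift_stable_compacts: "shift_stable {c. compact_object U C c}"
  unfolding shift_stable_def
proof (intro conjI ballI)
  show "{c. compact_object U C c} \<subseteq> Obj C" unfolding compact_object_def by blast
  fix c assume "c \<in> {c. compact_object U C c}"
  then have c: "compact_object U C c" "c \<in> Obj C" unfolding compact_object_def by blast+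
  show "\<exists>X'\<in>{c. compact_object U C c}. isomorphic C X' (ShO C c)"
    by (rule bexI[of _ "ShO C c"]) (use compact_object_ShO[OF c(1)] isomorphic_refl c(2) in auto)
  obtain d where d: "d \<in> Obj C" "isomorphic C (ShO C d) c" using shift_essentially_surjective c(2) by blast
  then have "compact_object U C d"
    using compact_object_desuspend compact_object_iso[OF c(1)] isomorphic_sym by blast
  then show "\<exists>X'\<in>{c. compact_object U C c}. isomorphic C (ShO C X') c" using d by blast
qed

lemma compact_Obj: "compact_object U C c \<Longrightarrow> c \<in> Obj C"
  unfolding compact_object_def by blast

text \<open>The objects right orthogonal to all compact objects form a shift-stable class, so their left
  orthogonal is localizing and contains the generators; hence these objects are orthogonal to
  themselves.\<close>

lemma zero_object_if_compact_orth:
  assumes Y: "Y \<in> Obj C" and o: "\<And>c. compact_object U C c \<Longrightarrow> orth c Y"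
  shows "zero_object C Y"
proof -
  let ?E = "{Y \<in> Obj C. \<forall>X\<in>{c. compact_object U C c}. orth X Y}"
  have tr: "triangulated_subcategory C ?E"
    using right_orthogonal_colocalizing[OF shift_stable_compacts] unfolding colocalizing_subcategory_def by blast
  have "shift_stable ?E"
    unfolding shift_stable_def
  proof (intro conjI ballI)
    fix Z assume Z: "Z \<in> ?E"
    then have ZO: "Z \<in> Obj C" by blast
    have "ShO C Z \<in> ?E" using tr ZO Z unfolding triangulated_subcategory_def by blast
    then show "\<exists>X'\<in>?E. isomorphic C X' (ShO C Z)" using isomorphic_refl[of "ShO C Z"] ZO by fastforce
    obtain d where d: "d \<in> Obj C" "isomorphic C (ShO C d) Z" using shift_essentially_surjective ZO by blast
    then have "ShO C d \<in> ?E" using tr Z isomorphic_sym isomorphic_Obj[OF d(2)] unfolding triangulated_subcategory_def by blast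
    then have "d \<in> ?E" using tr d(1) unfolding triangulated_subcategory_def by blast
    then show "\<exists>X'\<in>?E. isomorphic C (ShO C X') Z" using d by blast
  qed blast
  then have "localizing_subcategory U C {X \<in> Obj C. \<forall>Y\<in>?E. orth X Y}"
    by (rule left_orthogonal_localizing)
  then have "localizing_subcategory U C hull {X. compact_object U C X} \<subseteq> {X \<in> Obj C. \<forall>Y\<in>?E. orth X Y}"
    by (intro hull_minimal) (auto simp: compact_Obj)
  then have "orth Y Y" using compacts_generate Y o by blast
  then show ?thesis using zero_object_iff_orth Y by blast
qed

text \<open>No nonzero morphism from a compact \<open>c = \<Sigma>d\<close> reaches the cone: its boundary desuspends to a
  morphism \<open>d \<rightarrow> X\<close> killed by \<open>f\<close>, hence is zero, so it comes from \<open>c \<rightarrow> Y\<close>, thus from \<open>c \<rightarrow> X\<close>.\<close>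

lemma Iso_if_bij_compacts:
  assumes f: "f \<in> Hom C X Y"
    and bij: "\<And>c. compact_object U C c \<Longrightarrow> bij_betw (\<lambda>w. f \<cdot> w) (Hom C c X) (Hom C c Y)"
  shows "f \<in> Iso C X Y"
proof -
  have O1: "X \<in> Obj C" "Y \<in> Obj C" using f Hom_Obj by auto
  obtain g h Z where t: "(f, g, h) \<in> Tri C" "g \<in> Hom C Y Z" "h \<in> Hom C Z (ShO C X)" "Z \<in> Obj C"
    using cone_ex[OF f] .
  have inj: "w = ZeroM C c X" if c: "compact_object U C c" and w: "w \<in> Hom C c X" "f \<cdot> w = ZeroM C c Y" for c w
  proof -
    have z: "ZeroM C c X \<in> Hom C c X" "f \<cdot> ZeroM C c X = ZeroM C c Y"
      using ZeroM_Hom Cmp_Zero[OF f] compact_Obj[OF c] O1 by auto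
    show ?thesis using inj_onD[OF bij_betw_imp_inj_on[OF bij[OF c]] _ w(1) z(1)] w(2) z(2) by simp
  qed
  have "orth c Z" if c: "compact_object U C c" for c
  proof -
    obtain d where d: "compact_object U C d" "isomorphic C (ShO C d) c"
      using shift_stable_compacts c unfolding shift_stable_def by blast
    have dO: "d \<in> Obj C" using compact_Obj d by blast
    have cd: "compact_object U C (ShO C d)" using compact_object_ShO d by blast
    have "orth (ShO C d) Z" unfolding orth_def
    proof
      fix z assume z: "z \<in> Hom C (ShO C d) Z"
      have hz: "h \<cdot> z \<in> Hom C (ShO C d) (ShO C X)" using Cmp_Hom z t by blast
      obtain y where y: "y \<in> Hom C d X" "ShM C y = h \<cdot> z" using ShM_full[OF hz dO O1(1)] .
      have "ShM C (f \<cdot> y) = (ShM C f \<cdot> h) \<cdot> z"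
        using ShM_Cmp[OF y(1) f] y(2) Cmp_assoc[OF z t(3) ShM_Hom[OF f]] by simp
      also have "\<dots> = ZeroM C (ShO C d) (ShO C Y)"
        using Tri_Cmp_Zero''[OF t(1) f t(3)] Zero_Cmp[OF z] O1 by simp
      finally have "f \<cdot> y = ZeroM C d Y" using ShM_eq_Zero Cmp_Hom[OF y(1) f] by blast
      then have "y = ZeroM C d X" using inj[OF d(1) y(1)] by simp
      then have "h \<cdot> z = ZeroM C (ShO C d) (ShO C X)" using y(2) ShM_Zero dO O1 by simp
      then obtain w where w: "w \<in> Hom C (ShO C d) Y" "g \<cdot> w = z" using Tri_weak_kernel'[OF t(1) f t(2) z] by blast
      have "w \<in> (\<lambda>v. f \<cdot> v) ` Hom C (ShO C d) X"
        using bij_betw_imp_surj_on[OF bij[OF cd]] w(1) by simp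
      then obtain v where v: "v \<in> Hom C (ShO C d) X" "f \<cdot> v = w" by (elim imageE) simp
      have "z = (g \<cdot> f) \<cdot> v" using w v Cmp_assoc[OF v(1) f t(2)] by simp
      then show "z = ZeroM C (ShO C d) Z" using Tri_Cmp_Zero[OF t(1) f t(2)] Zero_Cmp[OF v(1)] t(4) by simp
    qed
    then show ?thesis using d orth_iso_left by blast
  qed
  then have "zero_object C Z" using zero_object_if_compact_orth t(4) by blast
  then show ?thesis using Iso_if_cone_zero[OF t(1) f t(2)] by blast
qed

lemma small_skeleton_of_compacts:
  obtains R where "is_skeleton C {c. compact_object U C c} R" "small U R"
proof -
  let ?L = "{c. compact_object U C c}"
  obtain R0 where R0: "R0 \<subseteq> ?L" "small U R0" "\<forall>X\<in>?L. \<exists>Y\<in>R0. isomorphic C X Y"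
    using compacts_essentially_small unfolding essentially_small_def by blast
  define r where "r X = (SOME Y. Y \<in> R0 \<and> isomorphic C X Y)" for X
  have r: "r X \<in> R0" "isomorphic C X (r X)" if "\<exists>Y\<in>R0. isomorphic C X Y" for X
    using someI_ex[of "\<lambda>Y. Y \<in> R0 \<and> isomorphic C X Y"] that unfolding r_def by blast+
  have req: "r X = r Y" if "isomorphic C X Y" for X Y
  proof -
    have "isomorphic C X Z \<longleftrightarrow> isomorphic C Y Z" for Z
      using that isomorphic_trans isomorphic_sym by blast
    then show ?thesis unfolding r_def by simp
  qed
  have "is_skeleton C ?L (r ` ?L)" unfolding is_skeleton_def
  proof (intro conjI ballI)
    show "r ` ?L \<subseteq> ?L" using r R0 by blast
    fix X assume X: "X \<in> ?L"
    show "\<exists>!Y. Y \<in> r ` ?L \<and> isomorphic C X Y"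
    proof (rule ex1I[of _ "r X"])
      show "r X \<in> r ` ?L \<and> isomorphic C X (r X)" using X r R0 by blast
      fix Y assume Y: "Y \<in> r ` ?L \<and> isomorphic C X Y"
      then obtain Z where Z: "Z \<in> ?L" "Y = r Z" by blast
      have "isomorphic C Z Y" using r(2)[of Z] Z R0(3) by simp
      then have "isomorphic C X Z" using Y isomorphic_sym isomorphic_trans by blast
      then show "Y = r X" using req Z by simp
    qed
  qed
  moreover have "small U (r ` ?L)" by (rule small_subset[OF R0(2)]) (use r R0(3) in blast)
  ultimately show ?thesis using that by blast
qed

end

section \<open>Mapping telescopes\<close>

lemma dependent_sequence:
  assumes "good x0" "\<And>x. good x \<Longrightarrow> \<exists>y. good y \<and> (\<exists>r. link x y r)"
  obtains x r where "x 0 = x0" "\<And>n :: nat. good (x n)" "\<And>n. link (x n) (x (Suc n)) (r n)"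
proof -
  have "\<exists>x. \<forall>n. (good (x n) \<and> (n = 0 \<longrightarrow> x n = x0)) \<and> (\<exists>r. link (x n) (x (Suc n)) r)"
    by (rule dependent_nat_choice) (use assms in auto)
  then obtain x where x: "x 0 = x0" "\<And>n. good (x n)" "\<And>n. \<exists>r. link (x n) (x (Suc n)) r" by auto
  then obtain r where "\<And>n. link (x n) (x (Suc n)) (r n)" by metis
  then show ?thesis using that x by blast
qed

lemma small_insert:
  assumes "universe U" "small U A" shows "small U (insert a A)"
proof -
  have "small U (Sigma (UNIV :: bool set) (\<lambda>b. if b then A else {a}))"
    by (rule small_Sigma[OF assms(1) small_countable[OF assms(1)]])
      (use assms(2) small_countable[OF assms(1), of "{a}"] in auto)
  from small_image[OF this, of snd] show ?thesis
  proof (rule small_subset, intro subsetI)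
    fix x assume "x \<in> insert a A"
    then have "(x \<in> A, x) \<in> Sigma UNIV (\<lambda>b. if b then A else {a})" by auto
    then show "x \<in> snd ` Sigma UNIV (\<lambda>b. if b then A else {a})" by (rule image_eqI[rotated]) simp
  qed
qed

context small_compactly_generated
begin

text \<open>\<open>L\<close> is the mapping telescope of the sequence \<open>i\<close>, with \<open>s\<close> the shift.  A morphism from a compact object
  to \<open>L\<close> lifts to the coproduct because \<open>1 - s\<close> is injective on morphisms from compact objects, and
  the lift only involves finitely many terms of the sequence, which can be moved into a common one.\<close>

lemma compact_telescope:
  assumes P: "is_coproduct C (UNIV :: nat set) X P \<iota>"
    and i: "\<And>n. i n \<in> Hom C (X n) (X (Suc n))"
    and s: "s \<in> Hom C P P" "\<And>n. s \<cdot> \<iota> n = \<iota> (Suc n) \<cdot> i n"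
    and t: "(Diff (Ide C P) s, w, \<delta>) \<in> Tri C" and w: "w \<in> Hom C P L"
  shows "\<And>n. w \<cdot> \<iota> (Suc n) \<cdot> i n = w \<cdot> \<iota> n"
    and "\<And>c f. compact_object U C c \<Longrightarrow> f \<in> Hom C c L \<Longrightarrow> \<exists>n. \<exists>f'\<in>Hom C c (X n). f = w \<cdot> \<iota> n \<cdot> f'"
    and "\<And>n m c f'. n \<le> m \<Longrightarrow> f' \<in> Hom C c (X n) \<Longrightarrow> \<exists>f''\<in>Hom C c (X m). w \<cdot> \<iota> n \<cdot> f' = w \<cdot> \<iota> m \<cdot> f''"
proof -
  have sn: "small U (UNIV :: nat set)" by (rule small_countable[OF universe countableI_type])
  note PO = is_coproductD(1)[OF P] and \<iota> = is_coproductD(2)[OF P UNIV_I] and XO = is_coproductD(3)[OF P UNIV_I]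
  have I: "Ide C P \<in> Hom C P P" using Ide_Hom PO by blast
  have D: "Diff (Ide C P) s \<in> Hom C P P" using Diff_Hom I s(1) by blast
  have LO: "L \<in> Obj C" using w Hom_Obj by blast
  have \<delta>: "\<delta> \<in> Hom C L (ShO C P)" using Tri_Hom_trd[OF t D w] .
  have "w \<cdot> Diff (Ide C P) s = ZeroM C P L" using Tri_Cmp_Zero[OF t D w] .
  then have "Diff (w \<cdot> Ide C P) (w \<cdot> s) = ZeroM C P L" using Cmp_Diff[OF I s(1) w] by simp
  then have ws: "w \<cdot> s = w" using Diff_eq_Zero[OF Cmp_Hom[OF I w] Cmp_Hom[OF s(1) w]] Cmp_Ide[OF w] by simp
  show a: "w \<cdot> \<iota> (Suc n) \<cdot> i n = w \<cdot> \<iota> n" for n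
  proof -
    have "w \<cdot> \<iota> (Suc n) \<cdot> i n = (w \<cdot> s) \<cdot> \<iota> n" using s(2)[of n] Cmp_assoc[OF \<iota>[of n] s(1) w] by simp
    then show ?thesis using ws by simp
  qed
  show up: "\<exists>f''\<in>Hom C c (X m). w \<cdot> \<iota> n \<cdot> f' = w \<cdot> \<iota> m \<cdot> f''" if "n \<le> m" "f' \<in> Hom C c (X n)" for n m c f'
    using that(1)
  proof (induction rule: dec_induct)
    case base
    then show ?case using that by blast
  next
    case (step m)
    then obtain f'' where f'': "f'' \<in> Hom C c (X m)" "w \<cdot> \<iota> n \<cdot> f' = w \<cdot> \<iota> m \<cdot> f''" by blast
    have "w \<cdot> \<iota> (Suc m) \<cdot> i m \<cdot> f'' = (w \<cdot> \<iota> (Suc m) \<cdot> i m) \<cdot> f''"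
      using f''(1) i[of m] \<iota>[of "Suc m"] w by (simp add: Hom_def)
    also have "\<dots> = w \<cdot> \<iota> m \<cdot> f''" using a[of m] f''(1) \<iota>[of m] w by (simp add: Hom_def)
    finally show ?case using f''(2) Cmp_Hom[OF f''(1) i[of m]] by (intro bexI[of _ "i m \<cdot> f''"]) simp_all
  qed
  obtain \<rho> where \<rho>: "\<And>n. \<rho> n \<in> Hom C P (X n)" "\<And>n. \<rho> n \<cdot> \<iota> n = Ide C (X n)"
    "\<And>n m. n \<noteq> m \<Longrightarrow> \<rho> n \<cdot> \<iota> m = ZeroM C (X m) (X n)"
    using coproduct_projections[OF P] by (metis UNIV_I)
  have \<rho>0: "\<rho> 0 \<cdot> s = ZeroM C P (X 0)"
  proof (rule coproduct_eqI[OF P])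
    show "\<rho> 0 \<cdot> s \<in> Hom C P (X 0)" using Cmp_Hom \<rho>(1) s(1) by blast
    show "ZeroM C P (X 0) \<in> Hom C P (X 0)" using ZeroM_Hom PO XO by blast
    fix n
    have "(\<rho> 0 \<cdot> s) \<cdot> \<iota> n = (\<rho> 0 \<cdot> \<iota> (Suc n)) \<cdot> i n"
      using Cmp_assoc[OF \<iota>[of n] s(1) \<rho>(1)[of 0]] s(2) Cmp_assoc[OF i[of n] \<iota>[of "Suc n"] \<rho>(1)[of 0]] by simp
    also have "\<dots> = ZeroM C (X n) (X 0)" using \<rho>(3)[of 0 "Suc n"] Zero_Cmp[OF i[of n] XO[of 0]] by simp
    finally show "(\<rho> 0 \<cdot> s) \<cdot> \<iota> n = ZeroM C P (X 0) \<cdot> \<iota> n" using Zero_Cmp[OF \<iota>[of n] XO[of 0]] by simp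
  qed
  have \<rho>S: "\<rho> (Suc n) \<cdot> s = i n \<cdot> \<rho> n" for n
  proof (rule coproduct_eqI[OF P])
    show "\<rho> (Suc n) \<cdot> s \<in> Hom C P (X (Suc n))" using Cmp_Hom \<rho>(1) s(1) by blast
    show "i n \<cdot> \<rho> n \<in> Hom C P (X (Suc n))" using Cmp_Hom \<rho>(1) i by blast
    fix m
    have "(\<rho> (Suc n) \<cdot> s) \<cdot> \<iota> m = (\<rho> (Suc n) \<cdot> \<iota> (Suc m)) \<cdot> i m"
      using Cmp_assoc[OF \<iota>[of m] s(1) \<rho>(1)[of "Suc n"]] s(2) Cmp_assoc[OF i[of m] \<iota>[of "Suc m"] \<rho>(1)[of "Suc n"]] by simp
    also have "\<dots> = i n \<cdot> (\<rho> n \<cdot> \<iota> m)"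
      using \<rho>(2,3) Zero_Cmp[OF i[of m] XO[of "Suc n"]] Cmp_Zero[OF i[of n] XO[of m]] Ide_Cmp[OF i[of n]] Cmp_Ide[OF i[of n]]
      by (cases "n = m") simp_all
    finally show "(\<rho> (Suc n) \<cdot> s) \<cdot> \<iota> m = (i n \<cdot> \<rho> n) \<cdot> \<iota> m" using Cmp_assoc[OF \<iota>[of m] \<rho>(1)[of n] i[of n]] by simp
  qed
  \<comment> \<open>\<open>1 - s\<close> is injective on \<open>Hom(d, P)\<close>: a fixed vector of \<open>s\<close> has all components zero.\<close>
  have inj: "g = ZeroM C d P" if d: "compact_object U C d" and g: "g \<in> Hom C d P" "s \<cdot> g = g" for d g
  proof (rule compact_component_zero[OF d P sn g(1) \<rho>])
    show "\<rho> n \<cdot> g = ZeroM C d (X n)" for n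
    proof (induction n)
      case 0
      have "\<rho> 0 \<cdot> g = (\<rho> 0 \<cdot> s) \<cdot> g" using Cmp_assoc[OF g(1) s(1) \<rho>(1)[of 0]] g(2) by simp
      then show ?case using \<rho>0 Zero_Cmp[OF g(1) XO] by simp
    next
      case (Suc n)
      have "\<rho> (Suc n) \<cdot> g = (\<rho> (Suc n) \<cdot> s) \<cdot> g" using Cmp_assoc[OF g(1) s(1) \<rho>(1)[of "Suc n"]] g(2) by simp
      also have "\<dots> = i n \<cdot> \<rho> n \<cdot> g" using \<rho>S Cmp_assoc[OF g(1) \<rho>(1)[of n] i[of n]] by simp
      finally show ?case using Suc Cmp_Zero[OF i] compact_Obj[OF d] by simp
    qed
  qed auto
  show "\<exists>n. \<exists>f'\<in>Hom C c (X n). f = w \<cdot> \<iota> n \<cdot> f'"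
    if c: "compact_object U C c" and f: "f \<in> Hom C c L" for c f
  proof -
    obtain d where d: "compact_object U C d" "isomorphic C (ShO C d) c"
      using shift_stable_compacts c unfolding shift_stable_def by blast
    have dO: "d \<in> Obj C" and cO: "c \<in> Obj C" using compact_Obj d c by blast+
    obtain e e' where e': "e' \<in> Hom C c (ShO C d)" "e' \<cdot> e = Ide C (ShO C d)" "e \<cdot> e' = Ide C c"
      "e \<in> Hom C (ShO C d) c" using isomorphicE[OF d(2)] .
    have \<delta>f: "\<delta> \<cdot> f \<in> Hom C c (ShO C P)" using Cmp_Hom f \<delta> by blast
    have \<delta>fe: "(\<delta> \<cdot> f) \<cdot> e \<in> Hom C (ShO C d) (ShO C P)" using Cmp_Hom \<delta>f e' by blast
    obtain g where g: "g \<in> Hom C d P" "ShM C g = (\<delta> \<cdot> f) \<cdot> e" using ShM_full[OF \<delta>fe dO PO] .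
    have "ShM C (Diff (Ide C P) s \<cdot> g) = (ShM C (Diff (Ide C P) s) \<cdot> \<delta>) \<cdot> (f \<cdot> e)"
      using ShM_Cmp[OF g(1) D] g(2) ShM_Hom[OF D] \<delta> f e'(4) by (simp add: Hom_def)
    also have "\<dots> = ZeroM C (ShO C d) (ShO C P)"
      using Tri_Cmp_Zero''[OF t D \<delta>] Zero_Cmp[OF Cmp_Hom[OF e'(4) f]] PO by simp
    finally have "Diff (Ide C P) s \<cdot> g = ZeroM C d P" using ShM_eq_Zero[OF Cmp_Hom[OF g(1) D]] by simp
    then have "Diff g (s \<cdot> g) = ZeroM C d P" using Diff_Cmp[OF g(1) I s(1)] Ide_Cmp[OF g(1)] by simp
    then have "s \<cdot> g = g" using Diff_eq_Zero[OF g(1) Cmp_Hom[OF g(1) s(1)]] by simp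
    then have "g = ZeroM C d P" using inj d g by blast
    then have "(\<delta> \<cdot> f) \<cdot> e = ZeroM C (ShO C d) (ShO C P)" using g(2) ShM_Zero dO PO by simp
    then have "((\<delta> \<cdot> f) \<cdot> e) \<cdot> e' = ZeroM C c (ShO C P)" using Zero_Cmp[OF e'(1)] PO by simp
    then have "\<delta> \<cdot> f = ZeroM C c (ShO C P)"
      using Cmp_assoc[OF e'(1,4) \<delta>f] e'(3) Cmp_Ide[OF \<delta>f] by simp
    then obtain h where h: "h \<in> Hom C c P" "w \<cdot> h = f" using Tri_weak_kernel'[OF t D w f] by blast
    have "\<exists>n. \<exists>f'\<in>Hom C c (X n). w \<cdot> h = w \<cdot> \<iota> n \<cdot> f'"
    proof (rule compact_object_induct[where Q = "\<lambda>h. \<exists>n. \<exists>f'\<in>Hom C c (X n). w \<cdot> h = w \<cdot> \<iota> n \<cdot> f'",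
          OF c P sn h(1)])
      show "\<exists>n. \<exists>f'\<in>Hom C c (X n). w \<cdot> ZeroM C c P = w \<cdot> \<iota> n \<cdot> f'"
        using Cmp_Zero[OF \<iota>[of 0] cO] ZeroM_Hom[OF cO XO[of 0]]
        by (intro exI[of _ 0] bexI[of _ "ZeroM C c (X 0)"]) simp_all
      show "\<exists>m. \<exists>f'\<in>Hom C c (X m). w \<cdot> \<iota> n \<cdot> g = w \<cdot> \<iota> m \<cdot> f'" if "g \<in> Hom C c (X n)" for n g
        using that by blast
      fix g h assume gh: "g \<in> Hom C c P" "h \<in> Hom C c P"
        and "\<exists>n. \<exists>f'\<in>Hom C c (X n). w \<cdot> g = w \<cdot> \<iota> n \<cdot> f'" "\<exists>n. \<exists>f'\<in>Hom C c (X n). w \<cdot> h = w \<cdot> \<iota> n \<cdot> f'"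
      then obtain n g1 m h1 where 1: "g1 \<in> Hom C c (X n)" "w \<cdot> g = w \<cdot> \<iota> n \<cdot> g1"
        "h1 \<in> Hom C c (X m)" "w \<cdot> h = w \<cdot> \<iota> m \<cdot> h1" by blast
      obtain g2 where g2: "g2 \<in> Hom C c (X (max n m))" "w \<cdot> g = w \<cdot> \<iota> (max n m) \<cdot> g2"
        using up[of n "max n m", OF _ 1(1)] 1(2) by auto
      obtain h2 where h2: "h2 \<in> Hom C c (X (max n m))" "w \<cdot> h = w \<cdot> \<iota> (max n m) \<cdot> h2"
        using up[of m "max n m", OF _ 1(3)] 1(4) by auto
      note \<iota>n = \<iota>[of "max n m"]
      have "w \<cdot> Add C g h = w \<cdot> \<iota> (max n m) \<cdot> Add C g2 h2"
        using Cmp_Add[OF gh w] Cmp_Add[OF g2(1) h2(1) \<iota>n] Cmp_Add[OF Cmp_Hom[OF g2(1) \<iota>n] Cmp_Hom[OF h2(1) \<iota>n] w] g2 h2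
        by simp
      then show "\<exists>n. \<exists>f'\<in>Hom C c (X n). w \<cdot> Add C g h = w \<cdot> \<iota> n \<cdot> f'"
        using Add_Hom[OF g2(1) h2(1)] by blast
    qed
    then show ?thesis using h(2) by simp
  qed
qed

end

section \<open>Brown representability\<close>

text \<open>
  A contravariant set-valued functor.  The weak equalizer condition replaces the usual cohomological
  condition, which would need values in abelian groups; it is immediate for functors
  of the form \<open>Hom(F -, A)\<close> and is what injectivity of the character group gives for duals.
\<close>

locale brown_functor = small_compactly_generated U C
  for U :: "'u set" and C :: "('o, 'm, 'z) triangulated_category_scheme" (structure) +
  fixes H :: "'o \<Rightarrow> 'h set" and HM :: "'m \<Rightarrow> 'h \<Rightarrow> 'h"
  assumes HM_in: "f \<in> Hom C X Y \<Longrightarrow> u \<in> H Y \<Longrightarrow> HM f u \<in> H X"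
    and HM_Ide: "X \<in> Obj C \<Longrightarrow> u \<in> H X \<Longrightarrow> HM (Ide C X) u = u"
    and HM_Cmp: "f \<in> Hom C X Y \<Longrightarrow> g \<in> Hom C Y Z \<Longrightarrow> u \<in> H Z \<Longrightarrow> HM (g \<cdot> f) u = HM f (HM g u)"
    and H_coproduct: "\<And>I A P \<iota> x. (I :: 'u set) \<subseteq> U \<Longrightarrow> small U I \<Longrightarrow> is_coproduct C I A P \<iota> \<Longrightarrow>
           (\<And>i. i \<in> I \<Longrightarrow> x i \<in> H (A i)) \<Longrightarrow> \<exists>!u. u \<in> H P \<and> (\<forall>i\<in>I. HM (\<iota> i) u = x i)"
    and H_weak_coequalizer: "f \<in> Hom C X Y \<Longrightarrow> g \<in> Hom C X Y \<Longrightarrow> (Diff f g, k, h) \<in> Tri C \<Longrightarrow>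
           k \<in> Hom C Y Z \<Longrightarrow> u \<in> H Y \<Longrightarrow> HM f u = HM g u \<Longrightarrow> \<exists>v\<in>H Z. HM k v = u"
    and H_small: "compact_object U C c \<Longrightarrow> small U (H c)"
begin

lemma H_coproduct_ex1:
  assumes I: "small U I" and P: "is_coproduct C I A P \<iota>" and x: "\<And>i. i \<in> I \<Longrightarrow> x i \<in> H (A i)"
  shows "\<exists>!u. u \<in> H P \<and> (\<forall>i\<in>I. HM (\<iota> i) u = x i)"
proof -
  obtain J e where J: "J \<subseteq> U" "small U J" "bij_betw e J I" using small_index[OF I] .
  have "x (e j) \<in> H (A (e j))" if "j \<in> J" for j using x J(3) that by (auto simp: bij_betw_def)
  from H_coproduct[OF J(1,2) coproduct_reindex[OF J(3) P], of "\<lambda>j. x (e j)", OF this]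
  have "\<exists>!u. u \<in> H P \<and> (\<forall>j\<in>J. HM (\<iota> (e j)) u = x (e j))" by simp
  moreover have "(\<forall>j\<in>J. HM (\<iota> (e j)) u = x (e j)) \<longleftrightarrow> (\<forall>i\<in>I. HM (\<iota> i) u = x i)" for u
    using J(3) by (auto simp: bij_betw_def)
  ultimately show ?thesis by simp
qed

lemma H_coproduct_ex:
  assumes "small U I" "is_coproduct C I A P \<iota>" "\<And>i. i \<in> I \<Longrightarrow> x i \<in> H (A i)"
  obtains u where "u \<in> H P" "\<And>i. i \<in> I \<Longrightarrow> HM (\<iota> i) u = x i"
proof -
  have "\<exists>u. u \<in> H P \<and> (\<forall>i\<in>I. HM (\<iota> i) u = x i)"
    using H_coproduct_ex1[of I A P \<iota> x, OF assms] by (rule ex1_implies_ex)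
  then show ?thesis using that by (elim exE conjE) simp
qed

lemma H_coproduct_eqI:
  assumes I: "small U I" and P: "is_coproduct C I A P \<iota>" and u: "u \<in> H P" "v \<in> H P"
    and eq: "\<And>i. i \<in> I \<Longrightarrow> HM (\<iota> i) u = HM (\<iota> i) v"
  shows "u = v"
proof -
  have "\<exists>!w. w \<in> H P \<and> (\<forall>i\<in>I. HM (\<iota> i) w = HM (\<iota> i) v)"
    by (rule H_coproduct_ex1[OF I P]) (use HM_in[OF is_coproductD(2)[OF P] u(2)] in blast)
  then obtain w where "\<And>k. k \<in> H P \<and> (\<forall>i\<in>I. HM (\<iota> i) k = HM (\<iota> i) v) \<Longrightarrow> k = w"
    by (elim ex1E) blast
  from this[of u] this[of v] show ?thesis using u eq by simp
qed

text \<open>\<open>F\<close> and \<open>G\<close> are the universal pair of morphisms from a coproduct of compact objects which pull \<open>u\<close>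
  back to the same element; the cone of \<open>F - G\<close> identifies them, and \<open>u\<close> extends to it by the weak
  equalizer condition.\<close>

lemma identify_step:
  assumes X: "X \<in> Obj C" and u: "u \<in> H X"
  obtains i X' u' where "i \<in> Hom C X X'" "u' \<in> H X'" "HM i u' = u" "X' \<in> Obj C"
    "\<forall>c f g. compact_object U C c \<longrightarrow> f \<in> Hom C c X \<longrightarrow> g \<in> Hom C c X \<longrightarrow> HM f u = HM g u \<longrightarrow> i \<cdot> f = i \<cdot> g"
proof -
  obtain R where R: "is_skeleton C {c. compact_object U C c} R" "small U R" using small_skeleton_of_compacts .
  have Rc: "compact_object U C c" if "c \<in> R" for c using R(1) that unfolding is_skeleton_def by blast
  define N where "N = {(c, f, g). c \<in> R \<and> f \<in> Hom C c X \<and> g \<in> Hom C c X \<and> HM f u = HM g u}"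
  have "small U (Sigma R (\<lambda>c. Hom C c X \<times> Hom C c X))"
    using small_Sigma[OF universe R(2)] small_Sigma[OF universe] locally_small Rc compact_Obj X
    unfolding locally_small_def by (metis (no_types, lifting))
  then have N: "small U N" by (rule small_subset) (auto simp: N_def)
  have "fst n \<in> Obj C" if "n \<in> N" for n using that Rc compact_Obj unfolding N_def by auto
  then obtain S \<iota> where S: "is_coproduct C N fst S \<iota>" using coproduct_exists[OF N, of fst] by blast
  have "fst (snd n) \<in> Hom C (fst n) X" if "n \<in> N" for n using that unfolding N_def by auto
  then obtain F where F: "F \<in> Hom C S X" "\<And>n. n \<in> N \<Longrightarrow> F \<cdot> \<iota> n = fst (snd n)"
    using coproduct_ex[OF S X, of "\<lambda>n. fst (snd n)"] by blast
  have "snd (snd n) \<in> Hom C (fst n) X" if "n \<in> N" for n using that unfolding N_def by auto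
  then obtain G where G: "G \<in> Hom C S X" "\<And>n. n \<in> N \<Longrightarrow> G \<cdot> \<iota> n = snd (snd n)"
    using coproduct_ex[OF S X, of "\<lambda>n. snd (snd n)"] by blast
  have eq: "HM F u = HM G u"
  proof (rule H_coproduct_eqI[OF N S HM_in[OF F(1) u] HM_in[OF G(1) u]])
    fix n assume n: "n \<in> N"
    have "HM (fst (snd n)) u = HM (snd (snd n)) u" using n unfolding N_def by auto
    then show "HM (\<iota> n) (HM F u) = HM (\<iota> n) (HM G u)"
      using HM_Cmp[OF is_coproductD(2)[OF S n] F(1) u] HM_Cmp[OF is_coproductD(2)[OF S n] G(1) u] F(2) G(2) n by simp
  qed
  have D: "Diff F G \<in> Hom C S X" using Diff_Hom F G by blast
  obtain k h X' where t: "(Diff F G, k, h) \<in> Tri C" "k \<in> Hom C X X'" "X' \<in> Obj C" using cone_ex[OF D] by blast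
  obtain u' where u': "u' \<in> H X'" "HM k u' = u" using H_weak_coequalizer[OF F(1) G(1) t(1,2) u eq] by blast
  have "Diff (k \<cdot> F) (k \<cdot> G) = ZeroM C S X'" using Tri_Cmp_Zero[OF t(1) D t(2)] Cmp_Diff[OF F(1) G(1) t(2)] by simp
  then have kFG: "k \<cdot> F = k \<cdot> G" using Diff_eq_Zero Cmp_Hom[OF F(1) t(2)] Cmp_Hom[OF G(1) t(2)] by blast
  have "k \<cdot> f = k \<cdot> g" if c: "compact_object U C c" and f: "f \<in> Hom C c X" and g: "g \<in> Hom C c X" and fg: "HM f u = HM g u" for c f g
  proof -
    obtain d a b where d: "d \<in> R"
      and b: "b \<in> Hom C c d" "b \<cdot> a = Ide C d" "a \<cdot> b = Ide C c" "a \<in> Hom C d c"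
      using skeletonE[OF R(1), of c] c by blast
    let ?n = "(d, f \<cdot> a, g \<cdot> a)"
    have n: "?n \<in> N" unfolding N_def
      using d Cmp_Hom[OF b(4) f] Cmp_Hom[OF b(4) g] HM_Cmp[OF b(4) f u] HM_Cmp[OF b(4) g u] fg by simp
    have \<iota>: "\<iota> ?n \<in> Hom C d S" using is_coproductD(2)[OF S n] by simp
    have "k \<cdot> f \<cdot> a = (k \<cdot> F) \<cdot> \<iota> ?n" using F(2)[OF n] Cmp_assoc[OF \<iota> F(1) t(2)] by simp
    also have "\<dots> = k \<cdot> g \<cdot> a" using G(2)[OF n] Cmp_assoc[OF \<iota> G(1) t(2)] kFG by simp
    finally have "(k \<cdot> f \<cdot> a) \<cdot> b = (k \<cdot> g \<cdot> a) \<cdot> b" by simp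
    then show ?thesis using t(2) f g b by (simp add: Hom_def)
  qed
  then show ?thesis by (intro that[OF t(2) u' t(3)] allI impI)
qed

text \<open>The coproduct of \<open>Y\<close> with all compact \<open>c\<close>, one copy for each element of \<open>H(c)\<close>; the index \<open>None\<close>
  stands for \<open>Y\<close>.\<close>

lemma generate_step:
  assumes Y: "Y \<in> Obj C" and y: "y \<in> H Y"
  obtains j X u where "j \<in> Hom C Y X" "u \<in> H X" "HM j u = y" "X \<in> Obj C"
    "\<forall>c x. compact_object U C c \<longrightarrow> x \<in> H c \<longrightarrow> (\<exists>f\<in>Hom C c X. HM f u = x)"
proof -
  obtain R where R: "is_skeleton C {c. compact_object U C c} R" "small U R" using small_skeleton_of_compacts .
  have Rc: "compact_object U C c" if "c \<in> R" for c using R(1) that unfolding is_skeleton_def by blast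
  define N where "N = insert None (Some ` Sigma R H)"
  have N: "small U N" unfolding N_def
    by (intro small_insert[OF universe] small_image small_Sigma[OF universe R(2)] H_small Rc)
  define A where "A n = (case n of None \<Rightarrow> Y | Some p \<Rightarrow> fst p)" for n :: "('o \<times> 'h) option"
  define x where "x n = (case n of None \<Rightarrow> y | Some p \<Rightarrow> snd p)" for n :: "('o \<times> 'h) option"
  have "A n \<in> Obj C" if "n \<in> N" for n using that Y Rc compact_Obj unfolding N_def A_def by auto
  then obtain X \<iota> where X: "is_coproduct C N A X \<iota>" using coproduct_exists[OF N, of A] by blast
  have "x n \<in> H (A n)" if "n \<in> N" for n using that y unfolding N_def A_def x_def by auto
  then obtain u where u: "u \<in> H X" "\<And>n. n \<in> N \<Longrightarrow> HM (\<iota> n) u = x n" using H_coproduct_ex[OF N X, of x] by blast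
  have None: "None \<in> N" unfolding N_def by simp
  show ?thesis
  proof (rule that)
    show "\<iota> None \<in> Hom C Y X" using is_coproductD(2)[OF X None] by (simp add: A_def)
    show "HM (\<iota> None) u = y" using u(2)[OF None] by (simp add: x_def)
    show "u \<in> H X" "X \<in> Obj C" using u is_coproductD[OF X] by auto
    show "\<forall>c z. compact_object U C c \<longrightarrow> z \<in> H c \<longrightarrow> (\<exists>f\<in>Hom C c X. HM f u = z)"
    proof (intro allI impI)
      fix c z assume c: "compact_object U C c" and z: "z \<in> H c"
      obtain d a b where d: "d \<in> R"
        and b: "b \<in> Hom C c d" "b \<cdot> a = Ide C d" "a \<cdot> b = Ide C c" "a \<in> Hom C d c"
        using skeletonE[OF R(1), of c] c by blast
      let ?n = "Some (d, HM a z)"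
      have n: "?n \<in> N" unfolding N_def using d HM_in[OF b(4) z] by simp
      have \<iota>: "\<iota> ?n \<in> Hom C d X" using is_coproductD(2)[OF X n] by (simp add: A_def)
      have "HM (\<iota> ?n \<cdot> b) u = HM b (HM a z)" using HM_Cmp[OF b(1) \<iota> u(1)] u(2)[OF n] by (simp add: x_def)
      also have "\<dots> = z" using HM_Cmp[OF b(1,4) z] b(3) HM_Ide[OF compact_Obj[OF c] z] by simp
      finally show "\<exists>f\<in>Hom C c X. HM f u = z" using Cmp_Hom[OF b(1) \<iota>] by blast
    qed
  qed
qed

definition represents_on_compacts :: "'o \<Rightarrow> 'h \<Rightarrow> bool" where
  "represents_on_compacts X v \<longleftrightarrow> X \<in> Obj C \<and> v \<in> H X \<and>
     (\<forall>c. compact_object U C c \<longrightarrow> bij_betw (\<lambda>f. HM f v) (Hom C c X) (H c))"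

text \<open>The telescope of a sequence in which each step identifies the coincidences of the previous term.
  Surjectivity on compact objects holds from the start.  For injectivity, two morphisms from a
  compact object to the telescope factor through one term, and coincide in the next one.\<close>

lemma approximation:
  assumes Y: "Y \<in> Obj C" and y: "y \<in> H Y"
  obtains X v j where "represents_on_compacts X v" "j \<in> Hom C Y X" "HM j v = y"
proof -
  obtain j X0 u0 where 0: "j \<in> Hom C Y X0" "u0 \<in> H X0" "HM j u0 = y" "X0 \<in> Obj C"
    and surj0: "\<forall>c x. compact_object U C c \<longrightarrow> x \<in> H c \<longrightarrow> (\<exists>f\<in>Hom C c X0. HM f u0 = x)"
    using generate_step[OF Y y] .
  define good where "good p \<longleftrightarrow> fst p \<in> Obj C \<and> snd p \<in> H (fst p)" for p :: "'o \<times> 'h"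
  define link where "link p q i \<longleftrightarrow> i \<in> Hom C (fst p) (fst q) \<and> HM i (snd q) = snd p \<and>
    (\<forall>c f g. compact_object U C c \<longrightarrow> f \<in> Hom C c (fst p) \<longrightarrow> g \<in> Hom C c (fst p) \<longrightarrow>
      HM f (snd p) = HM g (snd p) \<longrightarrow> i \<cdot> f = i \<cdot> g)" for p q :: "'o \<times> 'h" and i
  have step: "\<exists>q. good q \<and> (\<exists>i. link p q i)" if p: "good p" for p
  proof -
    have p': "fst p \<in> Obj C" "snd p \<in> H (fst p)" using p unfolding good_def by auto
    obtain i X' u' where q: "i \<in> Hom C (fst p) X'" "u' \<in> H X'" "HM i u' = snd p" "X' \<in> Obj C"
      "\<forall>c f g. compact_object U C c \<longrightarrow> f \<in> Hom C c (fst p) \<longrightarrow> g \<in> Hom C c (fst p) \<longrightarrow> HM f (snd p) = HM g (snd p) \<longrightarrow> i \<cdot> f = i \<cdot> g"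
      using identify_step[OF p'] .
    have "good (X', u') \<and> link p (X', u') i"
      unfolding good_def link_def fst_conv snd_conv by (intro conjI q)
    then show ?thesis by (intro exI conjI) (erule conjunct1, erule conjunct2)
  qed
  have "good (X0, u0)" using 0(2,4) by (simp add: good_def)
  then obtain p i where p: "p 0 = (X0, u0)" "\<And>n. good (p n)" and i: "\<And>n. link (p n) (p (Suc n)) (i n)"
    using dependent_sequence[of good "(X0, u0)" link, OF _ step] by blast
  define X u where "X n = fst (p n)" and "u n = snd (p n)" for n
  have XO: "X n \<in> Obj C" and uH: "u n \<in> H (X n)" for n using p(2)[of n] unfolding good_def X_def u_def by auto
  note ilink = i[unfolded link_def, folded X_def u_def]
  have ih: "i n \<in> Hom C (X n) (X (Suc n))" and iu: "HM (i n) (u (Suc n)) = u n" for n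
    using ilink[of n, THEN conjunct1] ilink[of n, THEN conjunct2, THEN conjunct1] .
  have ieq: "i n \<cdot> f = i n \<cdot> g" if "compact_object U C c" "f \<in> Hom C c (X n)" "g \<in> Hom C c (X n)" "HM f (u n) = HM g (u n)" for n c f g
    by (rule ilink[of n, THEN conjunct2, THEN conjunct2, rule_format, OF that])
  have sn: "small U (UNIV :: nat set)" by (rule small_countable[OF universe countableI_type])
  obtain P \<iota> where P: "is_coproduct C (UNIV :: nat set) X P \<iota>" using coproduct_exists[OF sn, of X] XO by blast
  note PO = is_coproductD(1)[OF P] and \<iota> = is_coproductD(2)[OF P UNIV_I]
  obtain s where s: "s \<in> Hom C P P" "\<And>n. s \<cdot> \<iota> n = \<iota> (Suc n) \<cdot> i n"
    using coproduct_ex[OF P PO, of "\<lambda>n. \<iota> (Suc n) \<cdot> i n"] Cmp_Hom[OF ih \<iota>] by (metis UNIV_I)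
  have I: "Ide C P \<in> Hom C P P" using Ide_Hom PO by blast
  obtain w \<delta> L where t: "(Diff (Ide C P) s, w, \<delta>) \<in> Tri C" "w \<in> Hom C P L" "L \<in> Obj C"
    using cone_ex[OF Diff_Hom[OF I s(1)]] by blast
  note tel = compact_telescope[OF P ih s t(1,2)]
  obtain U' where U': "U' \<in> H P" "\<And>n. HM (\<iota> n) U' = u n"
    using H_coproduct_ex[OF sn P, of u] uH by (metis UNIV_I)
  have "HM s U' = U'"
  proof (rule H_coproduct_eqI[OF sn P HM_in[OF s(1) U'(1)] U'(1)])
    fix n
    have "HM (\<iota> n) (HM s U') = HM (\<iota> (Suc n) \<cdot> i n) U'" using HM_Cmp[OF \<iota>[of n] s(1) U'(1)] s(2) by simp
    also have "\<dots> = u n" using HM_Cmp[OF ih[of n] \<iota>[of "Suc n"] U'(1)] U'(2) iu by simp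
    finally show "HM (\<iota> n) (HM s U') = HM (\<iota> n) U'" using U'(2) by simp
  qed
  then have "HM (Ide C P) U' = HM s U'" using HM_Ide[OF PO U'(1)] by simp
  then obtain v where v: "v \<in> H L" "HM w v = U'" using H_weak_coequalizer[OF I s(1) t(1,2) U'(1)] by blast
  have wi: "w \<cdot> \<iota> n \<in> Hom C (X n) L" for n using Cmp_Hom[OF \<iota> t(2)] .
  have wv: "HM (w \<cdot> \<iota> n) v = u n" for n using HM_Cmp[OF \<iota>[of n] t(2) v(1)] v(2) U'(2) by simp
  have wf: "w \<cdot> \<iota> n \<cdot> f = (w \<cdot> \<iota> n) \<cdot> f" if "f \<in> Hom C Z (X n)" for f n Z using Cmp_assoc[OF that \<iota> t(2)] by simp
  have "represents_on_compacts L v"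
    unfolding represents_on_compacts_def
  proof (intro conjI allI impI t(3) v(1))
    fix c assume c: "compact_object U C c"
    show "bij_betw (\<lambda>f. HM f v) (Hom C c L) (H c)"
      unfolding bij_betw_def
    proof (intro conjI equalityI subsetI inj_onI)
      fix x assume "x \<in> (\<lambda>f. HM f v) ` Hom C c L" then show "x \<in> H c" using HM_in v(1) by blast
    next
      fix x assume "x \<in> H c"
      then obtain f where f: "f \<in> Hom C c X0" "HM f u0 = x" using surj0 c by blast
      then have f0: "f \<in> Hom C c (X 0)" "HM f (u 0) = x" unfolding X_def u_def using p(1) by auto
      have "HM ((w \<cdot> \<iota> 0) \<cdot> f) v = x" using HM_Cmp[OF f0(1) wi v(1)] wv f0(2) by simp
      then show "x \<in> (\<lambda>f. HM f v) ` Hom C c L" using Cmp_Hom[OF f0(1) wi] by blast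
    next
      fix f g assume f: "f \<in> Hom C c L" and g: "g \<in> Hom C c L" and eq: "HM f v = HM g v"
      obtain n1 f1 where f1: "f1 \<in> Hom C c (X n1)" "f = w \<cdot> \<iota> n1 \<cdot> f1" using tel(2)[OF c f] by blast
      obtain n2 g1 where g1: "g1 \<in> Hom C c (X n2)" "g = w \<cdot> \<iota> n2 \<cdot> g1" using tel(2)[OF c g] by blast
      define n where "n = max n1 n2"
      obtain f2 where f2: "f2 \<in> Hom C c (X n)" "f = w \<cdot> \<iota> n \<cdot> f2" using tel(3)[of n1 n, OF _ f1(1)] f1(2) unfolding n_def by auto
      obtain g2 where g2: "g2 \<in> Hom C c (X n)" "g = w \<cdot> \<iota> n \<cdot> g2" using tel(3)[of n2 n, OF _ g1(1)] g1(2) unfolding n_def by auto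
      have "HM f2 (u n) = HM g2 (u n)"
        using eq f2 g2 wf[OF f2(1)] wf[OF g2(1)] HM_Cmp[OF f2(1) wi v(1)] HM_Cmp[OF g2(1) wi v(1)] wv by simp
      then have "i n \<cdot> f2 = i n \<cdot> g2" using ieq c f2 g2 by blast
      moreover have "w \<cdot> \<iota> n \<cdot> h = (w \<cdot> \<iota> (Suc n)) \<cdot> i n \<cdot> h" if h: "h \<in> Hom C c (X n)" for h
      proof -
        have "(w \<cdot> \<iota> (Suc n)) \<cdot> i n \<cdot> h = (w \<cdot> \<iota> (Suc n) \<cdot> i n) \<cdot> h"
          using h ih[of n] \<iota>[of "Suc n"] t(2) by (simp add: Hom_def)
        then show ?thesis using tel(1)[of n] wf[OF h] by simp
      qed
      ultimately show "f = g" using f2 g2 by simp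
    qed
  qed
  moreover have "(w \<cdot> \<iota> 0) \<cdot> j \<in> Hom C Y L" "HM ((w \<cdot> \<iota> 0) \<cdot> j) v = y"
  proof -
    have j: "j \<in> Hom C Y (X 0)" "HM j (u 0) = y" using 0 p(1) unfolding X_def u_def by auto
    show "(w \<cdot> \<iota> 0) \<cdot> j \<in> Hom C Y L" using Cmp_Hom[OF j(1) wi] .
    show "HM ((w \<cdot> \<iota> 0) \<cdot> j) v = y" using HM_Cmp[OF j(1) wi v(1)] wv j(2) by simp
  qed
  ultimately show ?thesis using that by blast
qed

lemma represents_on_compacts_Iso:
  assumes X: "represents_on_compacts X v" and Y: "represents_on_compacts Y w"
    and t: "t \<in> Hom C X Y" "HM t w = v"
  shows "t \<in> Iso C X Y"
proof (rule Iso_if_bij_compacts[OF t(1)])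
  fix c assume c: "compact_object U C c"
  have w: "w \<in> H Y" using Y unfolding represents_on_compacts_def by blast
  have bX: "bij_betw (\<lambda>f. HM f v) (Hom C c X) (H c)" and bY: "bij_betw (\<lambda>f. HM f w) (Hom C c Y) (H c)"
    using X Y c unfolding represents_on_compacts_def by blast+
  have eq: "HM (t \<cdot> f) w = HM f v" if "f \<in> Hom C c X" for f using HM_Cmp[OF that t(1) w] t(2) by simp
  show "bij_betw (\<lambda>f. t \<cdot> f) (Hom C c X) (Hom C c Y)"
    unfolding bij_betw_def
  proof (intro conjI inj_onI equalityI subsetI)
    fix f g assume "f \<in> Hom C c X" "g \<in> Hom C c X" "t \<cdot> f = t \<cdot> g"
    then show "f = g" using inj_onD[OF bij_betw_imp_inj_on[OF bX]] eq by metis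
  next
    fix g assume "g \<in> (\<lambda>f. t \<cdot> f) ` Hom C c X" then show "g \<in> Hom C c Y" using Cmp_Hom t(1) by blast
  next
    fix g assume g: "g \<in> Hom C c Y"
    have "HM g w \<in> (\<lambda>f. HM f v) ` Hom C c X" using bij_betw_imp_surj_on[OF bX] HM_in[OF g w] by simp
    then obtain f where f: "f \<in> Hom C c X" "HM g w = HM f v" by (elim imageE) simp
    then have "g = t \<cdot> f"
      using inj_onD[OF bij_betw_imp_inj_on[OF bY], of g "t \<cdot> f"] eq[OF f(1)] g Cmp_Hom[OF f(1) t(1)] by simp
    then show "g \<in> (\<lambda>f. t \<cdot> f) ` Hom C c X" using f(1) by blast
  qed
qed

text \<open>An object representing \<open>H\<close> on compact objects represents it everywhere.  An element \<open>y\<close> of \<open>H(Y)\<close> is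
  hit, since an approximation built on \<open>X + Y\<close> also represents \<open>H\<close> on compact objects and is
  therefore isomorphic to \<open>X\<close>.  Two morphisms \<open>Y \<rightarrow> X\<close> with the same image are equal, since they are
  identified in the cone of their difference, on which one can again build an approximation
  isomorphic to \<open>X\<close>.\<close>

theorem representable:
  obtains X v where "X \<in> Obj C" "v \<in> H X" "\<And>Y. Y \<in> Obj C \<Longrightarrow> bij_betw (\<lambda>f. HM f v) (Hom C Y X) (H Y)"
proof -
  have e: "small U ({} :: nat set)" using small_countable[OF universe countable_empty] .
  obtain Z \<iota> where Z: "is_coproduct C ({} :: nat set) (\<lambda>_. undefined) Z \<iota>" using coproduct_exists[OF e] by (metis empty_iff)
  obtain z where z: "z \<in> H Z" using H_coproduct_ex[OF e Z] by (metis empty_iff)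
  obtain X v where X: "represents_on_compacts X v" using approximation[OF is_coproductD(1)[OF Z] z] by blast
  have XO: "X \<in> Obj C" and v: "v \<in> H X" using X unfolding represents_on_compacts_def by auto
  have "bij_betw (\<lambda>f. HM f v) (Hom C Y X) (H Y)" if Y: "Y \<in> Obj C" for Y
    unfolding bij_betw_def
  proof (intro conjI inj_onI equalityI subsetI)
    fix f g assume f: "f \<in> Hom C Y X" and g: "g \<in> Hom C Y X" and eq: "HM f v = HM g v"
    note D = Diff_Hom[OF f g]
    obtain k h Z where t: "(Diff f g, k, h) \<in> Tri C" "k \<in> Hom C X Z" "Z \<in> Obj C" using cone_ex[OF D] by blast
    obtain v1 where v1: "v1 \<in> H Z" "HM k v1 = v" using H_weak_coequalizer[OF f g t(1,2) v eq] by blast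
    obtain X' v' j where X': "represents_on_compacts X' v'" "j \<in> Hom C Z X'" "HM j v' = v1" using approximation[OF t(3) v1(1)] .
    have v': "v' \<in> H X'" using X' unfolding represents_on_compacts_def by auto
    have "j \<cdot> k \<in> Iso C X X'"
      by (rule represents_on_compacts_Iso[OF X X'(1) Cmp_Hom[OF t(2) X'(2)]]) (simp add: HM_Cmp[OF t(2) X'(2) v'] X'(3) v1(2))
    then obtain m where m: "m \<in> Hom C X' X" "m \<cdot> j \<cdot> k = Ide C X" "j \<cdot> k \<in> Hom C X X'" using isoE by metis
    have "Diff (k \<cdot> f) (k \<cdot> g) = ZeroM C Y Z" using Tri_Cmp_Zero[OF t(1) D t(2)] Cmp_Diff[OF f g t(2)] by simp
    then have kfg: "k \<cdot> f = k \<cdot> g" using Diff_eq_Zero Cmp_Hom[OF f t(2)] Cmp_Hom[OF g t(2)] by blast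
    have red: "a = m \<cdot> j \<cdot> k \<cdot> a" if a: "a \<in> Hom C Y X" for a
    proof -
      have "m \<cdot> j \<cdot> k \<cdot> a = (m \<cdot> j \<cdot> k) \<cdot> a" using a m(1) X'(2) t(2) by (simp add: Hom_def)
      also have "\<dots> = Ide C X \<cdot> a" by (simp only: m(2))
      also have "\<dots> = a" using Ide_Cmp[OF a] .
      finally show ?thesis by simp
    qed
    show "f = g" using red[OF f] red[OF g] kfg by simp
  next
    fix y assume "y \<in> (\<lambda>f. HM f v) ` Hom C Y X" then show "y \<in> H Y" using HM_in v by blast
  next
    fix y assume y: "y \<in> H Y"
    obtain B \<beta> where B: "is_coproduct C (UNIV :: bool set) (\<lambda>b. if b then X else Y) B \<beta>"
      using ex_binary_coproduct XO Y by blast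
    note sb = small_countable[OF universe countable_finite[OF finite_UNIV[where 'a = bool]]]
    obtain b where b: "b \<in> H B" "\<And>i. HM (\<beta> i) b = (if i then v else y)"
      using H_coproduct_ex[OF sb B, of "\<lambda>i. if i then v else y"] v y by (metis (full_types) UNIV_I)
    have \<beta>: "\<beta> True \<in> Hom C X B" "\<beta> False \<in> Hom C Y B" using is_coproductD(2)[OF B UNIV_I, of True] is_coproductD(2)[OF B UNIV_I, of False] by simp_all
    obtain X' v' j where X': "represents_on_compacts X' v'" "j \<in> Hom C B X'" "HM j v' = b" using approximation[OF is_coproductD(1)[OF B] b(1)] .
    have v': "v' \<in> H X'" using X' unfolding represents_on_compacts_def by auto
    have jT: "HM (j \<cdot> \<beta> True) v' = v" using HM_Cmp[OF \<beta>(1) X'(2) v'] X'(3) b(2) by simp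
    have jF: "HM (j \<cdot> \<beta> False) v' = y" using HM_Cmp[OF \<beta>(2) X'(2) v'] X'(3) b(2) by simp
    have "j \<cdot> \<beta> True \<in> Iso C X X'" by (rule represents_on_compacts_Iso[OF X X'(1) Cmp_Hom[OF \<beta>(1) X'(2)] jT])
    then obtain m where m: "m \<in> Hom C X' X" "(j \<cdot> \<beta> True) \<cdot> m = Ide C X'" "j \<cdot> \<beta> True \<in> Hom C X X'" using isoE by metis
    have jFh: "j \<cdot> \<beta> False \<in> Hom C Y X'" using Cmp_Hom \<beta> X' by blast
    have mj: "m \<cdot> j \<cdot> \<beta> False \<in> Hom C Y X" using Cmp_Hom[OF jFh m(1)] .
    have "(j \<cdot> \<beta> True) \<cdot> m \<cdot> j \<cdot> \<beta> False = j \<cdot> \<beta> False"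
      using Cmp_assoc[OF jFh m(1,3)] m(2) Ide_Cmp[OF jFh] by simp
    then have "HM (m \<cdot> j \<cdot> \<beta> False) v = y" using HM_Cmp[OF mj m(3) v'] jT jF by simp
    then show "y \<in> (\<lambda>f. HM f v) ` Hom C Y X" using mj by blast
  qed
  then show ?thesis using that XO v by blast
qed

end

section \<open>Characters of abelian groups\<close>

definition divisible :: "('a, 'b) monoid_scheme \<Rightarrow> bool" where
  "divisible D \<longleftrightarrow> (\<forall>d\<in>carrier D. \<forall>n::nat. n > 0 \<longrightarrow> (\<exists>e\<in>carrier D. e [^]\<^bsub>D\<^esub> n = d))"

text \<open>Homomorphisms defined on a subgroup, represented by their graphs, so that extension is
  inclusion.\<close>

definition partial_hom :: "('a, 'c) monoid_scheme \<Rightarrow> ('b, 'd) monoid_scheme \<Rightarrow> ('a \<times> 'b) set \<Rightarrow> bool" where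
  "partial_hom G D \<Gamma> \<longleftrightarrow> \<Gamma> \<subseteq> carrier G \<times> carrier D \<and> (\<one>\<^bsub>G\<^esub>, \<one>\<^bsub>D\<^esub>) \<in> \<Gamma> \<and>
     (\<forall>a b a' b'. (a, b) \<in> \<Gamma> \<longrightarrow> (a', b') \<in> \<Gamma> \<longrightarrow> (a \<otimes>\<^bsub>G\<^esub> a', b \<otimes>\<^bsub>D\<^esub> b') \<in> \<Gamma>) \<and>
     (\<forall>a b. (a, b) \<in> \<Gamma> \<longrightarrow> (inv\<^bsub>G\<^esub> a, inv\<^bsub>D\<^esub> b) \<in> \<Gamma>) \<and>
     (\<forall>d. (\<one>\<^bsub>G\<^esub>, d) \<in> \<Gamma> \<longrightarrow> d = \<one>\<^bsub>D\<^esub>)"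

locale comm_group_pair = G: comm_group G + D: comm_group D
  for G :: "('a, 'c) monoid_scheme" and D :: "('b, 'd) monoid_scheme"
begin

lemma partial_homD:
  assumes "partial_hom G D \<Gamma>"
  shows "(a, b) \<in> \<Gamma> \<Longrightarrow> a \<in> carrier G" "(a, b) \<in> \<Gamma> \<Longrightarrow> b \<in> carrier D"
    "(\<one>\<^bsub>G\<^esub>, \<one>\<^bsub>D\<^esub>) \<in> \<Gamma>"
    "(a, b) \<in> \<Gamma> \<Longrightarrow> (a', b') \<in> \<Gamma> \<Longrightarrow> (a \<otimes>\<^bsub>G\<^esub> a', b \<otimes>\<^bsub>D\<^esub> b') \<in> \<Gamma>"
    "(a, b) \<in> \<Gamma> \<Longrightarrow> (inv\<^bsub>G\<^esub> a, inv\<^bsub>D\<^esub> b) \<in> \<Gamma>"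
    "(\<one>\<^bsub>G\<^esub>, d) \<in> \<Gamma> \<Longrightarrow> d = \<one>\<^bsub>D\<^esub>"
  using assms unfolding partial_hom_def by auto

lemma partial_hom_unique:
  assumes p: "partial_hom G D \<Gamma>" and a: "(a, b) \<in> \<Gamma>" "(a, b') \<in> \<Gamma>"
  shows "b = b'"
proof -
  note P = partial_homD[OF p]
  have "(a \<otimes>\<^bsub>G\<^esub> inv\<^bsub>G\<^esub> a, b \<otimes>\<^bsub>D\<^esub> inv\<^bsub>D\<^esub> b') \<in> \<Gamma>" using P(4)[OF a(1) P(5)[OF a(2)]] .
  then have "b \<otimes>\<^bsub>D\<^esub> inv\<^bsub>D\<^esub> b' = \<one>\<^bsub>D\<^esub>" using P(6) P(1)[OF a(1)] by simp
  then show ?thesis using P(2)[OF a(1)] P(2)[OF a(2)] D.inv_equality D.inv_inv D.inv_closed by metis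
qed

lemma partial_hom_pow:
  assumes p: "partial_hom G D \<Gamma>" and a: "(a, b) \<in> \<Gamma>"
  shows "(a [^]\<^bsub>G\<^esub> (k :: int), b [^]\<^bsub>D\<^esub> k) \<in> \<Gamma>"
proof -
  note P = partial_homD[OF p]
  have n: "(a [^]\<^bsub>G\<^esub> (n :: nat), b [^]\<^bsub>D\<^esub> n) \<in> \<Gamma>" for n
    by (induction n) (use P(3) P(4)[OF _ a] in auto)
  show ?thesis
  proof (cases k rule: int_cases2)
    case (nonneg m)
    show ?thesis unfolding nonneg int_pow_int by (rule n)
  next
    case (nonpos m)
    show ?thesis unfolding nonpos G.int_pow_neg_int[OF P(1)[OF a]] D.int_pow_neg_int[OF P(2)[OF a]]
      by (rule P(5)[OF n])
  qed
qed

text \<open>The condition on \<open>d\<close> makes \<open>a g\<^sup>n \<mapsto> b d\<^sup>n\<close> well defined.\<close>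

lemma partial_hom_extend:
  assumes p: "partial_hom G D \<Gamma>" and g: "g \<in> carrier G" and d: "d \<in> carrier D"
    and c: "\<And>n e. (g [^]\<^bsub>G\<^esub> (n :: int), e) \<in> \<Gamma> \<Longrightarrow> d [^]\<^bsub>D\<^esub> n = e"
  obtains \<Gamma>' where "partial_hom G D \<Gamma>'" "\<Gamma> \<subseteq> \<Gamma>'" "(g, d) \<in> \<Gamma>'"
proof -
  note P = partial_homD[OF p]
  define E where "E = {(a \<otimes>\<^bsub>G\<^esub> g [^]\<^bsub>G\<^esub> n, b \<otimes>\<^bsub>D\<^esub> d [^]\<^bsub>D\<^esub> n) | a b (n :: int). (a, b) \<in> \<Gamma>}"
  have EI: "(a \<otimes>\<^bsub>G\<^esub> g [^]\<^bsub>G\<^esub> n, b \<otimes>\<^bsub>D\<^esub> d [^]\<^bsub>D\<^esub> n) \<in> E" if "(a, b) \<in> \<Gamma>" for a b and n :: int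
    using that unfolding E_def by blast
  have EE: "\<exists>a b. \<exists>n :: int. x = a \<otimes>\<^bsub>G\<^esub> g [^]\<^bsub>G\<^esub> n \<and> y = b \<otimes>\<^bsub>D\<^esub> d [^]\<^bsub>D\<^esub> n \<and> (a, b) \<in> \<Gamma> \<and>
      a \<in> carrier G \<and> b \<in> carrier D" if "(x, y) \<in> E" for x y
    using that P(1,2) unfolding E_def by blast
  have "\<Gamma> \<subseteq> E"
  proof (clarify)
    fix a b assume "(a, b) \<in> \<Gamma>"
    then show "(a, b) \<in> E" using EI[of a b 0] P(1,2) by simp
  qed
  moreover have "(g, d) \<in> E" using EI[OF P(3), of 1] g d by simp
  moreover have "partial_hom G D E"
    unfolding partial_hom_def
  proof (intro conjI allI impI)
    show "E \<subseteq> carrier G \<times> carrier D"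
    proof clarify
      fix x y assume "(x, y) \<in> E"
      from EE[OF this] show "x \<in> carrier G \<and> y \<in> carrier D" using g d by auto
    qed
    show "(\<one>\<^bsub>G\<^esub>, \<one>\<^bsub>D\<^esub>) \<in> E" using EI[OF P(3), of 0] by simp
    fix x y assume xy: "(x, y) \<in> E"
    obtain a b n where 1: "x = a \<otimes>\<^bsub>G\<^esub> g [^]\<^bsub>G\<^esub> (n :: int)" "y = b \<otimes>\<^bsub>D\<^esub> d [^]\<^bsub>D\<^esub> n" "(a, b) \<in> \<Gamma>"
      "a \<in> carrier G" "b \<in> carrier D" using EE[OF xy] by blast
    show "(inv\<^bsub>G\<^esub> x, inv\<^bsub>D\<^esub> y) \<in> E"
      using EI[OF P(5)[OF 1(3)], of "- n"] 1 g d by (simp add: G.inv_mult D.inv_mult G.int_pow_neg D.int_pow_neg)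
    fix x' y' assume xy': "(x', y') \<in> E"
    obtain a' b' n' where 2: "x' = a' \<otimes>\<^bsub>G\<^esub> g [^]\<^bsub>G\<^esub> (n' :: int)" "y' = b' \<otimes>\<^bsub>D\<^esub> d [^]\<^bsub>D\<^esub> n'" "(a', b') \<in> \<Gamma>"
      "a' \<in> carrier G" "b' \<in> carrier D" using EE[OF xy'] by blast
    have "x \<otimes>\<^bsub>G\<^esub> x' = (a \<otimes>\<^bsub>G\<^esub> a') \<otimes>\<^bsub>G\<^esub> g [^]\<^bsub>G\<^esub> (n + n')"
      using 1 2 g by (simp add: G.int_pow_mult[symmetric] G.m_ac add.commute[of n' n])
    moreover have "y \<otimes>\<^bsub>D\<^esub> y' = (b \<otimes>\<^bsub>D\<^esub> b') \<otimes>\<^bsub>D\<^esub> d [^]\<^bsub>D\<^esub> (n + n')"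
      using 1 2 d by (simp add: D.int_pow_mult[symmetric] D.m_ac add.commute[of n' n])
    ultimately show "(x \<otimes>\<^bsub>G\<^esub> x', y \<otimes>\<^bsub>D\<^esub> y') \<in> E" using EI[OF P(4)[OF 1(3) 2(3)], of "n + n'"] by simp
  next
    fix y assume "(\<one>\<^bsub>G\<^esub>, y) \<in> E"
    then obtain a b n where 1: "\<one>\<^bsub>G\<^esub> = a \<otimes>\<^bsub>G\<^esub> g [^]\<^bsub>G\<^esub> (n :: int)" "y = b \<otimes>\<^bsub>D\<^esub> d [^]\<^bsub>D\<^esub> n" "(a, b) \<in> \<Gamma>"
      "a \<in> carrier G" "b \<in> carrier D" using EE by blast
    have "inv\<^bsub>G\<^esub> a = g [^]\<^bsub>G\<^esub> n"
      using G.inv_equality[of "g [^]\<^bsub>G\<^esub> n" a] 1 g G.m_comm[of a "g [^]\<^bsub>G\<^esub> n"] by simp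
    then have "d [^]\<^bsub>D\<^esub> n = inv\<^bsub>D\<^esub> b" using c P(5)[OF 1(3)] by simp
    then show "y = \<one>\<^bsub>D\<^esub>" using 1 by simp
  qed
  ultimately show ?thesis using that by blast
qed

text \<open>The value at \<open>g\<close> must be an \<open>n\<close>-th root of the value at \<open>g\<^sup>n\<close>, for the least positive \<open>n\<close> such
  that \<open>g\<^sup>n\<close> lies in the domain; all other constraints follow from this one.\<close>

lemma partial_hom_extension_value:
  assumes p: "partial_hom G D \<Gamma>" and g: "g \<in> carrier G" and dv: "divisible D"
  obtains d where "d \<in> carrier D" "\<And>n e. (g [^]\<^bsub>G\<^esub> (n :: int), e) \<in> \<Gamma> \<Longrightarrow> d [^]\<^bsub>D\<^esub> n = e"
proof (cases "\<exists>n :: nat. n > 0 \<and> (\<exists>e. (g [^]\<^bsub>G\<^esub> n, e) \<in> \<Gamma>)")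
  case True
  note P = partial_homD[OF p]
  define m where "m = (LEAST n :: nat. n > 0 \<and> (\<exists>e. (g [^]\<^bsub>G\<^esub> n, e) \<in> \<Gamma>))"
  have m: "m > 0" "\<exists>e. (g [^]\<^bsub>G\<^esub> m, e) \<in> \<Gamma>" using LeastI_ex[OF True] unfolding m_def by auto
  have m_le: "m \<le> k" if "k > 0" "(g [^]\<^bsub>G\<^esub> k, e') \<in> \<Gamma>" for k e'
    unfolding m_def by (rule Least_le) (use that in blast)
  obtain e0 where e0: "(g [^]\<^bsub>G\<^esub> m, e0) \<in> \<Gamma>" using m(2) by blast
  note e0c = P(2)[OF e0]
  obtain d where d: "d \<in> carrier D" "d [^]\<^bsub>D\<^esub> m = e0" using dv e0c m(1) unfolding divisible_def by blast
  have "d [^]\<^bsub>D\<^esub> n = e" if n: "(g [^]\<^bsub>G\<^esub> n, e) \<in> \<Gamma>" for n :: int and e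
  proof -
    let ?q = "n div int m" and ?r = "n mod int m"
    have ec: "e \<in> carrier D" using P(2)[OF n] .
    have "((g [^]\<^bsub>G\<^esub> m) [^]\<^bsub>G\<^esub> (- ?q), e0 [^]\<^bsub>D\<^esub> (- ?q)) \<in> \<Gamma>" by (rule partial_hom_pow[OF p e0])
    from P(4)[OF n this]
    have "(g [^]\<^bsub>G\<^esub> n \<otimes>\<^bsub>G\<^esub> (g [^]\<^bsub>G\<^esub> m) [^]\<^bsub>G\<^esub> (- ?q), e \<otimes>\<^bsub>D\<^esub> e0 [^]\<^bsub>D\<^esub> (- ?q)) \<in> \<Gamma>" .
    moreover have "g [^]\<^bsub>G\<^esub> n \<otimes>\<^bsub>G\<^esub> (g [^]\<^bsub>G\<^esub> m) [^]\<^bsub>G\<^esub> (- ?q) = g [^]\<^bsub>G\<^esub> ?r"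
    proof -
      have "(g [^]\<^bsub>G\<^esub> m) [^]\<^bsub>G\<^esub> (- ?q) = g [^]\<^bsub>G\<^esub> (int m * (- ?q))"
        using G.int_pow_pow[OF g, of "int m" "- ?q"] int_pow_int[of G g m] by simp
      then have "g [^]\<^bsub>G\<^esub> n \<otimes>\<^bsub>G\<^esub> (g [^]\<^bsub>G\<^esub> m) [^]\<^bsub>G\<^esub> (- ?q) = g [^]\<^bsub>G\<^esub> (n + int m * (- ?q))"
        using G.int_pow_mult[OF g, of n "int m * (- ?q)"] by simp
      moreover have "n + int m * (- ?q) = ?r" by (simp add: minus_mult_div_eq_mod)
      ultimately show ?thesis by simp
    qed
    ultimately have r: "(g [^]\<^bsub>G\<^esub> ?r, e \<otimes>\<^bsub>D\<^esub> e0 [^]\<^bsub>D\<^esub> (- ?q)) \<in> \<Gamma>" by simp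
    have r0: "?r = 0"
    proof (rule ccontr)
      assume "?r \<noteq> 0"
      then have pos: "nat ?r > 0" and lt: "nat ?r < m" using m(1) by (simp_all add: nat_less_iff order_le_neq_trans)
      have "g [^]\<^bsub>G\<^esub> ?r = g [^]\<^bsub>G\<^esub> (nat ?r)" using pos int_pow_int[of G g "nat ?r"] by simp
      then have "m \<le> nat ?r" using m_le[OF pos] r by simp
      then show False using lt by simp
    qed
    then have "e \<otimes>\<^bsub>D\<^esub> e0 [^]\<^bsub>D\<^esub> (- ?q) = \<one>\<^bsub>D\<^esub>" using P(6) r by simp
    then have "e = e0 [^]\<^bsub>D\<^esub> ?q"
      using D.inv_equality[of e "e0 [^]\<^bsub>D\<^esub> (- ?q)"] ec e0c by (simp add: D.int_pow_neg)
    also have "\<dots> = d [^]\<^bsub>D\<^esub> (int m * ?q)"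
      using D.int_pow_pow[OF d(1), of "int m" ?q] int_pow_int[of D d m] d(2) by simp
    also have "int m * ?q = n" using r0 by (metis add.right_neutral mult_div_mod_eq)
    finally show ?thesis by simp
  qed
  then show ?thesis using that d by blast
next
  case False
  note P = partial_homD[OF p]
  have "\<one>\<^bsub>D\<^esub> [^]\<^bsub>D\<^esub> n = e" if n: "(g [^]\<^bsub>G\<^esub> n, e) \<in> \<Gamma>" for n :: int and e
  proof -
    have "n = 0"
    proof (rule ccontr)
      assume n0: "n \<noteq> 0"
      have "\<exists>e. (g [^]\<^bsub>G\<^esub> (nat \<bar>n\<bar>), e) \<in> \<Gamma>"
      proof (cases "n \<ge> 0")
        case True
        then show ?thesis using n int_pow_int[of G g "nat n"] by auto
      next
        case False
        have "inv\<^bsub>G\<^esub> (g [^]\<^bsub>G\<^esub> n) = g [^]\<^bsub>G\<^esub> (nat \<bar>n\<bar>)"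
          using False G.int_pow_neg[OF g, of n, symmetric] int_pow_int[of G g "nat \<bar>n\<bar>"] by simp
        then show ?thesis using P(5)[OF n] by auto
      qed
      moreover have "nat \<bar>n\<bar> > 0" using n0 by simp
      ultimately show False using False by blast
    qed
    then show ?thesis using P(6) n by simp
  qed
  then show ?thesis using that[of "\<one>\<^bsub>D\<^esub>"] D.one_closed by blast
qed

text \<open>Baer's criterion: by Zorn's lemma there is a maximal extension, and it is total because every
  element can be adjoined.\<close>

theorem hom_extends_partial_hom:
  assumes p: "partial_hom G D \<Gamma>" and dv: "divisible D"
  obtains \<chi> where "\<chi> \<in> hom G D" "\<And>a b. (a, b) \<in> \<Gamma> \<Longrightarrow> \<chi> a = b"
proof -
  let ?A = "{\<Delta>. partial_hom G D \<Delta> \<and> \<Gamma> \<subseteq> \<Delta>}"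
  have "\<exists>M\<in>?A. \<forall>X\<in>?A. M \<subseteq> X \<longrightarrow> X = M"
  proof (rule subset_Zorn_nonempty)
    show "?A \<noteq> {}" using p by blast
    fix \<C> assume ne: "\<C> \<noteq> {}" and ch: "subset.chain ?A \<C>"
    have C: "partial_hom G D X" "\<Gamma> \<subseteq> X" if "X \<in> \<C>" for X using ch that unfolding subset.chain_def by blast+
    have lin: "X \<subseteq> Y \<or> Y \<subseteq> X" if "X \<in> \<C>" "Y \<in> \<C>" for X Y using ch that unfolding subset.chain_def by blast
    note P = partial_homD[OF C(1)]
    have "partial_hom G D (\<Union>\<C>)"
      unfolding partial_hom_def
    proof (intro conjI allI impI)
      show "\<Union>\<C> \<subseteq> carrier G \<times> carrier D" using P(1,2) by auto
      show "(\<one>\<^bsub>G\<^esub>, \<one>\<^bsub>D\<^esub>) \<in> \<Union>\<C>" using ne P(3) by blast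
      fix a b assume ab: "(a, b) \<in> \<Union>\<C>"
      then obtain X where X: "X \<in> \<C>" "(a, b) \<in> X" by blast
      show "(inv\<^bsub>G\<^esub> a, inv\<^bsub>D\<^esub> b) \<in> \<Union>\<C>" using X P(5)[OF X] by blast
      fix a' b' assume ab': "(a', b') \<in> \<Union>\<C>"
      then obtain Y where Y: "Y \<in> \<C>" "(a', b') \<in> Y" by blast
      show "(a \<otimes>\<^bsub>G\<^esub> a', b \<otimes>\<^bsub>D\<^esub> b') \<in> \<Union>\<C>"
        using lin[OF X(1) Y(1)]
      proof
        assume "X \<subseteq> Y"
        then show ?thesis using P(4)[OF Y(1) _ Y(2)] X(2) Y(1) by blast
      next
        assume "Y \<subseteq> X"
        then show ?thesis using P(4)[OF X(1) X(2)] Y(2) X(1) by blast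
      qed
    next
      fix d assume "(\<one>\<^bsub>G\<^esub>, d) \<in> \<Union>\<C>"
      then show "d = \<one>\<^bsub>D\<^esub>" using P(6) by blast
    qed
    then show "\<Union>\<C> \<in> ?A" using C(2) ne by blast
  qed
  then obtain M where M: "partial_hom G D M" "\<Gamma> \<subseteq> M"
    and max: "\<And>X. partial_hom G D X \<Longrightarrow> \<Gamma> \<subseteq> X \<Longrightarrow> M \<subseteq> X \<Longrightarrow> X = M" by auto
  note P = partial_homD[OF M(1)]
  have tot: "\<exists>b. (a, b) \<in> M" if a: "a \<in> carrier G" for a
  proof -
    obtain d where d: "d \<in> carrier D" "\<And>n e. (a [^]\<^bsub>G\<^esub> (n :: int), e) \<in> M \<Longrightarrow> d [^]\<^bsub>D\<^esub> n = e"
      using partial_hom_extension_value[OF M(1) a dv] by blast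
    obtain M' where M': "partial_hom G D M'" "M \<subseteq> M'" "(a, d) \<in> M'"
      using partial_hom_extend[OF M(1) a d] by blast
    then have "M' = M" using max M(2) by blast
    then show ?thesis using M'(3) by blast
  qed
  define \<chi> where "\<chi> a = (THE b. (a, b) \<in> M)" for a
  have eq: "\<chi> a = b" if "(a, b) \<in> M" for a b
    unfolding \<chi>_def using that partial_hom_unique[OF M(1)] by blast
  have mem: "(a, \<chi> a) \<in> M" if "a \<in> carrier G" for a using tot[OF that] eq by blast
  have "\<chi> \<in> hom G D"
    unfolding hom_def using mem P(2) eq[OF P(4)] by auto
  then show ?thesis using that[of \<chi>] eq M(2) by blast
qed

end

lemma partial_hom_trivial:
  assumes "comm_group G" "comm_group D" shows "partial_hom G D {(\<one>\<^bsub>G\<^esub>, \<one>\<^bsub>D\<^esub>)}"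
proof -
  interpret G: comm_group G by fact
  interpret D: comm_group D by fact
  show ?thesis unfolding partial_hom_def by simp
qed

section \<open>The group of rationals modulo the integers\<close>

definition Q_add :: "rat monoid" where
  "Q_add = \<lparr>carrier = UNIV, monoid.mult = (+), one = 0\<rparr>"

lemma Q_add_simps [simp]:
  "carrier Q_add = UNIV" "x \<otimes>\<^bsub>Q_add\<^esub> y = x + y" "\<one>\<^bsub>Q_add\<^esub> = 0"
  by (simp_all add: Q_add_def)

lemma Q_add_comm_group: "comm_group Q_add"
  by (rule comm_groupI) (auto simp: algebra_simps intro: exI[of _ "- _"])

lemma Q_add_pow: "q [^]\<^bsub>Q_add\<^esub> (n :: nat) = of_nat n * q"
proof -
  interpret comm_group Q_add by (rule Q_add_comm_group)
  show ?thesis by (induction n) (auto simp: algebra_simps)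
qed

lemma Q_add_inv: "inv\<^bsub>Q_add\<^esub> q = - q"
proof -
  interpret comm_group Q_add by (rule Q_add_comm_group)
  show ?thesis by (rule inv_equality) auto
qed

lemma Ints_subgroup: "subgroup \<int> Q_add"
  by unfold_locales (auto simp: Q_add_inv m_inv_def[symmetric])

lemma QZ_eq: "QZ = Q_add Mod \<int>"
  by (simp add: QZ_def Q_add_def)

lemma QZ_comm_group: "comm_group QZ"
  unfolding QZ_eq by (rule comm_group.abelian_FactGroup[OF Q_add_comm_group Ints_subgroup])

definition QZ_class :: "rat \<Rightarrow> rat set" where
  "QZ_class q = \<int> #>\<^bsub>Q_add\<^esub> q"

lemma Ints_normal: "normal \<int> Q_add"
  using comm_group.subgroup_imp_normal[OF Q_add_comm_group Ints_subgroup] .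

lemma carrier_QZ: "carrier QZ = range QZ_class"
  unfolding QZ_eq carrier_FactGroup QZ_class_def by simp

lemma QZ_class_pow: "QZ_class q [^]\<^bsub>QZ\<^esub> (n :: nat) = QZ_class (of_nat n * q)"
  unfolding QZ_eq QZ_class_def using normal.FactGroup_pow[OF Ints_normal, of q n] by (simp add: Q_add_pow)

lemma QZ_class_eq_one: "QZ_class q = \<one>\<^bsub>QZ\<^esub> \<longleftrightarrow> q \<in> \<int>"
proof
  assume "QZ_class q = \<one>\<^bsub>QZ\<^esub>"
  then have "\<int> #>\<^bsub>Q_add\<^esub> q = \<int>" unfolding QZ_eq QZ_class_def by simp
  moreover have "q \<in> \<int> #>\<^bsub>Q_add\<^esub> q" unfolding r_coset_def by (auto intro: bexI[of _ 0])
  ultimately show "q \<in> \<int>" by simp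
next
  assume q: "q \<in> \<int>"
  have "\<int> #>\<^bsub>Q_add\<^esub> q = \<int>"
  proof (intro equalityI subsetI)
    fix x assume "x \<in> \<int> #>\<^bsub>Q_add\<^esub> q"
    then show "x \<in> \<int>" using q unfolding r_coset_def by auto
  next
    fix x :: rat assume "x \<in> \<int>"
    then have "x - q \<in> \<int>" using q by simp
    then show "x \<in> \<int> #>\<^bsub>Q_add\<^esub> q" unfolding r_coset_def by (auto intro: bexI[of _ "x - q"])
  qed
  then show "QZ_class q = \<one>\<^bsub>QZ\<^esub>" unfolding QZ_eq QZ_class_def by simp
qed

lemma QZ_divisible: "divisible QZ"
  unfolding divisible_def
proof (intro ballI allI impI)
  fix d and n :: nat assume "d \<in> carrier QZ" and n: "n > 0"
  then obtain q where q: "d = QZ_class q" unfolding carrier_QZ by blast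
  have "QZ_class (q / of_nat n) [^]\<^bsub>QZ\<^esub> n = d" using n q by (simp add: QZ_class_pow)
  then show "\<exists>e\<in>carrier QZ. e [^]\<^bsub>QZ\<^esub> n = d" using carrier_QZ by blast
qed

lemma countable_carrier_QZ: "countable (carrier QZ)"
  unfolding carrier_QZ by simp

text \<open>A nontrivial element generates a nontrivial cyclic group, which has a nontrivial character;
  this character extends.\<close>

theorem character_separates:
  assumes G: "comm_group G" and g: "g \<in> carrier G" "g \<noteq> \<one>\<^bsub>G\<^esub>"
  obtains \<chi> where "\<chi> \<in> hom G QZ" "\<chi> g \<noteq> \<one>\<^bsub>QZ\<^esub>"
proof -
  interpret comm_group_pair G QZ using G QZ_comm_group by (simp add: comm_group_pair_def)
  let ?\<Gamma> = "{(\<one>\<^bsub>G\<^esub>, \<one>\<^bsub>QZ\<^esub>)}"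
  have p: "partial_hom G QZ ?\<Gamma>" by (rule partial_hom_trivial[OF G QZ_comm_group])
  \<comment> \<open>\<open>m\<close> is the order of \<open>g\<close>, and \<open>0\<close> if \<open>g\<close> has infinite order\<close>
  define m where "m = G.ord g"
  have ord: "g [^]\<^bsub>G\<^esub> n = \<one>\<^bsub>G\<^esub> \<longleftrightarrow> int m dvd n" for n :: int
    unfolding m_def using G.int_pow_eq_id[OF g(1)] by blast
  have m1: "m \<noteq> 1" using ord[of 1] g by auto
  \<comment> \<open>a nonzero class modulo the integers which is killed by \<open>m\<close>\<close>
  define q :: rat where "q = (if m = 0 then 1 / 2 else 1 / of_nat m)"
  have q: "q \<notin> \<int>"
  proof
    assume "q \<in> \<int>"
    moreover have "0 < q \<and> q < 1" using m1 unfolding q_def by auto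
    ultimately show False by (auto elim!: Ints_cases)
  qed
  have c: "QZ_class q \<in> carrier QZ" using carrier_QZ by blast
  have val: "(QZ_class q) [^]\<^bsub>QZ\<^esub> n = e" if "(g [^]\<^bsub>G\<^esub> n, e) \<in> ?\<Gamma>" for n :: int and e
  proof -
    have e: "e = \<one>\<^bsub>QZ\<^esub>" and "int m dvd n" using that ord by auto
    then obtain k where k: "n = int m * k" by blast
    have "QZ_class q [^]\<^bsub>QZ\<^esub> m = \<one>\<^bsub>QZ\<^esub>"
      using QZ_class_eq_one[of "of_nat m * q"] by (simp add: QZ_class_pow q_def)
    then have "QZ_class q [^]\<^bsub>QZ\<^esub> (int m * k) = \<one>\<^bsub>QZ\<^esub>"
      using D.int_pow_pow[OF c, of "int m" k] int_pow_int[of QZ "QZ_class q" m] by simp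
    then show ?thesis using e k by simp
  qed
  obtain \<Gamma>' where 1: "partial_hom G QZ \<Gamma>'" "(g, QZ_class q) \<in> \<Gamma>'"
    by (rule partial_hom_extend[OF p g(1) c val])
  obtain \<chi> where \<chi>: "\<chi> \<in> hom G QZ" "\<And>a b. (a, b) \<in> \<Gamma>' \<Longrightarrow> \<chi> a = b"
    using hom_extends_partial_hom[OF 1(1) QZ_divisible] by blast
  have "\<chi> g \<noteq> \<one>\<^bsub>QZ\<^esub>" using \<chi>(2)[OF 1(2)] QZ_class_eq_one[of q] q by simp
  then show ?thesis by (rule that[OF \<chi>(1)])
qed

section \<open>Products and right adjoints\<close>

context small_compactly_generated
begin

lemma small_Hom: "X \<in> Obj C \<Longrightarrow> Y \<in> Obj C \<Longrightarrow> small U (Hom C X Y)"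
  using locally_small unfolding locally_small_def by blast

text \<open>The functor \<open>Y \<mapsto> \<Prod>\<^sub>i Hom(Y, A\<^sub>i)\<close> is representable.\<close>

lemma product_exists:
  fixes I :: "'i set"
  assumes I: "small U I" and A: "\<And>i. i \<in> I \<Longrightarrow> A i \<in> Obj C"
  obtains P \<pi> where "is_product C I A P \<pi>"
proof -
  interpret B: brown_functor U C "\<lambda>Y. \<Pi>\<^sub>E i\<in>I. Hom C Y (A i)" "\<lambda>f u. \<lambda>i\<in>I. u i \<cdot> f"
  proof
    fix f X Y u assume f: "f \<in> Hom C X Y" and u: "u \<in> (\<Pi>\<^sub>E i\<in>I. Hom C Y (A i))"
    show "(\<lambda>i\<in>I. u i \<cdot> f) \<in> (\<Pi>\<^sub>E i\<in>I. Hom C X (A i))" using u Cmp_Hom[OF f] by (auto simp: PiE_iff)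
  next
    fix X u assume X: "X \<in> Obj C" and u: "u \<in> (\<Pi>\<^sub>E i\<in>I. Hom C X (A i))"
    have "u i \<cdot> Ide C X = u i" if "i \<in> I" for i using u that Cmp_Ide by (auto simp: PiE_iff)
    then have "(\<lambda>i\<in>I. u i \<cdot> Ide C X) = restrict u I" by (intro restrict_ext) simp
    then show "(\<lambda>i\<in>I. u i \<cdot> Ide C X) = u" using u by (simp add: PiE_iff extensional_restrict)
  next
    fix f g X Y Z u assume f: "f \<in> Hom C X Y" and g: "g \<in> Hom C Y Z" and u: "u \<in> (\<Pi>\<^sub>E i\<in>I. Hom C Z (A i))"
    have "u i \<cdot> (g \<cdot> f) = (u i \<cdot> g) \<cdot> f" if "i \<in> I" for i using u that Cmp_assoc[OF f g] by (auto simp: PiE_iff)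
    then show "(\<lambda>i\<in>I. u i \<cdot> (g \<cdot> f)) = (\<lambda>i\<in>I. (\<lambda>i\<in>I. u i \<cdot> g) i \<cdot> f)" by (intro restrict_ext) simp
  next
    fix J :: "'u set" and B P \<iota> x
    assume P: "is_coproduct C J B P \<iota>" and x: "\<And>j. j \<in> J \<Longrightarrow> x j \<in> (\<Pi>\<^sub>E i\<in>I. Hom C (B j) (A i))"
    have "\<exists>h. h \<in> Hom C P (A i) \<and> (\<forall>j\<in>J. h \<cdot> \<iota> j = x j i)" if i: "i \<in> I" for i
    proof -
      have "x j i \<in> Hom C (B j) (A i)" if "j \<in> J" for j using x[OF that] i by (auto simp: PiE_iff)
      then show ?thesis using coproduct_ex[OF P A[OF i], of "\<lambda>j. x j i"] by metis
    qed
    then obtain h where h: "\<And>i. i \<in> I \<Longrightarrow> h i \<in> Hom C P (A i)" "\<And>i j. i \<in> I \<Longrightarrow> j \<in> J \<Longrightarrow> h i \<cdot> \<iota> j = x j i"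
      by metis
    show "\<exists>!u. u \<in> (\<Pi>\<^sub>E i\<in>I. Hom C P (A i)) \<and> (\<forall>j\<in>J. (\<lambda>i\<in>I. u i \<cdot> \<iota> j) = x j)"
    proof (rule ex1I[of _ "restrict h I"])
      have "(\<lambda>i\<in>I. restrict h I i \<cdot> \<iota> j) = x j" if j: "j \<in> J" for j
      proof -
        have "(\<lambda>i\<in>I. restrict h I i \<cdot> \<iota> j) = restrict (x j) I" using h(2) j by (intro restrict_ext) simp
        also have "\<dots> = x j" using x[OF j] by (simp add: PiE_iff extensional_restrict)
        finally show ?thesis .
      qed
      then show "restrict h I \<in> (\<Pi>\<^sub>E i\<in>I. Hom C P (A i)) \<and> (\<forall>j\<in>J. (\<lambda>i\<in>I. restrict h I i \<cdot> \<iota> j) = x j)"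
        using h(1) by simp
      fix u assume u: "u \<in> (\<Pi>\<^sub>E i\<in>I. Hom C P (A i)) \<and> (\<forall>j\<in>J. (\<lambda>i\<in>I. u i \<cdot> \<iota> j) = x j)"
      show "u = restrict h I"
      proof (rule PiE_ext[OF conjunct1[OF u], of "restrict h I"])
        show "restrict h I \<in> (\<Pi>\<^sub>E i\<in>I. Hom C P (A i))" using h(1) by simp
        fix i assume i: "i \<in> I"
        have "u i = h i"
        proof (rule coproduct_eqI[OF P])
          show "u i \<in> Hom C P (A i)" "h i \<in> Hom C P (A i)" using u h(1) i by (auto simp: PiE_iff)
          show "u i \<cdot> \<iota> j = h i \<cdot> \<iota> j" if j: "j \<in> J" for j
            using conjunct2[OF u, rule_format, OF j, THEN fun_cong, of i] i h(2)[OF i j] by simp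
        qed
        then show "u i = restrict h I i" using i by simp
      qed
    qed
  next
    fix f g X Y k h Z u
    assume f: "f \<in> Hom C X Y" and g: "g \<in> Hom C X Y" and t: "(Diff f g, k, h) \<in> Tri C" and k: "k \<in> Hom C Y Z"
      and u: "u \<in> (\<Pi>\<^sub>E i\<in>I. Hom C Y (A i))" and eq: "(\<lambda>i\<in>I. u i \<cdot> f) = (\<lambda>i\<in>I. u i \<cdot> g)"
    have "\<exists>w. w \<in> Hom C Z (A i) \<and> w \<cdot> k = u i" if i: "i \<in> I" for i
    proof -
      have ui: "u i \<in> Hom C Y (A i)" using u i by (auto simp: PiE_iff)
      have "u i \<cdot> f = u i \<cdot> g" using fun_cong[OF eq, of i] i by simp
      then have "u i \<cdot> Diff f g = ZeroM C X (A i)"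
        using Cmp_Diff[OF f g ui] Diff_self[OF Cmp_Hom[OF g ui]] by simp
      then show ?thesis using Tri_weak_cokernel[OF t Diff_Hom[OF f g] k ui] by metis
    qed
    then obtain w where w: "\<And>i. i \<in> I \<Longrightarrow> w i \<in> Hom C Z (A i)" "\<And>i. i \<in> I \<Longrightarrow> w i \<cdot> k = u i" by metis
    have "(\<lambda>i\<in>I. restrict w I i \<cdot> k) = restrict u I" using w(2) by (intro restrict_ext) simp
    also have "\<dots> = u" using u by (simp add: PiE_iff extensional_restrict)
    finally show "\<exists>v\<in>\<Pi>\<^sub>E i\<in>I. Hom C Z (A i). (\<lambda>i\<in>I. v i \<cdot> k) = u"
      using w(1) by (intro bexI[of _ "restrict w I"]) simp_all
  next
    fix c assume c: "compact_object U C c"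
    show "small U (\<Pi>\<^sub>E i\<in>I. Hom C c (A i))"
      by (rule small_PiE[OF universe I small_Hom[OF compact_Obj[OF c] A]])
  qed
  obtain P v where P: "P \<in> Obj C" and v: "v \<in> (\<Pi>\<^sub>E i\<in>I. Hom C P (A i))"
    and bij: "\<And>Y. Y \<in> Obj C \<Longrightarrow> bij_betw (\<lambda>f. \<lambda>i\<in>I. v i \<cdot> f) (Hom C Y P) (\<Pi>\<^sub>E i\<in>I. Hom C Y (A i))"
    using B.representable by blast
  have "is_product C I A P v"
    unfolding is_product_def
  proof (intro conjI ballI allI impI)
    show "v i \<in> Hom C P (A i)" if "i \<in> I" for i using v that by (auto simp: PiE_iff)
    fix Y f assume Y: "Y \<in> Obj C" and f: "\<forall>i\<in>I. f i \<in> Hom C Y (A i)"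
    have "restrict f I \<in> (\<lambda>f. \<lambda>i\<in>I. v i \<cdot> f) ` Hom C Y P"
      using f bij_betw_imp_surj_on[OF bij[OF Y]] by simp
    then obtain h where h: "h \<in> Hom C Y P" "restrict f I = (\<lambda>i\<in>I. v i \<cdot> h)" by (elim imageE) simp
    show "\<exists>!h. h \<in> Hom C Y P \<and> (\<forall>i\<in>I. v i \<cdot> h = f i)"
    proof (rule ex1I[of _ h])
      have "v i \<cdot> h = f i" if "i \<in> I" for i using fun_cong[OF h(2), of i] that by simp
      then show "h \<in> Hom C Y P \<and> (\<forall>i\<in>I. v i \<cdot> h = f i)" using h(1) by blast
      fix k assume k: "k \<in> Hom C Y P \<and> (\<forall>i\<in>I. v i \<cdot> k = f i)"
      have "(\<lambda>i\<in>I. v i \<cdot> k) = restrict f I" using k by (intro restrict_ext) simp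
      then show "k = h" using inj_onD[OF bij_betw_imp_inj_on[OF bij[OF Y]], of k h] h k by simp
    qed
  qed (rule P)
  then show ?thesis using that by blast
qed

end

text \<open>A right adjoint amounts to a choice, for each object \<open>A\<close> of the target, of a terminal morphism
  \<open>F G \<rightarrow> A\<close>.\<close>

definition cofree ::
  "('o, 'm, 'y) category_scheme \<Rightarrow> ('k, 'n, 'z) category_scheme \<Rightarrow> ('o \<Rightarrow> 'k) \<Rightarrow> ('m \<Rightarrow> 'n) \<Rightarrow>
   'k \<Rightarrow> 'o \<Rightarrow> 'n \<Rightarrow> bool" where
  "cofree C D FO FM A G \<epsilon> \<longleftrightarrow> G \<in> Obj C \<and> \<epsilon> \<in> Hom D (FO G) A \<and>
     (\<forall>B\<in>Obj C. bij_betw (\<lambda>u. \<epsilon> \<cdot>\<^bsub>D\<^esub> FM u) (Hom C B G) (Hom D (FO B) A))"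

context cat_functor
begin

lemma cofreeD:
  assumes "cofree C D FO FM A G \<epsilon>"
  shows "G \<in> Obj C" "\<epsilon> \<in> Hom D (FO G) A"
    "u \<in> Hom C B G \<Longrightarrow> u' \<in> Hom C B G \<Longrightarrow> \<epsilon> \<cdot>\<^bsub>D\<^esub> FM u = \<epsilon> \<cdot>\<^bsub>D\<^esub> FM u' \<Longrightarrow> u = u'"
  using assms C.Hom_Obj[of u B G] unfolding cofree_def bij_betw_def inj_on_def by blast+

lemma cofree_ex:
  assumes "cofree C D FO FM A G \<epsilon>" "B \<in> Obj C" "f \<in> Hom D (FO B) A"
  obtains u where "u \<in> Hom C B G" "\<epsilon> \<cdot>\<^bsub>D\<^esub> FM u = f"
proof -
  have bij: "bij_betw (\<lambda>u. \<epsilon> \<cdot>\<^bsub>D\<^esub> FM u) (Hom C B G) (Hom D (FO B) A)"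
    using assms(1,2) unfolding cofree_def by blast
  have "f \<in> (\<lambda>u. \<epsilon> \<cdot>\<^bsub>D\<^esub> FM u) ` Hom C B G" using assms(3) bij_betw_imp_surj_on[OF bij] by simp
  then show ?thesis using that by (elim imageE) simp
qed

lemma cofree_of_right_adjoint:
  assumes adj: "is_right_adjoint C D FO FM GO GM" and A: "A \<in> Obj D"
  obtains \<epsilon> where "cofree C D FO FM A (GO A) \<epsilon>"
proof -
  interpret G: cat_functor D C GO GM using adj unfolding is_right_adjoint_def by blast
  obtain \<phi> where \<phi>: "\<And>X A. X \<in> Obj C \<Longrightarrow> A \<in> Obj D \<Longrightarrow> bij_betw (\<phi> X A) (Hom D (FO X) A) (Hom C X (GO A))"
    and nat: "\<And>X X' A A' u v f. u \<in> Hom C X' X \<Longrightarrow> v \<in> Hom D A A' \<Longrightarrow> f \<in> Hom D (FO X) A \<Longrightarrow>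
             \<phi> X' A' (v \<cdot>\<^bsub>D\<^esub> f \<cdot>\<^bsub>D\<^esub> FM u) = GM v \<cdot>\<^bsub>C\<^esub> \<phi> X A f \<cdot>\<^bsub>C\<^esub> u"
    using adj unfolding is_right_adjoint_def by metis
  have GA: "GO A \<in> Obj C" using G.FO_Obj A .
  have "Ide C (GO A) \<in> \<phi> (GO A) A ` Hom D (FO (GO A)) A"
    using bij_betw_imp_surj_on[OF \<phi>[OF GA A]] C.Ide_Hom[OF GA] by simp
  then obtain \<epsilon> where \<epsilon>: "\<epsilon> \<in> Hom D (FO (GO A)) A" "\<phi> (GO A) A \<epsilon> = Ide C (GO A)" by (elim imageE) simp
  have inv: "\<phi> B A (\<epsilon> \<cdot>\<^bsub>D\<^esub> FM u) = u" if u: "u \<in> Hom C B (GO A)" for B u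
  proof -
    have eu: "\<epsilon> \<cdot>\<^bsub>D\<^esub> FM u \<in> Hom D (FO B) A" using D.Cmp_Hom[OF FM_Hom[OF u] \<epsilon>(1)] .
    have "\<phi> B A (Ide D A \<cdot>\<^bsub>D\<^esub> \<epsilon> \<cdot>\<^bsub>D\<^esub> FM u) = GM (Ide D A) \<cdot>\<^bsub>C\<^esub> \<phi> (GO A) A \<epsilon> \<cdot>\<^bsub>C\<^esub> u"
      by (rule nat[OF u D.Ide_Hom[OF A] \<epsilon>(1)])
    then show ?thesis using D.Ide_Cmp[OF eu] \<epsilon>(2) G.FM_Ide[OF A] C.Ide_Cmp[OF u] by simp
  qed
  have "cofree C D FO FM A (GO A) \<epsilon>"
    unfolding cofree_def
  proof (intro conjI ballI GA \<epsilon>(1))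
    fix B assume B: "B \<in> Obj C"
    show "bij_betw (\<lambda>u. \<epsilon> \<cdot>\<^bsub>D\<^esub> FM u) (Hom C B (GO A)) (Hom D (FO B) A)"
      unfolding bij_betw_def
    proof (intro conjI inj_onI equalityI subsetI)
      fix u u' assume "u \<in> Hom C B (GO A)" "u' \<in> Hom C B (GO A)" "\<epsilon> \<cdot>\<^bsub>D\<^esub> FM u = \<epsilon> \<cdot>\<^bsub>D\<^esub> FM u'"
      then show "u = u'" using inv by metis
    next
      fix f assume "f \<in> (\<lambda>u. \<epsilon> \<cdot>\<^bsub>D\<^esub> FM u) ` Hom C B (GO A)"
      then show "f \<in> Hom D (FO B) A" using D.Cmp_Hom[OF FM_Hom \<epsilon>(1)] by blast
    next
      fix f assume f: "f \<in> Hom D (FO B) A"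
      have u: "\<phi> B A f \<in> Hom C B (GO A)" using bij_betwE[OF \<phi>[OF B A]] f by blast
      have "\<epsilon> \<cdot>\<^bsub>D\<^esub> FM (\<phi> B A f) = f"
        using inj_onD[OF bij_betw_imp_inj_on[OF \<phi>[OF B A]] inv[OF u] D.Cmp_Hom[OF FM_Hom[OF u] \<epsilon>(1)] f] .
      then show "f \<in> (\<lambda>u. \<epsilon> \<cdot>\<^bsub>D\<^esub> FM u) ` Hom C B (GO A)" using u by (metis image_eqI)
    qed
  qed
  then show ?thesis using that by blast
qed

lemma right_adjoint_exists:
  assumes ex: "\<And>A. A \<in> Obj D \<Longrightarrow> \<exists>G \<epsilon>. cofree C D FO FM A G \<epsilon>"
  shows "\<exists>GO GM. is_right_adjoint C D FO FM GO GM"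
proof -
  obtain G e where cf: "\<And>A. A \<in> Obj D \<Longrightarrow> cofree C D FO FM A (G A) (e A)" using ex by metis
  note GO = cofreeD(1)[OF cf] and eH = cofreeD(2)[OF cf] and uniq = cofreeD(3)[OF cf]
  define L where "L X A f = inv_into (Hom C X (G A)) (\<lambda>u. e A \<cdot>\<^bsub>D\<^esub> FM u) f" for X A f
  have bij: "bij_betw (\<lambda>u. e A \<cdot>\<^bsub>D\<^esub> FM u) (Hom C X (G A)) (Hom D (FO X) A)" if "X \<in> Obj C" "A \<in> Obj D" for X A
    using cf[OF that(2)] that(1) unfolding cofree_def by blast
  have Lbij: "bij_betw (L X A) (Hom D (FO X) A) (Hom C X (G A))" if "X \<in> Obj C" "A \<in> Obj D" for X A
    using bij_betw_inv_into[OF bij[OF that]] unfolding L_def by simp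
  have LH: "L X A f \<in> Hom C X (G A)" if "X \<in> Obj C" "f \<in> Hom D (FO X) A" for X A f
    using bij_betwE[OF Lbij] that D.Hom_Obj by blast
  have Le: "e A \<cdot>\<^bsub>D\<^esub> FM (L X A f) = f" if "X \<in> Obj C" "f \<in> Hom D (FO X) A" for X A f
  proof -
    have "A \<in> Obj D" using that D.Hom_Obj by blast
    then have "f \<in> (\<lambda>u. e A \<cdot>\<^bsub>D\<^esub> FM u) ` Hom C X (G A)"
      using bij_betw_imp_surj_on[OF bij[OF that(1)]] that(2) by simp
    then show ?thesis unfolding L_def by (rule f_inv_into_f)
  qed
  have LI: "L X A f = u" if "u \<in> Hom C X (G A)" "e A \<cdot>\<^bsub>D\<^esub> FM u = f" "A \<in> Obj D" for X A f u
    using inv_into_f_f[OF bij_betw_imp_inj_on[OF bij[OF _ that(3), of X]] that(1)] that(2) C.Hom_Obj[OF that(1)] unfolding L_def by simp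
  define GM where "GM v = L (G (Src D v)) (Tgt D v) (v \<cdot>\<^bsub>D\<^esub> e (Src D v))" for v
  have GM: "GM v \<in> Hom C (G A) (G A') \<and> e A' \<cdot>\<^bsub>D\<^esub> FM (GM v) = v \<cdot>\<^bsub>D\<^esub> e A" if v: "v \<in> Hom D A A'" for v A A'
  proof -
    have O1: "A \<in> Obj D" "A' \<in> Obj D" "Src D v = A" "Tgt D v = A'" using D.Hom_Obj[OF v] v by (auto simp: Hom_def)
    have "v \<cdot>\<^bsub>D\<^esub> e A \<in> Hom D (FO (G A)) A'" using D.Cmp_Hom[OF eH[OF O1(1)] v] .
    then show ?thesis unfolding GM_def O1(3,4) using LH[OF GO[OF O1(1)]] Le[OF GO[OF O1(1)]] by simp
  qed
  have "cat_functor D C G GM"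
  proof
    show "G A \<in> Obj C" if "A \<in> Obj D" for A using GO[OF that] .
    show "GM v \<in> Hom C (G A) (G A')" if "v \<in> Hom D A A'" for v A A' using GM[OF that] by blast
    show "GM (Ide D A) = Ide C (G A)" if A: "A \<in> Obj D" for A
    proof (rule uniq[OF A])
      show "GM (Ide D A) \<in> Hom C (G A) (G A)" using GM[OF D.Ide_Hom[OF A]] by blast
      show "Ide C (G A) \<in> Hom C (G A) (G A)" using C.Ide_Hom GO[OF A] by blast
      show "e A \<cdot>\<^bsub>D\<^esub> FM (GM (Ide D A)) = e A \<cdot>\<^bsub>D\<^esub> FM (Ide C (G A))"
        using GM[OF D.Ide_Hom[OF A]] D.Ide_Cmp[OF eH[OF A]] FM_Ide[OF GO[OF A]] D.Cmp_Ide[OF eH[OF A]] by simp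
    qed
    fix v w A A' A'' assume v: "v \<in> Hom D A A'" and w: "w \<in> Hom D A' A''"
    have O1: "A \<in> Obj D" "A' \<in> Obj D" "A'' \<in> Obj D" using D.Hom_Obj[OF v] D.Hom_Obj[OF w] by auto
    note gv = GM[OF v, THEN conjunct1] and gw = GM[OF w, THEN conjunct1] and wv = D.Cmp_Hom[OF v w]
    show "GM (w \<cdot>\<^bsub>D\<^esub> v) = GM w \<cdot>\<^bsub>C\<^esub> GM v"
    proof (rule uniq[OF O1(3)])
      show "GM (w \<cdot>\<^bsub>D\<^esub> v) \<in> Hom C (G A) (G A'')" using GM[OF wv] by blast
      show "GM w \<cdot>\<^bsub>C\<^esub> GM v \<in> Hom C (G A) (G A'')" using C.Cmp_Hom[OF gv gw] .
      have "e A'' \<cdot>\<^bsub>D\<^esub> FM (GM w \<cdot>\<^bsub>C\<^esub> GM v) = (e A'' \<cdot>\<^bsub>D\<^esub> FM (GM w)) \<cdot>\<^bsub>D\<^esub> FM (GM v)"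
        using FM_Cmp[OF gv gw] D.Cmp_assoc[OF FM_Hom[OF gv] FM_Hom[OF gw] eH[OF O1(3)]] by simp
      also have "\<dots> = w \<cdot>\<^bsub>D\<^esub> e A' \<cdot>\<^bsub>D\<^esub> FM (GM v)"
        using GM[OF w] D.Cmp_assoc[OF FM_Hom[OF gv] eH[OF O1(2)] w] by simp
      also have "\<dots> = (w \<cdot>\<^bsub>D\<^esub> v) \<cdot>\<^bsub>D\<^esub> e A" using GM[OF v] D.Cmp_assoc[OF eH[OF O1(1)] v w] by simp
      finally show "e A'' \<cdot>\<^bsub>D\<^esub> FM (GM (w \<cdot>\<^bsub>D\<^esub> v)) = e A'' \<cdot>\<^bsub>D\<^esub> FM (GM w \<cdot>\<^bsub>C\<^esub> GM v)"
        using GM[OF wv] by simp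
    qed
  qed
  moreover have "L X' A' (v \<cdot>\<^bsub>D\<^esub> f \<cdot>\<^bsub>D\<^esub> FM u) = GM v \<cdot>\<^bsub>C\<^esub> L X A f \<cdot>\<^bsub>C\<^esub> u"
    if u: "u \<in> Hom C X' X" and v: "v \<in> Hom D A A'" and f: "f \<in> Hom D (FO X) A" for X X' A A' u v f
  proof (rule LI)
    have O1: "A \<in> Obj D" "A' \<in> Obj D" "X \<in> Obj C" using D.Hom_Obj[OF v] C.Hom_Obj[OF u] by auto
    then show "A' \<in> Obj D" by simp
    note gv = GM[OF v, THEN conjunct1] and lf = LH[OF O1(3) f]
    note lfu = C.Cmp_Hom[OF u lf]
    show "GM v \<cdot>\<^bsub>C\<^esub> L X A f \<cdot>\<^bsub>C\<^esub> u \<in> Hom C X' (G A')" using C.Cmp_Hom[OF lfu gv] .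
    have "e A' \<cdot>\<^bsub>D\<^esub> FM (GM v \<cdot>\<^bsub>C\<^esub> L X A f \<cdot>\<^bsub>C\<^esub> u) = (e A' \<cdot>\<^bsub>D\<^esub> FM (GM v)) \<cdot>\<^bsub>D\<^esub> FM (L X A f \<cdot>\<^bsub>C\<^esub> u)"
      using FM_Cmp[OF lfu gv] D.Cmp_assoc[OF FM_Hom[OF lfu] FM_Hom[OF gv] eH[OF O1(2)]] by simp
    also have "\<dots> = v \<cdot>\<^bsub>D\<^esub> e A \<cdot>\<^bsub>D\<^esub> FM (L X A f \<cdot>\<^bsub>C\<^esub> u)"
      using GM[OF v] D.Cmp_assoc[OF FM_Hom[OF lfu] eH[OF O1(1)] v] by simp
    also have "e A \<cdot>\<^bsub>D\<^esub> FM (L X A f \<cdot>\<^bsub>C\<^esub> u) = f \<cdot>\<^bsub>D\<^esub> FM u"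
      using FM_Cmp[OF u lf] D.Cmp_assoc[OF FM_Hom[OF u] FM_Hom[OF lf] eH[OF O1(1)]] Le[OF O1(3) f] by simp
    finally show "e A' \<cdot>\<^bsub>D\<^esub> FM (GM v \<cdot>\<^bsub>C\<^esub> L X A f \<cdot>\<^bsub>C\<^esub> u) = v \<cdot>\<^bsub>D\<^esub> f \<cdot>\<^bsub>D\<^esub> FM u" .
  qed
  ultimately have "is_right_adjoint C D FO FM G GM"
    unfolding is_right_adjoint_def using Lbij by blast
  then show ?thesis by blast
qed

end

lemma (in triangulated_functor) cofree_exists:
  assumes gen: "small_compactly_generated U C" and ls: "locally_small U D"
    and cop: "preserves_coproducts U C D FO FM" and A: "A \<in> Obj D"
  shows "\<exists>G \<epsilon>. cofree C D FO FM A G \<epsilon>"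
proof -
  interpret S: small_compactly_generated U C by (rule gen)
  interpret B: brown_functor U C "\<lambda>Y. Hom D (FO Y) A" "\<lambda>f u. u \<cdot>\<^bsub>D\<^esub> FM f"
  proof
    show "u \<cdot>\<^bsub>D\<^esub> FM f \<in> Hom D (FO X) A" if "f \<in> Hom C X Y" "u \<in> Hom D (FO Y) A" for f X Y u
      using D.Cmp_Hom FM_Hom that by blast
    show "u \<cdot>\<^bsub>D\<^esub> FM (Ide C X) = u" if "X \<in> Obj C" "u \<in> Hom D (FO X) A" for X u
      using FM_Ide that D.Cmp_Ide by simp
    show "u \<cdot>\<^bsub>D\<^esub> FM (g \<cdot>\<^bsub>C\<^esub> f) = (u \<cdot>\<^bsub>D\<^esub> FM g) \<cdot>\<^bsub>D\<^esub> FM f"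
      if "f \<in> Hom C X Y" "g \<in> Hom C Y Z" "u \<in> Hom D (FO Z) A" for f g X Y Z u
      using FM_Cmp[OF that(1,2)] D.Cmp_assoc[OF FM_Hom[OF that(1)] FM_Hom[OF that(2)] that(3)] by simp
  next
    fix I :: "'a set" and B P \<iota> x
    assume "I \<subseteq> U" "small U I" "is_coproduct C I B P \<iota>" and x: "\<And>i. i \<in> I \<Longrightarrow> x i \<in> Hom D (FO (B i)) A"
    then have "is_coproduct D I (\<lambda>i. FO (B i)) (FO P) (\<lambda>i. FM (\<iota> i))"
      using cop unfolding preserves_coproducts_def by blast
    then show "\<exists>!u. u \<in> Hom D (FO P) A \<and> (\<forall>i\<in>I. u \<cdot>\<^bsub>D\<^esub> FM (\<iota> i) = x i)"
      using A x unfolding is_coproduct_def by simp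
  next
    fix f g X Y k h Z u
    assume f: "f \<in> Hom C X Y" and g: "g \<in> Hom C X Y" and t: "(Add C f (Neg C g), k, h) \<in> Tri C" and k: "k \<in> Hom C Y Z"
      and u: "u \<in> Hom D (FO Y) A" and eq: "u \<cdot>\<^bsub>D\<^esub> FM f = u \<cdot>\<^bsub>D\<^esub> FM g"
    have "FM (Add C f (Neg C g)) = Add D (FM f) (Neg D (FM g))"
      using FM_Add[OF f C.Neg_Hom[OF g]] FM_Neg[OF g] by simp
    then have z: "u \<cdot>\<^bsub>D\<^esub> FM (Add C f (Neg C g)) = ZeroM D (FO X) A"
      using D.Cmp_Diff[OF FM_Hom[OF f] FM_Hom[OF g] u] eq D.Diff_self[OF D.Cmp_Hom[OF FM_Hom[OF g] u]] by simp
    obtain w where "w \<in> Hom D (FO Z) A" "w \<cdot>\<^bsub>D\<^esub> FM k = u"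
      using D.Tri_weak_cokernel[OF FM_Tri[OF t] FM_Hom[OF C.Diff_Hom[OF f g]] FM_Hom[OF k] u z] .
    then show "\<exists>v\<in>Hom D (FO Z) A. v \<cdot>\<^bsub>D\<^esub> FM k = u" by blast
  next
    fix c assume "compact_object U C c"
    then have "FO c \<in> Obj D" using S.compact_Obj FO_Obj by blast
    then show "small U (Hom D (FO c) A)" using ls A unfolding locally_small_def by blast
  qed
  show ?thesis
  proof (rule B.representable)
    fix G \<epsilon> assume "G \<in> Obj C" "\<epsilon> \<in> Hom D (FO G) A"
      "\<And>Y. Y \<in> Obj C \<Longrightarrow> bij_betw (\<lambda>f. \<epsilon> \<cdot>\<^bsub>D\<^esub> FM f) (Hom C Y G) (Hom D (FO Y) A)"
    then have "cofree C D FO FM A G \<epsilon>" unfolding cofree_def by blast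
    then show ?thesis by blast
  qed
qed

section \<open>Brown--Comenetz duality\<close>

context additive_category
begin

lemma Neg_eq_m_inv: "f \<in> Hom C X Y \<Longrightarrow> Neg C f = inv\<^bsub>Hom_group C X Y\<^esub> f"
  by (simp add: Neg_def Hom_def)

lemma character_Zero:
  assumes "\<chi> \<in> hom (Hom_group C X Y) QZ" "X \<in> Obj C" "Y \<in> Obj C"
  shows "\<chi> (ZeroM C X Y) = \<one>\<^bsub>QZ\<^esub>"
  using hom_one[OF assms(1) Hom_group_group[OF assms(2,3)] comm_group.axioms(2)[OF QZ_comm_group]] by simp

lemma character_Add:
  assumes "\<chi> \<in> hom (Hom_group C X Y) QZ" "f \<in> Hom C X Y" "g \<in> Hom C X Y"
  shows "\<chi> (Add C f g) = \<chi> f \<otimes>\<^bsub>QZ\<^esub> \<chi> g"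
  using hom_mult[OF assms(1), of f g] assms by simp

lemma character_closed:
  assumes "\<chi> \<in> hom (Hom_group C X Y) QZ" "f \<in> Hom C X Y" shows "\<chi> f \<in> carrier QZ"
  using hom_in_carrier[OF assms(1), of f] assms by simp

lemma character_Neg:
  assumes "\<chi> \<in> hom (Hom_group C X Y) QZ" "f \<in> Hom C X Y"
  shows "\<chi> (Neg C f) = inv\<^bsub>QZ\<^esub> \<chi> f"
proof -
  interpret group_hom "Hom_group C X Y" QZ \<chi>
    using assms(1) Hom_group_group Hom_Obj[OF assms(2)] comm_group.axioms(2)[OF QZ_comm_group]
    by (simp add: group_hom_def group_hom_axioms_def)
  show ?thesis using hom_inv[of f] assms(2) by (simp add: Neg_eq_m_inv)
qed

lemma characterI:
  assumes "\<And>f. f \<in> Hom C X Y \<Longrightarrow> \<chi> f \<in> carrier QZ"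
    "\<And>f g. f \<in> Hom C X Y \<Longrightarrow> g \<in> Hom C X Y \<Longrightarrow> \<chi> (Add C f g) = \<chi> f \<otimes>\<^bsub>QZ\<^esub> \<chi> g"
  shows "\<chi> \<in> hom (Hom_group C X Y) QZ"
  using assms by (auto simp: hom_def)

end

context small_compactly_generated
begin

abbreviation "chars c Y \<equiv> carrier (char_group (Hom_group C c Y))"

lemma chars_iff: "\<chi> \<in> chars c Y \<longleftrightarrow> \<chi> \<in> hom (Hom_group C c Y) QZ \<and> \<chi> \<in> extensional (Hom C c Y)"
  by (simp add: char_group_def)

lemma character_pullback:
  assumes "\<chi> \<in> hom (Hom_group C c Y) QZ" "f \<in> Hom C X Y"
  shows "(\<lambda>h. \<chi> (f \<cdot> h)) \<in> hom (Hom_group C c X) QZ"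
proof (rule characterI)
  fix h assume h: "h \<in> Hom C c X"
  show "\<chi> (f \<cdot> h) \<in> carrier QZ" by (rule character_closed[OF assms(1) Cmp_Hom[OF h assms(2)]])
  fix h' assume h': "h' \<in> Hom C c X"
  show "\<chi> (f \<cdot> Add C h h') = \<chi> (f \<cdot> h) \<otimes>\<^bsub>QZ\<^esub> \<chi> (f \<cdot> h')"
    unfolding Cmp_Add[OF h h' assms(2)]
    by (rule character_Add[OF assms(1) Cmp_Hom[OF h assms(2)] Cmp_Hom[OF h' assms(2)]])
qed

lemma restrict_character:
  assumes "\<chi> \<in> hom (Hom_group C c X) QZ" "c \<in> Obj C" "X \<in> Obj C"
  shows "restrict \<chi> (Hom C c X) \<in> chars c X"
  unfolding chars_iff
proof
  show "restrict \<chi> (Hom C c X) \<in> hom (Hom_group C c X) QZ"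
  proof (rule characterI)
    fix f assume f: "f \<in> Hom C c X"
    then show "restrict \<chi> (Hom C c X) f \<in> carrier QZ" using character_closed[OF assms(1)] by simp
    fix g assume g: "g \<in> Hom C c X"
    show "restrict \<chi> (Hom C c X) (Add C f g) = restrict \<chi> (Hom C c X) f \<otimes>\<^bsub>QZ\<^esub> restrict \<chi> (Hom C c X) g"
      using f g Add_Hom[OF f g] character_Add[OF assms(1) f g] by simp
  qed
qed simp

text \<open>The character is the product of the given ones over the components; this product is finite on
  every morphism.\<close>

lemma coproduct_of_characters:
  assumes c: "compact_object U C c" and I: "small U I" and P: "is_coproduct C I A P \<iota>"
    and x: "\<And>i. i \<in> I \<Longrightarrow> x i \<in> hom (Hom_group C c (A i)) QZ"
  obtains \<chi> where "\<chi> \<in> hom (Hom_group C c P) QZ" "\<And>i h. i \<in> I \<Longrightarrow> h \<in> Hom C c (A i) \<Longrightarrow> \<chi> (\<iota> i \<cdot> h) = x i h"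
proof -
  interpret Q: comm_group QZ by (rule QZ_comm_group)
  note PD = is_coproductD[OF P]
  have cO: "c \<in> Obj C" using compact_Obj c by blast
  obtain \<rho> where \<rho>: "\<And>i. i \<in> I \<Longrightarrow> \<rho> i \<in> Hom C P (A i)" "\<And>i. i \<in> I \<Longrightarrow> \<rho> i \<cdot> \<iota> i = Ide C (A i)"
    "\<And>i j. i \<in> I \<Longrightarrow> j \<in> I \<Longrightarrow> i \<noteq> j \<Longrightarrow> \<rho> i \<cdot> \<iota> j = ZeroM C (A j) (A i)"
    using coproduct_projections[OF P] by blast
  have \<rho>\<iota>: "\<rho> j \<cdot> \<iota> i \<cdot> g = (if j = i then g else ZeroM C c (A j))"
    if "i \<in> I" "j \<in> I" "g \<in> Hom C c (A i)" for i j g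
    using \<rho> that Cmp_assoc[OF that(3) PD(2)[OF that(1)] \<rho>(1)[OF that(2)]] Ide_Cmp[OF that(3)]
      Zero_Cmp[OF that(3) PD(3)[OF that(2)]] by auto
  \<comment> \<open>by compactness, only finitely many components of a morphism \<open>c \<rightarrow> P\<close> are nonzero\<close>
  have fin: "finite {i \<in> I. \<rho> i \<cdot> f \<noteq> ZeroM C c (A i)}" if f: "f \<in> Hom C c P" for f
  proof (rule compact_object_induct[where Q = "\<lambda>f. finite {i \<in> I. \<rho> i \<cdot> f \<noteq> ZeroM C c (A i)}", OF c P I f])
    have "{i \<in> I. \<rho> i \<cdot> ZeroM C c P \<noteq> ZeroM C c (A i)} = {}" using Cmp_Zero[OF \<rho>(1) cO] by blast
    then show "finite {i \<in> I. \<rho> i \<cdot> ZeroM C c P \<noteq> ZeroM C c (A i)}" by (simp only: finite.emptyI)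
    fix g h assume g: "g \<in> Hom C c P" and h: "h \<in> Hom C c P"
      and fin: "finite {i \<in> I. \<rho> i \<cdot> g \<noteq> ZeroM C c (A i)}" "finite {i \<in> I. \<rho> i \<cdot> h \<noteq> ZeroM C c (A i)}"
    have "{i \<in> I. \<rho> i \<cdot> Add C g h \<noteq> ZeroM C c (A i)} \<subseteq>
        {i \<in> I. \<rho> i \<cdot> g \<noteq> ZeroM C c (A i)} \<union> {i \<in> I. \<rho> i \<cdot> h \<noteq> ZeroM C c (A i)}"
    proof (intro subsetI, rule ccontr)
      fix i assume i: "i \<in> {i \<in> I. \<rho> i \<cdot> Add C g h \<noteq> ZeroM C c (A i)}"
        and n: "i \<notin> {i \<in> I. \<rho> i \<cdot> g \<noteq> ZeroM C c (A i)} \<union> {i \<in> I. \<rho> i \<cdot> h \<noteq> ZeroM C c (A i)}"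
      have "i \<in> I" "\<rho> i \<cdot> g = ZeroM C c (A i)" "\<rho> i \<cdot> h = ZeroM C c (A i)" using i n by auto
      then have "\<rho> i \<cdot> Add C g h = ZeroM C c (A i)"
        using Cmp_Add[OF g h \<rho>(1)] Zero_Add[OF ZeroM_Hom[OF cO PD(3)]] by simp
      then show False using i by simp
    qed
    then show "finite {i \<in> I. \<rho> i \<cdot> Add C g h \<noteq> ZeroM C c (A i)}" using fin finite_subset by blast
  next
    fix i g assume "i \<in> I" "g \<in> Hom C c (A i)"
    then have "{j \<in> I. \<rho> j \<cdot> \<iota> i \<cdot> g \<noteq> ZeroM C c (A j)} \<subseteq> {i}" using \<rho>\<iota> by (auto split: if_splits)
    then show "finite {j \<in> I. \<rho> j \<cdot> \<iota> i \<cdot> g \<noteq> ZeroM C c (A j)}" using finite_subset by blast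
  qed
  have xz: "x i (ZeroM C c (A i)) = \<one>\<^bsub>QZ\<^esub>" if "i \<in> I" for i using character_Zero[OF x] that cO PD(3) by blast
  have xin: "x i (\<rho> i \<cdot> f) \<in> carrier QZ" if "i \<in> I" "f \<in> Hom C c P" for i f
    using character_closed[OF x[OF that(1)] Cmp_Hom[OF that(2) \<rho>(1)[OF that(1)]]] .
  have finx: "finite {i \<in> I. x i (\<rho> i \<cdot> f) \<noteq> \<one>\<^bsub>QZ\<^esub>}" if "f \<in> Hom C c P" for f
    by (rule finite_subset[OF _ fin[OF that]]) (use xz in auto)
  define \<chi> where "\<chi> f = gfinprod QZ (\<lambda>i. x i (\<rho> i \<cdot> f)) I" for f
  have "\<chi> \<in> hom (Hom_group C c P) QZ"
  proof (rule characterI)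
    show "\<chi> f \<in> carrier QZ" if "f \<in> Hom C c P" for f
      unfolding \<chi>_def by (rule Q.gfinprod_closed) (use xin that in auto)
    fix f g assume f: "f \<in> Hom C c P" and g: "g \<in> Hom C c P"
    have "\<chi> (Add C f g) = gfinprod QZ (\<lambda>i. x i (\<rho> i \<cdot> f) \<otimes>\<^bsub>QZ\<^esub> x i (\<rho> i \<cdot> g)) I"
      unfolding \<chi>_def
    proof (rule Q.gfinprod_cong[OF refl])
      show "(\<lambda>i. x i (\<rho> i \<cdot> Add C f g)) \<in> I \<rightarrow> carrier QZ" using xin[OF _ Add_Hom[OF f g]] by auto
      have "x i (\<rho> i \<cdot> Add C f g) = x i (\<rho> i \<cdot> f) \<otimes>\<^bsub>QZ\<^esub> x i (\<rho> i \<cdot> g)" if i: "i \<in> I" for i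
        using Cmp_Add[OF f g \<rho>(1)[OF i]] character_Add[OF x[OF i] Cmp_Hom[OF f \<rho>(1)[OF i]] Cmp_Hom[OF g \<rho>(1)[OF i]]] by simp
      then show "i \<in> I =simp=> x i (\<rho> i \<cdot> Add C f g) = x i (\<rho> i \<cdot> f) \<otimes>\<^bsub>QZ\<^esub> x i (\<rho> i \<cdot> g)" for i
        by (simp add: simp_implies_def)
    qed
    also have "\<dots> = \<chi> f \<otimes>\<^bsub>QZ\<^esub> \<chi> g" unfolding \<chi>_def
      by (rule Q.gfinprod_distrib) (use finx xin f g in auto)
    finally show "\<chi> (Add C f g) = \<chi> f \<otimes>\<^bsub>QZ\<^esub> \<chi> g" .
  qed
  moreover have "\<chi> (\<iota> i \<cdot> h) = x i h" if i: "i \<in> I" and h: "h \<in> Hom C c (A i)" for i h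
  proof -
    have one: "x j (\<rho> j \<cdot> \<iota> i \<cdot> h) = \<one>\<^bsub>QZ\<^esub>" if "j \<in> I" "j \<noteq> i" for j using \<rho>\<iota>[OF i that(1) h] that xz by simp
    have xi: "x i (\<rho> i \<cdot> \<iota> i \<cdot> h) = x i h" using \<rho>\<iota>[OF i i h] by simp
    have xc: "x i h \<in> carrier QZ" using character_closed[OF x[OF i] h] .
    have "\<chi> (\<iota> i \<cdot> h) = gfinprod QZ (\<lambda>j. x j (\<rho> j \<cdot> \<iota> i \<cdot> h)) {i}"
      unfolding \<chi>_def by (rule Q.gfinprod_mono_neutral_cong_right) (use i one xi xc xin[OF _ Cmp_Hom[OF h PD(2)[OF i]]] in auto)
    also have "\<dots> = x i h" using xi xc by (subst Q.gfinprod_eq_finprod) auto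
    finally show ?thesis .
  qed
  ultimately show ?thesis using that by blast
qed

text \<open>The functor \<open>Y \<mapsto> Hom(Hom(c, Y), Q/Z)\<close> is representable: by compactness of \<open>c\<close> it sends coproducts to
  products, and the weak equalizer condition follows from the injectivity of the character group.\<close>

lemma Brown_Comenetz_dual_exists:
  assumes c: "compact_object U C c"
  shows "\<exists>D. is_Brown_Comenetz_dual C c D"
proof -
  have cO: "c \<in> Obj C" using compact_Obj c by blast
  interpret Q: comm_group QZ by (rule QZ_comm_group)
  let ?HM = "\<lambda>f \<chi>. \<lambda>h\<in>Hom C c (Src C f). \<chi> (f \<cdot> h)"
  have HM: "?HM f \<chi> = (\<lambda>h\<in>Hom C c X. \<chi> (f \<cdot> h))" if "f \<in> Hom C X Y" for f X Y \<chi>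
    using that by (simp add: Hom_def)
  interpret B: brown_functor U C "\<lambda>Y. chars c Y" ?HM
  proof
    fix f X Y \<chi> assume f: "f \<in> Hom C X Y" and \<chi>: "\<chi> \<in> chars c Y"
    show "?HM f \<chi> \<in> chars c X"
      unfolding HM[OF f]
      by (rule restrict_character[OF character_pullback[OF _ f] cO]) (use \<chi> chars_iff f Hom_Obj in blast)+
  next
    fix X \<chi> assume X: "X \<in> Obj C" and \<chi>: "\<chi> \<in> chars c X"
    have "?HM (Ide C X) \<chi> = restrict \<chi> (Hom C c X)"
      unfolding HM[OF Ide_Hom[OF X]] by (rule restrict_ext) (simp add: Ide_Cmp)
    then show "?HM (Ide C X) \<chi> = \<chi>" using \<chi> by (simp add: chars_iff extensional_restrict)
  next
    fix f g X Y Z \<chi> assume f: "f \<in> Hom C X Y" and g: "g \<in> Hom C Y Z" and \<chi>: "\<chi> \<in> chars c Z"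
    show "?HM (g \<cdot> f) \<chi> = ?HM f (?HM g \<chi>)"
      unfolding HM[OF f] HM[OF g] HM[OF Cmp_Hom[OF f g]]
      by (rule restrict_ext) (use Cmp_Hom[OF _ f] Cmp_assoc[OF _ f g] in simp)
  next
    fix I :: "'u set" and A P \<iota> x
    assume I: "small U I" and P: "is_coproduct C I A P \<iota>" and x: "\<And>i. i \<in> I \<Longrightarrow> x i \<in> chars c (A i)"
    note PD = is_coproductD[OF P]
    have xh: "x i \<in> hom (Hom_group C c (A i)) QZ" "x i \<in> extensional (Hom C c (A i))" if "i \<in> I" for i
      using x[OF that] unfolding chars_iff by blast+
    obtain \<chi> where \<chi>: "\<chi> \<in> hom (Hom_group C c P) QZ" "\<And>i h. i \<in> I \<Longrightarrow> h \<in> Hom C c (A i) \<Longrightarrow> \<chi> (\<iota> i \<cdot> h) = x i h"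
      using coproduct_of_characters[OF c I P, of x] xh(1) by blast
    let ?u = "restrict \<chi> (Hom C c P)"
    have u: "?u \<in> chars c P" by (rule restrict_character[OF \<chi>(1) cO PD(1)])
    show "\<exists>!u. u \<in> chars c P \<and> (\<forall>i\<in>I. ?HM (\<iota> i) u = x i)"
    proof (rule ex1I[of _ ?u])
      have "?HM (\<iota> i) ?u = x i" if i: "i \<in> I" for i
      proof -
        have "?HM (\<iota> i) ?u = restrict (x i) (Hom C c (A i))"
          unfolding HM[OF PD(2)[OF i]]
          by (rule restrict_ext) (use \<chi>(2)[OF i] Cmp_Hom[OF _ PD(2)[OF i]] in simp)
        then show ?thesis using xh(2)[OF i] by (simp add: extensional_restrict)
      qed
      then show "?u \<in> chars c P \<and> (\<forall>i\<in>I. ?HM (\<iota> i) ?u = x i)" using u by blast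
      fix v assume v: "v \<in> chars c P \<and> (\<forall>i\<in>I. ?HM (\<iota> i) v = x i)"
      then have vh: "v \<in> hom (Hom_group C c P) QZ" "v \<in> extensional (Hom C c P)" unfolding chars_iff by blast+
      have vi: "v (\<iota> i \<cdot> h) = x i h" if i: "i \<in> I" and h: "h \<in> Hom C c (A i)" for i h
      proof -
        have "?HM (\<iota> i) v = x i" using v i by blast
        from fun_cong[OF this, of h] show ?thesis unfolding HM[OF PD(2)[OF i]] using h by simp
      qed
      have "v f = \<chi> f" if f: "f \<in> Hom C c P" for f
      proof (rule compact_object_induct[where Q = "\<lambda>f. v f = \<chi> f", OF c P I f])
        show "v (ZeroM C c P) = \<chi> (ZeroM C c P)" using character_Zero[OF vh(1) cO PD(1)] character_Zero[OF \<chi>(1) cO PD(1)] by simp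
        show "v (Add C g h) = \<chi> (Add C g h)" if "g \<in> Hom C c P" "h \<in> Hom C c P" "v g = \<chi> g" "v h = \<chi> h" for g h
          using character_Add[OF vh(1) that(1,2)] character_Add[OF \<chi>(1) that(1,2)] that(3,4) by simp
        show "v (\<iota> i \<cdot> g) = \<chi> (\<iota> i \<cdot> g)" if "i \<in> I" "g \<in> Hom C c (A i)" for i g
          using vi[OF that] \<chi>(2)[OF that] by simp
      qed
      then have "restrict v (Hom C c P) = ?u" by (intro restrict_ext) simp
      then show "v = ?u" using vh(2) by (simp add: extensional_restrict)
    qed
  next
    fix f g X Y k h Z u
    assume f: "f \<in> Hom C X Y" and g: "g \<in> Hom C X Y" and t: "(Diff f g, k, h) \<in> Tri C" and k: "k \<in> Hom C Y Z"
      and u: "u \<in> chars c Y" and eq: "?HM f u = ?HM g u"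
    have XYZ: "X \<in> Obj C" "Y \<in> Obj C" "Z \<in> Obj C" using Hom_Obj[OF f] Hom_Obj[OF k] by auto
    have uh: "u \<in> hom (Hom_group C c Y) QZ" "u \<in> extensional (Hom C c Y)" using u unfolding chars_iff by blast+
    have ueq: "u (f \<cdot> w) = u (g \<cdot> w)" if "w \<in> Hom C c X" for w
      using fun_cong[OF eq, of w] that unfolding HM[OF f] HM[OF g] by simp
    let ?G = "Hom_group C c Z"
    interpret P: comm_group_pair ?G QZ
      using Hom_comm_group[OF cO XYZ(3)] QZ_comm_group by (simp add: comm_group_pair_def)
    \<comment> \<open>\<open>u\<close> descends to the image of \<open>Hom(c, Y)\<close> in \<open>Hom(c, Z)\<close>, since it kills the image of \<open>f - g\<close>\<close>
    let ?\<Gamma> = "(\<lambda>y. (k \<cdot> y, u y)) ` Hom C c Y"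
    have ph: "partial_hom ?G QZ ?\<Gamma>"
      unfolding partial_hom_def
    proof (intro conjI allI impI)
      show "?\<Gamma> \<subseteq> carrier ?G \<times> carrier QZ" using Cmp_Hom[OF _ k] character_closed[OF uh(1)] by auto
      have "(k \<cdot> ZeroM C c Y, u (ZeroM C c Y)) \<in> ?\<Gamma>" using ZeroM_Hom[OF cO XYZ(2)] by (rule imageI)
      then show "(\<one>\<^bsub>?G\<^esub>, \<one>\<^bsub>QZ\<^esub>) \<in> ?\<Gamma>" using Cmp_Zero[OF k cO] character_Zero[OF uh(1) cO XYZ(2)] by simp
      fix a b assume "(a, b) \<in> ?\<Gamma>"
      then obtain y where y: "y \<in> Hom C c Y" "a = k \<cdot> y" "b = u y" by auto
      have "(k \<cdot> Neg C y, u (Neg C y)) \<in> ?\<Gamma>" using Neg_Hom[OF y(1)] by (rule imageI)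
      then show "(inv\<^bsub>?G\<^esub> a, inv\<^bsub>QZ\<^esub> b) \<in> ?\<Gamma>"
        using Cmp_Neg[OF y(1) k] character_Neg[OF uh(1) y(1)] Neg_eq_m_inv[OF Cmp_Hom[OF y(1) k]] y by simp
      fix a' b' assume "(a', b') \<in> ?\<Gamma>"
      then obtain y' where y': "y' \<in> Hom C c Y" "a' = k \<cdot> y'" "b' = u y'" by auto
      have "(k \<cdot> Add C y y', u (Add C y y')) \<in> ?\<Gamma>" using Add_Hom[OF y(1) y'(1)] by (rule imageI)
      then show "(a \<otimes>\<^bsub>?G\<^esub> a', b \<otimes>\<^bsub>QZ\<^esub> b') \<in> ?\<Gamma>"
        using Cmp_Add[OF y(1) y'(1) k] character_Add[OF uh(1) y(1) y'(1)] y y' by simp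
    next
      fix d assume "(\<one>\<^bsub>?G\<^esub>, d) \<in> ?\<Gamma>"
      then obtain y where y: "y \<in> Hom C c Y" "k \<cdot> y = ZeroM C c Z" "d = u y" by auto
      obtain w where w: "w \<in> Hom C c X" "Diff f g \<cdot> w = y"
        using Tri_weak_kernel[OF t Diff_Hom[OF f g] k y(1,2)] .
      note fw = Cmp_Hom[OF w(1) f] and gw = Cmp_Hom[OF w(1) g]
      have "u y = u (Diff (f \<cdot> w) (g \<cdot> w))" using Diff_Cmp[OF w(1) f g] w(2) by simp
      also have "\<dots> = u (f \<cdot> w) \<otimes>\<^bsub>QZ\<^esub> inv\<^bsub>QZ\<^esub> u (g \<cdot> w)"
        using character_Add[OF uh(1) fw Neg_Hom[OF gw]] character_Neg[OF uh(1) gw] by simp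
      also have "\<dots> = \<one>\<^bsub>QZ\<^esub>" using ueq[OF w(1)] character_closed[OF uh(1) gw] by simp
      finally show "d = \<one>\<^bsub>QZ\<^esub>" using y(3) by simp
    qed
    obtain v where v: "v \<in> hom ?G QZ" "\<And>a b. (a, b) \<in> ?\<Gamma> \<Longrightarrow> v a = b"
      using P.hom_extends_partial_hom[OF ph QZ_divisible] by blast
    let ?v = "restrict v (Hom C c Z)"
    have "?HM k ?v = restrict u (Hom C c Y)"
      unfolding HM[OF k]
    proof (rule restrict_ext)
      fix y assume y: "y \<in> Hom C c Y"
      then have "(k \<cdot> y, u y) \<in> ?\<Gamma>" by (rule imageI)
      then show "?v (k \<cdot> y) = u y" using v(2) Cmp_Hom[OF y k] by simp
    qed
    then have "?HM k ?v = u" using uh(2) by (simp add: extensional_restrict)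
    moreover have "?v \<in> chars c Z" by (rule restrict_character[OF v(1) cO XYZ(3)])
    ultimately show "\<exists>v\<in>chars c Z. ?HM k v = u" by (rule bexI)
  next
    fix d assume "compact_object U C d"
    then have dO: "d \<in> Obj C" using compact_Obj by blast
    have sm: "small U (Hom C c d \<rightarrow>\<^sub>E carrier QZ)"
      by (rule small_PiE[OF universe small_Hom[OF cO dO] small_countable[OF universe countable_carrier_QZ]])
    have sub: "\<chi> \<in> (Hom C c d \<rightarrow>\<^sub>E carrier QZ)" if "\<chi> \<in> chars c d" for \<chi>
      using that character_closed[of \<chi> c d] unfolding chars_iff PiE_def Pi_def by blast
    show "small U (chars c d)" by (rule small_subset[OF sm subsetI[OF sub]])
  qed
  obtain D v where D: "D \<in> Obj C" and v: "v \<in> chars c D"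
    and bij: "\<And>Y. Y \<in> Obj C \<Longrightarrow> bij_betw (\<lambda>f. ?HM f v) (Hom C Y D) (chars c Y)"
    using B.representable by blast
  have vh: "v \<in> hom (Hom_group C c D) QZ" using v unfolding chars_iff by blast
  have "is_Brown_Comenetz_dual C c D"
    unfolding is_Brown_Comenetz_dual_def
  proof (intro conjI exI[of _ "\<lambda>y f. ?HM f v"] ballI allI impI)
    fix y assume y: "y \<in> Obj C"
    have "(\<lambda>f. ?HM f v) \<in> hom (Hom_group C y D) (char_group (Hom_group C c y))"
    proof (rule homI)
      fix f assume "f \<in> carrier (Hom_group C y D)"
      then show "?HM f v \<in> chars c y" using B.HM_in v by simp
    next
      fix f g assume "f \<in> carrier (Hom_group C y D)" "g \<in> carrier (Hom_group C y D)"
      then have f: "f \<in> Hom C y D" and g: "g \<in> Hom C y D" by simp_all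
      have "(\<lambda>h\<in>Hom C c y. v (Add C f g \<cdot> h)) =
          (\<lambda>h\<in>Hom C c y. (\<lambda>h\<in>Hom C c y. v (f \<cdot> h)) h \<otimes>\<^bsub>QZ\<^esub> (\<lambda>h\<in>Hom C c y. v (g \<cdot> h)) h)"
      proof (rule restrict_ext)
        fix h assume h: "h \<in> Hom C c y"
        show "v (Add C f g \<cdot> h) = (\<lambda>h\<in>Hom C c y. v (f \<cdot> h)) h \<otimes>\<^bsub>QZ\<^esub> (\<lambda>h\<in>Hom C c y. v (g \<cdot> h)) h"
          using h Add_Cmp[OF h f g] character_Add[OF vh Cmp_Hom[OF h f] Cmp_Hom[OF h g]] by simp
      qed
      then show "?HM (f \<otimes>\<^bsub>Hom_group C y D\<^esub> g) v = ?HM f v \<otimes>\<^bsub>char_group (Hom_group C c y)\<^esub> ?HM g v"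
        unfolding Hom_group_simps HM[OF Add_Hom[OF f g]] HM[OF f] HM[OF g] by (simp add: char_group_def)
    qed
    then show "(\<lambda>f. ?HM f v) \<in> iso (Hom_group C y D) (char_group (Hom_group C c y))"
      using bij[OF y] by (simp add: iso_def)
  next
    fix y y' f g h assume "g \<in> Hom C y' y \<and> f \<in> Hom C y D \<and> h \<in> Hom C c y'"
    then have g: "g \<in> Hom C y' y" and f: "f \<in> Hom C y D" and h: "h \<in> Hom C c y'" by auto
    show "?HM (f \<cdot> g) v h = ?HM f v (g \<cdot> h)"
      unfolding HM[OF f] HM[OF Cmp_Hom[OF g f]] using h Cmp_Hom[OF h g] Cmp_assoc[OF h g f] by simp
  qed (rule D)
  then show ?thesis by blast
qed

lemma BC_cogenerator: "is_Brown_Comenetz_cogenerator U C (BC_cogenerator U C)"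
proof -
  obtain R where R: "is_skeleton C {c. compact_object U C c} R" "small U R" using small_skeleton_of_compacts .
  have Rc: "compact_object U C c" if "c \<in> R" for c using R(1) that unfolding is_skeleton_def by blast
  then obtain D where D: "\<And>c. c \<in> R \<Longrightarrow> is_Brown_Comenetz_dual C c (D c)"
    using Brown_Comenetz_dual_exists by metis
  then have "D c \<in> Obj C" if "c \<in> R" for c using that unfolding is_Brown_Comenetz_dual_def by blast
  then obtain I \<pi> where "is_product C R D I \<pi>" using product_exists[OF R(2), of D] by blast
  then have "is_Brown_Comenetz_cogenerator U C I"
    unfolding is_Brown_Comenetz_cogenerator_def using R(1) D by blast
  then show ?thesis unfolding BC_cogenerator_def by (rule someI)
qed

lemma BC_cogenerator_Obj: "BC_cogenerator U C \<in> Obj C"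
  using BC_cogenerator is_productD(1) unfolding is_Brown_Comenetz_cogenerator_def by blast

text \<open>A character of \<open>Hom(c, W)\<close> which does not kill \<open>g\<close> corresponds to a morphism from \<open>W\<close> to the dual of
  \<open>c\<close>, a factor of the cogenerator; the other components are taken to be zero.\<close>

lemma BC_cogenerator_detects:
  assumes c: "compact_object U C c" and g: "g \<in> Hom C c W" "g \<noteq> ZeroM C c W"
  obtains \<phi> where "\<phi> \<in> Hom C W (BC_cogenerator U C)" "\<phi> \<cdot> g \<noteq> ZeroM C c (BC_cogenerator U C)"
proof -
  let ?I = "BC_cogenerator U C"
  obtain R D \<pi> where R: "is_skeleton C {c. compact_object U C c} R"
    and D: "\<And>c. c \<in> R \<Longrightarrow> is_Brown_Comenetz_dual C c (D c)" and P: "is_product C R D ?I \<pi>"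
    using BC_cogenerator unfolding is_Brown_Comenetz_cogenerator_def by blast
  have W: "W \<in> Obj C" and cO: "c \<in> Obj C" using Hom_Obj[OF g(1)] by auto
  obtain d a b where d: "d \<in> R"
    and b: "b \<in> Hom C c d" "b \<cdot> a = Ide C d" "a \<cdot> b = Ide C c" "a \<in> Hom C d c"
    using skeletonE[OF R, of c] c by blast
  have dO: "d \<in> Obj C" using Hom_Obj[OF b(1)] by simp
  have ga: "g \<cdot> a \<in> Hom C d W" using Cmp_Hom[OF b(4) g(1)] .
  have ga0: "g \<cdot> a \<noteq> ZeroM C d W"
  proof
    assume "g \<cdot> a = ZeroM C d W"
    then have "(g \<cdot> a) \<cdot> b = ZeroM C c W" using Zero_Cmp[OF b(1) W] by simp
    then show False using g b(3) Cmp_assoc[OF b(1,4) g(1)] Cmp_Ide[OF g(1)] by simp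
  qed
  obtain \<chi> where \<chi>: "\<chi> \<in> hom (Hom_group C d W) QZ" "\<chi> (g \<cdot> a) \<noteq> \<one>\<^bsub>QZ\<^esub>"
    using character_separates[OF Hom_comm_group[OF dO W], of "g \<cdot> a"] ga ga0 by auto
  obtain \<Phi> where \<Phi>: "\<And>y. y \<in> Obj C \<Longrightarrow> \<Phi> y \<in> iso (Hom_group C y (D d)) (char_group (Hom_group C d y))"
    and nat: "\<And>y y' f g h. g \<in> Hom C y' y \<Longrightarrow> f \<in> Hom C y (D d) \<Longrightarrow> h \<in> Hom C d y' \<Longrightarrow>
             \<Phi> y' (f \<cdot> g) h = \<Phi> y f (g \<cdot> h)"
    and DO: "D d \<in> Obj C"
    using D[OF d] unfolding is_Brown_Comenetz_dual_def by metis
  have bij: "bij_betw (\<Phi> W) (Hom C W (D d)) (chars d W)" using \<Phi>[OF W] by (simp add: iso_def)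
  have "restrict \<chi> (Hom C d W) \<in> \<Phi> W ` Hom C W (D d)"
    using bij_betw_imp_surj_on[OF bij] restrict_character[OF \<chi>(1) dO W] by simp
  then obtain \<psi> where \<psi>: "\<psi> \<in> Hom C W (D d)" "restrict \<chi> (Hom C d W) = \<Phi> W \<psi>" by (elim imageE) simp
  have DR: "D e \<in> Obj C" if "e \<in> R" for e using is_productD(3)[OF P that] .
  have "(if e = d then \<psi> else ZeroM C W (D e)) \<in> Hom C W (D e)" if "e \<in> R" for e
    using \<psi>(1) ZeroM_Hom[OF W DR[OF that]] by simp
  then obtain \<phi> where \<phi>: "\<phi> \<in> Hom C W ?I" "\<And>e. e \<in> R \<Longrightarrow> \<pi> e \<cdot> \<phi> = (if e = d then \<psi> else ZeroM C W (D e))"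
    using product_ex[OF P W, of "\<lambda>e. if e = d then \<psi> else ZeroM C W (D e)"] by blast
  have "\<phi> \<cdot> g \<noteq> ZeroM C c ?I"
  proof
    assume z: "\<phi> \<cdot> g = ZeroM C c ?I"
    note \<pi>d = is_productD(2)[OF P d]
    have "\<psi> \<cdot> (g \<cdot> a) = ((\<pi> d \<cdot> \<phi>) \<cdot> g) \<cdot> a" using \<phi>(2)[OF d] Cmp_assoc[OF b(4) g(1) \<psi>(1)] by simp
    also have "(\<pi> d \<cdot> \<phi>) \<cdot> g = ZeroM C c (D d)" using Cmp_assoc[OF g(1) \<phi>(1) \<pi>d] z Cmp_Zero[OF \<pi>d cO] by simp
    also have "ZeroM C c (D d) \<cdot> a = ZeroM C d (D d)" using Zero_Cmp[OF b(4) DO] .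
    finally have 0: "\<psi> \<cdot> (g \<cdot> a) = ZeroM C d (D d)" .
    have "\<Phi> d (\<psi> \<cdot> (g \<cdot> a)) (Ide C d) = \<Phi> W \<psi> ((g \<cdot> a) \<cdot> Ide C d)"
      using nat[OF ga \<psi>(1) Ide_Hom[OF dO]] .
    also have "\<dots> = \<chi> (g \<cdot> a)" using \<psi>(2)[symmetric] ga Cmp_Ide[OF ga] by simp
    finally have "\<Phi> d (ZeroM C d (D d)) (Ide C d) \<noteq> \<one>\<^bsub>QZ\<^esub>" using 0 \<chi>(2) by simp
    moreover have "\<Phi> d (ZeroM C d (D d)) (Ide C d) = \<one>\<^bsub>QZ\<^esub>"
    proof -
      have z: "ZeroM C d (D d) \<in> Hom C d (D d)" using ZeroM_Hom[OF dO DO] .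
      have h: "\<Phi> d \<in> hom (Hom_group C d (D d)) (char_group (Hom_group C d d))" using \<Phi>[OF dO] by (simp add: iso_def)
      note I = Ide_Hom[OF dO]
      let ?x = "\<Phi> d (ZeroM C d (D d))"
      have "?x \<in> chars d d" using hom_in_carrier[OF h, of "ZeroM C d (D d)"] z by simp
      then have xc: "?x (Ide C d) \<in> carrier QZ" using character_closed I unfolding chars_iff by blast
      have "?x = ?x \<otimes>\<^bsub>char_group (Hom_group C d d)\<^esub> ?x"
        using hom_mult[OF h, of "ZeroM C d (D d)" "ZeroM C d (D d)"] z Zero_Add[OF z] by simp
      from fun_cong[OF this, of "Ide C d"] have "?x (Ide C d) = ?x (Ide C d) \<otimes>\<^bsub>QZ\<^esub> ?x (Ide C d)"
        using I by (simp add: char_group_def)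
      then show ?thesis
        using group.r_cancel_one'[OF comm_group.axioms(2)[OF QZ_comm_group] xc xc] by simp
    qed
    ultimately show False by simp
  qed
  then show ?thesis using that \<phi>(1) by blast
qed

lemma BC_cogenerator_cogenerates:
  assumes "W \<in> Obj C" "orth W (BC_cogenerator U C)" shows "zero_object C W"
proof (rule zero_object_if_compact_orth[OF assms(1)])
  fix c assume c: "compact_object U C c"
  show "orth c W" unfolding orth_def
  proof (intro ballI, rule ccontr)
    fix g assume g: "g \<in> Hom C c W" "g \<noteq> ZeroM C c W"
    obtain \<phi> where \<phi>: "\<phi> \<in> Hom C W (BC_cogenerator U C)" "\<phi> \<cdot> g \<noteq> ZeroM C c (BC_cogenerator U C)"
      using BC_cogenerator_detects[OF c g] .
    have "\<phi> = ZeroM C W (BC_cogenerator U C)" using orthD[OF assms(2) \<phi>(1)] .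
    then show False using \<phi>(2) Zero_Cmp[OF g(1) BC_cogenerator_Obj] by simp
  qed
qed

end

section \<open>The Brown--Comenetz cogenerator generates under products\<close>

context triangulated_category
begin

lemma triangulated_subcategoryD:
  assumes "triangulated_subcategory C L"
  shows "X \<in> L \<Longrightarrow> X \<in> Obj C" "zero_object C X \<Longrightarrow> X \<in> L"
    "X \<in> L \<Longrightarrow> isomorphic C X Y \<Longrightarrow> Y \<in> L"
    "X \<in> Obj C \<Longrightarrow> ShO C X \<in> L \<longleftrightarrow> X \<in> L"
    "(f, g, h) \<in> Tri C \<Longrightarrow> Src C f \<in> L \<Longrightarrow> Src C g \<in> L \<Longrightarrow> Src C h \<in> L"
proof -
  note D = assms[unfolded triangulated_subcategory_def]
  show "X \<in> L \<Longrightarrow> X \<in> Obj C" "zero_object C X \<Longrightarrow> X \<in> L" using D by blast+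
  show "X \<in> L \<Longrightarrow> isomorphic C X Y \<Longrightarrow> Y \<in> L" using D isomorphic_Obj[of X Y] by blast
  show "X \<in> Obj C \<Longrightarrow> ShO C X \<in> L \<longleftrightarrow> X \<in> L" using D by blast
  show "(f, g, h) \<in> Tri C \<Longrightarrow> Src C f \<in> L \<Longrightarrow> Src C g \<in> L \<Longrightarrow> Src C h \<in> L" using D by fastforce
qed

lemma triangulated_subcategory_fibre:
  assumes L: "triangulated_subcategory C L" and t: "(f, g, h) \<in> Tri C"
    and f: "f \<in> Hom C X Y" and g: "g \<in> Hom C Y Z" and YZ: "Y \<in> L" "Z \<in> L"
  shows "X \<in> L"
proof -
  have h: "h \<in> Hom C Z (ShO C X)" using Tri_Hom_trd[OF t f g] .
  have "Src C g = Y" "Src C h = Z" "Src C (Neg C (ShM C f)) = ShO C X"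
    using g h Neg_Hom[OF ShM_Hom[OF f]] by (simp_all add: Hom_def)
  then have "ShO C X \<in> L" using triangulated_subcategoryD(5)[OF L Tri_rotate[OF t]] YZ by simp
  then show ?thesis using triangulated_subcategoryD(4)[OF L] Hom_Obj[OF f] by blast
qed

lemma colocalizing_product:
  fixes U :: "'u set"
  assumes L: "colocalizing_subcategory U C L" and I: "small U I"
    and A: "\<And>i. i \<in> I \<Longrightarrow> A i \<in> L" and P: "is_product C I A P \<pi>"
  shows "P \<in> L"
proof -
  obtain J e where J: "J \<subseteq> U" "small U J" "bij_betw e J I" using small_index[OF I] .
  have "\<forall>j\<in>J. A (e j) \<in> L" using A J(3) by (auto simp: bij_betw_def)
  moreover have "is_product C J (\<lambda>j. A (e j)) P (\<lambda>j. \<pi> (e j))" by (rule product_reindex[OF J(3) P])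
  ultimately show ?thesis
    using L[unfolded colocalizing_subcategory_def, THEN conjunct2, rule_format, OF J(1), of "\<lambda>j. A (e j)" P "\<lambda>j. \<pi> (e j)"]
      J(2) by simp
qed

end

context additive_category
begin

lemma Add_Diff_right: "f \<in> Hom C X Y \<Longrightarrow> g \<in> Hom C X Y \<Longrightarrow> Diff (Add C f g) g = f"
  using Add_assoc[of f X Y g "Neg C g"] Neg_Hom Add_Neg Add_Zero by simp

end

context small_compactly_generated
begin

text \<open>\<open>Q\<close> is the power of the cogenerator with one factor for each morphism from \<open>W\<close> to it.\<close>

lemma embed_in_colocalizing:
  assumes L: "colocalizing_subcategory U C L" "BC_cogenerator U C \<in> L" and W: "W \<in> Obj C"
  obtains Q j where "Q \<in> L" "j \<in> Hom C W Q"
    "\<And>c g. compact_object U C c \<Longrightarrow> g \<in> Hom C c W \<Longrightarrow> j \<cdot> g = ZeroM C c Q \<Longrightarrow> g = ZeroM C c W"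
proof -
  let ?I = "BC_cogenerator U C"
  let ?N = "Hom C W ?I"
  have N: "small U ?N" using small_Hom[OF W BC_cogenerator_Obj] .
  obtain Q \<pi> where Q: "is_product C ?N (\<lambda>_. ?I) Q \<pi>" using product_exists[OF N, of "\<lambda>_. ?I"] BC_cogenerator_Obj by blast
  have QL: "Q \<in> L" by (rule colocalizing_product[OF L(1) N L(2) Q])
  obtain j where j: "j \<in> Hom C W Q" "\<And>\<phi>. \<phi> \<in> ?N \<Longrightarrow> \<pi> \<phi> \<cdot> j = \<phi>"
    using product_ex[OF Q W, of "\<lambda>\<phi>. \<phi>"] by blast
  have "g = ZeroM C c W" if c: "compact_object U C c" and g: "g \<in> Hom C c W" "j \<cdot> g = ZeroM C c Q" for c g
  proof (rule ccontr)
    assume "g \<noteq> ZeroM C c W"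
    then obtain \<phi> where \<phi>: "\<phi> \<in> ?N" "\<phi> \<cdot> g \<noteq> ZeroM C c ?I" using BC_cogenerator_detects[OF c g(1)] by blast
    note p = is_productD(2)[OF Q \<phi>(1)]
    have "\<phi> \<cdot> g = \<pi> \<phi> \<cdot> j \<cdot> g" using j(2)[OF \<phi>(1)] Cmp_assoc[OF g(1) j(1) p] by simp
    then show False using g(2) \<phi>(2) Cmp_Zero[OF p compact_Obj[OF c]] by simp
  qed
  then show ?thesis using that QL j(1) by blast
qed

text \<open>\<open>Z'\<close> is the fibre of \<open>Z \<rightarrow> W \<rightarrow> Q\<close>, where \<open>W\<close> is the cone of \<open>a\<close> and \<open>W \<rightarrow> Q\<close> is injective on morphisms
  from compact objects.  What lifts from \<open>Z\<close> to \<open>Z'\<close> dies in \<open>Q\<close>, hence in \<open>W\<close>, and so comes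
  from \<open>A\<close>.\<close>

lemma colocalizing_tower_step:
  assumes L: "colocalizing_subcategory U C L" "BC_cogenerator U C \<in> L"
    and Z: "Z \<in> L" and a: "a \<in> Hom C A Z"
  obtains Z' a' p where "Z' \<in> L" "a' \<in> Hom C A Z'" "p \<in> Hom C Z' Z" "p \<cdot> a' = a"
    "\<forall>c z. compact_object U C c \<longrightarrow> z \<in> Hom C c Z' \<longrightarrow> (\<exists>w\<in>Hom C c A. p \<cdot> z = a \<cdot> w)"
proof -
  have tr: "triangulated_subcategory C L" using L(1) unfolding colocalizing_subcategory_def by blast
  have AO: "A \<in> Obj C" using Hom_Obj[OF a] by simp
  obtain b d W where t: "(a, b, d) \<in> Tri C" "b \<in> Hom C Z W" "W \<in> Obj C" using cone_ex[OF a] by blast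
  obtain Q j where Q: "Q \<in> L" "j \<in> Hom C W Q"
    and inj: "\<And>c g. compact_object U C c \<Longrightarrow> g \<in> Hom C c W \<Longrightarrow> j \<cdot> g = ZeroM C c Q \<Longrightarrow> g = ZeroM C c W"
    using embed_in_colocalizing[OF L t(3)] by blast
  have QO: "Q \<in> Obj C" using Hom_Obj[OF Q(2)] by simp
  have q: "j \<cdot> b \<in> Hom C Z Q" using Cmp_Hom[OF t(2) Q(2)] .
  obtain p h Z' where t': "(p, j \<cdot> b, h) \<in> Tri C" "p \<in> Hom C Z' Z" using fibre_ex[OF q] by blast
  have Z'L: "Z' \<in> L" by (rule triangulated_subcategory_fibre[OF tr t' q Z Q(1)])
  have "(j \<cdot> b) \<cdot> a = ZeroM C A Q"
    using Cmp_assoc[OF a t(2) Q(2)] Tri_Cmp_Zero[OF t(1) a t(2)] Cmp_Zero[OF Q(2) AO] by simp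
  then obtain a' where a': "a' \<in> Hom C A Z'" "p \<cdot> a' = a" using Tri_weak_kernel[OF t' q a] by blast
  have "\<exists>w\<in>Hom C c A. p \<cdot> z = a \<cdot> w" if c: "compact_object U C c" and z: "z \<in> Hom C c Z'" for c z
  proof -
    have pz: "p \<cdot> z \<in> Hom C c Z" using Cmp_Hom[OF z t'(2)] .
    have "j \<cdot> b \<cdot> p \<cdot> z = ((j \<cdot> b) \<cdot> p) \<cdot> z" using z t'(2) t(2) Q(2) by (simp add: Hom_def)
    also have "\<dots> = ZeroM C c Q" using Tri_Cmp_Zero[OF t' q] Zero_Cmp[OF z QO] by simp
    finally have "b \<cdot> p \<cdot> z = ZeroM C c W" using inj[OF c Cmp_Hom[OF pz t(2)]] by simp
    then show ?thesis using Tri_weak_kernel[OF t(1) a t(2) pz] by metis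
  qed
  then show ?thesis by (intro that[OF Z'L a'(1) t'(2) a'(2)] allI impI)
qed

text \<open>\<open>A\<close> is the homotopy limit of the tower \<open>Z\<close> starting with a power of the cogenerator.  On morphisms from a
  compact object, \<open>A\<close> embeds in every term, and the image of each term in the preceding one is that
  of \<open>A\<close>; so the limit of the tower is \<open>A\<close> and its derived limit vanishes.\<close>

theorem colocalizing_BC_cogenerator:
  assumes L: "colocalizing_subcategory U C L" "BC_cogenerator U C \<in> L"
  shows "L = Obj C"
proof (intro equalityI subsetI)
  have tr: "triangulated_subcategory C L" using L(1) unfolding colocalizing_subcategory_def by blast
  show "A \<in> Obj C" if "A \<in> L" for A using triangulated_subcategoryD(1)[OF tr that] .
  fix A assume A: "A \<in> Obj C"
  obtain Z0 a0 where 0: "Z0 \<in> L" "a0 \<in> Hom C A Z0"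
    and inj0: "\<And>c g. compact_object U C c \<Longrightarrow> g \<in> Hom C c A \<Longrightarrow> a0 \<cdot> g = ZeroM C c Z0 \<Longrightarrow> g = ZeroM C c A"
    using embed_in_colocalizing[OF L A] by blast
  define good where "good q \<longleftrightarrow> fst q \<in> L \<and> snd q \<in> Hom C A (fst q)" for q :: "'o \<times> 'm"
  define link where "link q q' p \<longleftrightarrow> p \<in> Hom C (fst q') (fst q) \<and> p \<cdot> snd q' = snd q \<and>
    (\<forall>c z. compact_object U C c \<longrightarrow> z \<in> Hom C c (fst q') \<longrightarrow> (\<exists>w\<in>Hom C c A. p \<cdot> z = snd q \<cdot> w))"
    for q q' :: "'o \<times> 'm" and p
  have step: "\<exists>q'. good q' \<and> (\<exists>p. link q q' p)" if q: "good q" for q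
  proof -
    obtain Z' a' p where r: "Z' \<in> L" "a' \<in> Hom C A Z'" "p \<in> Hom C Z' (fst q)" "p \<cdot> a' = snd q"
      "\<forall>c z. compact_object U C c \<longrightarrow> z \<in> Hom C c Z' \<longrightarrow> (\<exists>w\<in>Hom C c A. p \<cdot> z = snd q \<cdot> w)"
      using colocalizing_tower_step[OF L q[unfolded good_def, THEN conjunct1] q[unfolded good_def, THEN conjunct2]] .
    have "good (Z', a') \<and> link q (Z', a') p"
      unfolding good_def link_def fst_conv snd_conv by (intro conjI r)
    then show ?thesis by (intro exI conjI) (erule conjunct1, erule conjunct2)
  qed
  have "good (Z0, a0)" using 0 by (simp add: good_def)
  then obtain q p where q: "q 0 = (Z0, a0)" "\<And>n. good (q n)" and lk: "\<And>n. link (q n) (q (Suc n)) (p n)"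
    using dependent_sequence[of good "(Z0, a0)" link, OF _ step] by blast
  define Z a where "Z n = fst (q n)" and "a n = snd (q n)" for n
  note plink = lk[unfolded link_def, folded Z_def a_def]
  have ZL: "Z n \<in> L" and a: "a n \<in> Hom C A (Z n)" for n using q(2)[of n] unfolding good_def Z_def a_def by auto
  have p: "p n \<in> Hom C (Z (Suc n)) (Z n)" and pa: "p n \<cdot> a (Suc n) = a n" for n
    using plink[of n, THEN conjunct1] plink[of n, THEN conjunct2, THEN conjunct1] .
  have im: "\<exists>w\<in>Hom C c A. p n \<cdot> z = a n \<cdot> w" if "compact_object U C c" "z \<in> Hom C c (Z (Suc n))" for n c z
    by (rule plink[of n, THEN conjunct2, THEN conjunct2, rule_format, OF that])
  have ZO: "Z n \<in> Obj C" for n using Hom_Obj[OF a[of n]] by simp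
  have a00: "Z 0 = Z0" "a 0 = a0" unfolding Z_def a_def q(1) by simp_all
  have a_step: "a n \<cdot> w = p n \<cdot> a (Suc n) \<cdot> w" if "w \<in> Hom C c A" for n c w
    using Cmp_assoc[OF that a[of "Suc n"] p[of n]] pa[of n] by simp
  have inj: "w = ZeroM C c A" if c: "compact_object U C c" and w: "w \<in> Hom C c A" "a n \<cdot> w = ZeroM C c (Z n)" for n c w
    using w(2)
  proof (induction n)
    case 0
    then show ?case using inj0[OF c w(1)] a00 by simp
  next
    case (Suc n)
    then show ?case using a_step[OF w(1), of n] Cmp_Zero[OF p[of n] compact_Obj[OF c]] by simp
  qed
  have inj': "w = w'" if c: "compact_object U C c" and w: "w \<in> Hom C c A" "w' \<in> Hom C c A" "a n \<cdot> w = a n \<cdot> w'" for n c w w'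
  proof -
    have "a n \<cdot> Diff w w' = ZeroM C c (Z n)"
      using Cmp_Diff[OF w(1,2) a[of n]] w(3) Diff_self[OF Cmp_Hom[OF w(2) a[of n]]] by simp
    then show ?thesis using inj[OF c Diff_Hom[OF w(1,2)]] Diff_eq_Zero[OF w(1,2)] by simp
  qed
  have sn: "small U (UNIV :: nat set)" by (rule small_countable[OF universe countableI_type])
  obtain P \<pi> where P: "is_product C (UNIV :: nat set) Z P \<pi>" using product_exists[OF sn, of Z] ZO by blast
  note PO = is_productD(1)[OF P] and \<pi> = is_productD(2)[OF P UNIV_I]
  have PL: "P \<in> L" by (rule colocalizing_product[OF L(1) sn ZL P])
  have "p n \<cdot> \<pi> (Suc n) \<in> Hom C P (Z n)" for n using Cmp_Hom[OF \<pi>[of "Suc n"] p[of n]] .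
  then obtain s where s: "s \<in> Hom C P P" "\<And>n. \<pi> n \<cdot> s = p n \<cdot> \<pi> (Suc n)"
    using product_ex[OF P PO, of "\<lambda>n. p n \<cdot> \<pi> (Suc n)"] by (metis UNIV_I)
  obtain \<alpha> where \<alpha>: "\<alpha> \<in> Hom C A P" "\<And>n. \<pi> n \<cdot> \<alpha> = a n" using product_ex[OF P A, of a] a by (metis UNIV_I)
  have I: "Ide C P \<in> Hom C P P" using Ide_Hom[OF PO] .
  let ?D = "Diff (Ide C P) s"
  have D: "?D \<in> Hom C P P" using Diff_Hom[OF I s(1)] .
  have Dy: "?D \<cdot> y = Diff y (s \<cdot> y)" if "y \<in> Hom C c P" for c y
    using Diff_Cmp[OF that I s(1)] Ide_Cmp[OF that] by simp
  have D0: "?D \<cdot> y = ZeroM C c P \<longleftrightarrow> s \<cdot> y = y" if y: "y \<in> Hom C c P" for c y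
    using Dy[OF y] Diff_eq_Zero[OF y Cmp_Hom[OF y s(1)]] by auto
  have sy: "\<pi> n \<cdot> s \<cdot> y = p n \<cdot> \<pi> (Suc n) \<cdot> y" if y: "y \<in> Hom C c P" for n c y
    using Cmp_assoc[OF y s(1) \<pi>[of n]] Cmp_assoc[OF y \<pi>[of "Suc n"] p[of n]] s(2) by simp
  have \<alpha>w: "\<pi> n \<cdot> \<alpha> \<cdot> w = a n \<cdot> w" if w: "w \<in> Hom C c A" for n c w
    using Cmp_assoc[OF w \<alpha>(1) \<pi>[of n]] \<alpha>(2) by simp
  have s\<alpha>: "s \<cdot> \<alpha> = \<alpha>"
  proof (rule product_eqI[OF P Cmp_Hom[OF \<alpha>(1) s(1)] \<alpha>(1)])
    show "\<pi> n \<cdot> s \<cdot> \<alpha> = \<pi> n \<cdot> \<alpha>" for n using sy[OF \<alpha>(1)] \<alpha>(2) pa by simp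
  qed
  \<comment> \<open>on compact objects, the kernel of \<open>1 - s\<close> is \<open>A\<close>\<close>
  have ker: "\<exists>w\<in>Hom C c A. y = \<alpha> \<cdot> w" if c: "compact_object U C c" and y: "y \<in> Hom C c P" "s \<cdot> y = y" for c y
  proof -
    have y1: "\<pi> n \<cdot> y = p n \<cdot> \<pi> (Suc n) \<cdot> y" for n using sy[OF y(1), of n] y(2) by simp
    have "\<exists>w. w \<in> Hom C c A \<and> \<pi> n \<cdot> y = a n \<cdot> w" for n
      using im[OF c Cmp_Hom[OF y(1) \<pi>[of "Suc n"]]] y1[of n] by auto
    then obtain w where w: "\<And>n. w n \<in> Hom C c A" "\<And>n. \<pi> n \<cdot> y = a n \<cdot> w n" by metis
    have "w (Suc n) = w n" for n
    proof (rule inj'[OF c w(1) w(1)])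
      show "a n \<cdot> w (Suc n) = a n \<cdot> w n"
        using a_step[OF w(1)[of "Suc n"], of n] w(2)[of "Suc n"] y1[of n] w(2)[of n] by simp
    qed
    then have w0: "w n = w 0" for n by (induction n) simp_all
    have "y = \<alpha> \<cdot> w 0"
    proof (rule product_eqI[OF P y(1) Cmp_Hom[OF w(1) \<alpha>(1)]])
      show "\<pi> n \<cdot> y = \<pi> n \<cdot> \<alpha> \<cdot> w 0" for n using \<alpha>w[OF w(1)] w(2)[of n] w0[of n] by simp
    qed
    then show ?thesis using w(1) by blast
  qed
  \<comment> \<open>on compact objects, \<open>1 - s\<close> is surjective\<close>
  have surj: "\<exists>z\<in>Hom C c P. ?D \<cdot> z = y" if c: "compact_object U C c" and y: "y \<in> Hom C c P" for c y
  proof -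
    have cO: "c \<in> Obj C" using compact_Obj[OF c] .
    have yn: "\<pi> n \<cdot> y \<in> Hom C c (Z n)" for n using Cmp_Hom[OF y \<pi>[of n]] .
    have "\<exists>u. u \<in> Hom C c A \<and> p n \<cdot> \<pi> (Suc n) \<cdot> y = a n \<cdot> u" for n using im[OF c yn[of "Suc n"]] by blast
    then obtain u where u: "\<And>n. u n \<in> Hom C c A" "\<And>n. p n \<cdot> \<pi> (Suc n) \<cdot> y = a n \<cdot> u n" by metis
    \<comment> \<open>\<open>z\<^sub>n = y\<^sub>n + a\<^sub>n v\<^sub>n\<close> solves \<open>z\<^sub>n - p\<^sub>n z\<^sub>n\<^sub>+\<^sub>1 = y\<^sub>n\<close> if \<open>v\<^sub>n\<^sub>+\<^sub>1 = v\<^sub>n - u\<^sub>n\<close>\<close>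
    define v where "v = rec_nat (ZeroM C c A) (\<lambda>n x. Diff x (u n))"
    have v0: "v 0 = ZeroM C c A" and vS: "v (Suc n) = Diff (v n) (u n)" for n unfolding v_def by simp_all
    have v: "v n \<in> Hom C c A" for n by (induction n) (use v0 vS ZeroM_Hom[OF cO A] Diff_Hom u(1) in auto)
    have av: "a n \<cdot> v m \<in> Hom C c (Z n)" and au: "a n \<cdot> u m \<in> Hom C c (Z n)" for n m
      using Cmp_Hom[OF v a] Cmp_Hom[OF u(1) a] .
    define z where "z n = Add C (\<pi> n \<cdot> y) (a n \<cdot> v n)" for n
    have z: "z n \<in> Hom C c (Z n)" for n unfolding z_def by (rule Add_Hom[OF yn av])
    obtain x where x: "x \<in> Hom C c P" "\<And>n. \<pi> n \<cdot> x = z n" using product_ex[OF P cO, of z] z by (metis UNIV_I)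
    have pz: "p n \<cdot> z (Suc n) = a n \<cdot> v n" for n
    proof -
      have "p n \<cdot> z (Suc n) = Add C (p n \<cdot> \<pi> (Suc n) \<cdot> y) (p n \<cdot> a (Suc n) \<cdot> v (Suc n))"
        unfolding z_def by (rule Cmp_Add[OF yn av p])
      also have "\<dots> = Add C (a n \<cdot> u n) (a n \<cdot> v (Suc n))" using u(2)[of n] a_step[OF v[of "Suc n"], of n] by simp
      also have "\<dots> = a n \<cdot> Add C (u n) (v (Suc n))" using Cmp_Add[OF u(1)[of n] v[of "Suc n"] a[of n]] by simp
      also have "Add C (u n) (v (Suc n)) = v n" unfolding vS by (rule Add_Diff_cancel[OF v u(1)])
      finally show ?thesis .
    qed
    have "?D \<cdot> x = y"
    proof (rule product_eqI[OF P Cmp_Hom[OF x(1) D] y])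
      fix n
      have "\<pi> n \<cdot> (?D \<cdot> x) = Diff (\<pi> n \<cdot> x) (\<pi> n \<cdot> s \<cdot> x)"
        unfolding Dy[OF x(1)] by (rule Cmp_Diff[OF x(1) Cmp_Hom[OF x(1) s(1)] \<pi>])
      also have "\<dots> = Diff (z n) (a n \<cdot> v n)" using sy[OF x(1)] x(2) pz by simp
      also have "\<dots> = \<pi> n \<cdot> y" unfolding z_def by (rule Add_Diff_right[OF yn av])
      finally show "\<pi> n \<cdot> (?D \<cdot> x) = \<pi> n \<cdot> y" .
    qed
    then show ?thesis using x(1) by blast
  qed
  obtain e h X where t: "(e, ?D, h) \<in> Tri C" and e: "e \<in> Hom C X P" and h: "h \<in> Hom C P (ShO C X)" and XO: "X \<in> Obj C"
    using fibre_ex[OF D] .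
  have XL: "X \<in> L" by (rule triangulated_subcategory_fibre[OF tr t e D PL PL])
  have "?D \<cdot> \<alpha> = ZeroM C A P" using D0[OF \<alpha>(1)] s\<alpha> by simp
  then obtain b where b: "b \<in> Hom C A X" "e \<cdot> b = \<alpha>" using Tri_weak_kernel[OF t e D \<alpha>(1)] by blast
  have e_inj: "x = ZeroM C c X" if c: "compact_object U C c" and x: "x \<in> Hom C c X" "e \<cdot> x = ZeroM C c P" for c x
  proof -
    have cO: "c \<in> Obj C" using compact_Obj[OF c] .
    have "ShM C e \<cdot> ShM C x = ZeroM C (ShO C c) (ShO C P)"
      using ShM_Cmp[OF x(1) e] x(2) ShM_Zero[OF cO PO] by simp
    then obtain v where v: "v \<in> Hom C (ShO C c) P" "h \<cdot> v = ShM C x"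
      using Tri_weak_kernel''[OF t e h ShM_Hom[OF x(1)]] by blast
    obtain z where z: "z \<in> Hom C (ShO C c) P" "?D \<cdot> z = v" using surj[OF compact_object_ShO[OF c] v(1)] by blast
    have "ShM C x = (h \<cdot> ?D) \<cdot> z" using Cmp_assoc[OF z(1) D h] z(2) v(2) by simp
    also have "\<dots> = ZeroM C (ShO C c) (ShO C X)"
      using Tri_Cmp_Zero'[OF t e D] Zero_Cmp[OF z(1)] XO by simp
    finally show ?thesis using ShM_eq_Zero[OF x(1)] by simp
  qed
  have "b \<in> Iso C A X"
  proof (rule Iso_if_bij_compacts[OF b(1)])
    fix c assume c: "compact_object U C c"
    have eb: "e \<cdot> b \<cdot> w = \<alpha> \<cdot> w" if "w \<in> Hom C c A" for w using Cmp_assoc[OF that b(1) e] b(2) by simp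
    show "bij_betw (\<lambda>w. b \<cdot> w) (Hom C c A) (Hom C c X)"
      unfolding bij_betw_def
    proof (intro conjI inj_onI equalityI subsetI)
      fix w w' assume w: "w \<in> Hom C c A" "w' \<in> Hom C c A" "b \<cdot> w = b \<cdot> w'"
      then have "\<alpha> \<cdot> w = \<alpha> \<cdot> w'" using eb[OF w(1)] eb[OF w(2)] by simp
      then have "a 0 \<cdot> w = a 0 \<cdot> w'" using \<alpha>w[OF w(1), of 0] \<alpha>w[OF w(2), of 0] by simp
      then show "w = w'" using inj'[OF c w(1,2)] by blast
    next
      fix x assume "x \<in> (\<lambda>w. b \<cdot> w) ` Hom C c A" then show "x \<in> Hom C c X" using Cmp_Hom[OF _ b(1)] by blast
    next
      fix x assume x: "x \<in> Hom C c X"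
      have ex: "e \<cdot> x \<in> Hom C c P" using Cmp_Hom[OF x e] .
      have "?D \<cdot> e \<cdot> x = ZeroM C c P"
        using Cmp_assoc[OF x e D] Tri_Cmp_Zero[OF t e D] Zero_Cmp[OF x PO] by simp
      then have "s \<cdot> e \<cdot> x = e \<cdot> x" using D0[OF ex] by simp
      then obtain w where w: "w \<in> Hom C c A" "e \<cdot> x = \<alpha> \<cdot> w" using ker[OF c ex] by blast
      note bw = Cmp_Hom[OF w(1) b(1)]
      have "e \<cdot> Diff x (b \<cdot> w) = ZeroM C c P"
        using Cmp_Diff[OF x bw e] eb[OF w(1)] w(2) Diff_self[OF ex] by simp
      then have "x = b \<cdot> w" using e_inj[OF c Diff_Hom[OF x bw]] Diff_eq_Zero[OF x bw] by simp
      then show "x \<in> (\<lambda>w. b \<cdot> w) ` Hom C c A" using w(1) by blast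
    qed
  qed
  then have "isomorphic C X A" using isomorphic_sym unfolding isomorphic_def by blast
  then show "A \<in> L" using triangulated_subcategoryD(3)[OF tr XL] by blast
qed

end

section \<open>Right adjoints of triangulated functors\<close>

lemma (in category) bij_betw_Cmp_Iso:
  assumes i: "i \<in> Iso C A B"
  shows "bij_betw (\<lambda>f. i \<cdot> f) (Hom C W A) (Hom C W B)"
proof -
  obtain j where j: "j \<in> Hom C B A" "j \<cdot> i = Ide C A" "i \<cdot> j = Ide C B" "i \<in> Hom C A B" using isoE[OF i] .
  show ?thesis
  proof (rule bij_betw_byWitness[where f' = "\<lambda>f. j \<cdot> f"])
    show "\<forall>f\<in>Hom C W A. j \<cdot> i \<cdot> f = f"
      using Cmp_assoc[OF _ j(4,1)] j(2) Ide_Cmp by simp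
    show "\<forall>f\<in>Hom C W B. i \<cdot> j \<cdot> f = f"
      using Cmp_assoc[OF _ j(1,4)] j(3) Ide_Cmp by simp
    show "(\<lambda>f. i \<cdot> f) ` Hom C W A \<subseteq> Hom C W B" using Cmp_Hom[OF _ j(4)] by blast
    show "(\<lambda>f. j \<cdot> f) ` Hom C W B \<subseteq> Hom C W A" using Cmp_Hom[OF _ j(1)] by blast
  qed
qed

context cat_functor
begin

lemma cofreeI:
  assumes "G \<in> Obj C" "\<epsilon> \<in> Hom D (FO G) A"
    "\<And>B u u'. u \<in> Hom C B G \<Longrightarrow> u' \<in> Hom C B G \<Longrightarrow> \<epsilon> \<cdot>\<^bsub>D\<^esub> FM u = \<epsilon> \<cdot>\<^bsub>D\<^esub> FM u' \<Longrightarrow> u = u'"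
    "\<And>B f. B \<in> Obj C \<Longrightarrow> f \<in> Hom D (FO B) A \<Longrightarrow> \<exists>u\<in>Hom C B G. \<epsilon> \<cdot>\<^bsub>D\<^esub> FM u = f"
  shows "cofree C D FO FM A G \<epsilon>"
  unfolding cofree_def
proof (intro conjI ballI assms(1,2))
  fix B assume B: "B \<in> Obj C"
  show "bij_betw (\<lambda>u. \<epsilon> \<cdot>\<^bsub>D\<^esub> FM u) (Hom C B G) (Hom D (FO B) A)"
    unfolding bij_betw_def
  proof (intro conjI inj_onI equalityI subsetI)
    fix u u' assume "u \<in> Hom C B G" "u' \<in> Hom C B G" "\<epsilon> \<cdot>\<^bsub>D\<^esub> FM u = \<epsilon> \<cdot>\<^bsub>D\<^esub> FM u'"
    then show "u = u'" by (rule assms(3))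
  next
    fix f assume "f \<in> (\<lambda>u. \<epsilon> \<cdot>\<^bsub>D\<^esub> FM u) ` Hom C B G"
    then show "f \<in> Hom D (FO B) A" using D.Cmp_Hom[OF FM_Hom assms(2)] by blast
  next
    fix f assume "f \<in> Hom D (FO B) A"
    then obtain u where "u \<in> Hom C B G" "\<epsilon> \<cdot>\<^bsub>D\<^esub> FM u = f" using assms(4)[OF B] by blast
    then show "f \<in> (\<lambda>u. \<epsilon> \<cdot>\<^bsub>D\<^esub> FM u) ` Hom C B G" by (intro image_eqI[of f _ u]) simp_all
  qed
qed

lemma cofree_unique:
  assumes c: "cofree C D FO FM A G \<epsilon>" "cofree C D FO FM A G' \<epsilon>'"
  shows "isomorphic C G G'"
proof -
  note G = cofreeD[OF c(1)] and G' = cofreeD[OF c(2)]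
  obtain f where f: "f \<in> Hom C G G'" "\<epsilon>' \<cdot>\<^bsub>D\<^esub> FM f = \<epsilon>" using cofree_ex[OF c(2) G(1,2)] .
  obtain g where g: "g \<in> Hom C G' G" "\<epsilon> \<cdot>\<^bsub>D\<^esub> FM g = \<epsilon>'" using cofree_ex[OF c(1) G'(1,2)] .
  have "g \<cdot>\<^bsub>C\<^esub> f = Ide C G"
  proof (rule G(3)[OF C.Cmp_Hom[OF f(1) g(1)] C.Ide_Hom[OF G(1)]])
    show "\<epsilon> \<cdot>\<^bsub>D\<^esub> FM (g \<cdot>\<^bsub>C\<^esub> f) = \<epsilon> \<cdot>\<^bsub>D\<^esub> FM (Ide C G)"
      using FM_Cmp[OF f(1) g(1)] D.Cmp_assoc[OF FM_Hom[OF f(1)] FM_Hom[OF g(1)] G(2)] f(2) g(2)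
        FM_Ide[OF G(1)] D.Cmp_Ide[OF G(2)] by simp
  qed
  moreover have "f \<cdot>\<^bsub>C\<^esub> g = Ide C G'"
  proof (rule G'(3)[OF C.Cmp_Hom[OF g(1) f(1)] C.Ide_Hom[OF G'(1)]])
    show "\<epsilon>' \<cdot>\<^bsub>D\<^esub> FM (f \<cdot>\<^bsub>C\<^esub> g) = \<epsilon>' \<cdot>\<^bsub>D\<^esub> FM (Ide C G')"
      using FM_Cmp[OF g(1) f(1)] D.Cmp_assoc[OF FM_Hom[OF g(1)] FM_Hom[OF f(1)] G'(2)] f(2) g(2)
        FM_Ide[OF G'(1)] D.Cmp_Ide[OF G'(2)] by simp
  qed
  ultimately show ?thesis using C.isoI(1)[OF f(1) g(1)] unfolding isomorphic_def by blast
qed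

lemma cofree_iso_target:
  assumes c: "cofree C D FO FM A G \<epsilon>" and i: "i \<in> Iso D A A'"
  shows "cofree C D FO FM A' G (i \<cdot>\<^bsub>D\<^esub> \<epsilon>)"
proof -
  note G = cofreeD[OF c]
  have ih: "i \<in> Hom D A A'" using D.Iso_Hom[OF i] .
  show ?thesis unfolding cofree_def
  proof (intro conjI ballI)
    show "G \<in> Obj C" using G(1) .
    show "i \<cdot>\<^bsub>D\<^esub> \<epsilon> \<in> Hom D (FO G) A'" using D.Cmp_Hom[OF G(2) ih] .
    fix B assume B: "B \<in> Obj C"
    have "bij_betw (\<lambda>u. \<epsilon> \<cdot>\<^bsub>D\<^esub> FM u) (Hom C B G) (Hom D (FO B) A)" using c B unfolding cofree_def by blast
    from bij_betw_trans[OF this D.bij_betw_Cmp_Iso[OF i]]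
    have "bij_betw ((\<lambda>f. i \<cdot>\<^bsub>D\<^esub> f) \<circ> (\<lambda>u. \<epsilon> \<cdot>\<^bsub>D\<^esub> FM u)) (Hom C B G) (Hom D (FO B) A')" .
    then show "bij_betw (\<lambda>u. (i \<cdot>\<^bsub>D\<^esub> \<epsilon>) \<cdot>\<^bsub>D\<^esub> FM u) (Hom C B G) (Hom D (FO B) A')"
    proof (rule bij_betw_cong[THEN iffD1, rotated])
      fix u assume u: "u \<in> Hom C B G"
      show "((\<lambda>f. i \<cdot>\<^bsub>D\<^esub> f) \<circ> (\<lambda>u. \<epsilon> \<cdot>\<^bsub>D\<^esub> FM u)) u = (i \<cdot>\<^bsub>D\<^esub> \<epsilon>) \<cdot>\<^bsub>D\<^esub> FM u"
        using D.Cmp_assoc[OF FM_Hom[OF u] G(2) ih] by simp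
    qed
  qed
qed

lemma cofree_product:
  assumes P: "is_product D I A P \<pi>" and c: "cofree C D FO FM P GP \<epsilon>"
    and G: "\<And>i. i \<in> I \<Longrightarrow> cofree C D FO FM (A i) (G i) (e i)"
  obtains \<pi>' where "is_product C I G GP \<pi>'"
proof -
  note GP = cofreeD[OF c]
  have "\<exists>p. p \<in> Hom C GP (G i) \<and> e i \<cdot>\<^bsub>D\<^esub> FM p = \<pi> i \<cdot>\<^bsub>D\<^esub> \<epsilon>" if i: "i \<in> I" for i
    using cofree_ex[OF G[OF i] GP(1) D.Cmp_Hom[OF GP(2) D.is_productD(2)[OF P i]]] by metis
  then obtain p where p: "\<And>i. i \<in> I \<Longrightarrow> p i \<in> Hom C GP (G i)" "\<And>i. i \<in> I \<Longrightarrow> e i \<cdot>\<^bsub>D\<^esub> FM (p i) = \<pi> i \<cdot>\<^bsub>D\<^esub> \<epsilon>"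
    by metis
  have comp: "e i \<cdot>\<^bsub>D\<^esub> FM (p i \<cdot>\<^bsub>C\<^esub> h) = \<pi> i \<cdot>\<^bsub>D\<^esub> \<epsilon> \<cdot>\<^bsub>D\<^esub> FM h" if i: "i \<in> I" and h: "h \<in> Hom C Y GP" for i h Y
  proof -
    have "e i \<cdot>\<^bsub>D\<^esub> FM (p i \<cdot>\<^bsub>C\<^esub> h) = (e i \<cdot>\<^bsub>D\<^esub> FM (p i)) \<cdot>\<^bsub>D\<^esub> FM h"
      using FM_Cmp[OF h p(1)[OF i]] D.Cmp_assoc[OF FM_Hom[OF h] FM_Hom[OF p(1)[OF i]] cofreeD(2)[OF G[OF i]]] by simp
    then show ?thesis using p(2)[OF i] D.Cmp_assoc[OF FM_Hom[OF h] GP(2) D.is_productD(2)[OF P i]] by simp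
  qed
  have "is_product C I G GP p"
    unfolding is_product_def
  proof (intro conjI ballI allI impI GP(1) p(1))
    fix Y f assume Y: "Y \<in> Obj C" and f: "\<forall>i\<in>I. f i \<in> Hom C Y (G i)"
    have ef: "e i \<cdot>\<^bsub>D\<^esub> FM (f i) \<in> Hom D (FO Y) (A i)" if i: "i \<in> I" for i
      using D.Cmp_Hom[OF FM_Hom cofreeD(2)[OF G[OF i]]] f i by blast
    obtain k where k: "k \<in> Hom D (FO Y) P" "\<And>i. i \<in> I \<Longrightarrow> \<pi> i \<cdot>\<^bsub>D\<^esub> k = e i \<cdot>\<^bsub>D\<^esub> FM (f i)"
      using D.product_ex[OF P FO_Obj[OF Y], of "\<lambda>i. e i \<cdot>\<^bsub>D\<^esub> FM (f i)"] ef by blast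
    obtain h where h: "h \<in> Hom C Y GP" "\<epsilon> \<cdot>\<^bsub>D\<^esub> FM h = k" using cofree_ex[OF c Y k(1)] .
    show "\<exists>!h. h \<in> Hom C Y GP \<and> (\<forall>i\<in>I. p i \<cdot>\<^bsub>C\<^esub> h = f i)"
    proof (rule ex1I[of _ h])
      have "p i \<cdot>\<^bsub>C\<^esub> h = f i" if i: "i \<in> I" for i
      proof (rule cofreeD(3)[OF G[OF i] C.Cmp_Hom[OF h(1) p(1)[OF i]]])
        show "f i \<in> Hom C Y (G i)" using f i by blast
        show "e i \<cdot>\<^bsub>D\<^esub> FM (p i \<cdot>\<^bsub>C\<^esub> h) = e i \<cdot>\<^bsub>D\<^esub> FM (f i)" using comp[OF i h(1)] h(2) k(2)[OF i] by simp
      qed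
      then show "h \<in> Hom C Y GP \<and> (\<forall>i\<in>I. p i \<cdot>\<^bsub>C\<^esub> h = f i)" using h(1) by blast
      fix h' assume h': "h' \<in> Hom C Y GP \<and> (\<forall>i\<in>I. p i \<cdot>\<^bsub>C\<^esub> h' = f i)"
      then have h'H: "h' \<in> Hom C Y GP" by blast
      have "\<epsilon> \<cdot>\<^bsub>D\<^esub> FM h' = k"
      proof (rule D.product_eqI[OF P D.Cmp_Hom[OF FM_Hom[OF h'H] GP(2)] k(1)])
        fix i assume i: "i \<in> I"
        show "\<pi> i \<cdot>\<^bsub>D\<^esub> \<epsilon> \<cdot>\<^bsub>D\<^esub> FM h' = \<pi> i \<cdot>\<^bsub>D\<^esub> k" using comp[OF i h'H] k(2)[OF i] h' i by simp
      qed
      then show "h' = h" using GP(3)[OF h'H h(1)] h(2) by simp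
    qed
  qed
  then show ?thesis using that by blast
qed

end

context triangulated_functor
begin

lemma cofree_orth_iff:
  assumes c: "cofree C D FO FM A G \<epsilon>" and B: "B \<in> Obj C"
  shows "C.orth B G \<longleftrightarrow> D.orth (FO B) A"
proof -
  note G = cofreeD[OF c]
  have AO: "A \<in> Obj D" using D.Hom_Obj[OF G(2)] by simp
  have z: "ZeroM C B G \<in> Hom C B G" using C.ZeroM_Hom[OF B G(1)] .
  have ez: "\<epsilon> \<cdot>\<^bsub>D\<^esub> FM (ZeroM C B G) = ZeroM D (FO B) A"
    using FM_Zero[OF B G(1)] D.Cmp_Zero[OF G(2) FO_Obj[OF B]] by simp
  show ?thesis
  proof
    assume o: "C.orth B G"
    show "D.orth (FO B) A" unfolding D.orth_def
    proof
      fix f assume "f \<in> Hom D (FO B) A"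
      then obtain u where u: "u \<in> Hom C B G" "\<epsilon> \<cdot>\<^bsub>D\<^esub> FM u = f" using cofree_ex[OF c B] by blast
      then show "f = ZeroM D (FO B) A" using C.orthD[OF o u(1)] ez by simp
    qed
  next
    assume o: "D.orth (FO B) A"
    show "C.orth B G" unfolding C.orth_def
    proof
      fix u assume u: "u \<in> Hom C B G"
      show "u = ZeroM C B G"
        by (rule G(3)[OF u z]) (use D.orthD[OF o D.Cmp_Hom[OF FM_Hom[OF u] G(2)]] ez in simp)
    qed
  qed
qed

text \<open>Every \<open>B\<close> is isomorphic to some \<open>\<Sigma>B'\<close>, and morphisms from it are suspensions of morphisms from \<open>B'\<close>.\<close>

lemma cofree_ShO:
  assumes c: "cofree C D FO FM A G \<epsilon>"
  shows "cofree C D FO FM (ShO D A) (ShO C G) (ShM D \<epsilon> \<cdot>\<^bsub>D\<^esub> \<theta> G)"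
proof -
  note G = cofreeD[OF c]
  have AO: "A \<in> Obj D" using D.Hom_Obj[OF G(2)] by simp
  have th: "\<theta> B \<in> Hom D (FO (ShO C B)) (ShO D (FO B))" if "B \<in> Obj C" for B
    using D.Iso_Hom[OF theta_Iso[OF that]] .
  note eS = D.ShM_Hom[OF G(2)]
  have et: "ShM D \<epsilon> \<cdot>\<^bsub>D\<^esub> \<theta> G \<in> Hom D (FO (ShO C G)) (ShO D A)" using D.Cmp_Hom[OF th[OF G(1)] eS] .
  have shift: "(ShM D \<epsilon> \<cdot>\<^bsub>D\<^esub> \<theta> G) \<cdot>\<^bsub>D\<^esub> FM (ShM C w) = ShM D (\<epsilon> \<cdot>\<^bsub>D\<^esub> FM w) \<cdot>\<^bsub>D\<^esub> \<theta> B" if w: "w \<in> Hom C B G" for w B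
  proof -
    have BO: "B \<in> Obj C" using C.Hom_Obj[OF w] by simp
    have "(ShM D \<epsilon> \<cdot>\<^bsub>D\<^esub> \<theta> G) \<cdot>\<^bsub>D\<^esub> FM (ShM C w) = ShM D \<epsilon> \<cdot>\<^bsub>D\<^esub> \<theta> G \<cdot>\<^bsub>D\<^esub> FM (ShM C w)"
      using D.Cmp_assoc[OF FM_Hom[OF C.ShM_Hom[OF w]] th[OF G(1)] eS] .
    also have "\<dots> = ShM D \<epsilon> \<cdot>\<^bsub>D\<^esub> ShM D (FM w) \<cdot>\<^bsub>D\<^esub> \<theta> B" using theta_natural[OF w] by simp
    also have "\<dots> = (ShM D \<epsilon> \<cdot>\<^bsub>D\<^esub> ShM D (FM w)) \<cdot>\<^bsub>D\<^esub> \<theta> B"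
      using D.Cmp_assoc[OF th[OF BO] D.ShM_Hom[OF FM_Hom[OF w]] eS] by simp
    finally show ?thesis using D.ShM_Cmp[OF FM_Hom[OF w] G(2)] by simp
  qed
  have desusp: "\<exists>B' b b'. B' \<in> Obj C \<and> b \<in> Hom C (ShO C B') B \<and> b' \<in> Hom C B (ShO C B') \<and>
      b' \<cdot>\<^bsub>C\<^esub> b = Ide C (ShO C B') \<and> b \<cdot>\<^bsub>C\<^esub> b' = Ide C B" if "B \<in> Obj C" for B
    using C.shift_essentially_surjective[OF that] unfolding isomorphic_def Iso_def by blast
  show ?thesis
  proof (rule cofreeI[OF C.ShO_Obj[OF G(1)] et])
    fix B u u' assume u: "u \<in> Hom C B (ShO C G)" "u' \<in> Hom C B (ShO C G)"
      and eq: "(ShM D \<epsilon> \<cdot>\<^bsub>D\<^esub> \<theta> G) \<cdot>\<^bsub>D\<^esub> FM u = (ShM D \<epsilon> \<cdot>\<^bsub>D\<^esub> \<theta> G) \<cdot>\<^bsub>D\<^esub> FM u'"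
    have B: "B \<in> Obj C" using C.Hom_Obj[OF u(1)] by simp
    obtain B' b b' where b: "B' \<in> Obj C" "b \<in> Hom C (ShO C B') B" "b' \<in> Hom C B (ShO C B')"
      "b' \<cdot>\<^bsub>C\<^esub> b = Ide C (ShO C B')" "b \<cdot>\<^bsub>C\<^esub> b' = Ide C B" using desusp[OF B] by blast
    obtain w where w: "w \<in> Hom C B' G" "ShM C w = u \<cdot>\<^bsub>C\<^esub> b" using C.ShM_full[OF C.Cmp_Hom[OF b(2) u(1)] b(1) G(1)] .
    obtain w' where w': "w' \<in> Hom C B' G" "ShM C w' = u' \<cdot>\<^bsub>C\<^esub> b" using C.ShM_full[OF C.Cmp_Hom[OF b(2) u(2)] b(1) G(1)] .
    have "ShM D (\<epsilon> \<cdot>\<^bsub>D\<^esub> FM w) \<cdot>\<^bsub>D\<^esub> \<theta> B' = ((ShM D \<epsilon> \<cdot>\<^bsub>D\<^esub> \<theta> G) \<cdot>\<^bsub>D\<^esub> FM u) \<cdot>\<^bsub>D\<^esub> FM b"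
      using shift[OF w(1)] w(2) FM_Cmp[OF b(2) u(1)] D.Cmp_assoc[OF FM_Hom[OF b(2)] FM_Hom[OF u(1)] et] by simp
    also have "\<dots> = ((ShM D \<epsilon> \<cdot>\<^bsub>D\<^esub> \<theta> G) \<cdot>\<^bsub>D\<^esub> FM u') \<cdot>\<^bsub>D\<^esub> FM b" using eq by simp
    also have "\<dots> = ShM D (\<epsilon> \<cdot>\<^bsub>D\<^esub> FM w') \<cdot>\<^bsub>D\<^esub> \<theta> B'"
      using shift[OF w'(1)] w'(2) FM_Cmp[OF b(2) u(2)] D.Cmp_assoc[OF FM_Hom[OF b(2)] FM_Hom[OF u(2)] et] by simp
    finally have 1: "ShM D (\<epsilon> \<cdot>\<^bsub>D\<^esub> FM w) \<cdot>\<^bsub>D\<^esub> \<theta> B' = ShM D (\<epsilon> \<cdot>\<^bsub>D\<^esub> FM w') \<cdot>\<^bsub>D\<^esub> \<theta> B'" .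
    have ew: "\<epsilon> \<cdot>\<^bsub>D\<^esub> FM w \<in> Hom D (FO B') A" "\<epsilon> \<cdot>\<^bsub>D\<^esub> FM w' \<in> Hom D (FO B') A"
      using D.Cmp_Hom[OF FM_Hom[OF w(1)] G(2)] D.Cmp_Hom[OF FM_Hom[OF w'(1)] G(2)] .
    obtain t where t: "t \<in> Hom D (ShO D (FO B')) (FO (ShO C B'))" "t \<cdot>\<^bsub>D\<^esub> \<theta> B' = Ide D (FO (ShO C B'))"
      "\<theta> B' \<cdot>\<^bsub>D\<^esub> t = Ide D (ShO D (FO B'))" "\<theta> B' \<in> Hom D (FO (ShO C B')) (ShO D (FO B'))"
      using D.isoE[OF theta_Iso[OF b(1)]] .
    have cancel: "x = (x \<cdot>\<^bsub>D\<^esub> \<theta> B') \<cdot>\<^bsub>D\<^esub> t" if x: "x \<in> Hom D (ShO D (FO B')) (ShO D A)" for x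
      using D.Cmp_assoc[OF t(1,4) x] t(3) D.Cmp_Ide[OF x] by simp
    have "ShM D (\<epsilon> \<cdot>\<^bsub>D\<^esub> FM w) = ShM D (\<epsilon> \<cdot>\<^bsub>D\<^esub> FM w')"
      using cancel[OF D.ShM_Hom[OF ew(1)]] cancel[OF D.ShM_Hom[OF ew(2)]] 1 by simp
    then have "w = w'" using D.ShM_faithful[OF ew] G(3)[OF w(1) w'(1)] by blast
    then have "(u \<cdot>\<^bsub>C\<^esub> b) \<cdot>\<^bsub>C\<^esub> b' = (u' \<cdot>\<^bsub>C\<^esub> b) \<cdot>\<^bsub>C\<^esub> b'" using w(2) w'(2) by simp
    then show "u = u'"
      using C.Cmp_assoc[OF b(3,2) u(1)] C.Cmp_assoc[OF b(3,2) u(2)] b(5) C.Cmp_Ide[OF u(1)] C.Cmp_Ide[OF u(2)] by simp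
  next
    fix B f assume B: "B \<in> Obj C" and f: "f \<in> Hom D (FO B) (ShO D A)"
    obtain B' b b' where b: "B' \<in> Obj C" "b \<in> Hom C (ShO C B') B" "b' \<in> Hom C B (ShO C B')"
      "b' \<cdot>\<^bsub>C\<^esub> b = Ide C (ShO C B')" "b \<cdot>\<^bsub>C\<^esub> b' = Ide C B" using desusp[OF B] by blast
    obtain t where t: "t \<in> Hom D (ShO D (FO B')) (FO (ShO C B'))" "t \<cdot>\<^bsub>D\<^esub> \<theta> B' = Ide D (FO (ShO C B'))"
      "\<theta> B' \<cdot>\<^bsub>D\<^esub> t = Ide D (ShO D (FO B'))" "\<theta> B' \<in> Hom D (FO (ShO C B')) (ShO D (FO B'))"
      using D.isoE[OF theta_Iso[OF b(1)]] .
    have fb: "f \<cdot>\<^bsub>D\<^esub> FM b \<in> Hom D (FO (ShO C B')) (ShO D A)" using D.Cmp_Hom[OF FM_Hom[OF b(2)] f] .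
    obtain g where g: "g \<in> Hom D (FO B') A" "ShM D g = (f \<cdot>\<^bsub>D\<^esub> FM b) \<cdot>\<^bsub>D\<^esub> t"
      using D.ShM_full[OF D.Cmp_Hom[OF t(1) fb] FO_Obj[OF b(1)] AO] .
    obtain w where w: "w \<in> Hom C B' G" "\<epsilon> \<cdot>\<^bsub>D\<^esub> FM w = g" using cofree_ex[OF c b(1) g(1)] .
    have u: "ShM C w \<cdot>\<^bsub>C\<^esub> b' \<in> Hom C B (ShO C G)" using C.Cmp_Hom[OF b(3) C.ShM_Hom[OF w(1)]] .
    have "(ShM D \<epsilon> \<cdot>\<^bsub>D\<^esub> \<theta> G) \<cdot>\<^bsub>D\<^esub> FM (ShM C w \<cdot>\<^bsub>C\<^esub> b') = (ShM D g \<cdot>\<^bsub>D\<^esub> \<theta> B') \<cdot>\<^bsub>D\<^esub> FM b'"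
      using FM_Cmp[OF b(3) C.ShM_Hom[OF w(1)]] D.Cmp_assoc[OF FM_Hom[OF b(3)] FM_Hom[OF C.ShM_Hom[OF w(1)]] et]
        shift[OF w(1)] w(2) by simp
    also have "ShM D g \<cdot>\<^bsub>D\<^esub> \<theta> B' = f \<cdot>\<^bsub>D\<^esub> FM b"
      using g(2) D.Cmp_assoc[OF t(4,1) fb] t(2) D.Cmp_Ide[OF fb] by simp
    also have "(f \<cdot>\<^bsub>D\<^esub> FM b) \<cdot>\<^bsub>D\<^esub> FM b' = f"
      using D.Cmp_assoc[OF FM_Hom[OF b(3)] FM_Hom[OF b(2)] f] FM_Cmp[OF b(3,2), symmetric] b(5) FM_Ide[OF B] D.Cmp_Ide[OF f] by simp
    finally show "\<exists>u\<in>Hom C B (ShO C G). (ShM D \<epsilon> \<cdot>\<^bsub>D\<^esub> \<theta> G) \<cdot>\<^bsub>D\<^esub> FM u = f" using u by blast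
  qed
qed

text \<open>The morphism \<open>c : F Q \<rightarrow> Z\<close> is a fill-in of the image under \<open>F\<close> of the triangle on \<open>u\<close> into the triangle on \<open>f\<close>.
  That it is universal is the five lemma for \<open>Hom(W, -)\<close>, where the outer isomorphisms come from the
  universal morphisms to \<open>A\<close>, \<open>B\<close> and their suspensions.\<close>

lemma cofree_cone:
  assumes a: "cofree C D FO FM A GA \<epsilon>A" and b: "cofree C D FO FM B GB \<epsilon>B"
    and t: "(f, g, h) \<in> Tri D" and f: "f \<in> Hom D A B" and g: "g \<in> Hom D B Z"
    and u: "u \<in> Hom C GA GB" "\<epsilon>B \<cdot>\<^bsub>D\<^esub> FM u = f \<cdot>\<^bsub>D\<^esub> \<epsilon>A"
    and t': "(u, k, d) \<in> Tri C" and k: "k \<in> Hom C GB Q"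
  shows "\<exists>\<epsilon>. cofree C D FO FM Z Q \<epsilon>"
proof -
  note GA = cofreeD[OF a] and GB = cofreeD[OF b]
  note SA = cofree_ShO[OF a] and SB = cofree_ShO[OF b]
  note SAD = cofreeD[OF SA] and SBD = cofreeD[OF SB]
  have h: "h \<in> Hom D Z (ShO D A)" using D.Tri_Hom_trd[OF t f g] .
  have d: "d \<in> Hom C Q (ShO C GA)" using C.Tri_Hom_trd[OF t' u(1) k] .
  have QO: "Q \<in> Obj C" and ZO: "Z \<in> Obj D" and BO: "B \<in> Obj D" and AO: "A \<in> Obj D"
    using C.Hom_Obj[OF k] D.Hom_Obj[OF g] D.Hom_Obj[OF f] by auto
  have tA: "\<theta> GA \<in> Hom D (FO (ShO C GA)) (ShO D (FO GA))" and tB: "\<theta> GB \<in> Hom D (FO (ShO C GB)) (ShO D (FO GB))"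
    using D.Iso_Hom[OF theta_Iso] GA(1) GB(1) by blast+
  have Ft: "(FM u, FM k, \<theta> GA \<cdot>\<^bsub>D\<^esub> FM d) \<in> Tri D" using FM_Tri[OF t'] u(1) by (simp add: Hom_def)
  have td: "\<theta> GA \<cdot>\<^bsub>D\<^esub> FM d \<in> Hom D (FO Q) (ShO D (FO GA))" using D.Cmp_Hom[OF FM_Hom[OF d] tA] .
  have s: "Src D (FM u) = FO GA" "Src D (FM k) = FO GB" "Src D (\<theta> GA \<cdot>\<^bsub>D\<^esub> FM d) = FO Q"
    "Src D f = A" "Src D g = B" "Src D h = Z"
    using FM_Hom[OF u(1)] FM_Hom[OF k] td f g h by (simp_all add: Hom_def)
  have "\<exists>c\<in>Hom D (Src D (\<theta> GA \<cdot>\<^bsub>D\<^esub> FM d)) (Src D h).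
      c \<cdot>\<^bsub>D\<^esub> FM k = g \<cdot>\<^bsub>D\<^esub> \<epsilon>B \<and> ShM D \<epsilon>A \<cdot>\<^bsub>D\<^esub> \<theta> GA \<cdot>\<^bsub>D\<^esub> FM d = h \<cdot>\<^bsub>D\<^esub> c"
    by (rule D.TR3[OF Ft t]) (simp_all only: s GA(2) GB(2) u(2))
  then obtain c where c: "c \<in> Hom D (FO Q) Z" "c \<cdot>\<^bsub>D\<^esub> FM k = g \<cdot>\<^bsub>D\<^esub> \<epsilon>B"
    "ShM D \<epsilon>A \<cdot>\<^bsub>D\<^esub> \<theta> GA \<cdot>\<^bsub>D\<^esub> FM d = h \<cdot>\<^bsub>D\<^esub> c" unfolding s by blast
  have c3: "(ShM D \<epsilon>A \<cdot>\<^bsub>D\<^esub> \<theta> GA) \<cdot>\<^bsub>D\<^esub> FM d = h \<cdot>\<^bsub>D\<^esub> c"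
    using D.Cmp_assoc[OF FM_Hom[OF d] tA D.ShM_Hom[OF GA(2)]] c(3) by simp
  have ck: "c \<cdot>\<^bsub>D\<^esub> FM (k \<cdot>\<^bsub>C\<^esub> y) = g \<cdot>\<^bsub>D\<^esub> \<epsilon>B \<cdot>\<^bsub>D\<^esub> FM y" if y: "y \<in> Hom C W GB" for y W
  proof -
    have "c \<cdot>\<^bsub>D\<^esub> FM (k \<cdot>\<^bsub>C\<^esub> y) = (c \<cdot>\<^bsub>D\<^esub> FM k) \<cdot>\<^bsub>D\<^esub> FM y"
      using FM_Cmp[OF y k] D.Cmp_assoc[OF FM_Hom[OF y] FM_Hom[OF k] c(1)] by simp
    then show ?thesis using c(2) D.Cmp_assoc[OF FM_Hom[OF y] GB(2) g] by simp
  qed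
  have hc: "h \<cdot>\<^bsub>D\<^esub> c \<cdot>\<^bsub>D\<^esub> FM w = (ShM D \<epsilon>A \<cdot>\<^bsub>D\<^esub> \<theta> GA) \<cdot>\<^bsub>D\<^esub> FM (d \<cdot>\<^bsub>C\<^esub> w)" if w: "w \<in> Hom C W Q" for w W
    using D.Cmp_assoc[OF FM_Hom[OF w] c(1) h] c3 FM_Cmp[OF w d] D.Cmp_assoc[OF FM_Hom[OF w] FM_Hom[OF d] SAD(2)] by simp
  have Bu: "(ShM D \<epsilon>B \<cdot>\<^bsub>D\<^esub> \<theta> GB) \<cdot>\<^bsub>D\<^esub> FM (ShM C u \<cdot>\<^bsub>C\<^esub> w) = ShM D f \<cdot>\<^bsub>D\<^esub> (ShM D \<epsilon>A \<cdot>\<^bsub>D\<^esub> \<theta> GA) \<cdot>\<^bsub>D\<^esub> FM w"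
    if w: "w \<in> Hom C W (ShO C GA)" for w W
  proof -
    note Su = C.ShM_Hom[OF u(1)] and Fw = FM_Hom[OF w]
    note SFu = D.ShM_Hom[OF FM_Hom[OF u(1)]]
    have "(ShM D \<epsilon>B \<cdot>\<^bsub>D\<^esub> \<theta> GB) \<cdot>\<^bsub>D\<^esub> FM (ShM C u \<cdot>\<^bsub>C\<^esub> w) = ShM D \<epsilon>B \<cdot>\<^bsub>D\<^esub> (\<theta> GB \<cdot>\<^bsub>D\<^esub> FM (ShM C u)) \<cdot>\<^bsub>D\<^esub> FM w"
      using FM_Cmp[OF w Su] D.Cmp_assoc[OF FM_Hom[OF C.Cmp_Hom[OF w Su]] tB D.ShM_Hom[OF GB(2)]]
        D.Cmp_assoc[OF Fw FM_Hom[OF Su] tB] by simp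
    also have "\<theta> GB \<cdot>\<^bsub>D\<^esub> FM (ShM C u) = ShM D (FM u) \<cdot>\<^bsub>D\<^esub> \<theta> GA" using theta_natural[OF u(1)] .
    also have "ShM D \<epsilon>B \<cdot>\<^bsub>D\<^esub> (ShM D (FM u) \<cdot>\<^bsub>D\<^esub> \<theta> GA) \<cdot>\<^bsub>D\<^esub> FM w = (ShM D \<epsilon>B \<cdot>\<^bsub>D\<^esub> ShM D (FM u)) \<cdot>\<^bsub>D\<^esub> \<theta> GA \<cdot>\<^bsub>D\<^esub> FM w"
      using D.Cmp_assoc[OF Fw tA SFu] D.Cmp_assoc[OF D.Cmp_Hom[OF Fw tA] SFu D.ShM_Hom[OF GB(2)]] by simp
    also have "ShM D \<epsilon>B \<cdot>\<^bsub>D\<^esub> ShM D (FM u) = ShM D f \<cdot>\<^bsub>D\<^esub> ShM D \<epsilon>A"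
      using D.ShM_Cmp[OF FM_Hom[OF u(1)] GB(2)] u(2) D.ShM_Cmp[OF GA(2) f] by simp
    also have "(ShM D f \<cdot>\<^bsub>D\<^esub> ShM D \<epsilon>A) \<cdot>\<^bsub>D\<^esub> \<theta> GA \<cdot>\<^bsub>D\<^esub> FM w = ShM D f \<cdot>\<^bsub>D\<^esub> (ShM D \<epsilon>A \<cdot>\<^bsub>D\<^esub> \<theta> GA) \<cdot>\<^bsub>D\<^esub> FM w"
      using D.Cmp_assoc[OF D.Cmp_Hom[OF Fw tA] D.ShM_Hom[OF GA(2)] D.ShM_Hom[OF f]]
        D.Cmp_assoc[OF Fw tA D.ShM_Hom[OF GA(2)]] by simp
    finally show ?thesis .
  qed
  have zero: "\<epsilon> \<cdot>\<^bsub>D\<^esub> FM (ZeroM C W G) = ZeroM D (FO W) X" if "W \<in> Obj C" "G \<in> Obj C" "\<epsilon> \<in> Hom D (FO G) X" for \<epsilon> W G X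
    using FM_Zero[OF that(1,2)] D.Cmp_Zero[OF that(3) FO_Obj[OF that(1)]] by simp
  have "cofree C D FO FM Z Q c"
  proof (rule cofreeI[OF QO c(1)])
    have inj: "w = ZeroM C W Q" if w: "w \<in> Hom C W Q" "c \<cdot>\<^bsub>D\<^esub> FM w = ZeroM D (FO W) Z" for w W
    proof -
      have W: "W \<in> Obj C" using C.Hom_Obj[OF w(1)] by simp
      have "(ShM D \<epsilon>A \<cdot>\<^bsub>D\<^esub> \<theta> GA) \<cdot>\<^bsub>D\<^esub> FM (d \<cdot>\<^bsub>C\<^esub> w) = ZeroM D (FO W) (ShO D A)"
        using hc[OF w(1)] w(2) D.Cmp_Zero[OF h FO_Obj[OF W]] by simp
      then have "d \<cdot>\<^bsub>C\<^esub> w = ZeroM C W (ShO C GA)"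
        using SAD(3)[OF C.Cmp_Hom[OF w(1) d] C.ZeroM_Hom[OF W SAD(1)]] zero[OF W SAD(1,2)] by simp
      then obtain y where y: "y \<in> Hom C W GB" "k \<cdot>\<^bsub>C\<^esub> y = w" using C.Tri_weak_kernel'[OF t' u(1) k w(1)] by blast
      have ey: "\<epsilon>B \<cdot>\<^bsub>D\<^esub> FM y \<in> Hom D (FO W) B" using D.Cmp_Hom[OF FM_Hom[OF y(1)] GB(2)] .
      have "g \<cdot>\<^bsub>D\<^esub> \<epsilon>B \<cdot>\<^bsub>D\<^esub> FM y = ZeroM D (FO W) Z" using ck[OF y(1)] y(2) w(2) by simp
      then obtain x where x: "x \<in> Hom D (FO W) A" "f \<cdot>\<^bsub>D\<^esub> x = \<epsilon>B \<cdot>\<^bsub>D\<^esub> FM y" using D.Tri_weak_kernel[OF t f g ey] by blast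
      obtain v where v: "v \<in> Hom C W GA" "\<epsilon>A \<cdot>\<^bsub>D\<^esub> FM v = x" using cofree_ex[OF a W x(1)] .
      have "\<epsilon>B \<cdot>\<^bsub>D\<^esub> FM (u \<cdot>\<^bsub>C\<^esub> v) = (\<epsilon>B \<cdot>\<^bsub>D\<^esub> FM u) \<cdot>\<^bsub>D\<^esub> FM v"
        using FM_Cmp[OF v(1) u(1)] D.Cmp_assoc[OF FM_Hom[OF v(1)] FM_Hom[OF u(1)] GB(2)] by simp
      also have "\<dots> = f \<cdot>\<^bsub>D\<^esub> x" using u(2) v(2) D.Cmp_assoc[OF FM_Hom[OF v(1)] GA(2) f] by simp
      finally have "u \<cdot>\<^bsub>C\<^esub> v = y" using GB(3)[OF C.Cmp_Hom[OF v(1) u(1)] y(1)] x(2) by simp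
      then have "w = (k \<cdot>\<^bsub>C\<^esub> u) \<cdot>\<^bsub>C\<^esub> v" using y(2) C.Cmp_assoc[OF v(1) u(1) k] by simp
      then show ?thesis using C.Tri_Cmp_Zero[OF t' u(1) k] C.Zero_Cmp[OF v(1) QO] by simp
    qed
    fix W w w' assume w: "w \<in> Hom C W Q" "w' \<in> Hom C W Q" and eq: "c \<cdot>\<^bsub>D\<^esub> FM w = c \<cdot>\<^bsub>D\<^esub> FM w'"
    have "c \<cdot>\<^bsub>D\<^esub> FM (Add C w (Neg C w')) = Add D (c \<cdot>\<^bsub>D\<^esub> FM w) (Neg D (c \<cdot>\<^bsub>D\<^esub> FM w'))"
      using FM_Add[OF w(1) C.Neg_Hom[OF w(2)]] FM_Neg[OF w(2)] D.Cmp_Diff[OF FM_Hom[OF w(1)] FM_Hom[OF w(2)] c(1)] by simp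
    also have "\<dots> = ZeroM D (FO W) Z" unfolding eq by (rule D.Add_Neg[OF D.Cmp_Hom[OF FM_Hom[OF w(2)] c(1)]])
    finally show "w = w'" using inj[OF C.Diff_Hom[OF w]] C.Diff_eq_Zero[OF w] by simp
  next
    fix W z assume W: "W \<in> Obj C" and z: "z \<in> Hom D (FO W) Z"
    have hz: "h \<cdot>\<^bsub>D\<^esub> z \<in> Hom D (FO W) (ShO D A)" using D.Cmp_Hom[OF z h] .
    obtain w' where w': "w' \<in> Hom C W (ShO C GA)" "(ShM D \<epsilon>A \<cdot>\<^bsub>D\<^esub> \<theta> GA) \<cdot>\<^bsub>D\<^esub> FM w' = h \<cdot>\<^bsub>D\<^esub> z" using cofree_ex[OF SA W hz] .
    note Suw = C.Cmp_Hom[OF w'(1) C.ShM_Hom[OF u(1)]]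
    have "(ShM D \<epsilon>B \<cdot>\<^bsub>D\<^esub> \<theta> GB) \<cdot>\<^bsub>D\<^esub> FM (ShM C u \<cdot>\<^bsub>C\<^esub> w') = (ShM D f \<cdot>\<^bsub>D\<^esub> h) \<cdot>\<^bsub>D\<^esub> z"
      using Bu[OF w'(1)] w'(2) D.Cmp_assoc[OF z h D.ShM_Hom[OF f]] by simp
    also have "\<dots> = ZeroM D (FO W) (ShO D B)"
      using D.Tri_Cmp_Zero''[OF t f h] D.Zero_Cmp[OF z D.ShO_Obj[OF BO]] by simp
    finally have "ShM C u \<cdot>\<^bsub>C\<^esub> w' = ZeroM C W (ShO C GB)"
      using SBD(3)[OF Suw C.ZeroM_Hom[OF W SBD(1)]] zero[OF W SBD(1,2)] by simp
    then obtain w where w: "w \<in> Hom C W Q" "d \<cdot>\<^bsub>C\<^esub> w = w'" using C.Tri_weak_kernel''[OF t' u(1) d w'(1)] by blast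
    note cw = D.Cmp_Hom[OF FM_Hom[OF w(1)] c(1)]
    have "h \<cdot>\<^bsub>D\<^esub> Add D z (Neg D (c \<cdot>\<^bsub>D\<^esub> FM w)) = ZeroM D (FO W) (ShO D A)"
      using D.Cmp_Diff[OF z cw h] hc[OF w(1)] w(2) w'(2) D.Add_Neg[OF hz] by simp
    then obtain y where y: "y \<in> Hom D (FO W) B" "g \<cdot>\<^bsub>D\<^esub> y = Add D z (Neg D (c \<cdot>\<^bsub>D\<^esub> FM w))"
      using D.Tri_weak_kernel'[OF t f g D.Diff_Hom[OF z cw]] by blast
    obtain v where v: "v \<in> Hom C W GB" "\<epsilon>B \<cdot>\<^bsub>D\<^esub> FM v = y" using cofree_ex[OF b W y(1)] .
    note kv = C.Cmp_Hom[OF v(1) k]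
    have "c \<cdot>\<^bsub>D\<^esub> FM (Add C w (k \<cdot>\<^bsub>C\<^esub> v)) = Add D (c \<cdot>\<^bsub>D\<^esub> FM w) (c \<cdot>\<^bsub>D\<^esub> FM (k \<cdot>\<^bsub>C\<^esub> v))"
      using FM_Add[OF w(1) kv] D.Cmp_Add[OF FM_Hom[OF w(1)] FM_Hom[OF kv] c(1)] by simp
    also have "\<dots> = Add D (c \<cdot>\<^bsub>D\<^esub> FM w) (Add D z (Neg D (c \<cdot>\<^bsub>D\<^esub> FM w)))" using ck[OF v(1)] v(2) y(2) by simp
    also have "\<dots> = z" by (rule D.Add_Diff_cancel[OF z cw])
    finally show "\<exists>u\<in>Hom C W Q. c \<cdot>\<^bsub>D\<^esub> FM u = z" using C.Add_Hom[OF w(1) kv] by blast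
  qed
  then show ?thesis by blast
qed

text \<open>Universal morphisms are unique up to isomorphism and compatible with suspensions, cones and
  products, by the preceding lemmas.\<close>

lemma right_adjoint_preimage_colocalizing:
  fixes U :: "'u set"
  assumes cf: "\<And>A. A \<in> Obj D \<Longrightarrow> \<exists>\<epsilon>. cofree C D FO FM A (GO A) \<epsilon>"
    and L: "colocalizing_subcategory U C L"
  shows "colocalizing_subcategory U D {A \<in> Obj D. GO A \<in> L}" (is "colocalizing_subcategory U D ?L")
proof -
  have tr: "triangulated_subcategory C L" using L unfolding colocalizing_subcategory_def by blast
  note TD = C.triangulated_subcategoryD[OF tr]
  obtain e where e: "\<And>A. A \<in> Obj D \<Longrightarrow> cofree C D FO FM A (GO A) (e A)" using cf by metis
  have zero: "A \<in> ?L" if A: "zero_object D A" for A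
  proof -
    have AO: "A \<in> Obj D" using D.zero_object_Hom(1)[OF A] .
    note GA = cofreeD(1)[OF e[OF AO]]
    have "C.orth (GO A) (GO A)" using cofree_orth_iff[OF e[OF AO] GA] D.orth_zero(2)[OF A] by blast
    then have "zero_object C (GO A)" using C.zero_object_iff_orth GA by blast
    then show ?thesis using TD(2) AO by blast
  qed
  have iso: "B \<in> ?L" if A: "A \<in> ?L" and i: "isomorphic D A B" for A B
  proof -
    have O1: "A \<in> Obj D" "B \<in> Obj D" using D.isomorphic_Obj[OF i] by auto
    obtain j where "j \<in> Iso D A B" using i unfolding isomorphic_def by blast
    from cofree_unique[OF cofree_iso_target[OF e[OF O1(1)] this] e[OF O1(2)]] have "isomorphic C (GO A) (GO B)" .
    then show ?thesis using TD(3) A O1(2) by blast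
  qed
  have shift: "ShO D A \<in> ?L \<longleftrightarrow> A \<in> ?L" if A: "A \<in> Obj D" for A
  proof -
    have i: "isomorphic C (ShO C (GO A)) (GO (ShO D A))"
      using cofree_unique[OF cofree_ShO[OF e[OF A]] e[OF D.ShO_Obj[OF A]]] .
    have "GO (ShO D A) \<in> L \<longleftrightarrow> ShO C (GO A) \<in> L" using TD(3) i C.isomorphic_sym[OF i] by blast
    then show ?thesis using TD(4)[OF cofreeD(1)[OF e[OF A]]] A by simp
  qed
  have cone: "Src D h \<in> ?L" if t: "(f, g, h) \<in> Tri D" and L': "Src D f \<in> ?L" "Src D g \<in> ?L" for f g h
  proof -
    obtain A B Z where H: "f \<in> Hom D A B" "g \<in> Hom D B Z" "h \<in> Hom D Z (ShO D A)" using D.TriE[OF t] .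
    have s: "Src D f = A" "Src D g = B" "Src D h = Z" using H by (simp_all add: Hom_def)
    have O1: "A \<in> Obj D" "B \<in> Obj D" "Z \<in> Obj D" using D.Hom_Obj[OF H(1)] D.Hom_Obj[OF H(2)] by auto
    note a = e[OF O1(1)] and b = e[OF O1(2)]
    obtain u where u: "u \<in> Hom C (GO A) (GO B)" "e B \<cdot>\<^bsub>D\<^esub> FM u = f \<cdot>\<^bsub>D\<^esub> e A"
      using cofree_ex[OF b cofreeD(1)[OF a] D.Cmp_Hom[OF cofreeD(2)[OF a] H(1)]] .
    obtain k d Q where q: "(u, k, d) \<in> Tri C" "k \<in> Hom C (GO B) Q" "d \<in> Hom C Q (ShO C (GO A))" using C.cone_ex[OF u(1)] by blast
    have "Src C u = GO A" "Src C k = GO B" "Src C d = Q" using u(1) q by (simp_all add: Hom_def)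
    then have QL: "Q \<in> L" using TD(5)[OF q(1)] L' s by simp
    obtain \<epsilon> where "cofree C D FO FM Z Q \<epsilon>" using cofree_cone[OF a b t H(1,2) u q(1,2)] by blast
    from cofree_unique[OF this e[OF O1(3)]] have "GO Z \<in> L" using TD(3) QL by blast
    then show ?thesis using s O1(3) by simp
  qed
  have "triangulated_subcategory D ?L"
    unfolding triangulated_subcategory_def
  proof (intro conjI ballI allI impI)
    show "?L \<subseteq> Obj D" by blast
    show "{X. zero_object D X} \<subseteq> ?L" using zero by blast
    show "Y \<in> ?L" if "X \<in> ?L" "isomorphic D X Y" for X Y using iso[OF that] .
    show "ShO D X \<in> ?L \<longleftrightarrow> X \<in> ?L" if "X \<in> Obj D" for X using shift[OF that] .
    fix t assume "t \<in> Tri D"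
    then show "case t of (f, g, h) \<Rightarrow> Src D f \<in> ?L \<and> Src D g \<in> ?L \<longrightarrow> Src D h \<in> ?L"
      using cone by (cases t) simp
  qed
  moreover have "P \<in> ?L" if I: "I \<subseteq> U" "small U I" and A: "\<And>i. i \<in> I \<Longrightarrow> A i \<in> ?L" and P: "is_product D I A P \<pi>" for I :: "'u set" and A P \<pi>
  proof -
    have AO: "A i \<in> Obj D" if "i \<in> I" for i using A[OF that] by blast
    obtain \<pi>' where p: "is_product C I (\<lambda>i. GO (A i)) (GO P) \<pi>'"
      using cofree_product[OF P e[OF D.is_productD(1)[OF P]], of "\<lambda>i. GO (A i)" "\<lambda>i. e (A i)"] e AO by blast
    have "GO P \<in> L" by (rule C.colocalizing_product[OF L I(2) _ p]) (use A in blast)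
    then show ?thesis using D.is_productD(1)[OF P] by blast
  qed
  ultimately show ?thesis unfolding colocalizing_subcategory_def by (intro conjI allI impI) blast+
qed

end

section \<open>Stratification in a lattice of subobjects with supports\<close>

text \<open>\<open>Ob\<close> is the class of all objects, \<open>sub\<close> the family of subobjects, \<open>N\<close> the least of them (the zero
  objects), \<open>\<sigma>\<close> the support and \<open>\<gamma> s A\<close> the piece of \<open>A\<close> at \<open>s\<close>.  The part \<open>m s\<close> supported at \<open>s\<close> is
  left unspecified, as it is generated by all pieces at \<open>s\<close> in the localizing case, but by the piece of the
  cogenerator in the colocalizing one.\<close>

locale support_theory =
  fixes Ob :: "'a set" and sub :: "'a set \<Rightarrow> bool" and N :: "'a set" and S :: "'s set"
    and \<sigma> :: "'a \<Rightarrow> 's set" and \<gamma> :: "'s \<Rightarrow> 'a \<Rightarrow> 'a" and m :: "'s \<Rightarrow> 'a set" and V :: "'s set"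
  assumes sub_subset: "sub L \<Longrightarrow> L \<subseteq> Ob"
    and sub_Inter: "\<L> \<noteq> {} \<Longrightarrow> (\<And>L. L \<in> \<L> \<Longrightarrow> sub L) \<Longrightarrow> sub (\<Inter>\<L>)"
    and sub_Ob: "sub Ob"
    and sub_N: "sub N"
    and N_least: "sub L \<Longrightarrow> N \<subseteq> L"
    and sub_supp: "sub {A \<in> Ob. \<sigma> A \<subseteq> W}"
    and piece_in: "sub L \<Longrightarrow> A \<in> L \<Longrightarrow> s \<in> S \<Longrightarrow> \<gamma> s A \<in> L"
    and supp_iff: "A \<in> Ob \<Longrightarrow> s \<in> \<sigma> A \<longleftrightarrow> s \<in> S \<and> \<gamma> s A \<notin> N"
    and supp_piece: "A \<in> Ob \<Longrightarrow> s \<in> S \<Longrightarrow> \<sigma> (\<gamma> s A) = {s} \<inter> \<sigma> A"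
    and supp_bound: "A \<in> Ob \<Longrightarrow> \<sigma> A \<subseteq> V"
    and V_subset: "V \<subseteq> S"
    and sub_m: "s \<in> S \<Longrightarrow> sub (m s)"
    and piece_in_m: "s \<in> S \<Longrightarrow> A \<in> Ob \<Longrightarrow> \<gamma> s A \<in> m s"
    and supp_m: "s \<in> S \<Longrightarrow> A \<in> m s \<Longrightarrow> \<sigma> A \<subseteq> {s}"
    and m_nonzero: "s \<in> V \<Longrightarrow> \<exists>A\<in>m s. s \<in> \<sigma> A"
begin

definition "\<tau> W = {A \<in> Ob. \<sigma> A \<subseteq> W}"
definition "Supp L = (\<Union>A\<in>L. \<sigma> A)"

lemma sub_hull: "X \<subseteq> Ob \<Longrightarrow> sub (sub hull X)"
  unfolding hull_def by (rule sub_Inter) (use sub_Ob in auto)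

lemma Supp_hull:
  assumes "X \<subseteq> Ob" shows "Supp (sub hull X) = (\<Union>A\<in>X. \<sigma> A)"
proof
  have "sub hull X \<subseteq> \<tau> (\<Union>A\<in>X. \<sigma> A)"
    unfolding \<tau>_def by (rule hull_minimal) (use assms sub_supp in auto)
  then show "Supp (sub hull X) \<subseteq> (\<Union>A\<in>X. \<sigma> A)" unfolding Supp_def \<tau>_def by blast
  show "(\<Union>A\<in>X. \<sigma> A) \<subseteq> Supp (sub hull X)" unfolding Supp_def using hull_subset[of X sub] by blast
qed

lemma Supp_subset_V: "sub L \<Longrightarrow> Supp L \<subseteq> V"
  unfolding Supp_def using supp_bound sub_subset by blast

lemma piece_Ob: "s \<in> S \<Longrightarrow> A \<in> Ob \<Longrightarrow> \<gamma> s A \<in> Ob"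
  using piece_in[OF sub_Ob] by blast

lemma pieces_subset: "A \<in> Ob \<Longrightarrow> {\<gamma> s A | s. s \<in> S} \<subseteq> Ob"
  using piece_Ob by blast

text \<open>Given the local-to-global principle and minimality, let the support of \<open>A\<close> be contained in that of \<open>L\<close>.
  Then for \<open>s\<close> in the support of \<open>A\<close>, some piece \<open>\<gamma> s B\<close> with \<open>B\<close> in \<open>L\<close> is nonzero, so minimality,
  applied to \<open>L \<inter> m s\<close>, puts \<open>m s\<close> and hence \<open>\<gamma> s A\<close> into \<open>L\<close>.  In the other direction, both principles
  compare subobjects with equal supports.\<close>

lemma stratification_iff:
  "mutually_inverse_bijections (Pow V) {L. sub L} \<tau> Supp \<longleftrightarrow>
     (\<forall>A\<in>Ob. sub hull {A} = sub hull {\<gamma> s A | s. s \<in> S}) \<and>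
     (\<forall>s\<in>S. \<forall>L. sub L \<and> L \<subseteq> m s \<longrightarrow> L = N \<or> L = m s)"
proof
  assume bij: "mutually_inverse_bijections (Pow V) {L. sub L} \<tau> Supp"
  have eqI: "L = L'" if "sub L" "sub L'" "Supp L = Supp L'" for L L'
    using bij that unfolding mutually_inverse_bijections_def by (metis mem_Collect_eq)
  have "sub hull {A} = sub hull {\<gamma> s A | s. s \<in> S}" if A: "A \<in> Ob" for A
  proof (rule eqI)
    show "sub (sub hull {A})" using sub_hull A by blast
    show "sub (sub hull {\<gamma> s A | s. s \<in> S})" by (rule sub_hull[OF pieces_subset[OF A]])
    have "(\<Union>B\<in>{\<gamma> s A | s. s \<in> S}. \<sigma> B) = \<sigma> A"
    proof (intro equalityI subsetI)
      fix s assume "s \<in> (\<Union>B\<in>{\<gamma> s A | s. s \<in> S}. \<sigma> B)"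
      then show "s \<in> \<sigma> A" using supp_piece[OF A] by auto
    next
      fix s assume s: "s \<in> \<sigma> A"
      then have "s \<in> S" using supp_iff[OF A] by blast
      moreover have "s \<in> \<sigma> (\<gamma> s A)" using supp_piece[OF A \<open>s \<in> S\<close>] s by blast
      ultimately show "s \<in> (\<Union>B\<in>{\<gamma> s A | s. s \<in> S}. \<sigma> B)" by blast
    qed
    then show "Supp (sub hull {A}) = Supp (sub hull {\<gamma> s A | s. s \<in> S})"
      using Supp_hull[OF pieces_subset[OF A]] Supp_hull[of "{A}"] A by simp
  qed
  moreover have "L = N \<or> L = m s" if s: "s \<in> S" and L: "sub L" "L \<subseteq> m s" for s L
  proof -
    have ms: "Supp (m s) \<subseteq> {s}" using supp_m[OF s] unfolding Supp_def by blast
    then have "Supp L \<subseteq> {s}" using L(2) unfolding Supp_def by blast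
    then consider "Supp L = {}" | "Supp L = {s}" by blast
    then show ?thesis
    proof cases
      case 1
      have "Supp N = {}"
        unfolding Supp_def using supp_iff piece_in[OF sub_N] sub_subset[OF sub_N] by blast
      then show ?thesis using eqI[OF L(1) sub_N] 1 by simp
    next
      case 2
      then have "Supp (m s) = {s}" using ms L(2) unfolding Supp_def by blast
      then show ?thesis using eqI[OF L(1) sub_m[OF s]] 2 by simp
    qed
  qed
  ultimately show "(\<forall>A\<in>Ob. sub hull {A} = sub hull {\<gamma> s A | s. s \<in> S}) \<and>
     (\<forall>s\<in>S. \<forall>L. sub L \<and> L \<subseteq> m s \<longrightarrow> L = N \<or> L = m s)" by blast
next
  assume "(\<forall>A\<in>Ob. sub hull {A} = sub hull {\<gamma> s A | s. s \<in> S}) \<and>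
     (\<forall>s\<in>S. \<forall>L. sub L \<and> L \<subseteq> m s \<longrightarrow> L = N \<or> L = m s)"
  then have ltg: "\<And>A. A \<in> Ob \<Longrightarrow> sub hull {A} = sub hull {\<gamma> s A | s. s \<in> S}"
    and min: "\<And>s L. s \<in> S \<Longrightarrow> sub L \<Longrightarrow> L \<subseteq> m s \<Longrightarrow> L = N \<or> L = m s" by blast+
  have \<tau>Supp: "\<tau> (Supp L) = L" if L: "sub L" for L
  proof
    show "L \<subseteq> \<tau> (Supp L)" using sub_subset[OF L] unfolding \<tau>_def Supp_def by blast
    show "\<tau> (Supp L) \<subseteq> L"
    proof
      fix A assume "A \<in> \<tau> (Supp L)"
      then have A: "A \<in> Ob" "\<sigma> A \<subseteq> Supp L" unfolding \<tau>_def by auto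
      have "\<gamma> s A \<in> L" if s: "s \<in> S" for s
      proof (cases "s \<in> \<sigma> A")
        case False
        then show ?thesis using supp_iff[OF A(1)] s N_least[OF L] by blast
      next
        case True
        then obtain B where B: "B \<in> L" "s \<in> \<sigma> B" using A(2) unfolding Supp_def by blast
        have BO: "B \<in> Ob" using sub_subset[OF L] B(1) by blast
        have LM: "sub (L \<inter> m s)" using sub_Inter[of "{L, m s}"] L sub_m[OF s] by auto
        have "\<gamma> s B \<in> L \<inter> m s" using piece_in[OF L B(1) s] piece_in_m[OF s BO] by blast
        moreover have "\<gamma> s B \<notin> N" using supp_iff[OF BO] B(2) by blast
        ultimately have "L \<inter> m s = m s" using min[OF s LM] by blast
        then show ?thesis using piece_in_m[OF s A(1)] by blast
      qed
      then have "{\<gamma> s A | s. s \<in> S} \<subseteq> L" by blast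
      from hull_minimal[of _ _ sub, OF this L] have "sub hull {\<gamma> s A | s. s \<in> S} \<subseteq> L" .
      then show "A \<in> L" using ltg[OF A(1)] hull_subset[of "{A}" sub] by blast
    qed
  qed
  have Supp\<tau>: "Supp (\<tau> W) = W" if W: "W \<subseteq> V" for W
  proof
    show "Supp (\<tau> W) \<subseteq> W" unfolding Supp_def \<tau>_def by blast
    show "W \<subseteq> Supp (\<tau> W)"
    proof
      fix s assume s: "s \<in> W"
      then obtain A where A: "A \<in> m s" "s \<in> \<sigma> A" using m_nonzero W by blast
      have sS: "s \<in> S" using s W V_subset by blast
      have "A \<in> Ob" using A(1) sub_subset[OF sub_m[OF sS]] by blast
      moreover have "\<sigma> A \<subseteq> W" using supp_m[OF sS A(1)] s by blast
      ultimately show "s \<in> Supp (\<tau> W)" using A(2) unfolding Supp_def \<tau>_def by blast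
    qed
  qed
  have t: "\<tau> ` Pow V \<subseteq> {L. sub L}" unfolding \<tau>_def using sub_supp by blast
  have s: "Supp ` {L. sub L} \<subseteq> Pow V" using Supp_subset_V by blast
  show "mutually_inverse_bijections (Pow V) {L. sub L} \<tau> Supp"
    unfolding mutually_inverse_bijections_def
  proof (intro conjI)
    show "bij_betw \<tau> (Pow V) {L. sub L}"
      by (rule bij_betw_byWitness[where f' = Supp]) (use \<tau>Supp Supp\<tau> t s in auto)
    show "bij_betw Supp {L. sub L} (Pow V)"
      by (rule bij_betw_byWitness[where f' = \<tau>]) (use \<tau>Supp Supp\<tau> t s in auto)
  qed (use \<tau>Supp Supp\<tau> in auto)
qed

end

section \<open>Localizing and colocalizing subcategories\<close>

context triangulated_category
begin

lemma triangulated_subcategory_Inter: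
  assumes ne: "\<L> \<noteq> {}" and L: "\<And>L. L \<in> \<L> \<Longrightarrow> triangulated_subcategory C L"
  shows "triangulated_subcategory C (\<Inter>\<L>)"
  unfolding triangulated_subcategory_def
proof (intro conjI ballI allI impI)
  note TD = triangulated_subcategoryD[OF L]
  show "\<Inter>\<L> \<subseteq> Obj C" using ne TD(1) by blast
  show "{X. zero_object C X} \<subseteq> \<Inter>\<L>" using TD(2) by blast
  show "Y \<in> \<Inter>\<L>" if "X \<in> \<Inter>\<L>" "isomorphic C X Y" for X Y using TD(3) that by blast
  show "ShO C X \<in> \<Inter>\<L> \<longleftrightarrow> X \<in> \<Inter>\<L>" if "X \<in> Obj C" for X using TD(4)[OF _ that] by blast
  fix t assume t: "t \<in> Tri C"
  obtain f g h where fgh: "t = (f, g, h)" by (cases t)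
  show "case t of (f, g, h) \<Rightarrow> Src C f \<in> \<Inter>\<L> \<and> Src C g \<in> \<Inter>\<L> \<longrightarrow> Src C h \<in> \<Inter>\<L>"
    using TD(5)[of _ f g h] t unfolding fgh by simp
qed

lemma localizing_Inter:
  fixes U :: "'u set"
  assumes ne: "\<L> \<noteq> {}" and L: "\<And>L. L \<in> \<L> \<Longrightarrow> localizing_subcategory U C L"
  shows "localizing_subcategory U C (\<Inter>\<L>)"
  unfolding localizing_subcategory_def
proof (intro conjI allI impI)
  show "triangulated_subcategory C (\<Inter>\<L>)"
    by (rule triangulated_subcategory_Inter[OF ne]) (use L in \<open>simp add: localizing_subcategory_def\<close>)
  fix I :: "'u set" and A P \<iota>
  assume I: "I \<subseteq> U" and a: "small U I \<and> (\<forall>i\<in>I. A i \<in> \<Inter>\<L>) \<and> is_coproduct C I A P \<iota>"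
  show "P \<in> \<Inter>\<L>"
  proof
    fix L assume X: "L \<in> \<L>"
    show "P \<in> L"
      using L[OF X, unfolded localizing_subcategory_def, THEN conjunct2, rule_format, OF I, of A P \<iota>] a X by auto
  qed
qed

lemma colocalizing_Inter:
  fixes U :: "'u set"
  assumes ne: "\<L> \<noteq> {}" and L: "\<And>L. L \<in> \<L> \<Longrightarrow> colocalizing_subcategory U C L"
  shows "colocalizing_subcategory U C (\<Inter>\<L>)"
  unfolding colocalizing_subcategory_def
proof (intro conjI allI impI)
  show "triangulated_subcategory C (\<Inter>\<L>)"
    by (rule triangulated_subcategory_Inter[OF ne]) (use L in \<open>simp add: colocalizing_subcategory_def\<close>)
  fix I :: "'u set" and A P \<pi>
  assume I: "I \<subseteq> U" and a: "small U I \<and> (\<forall>i\<in>I. A i \<in> \<Inter>\<L>) \<and> is_product C I A P \<pi>"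
  show "P \<in> \<Inter>\<L>"
  proof
    fix L assume X: "L \<in> \<L>"
    show "P \<in> L"
      using L[OF X, unfolded colocalizing_subcategory_def, THEN conjunct2, rule_format, OF I, of A P \<pi>] a X by auto
  qed
qed

lemma triangulated_subcategory_Obj: "triangulated_subcategory C (Obj C)"
  unfolding triangulated_subcategory_def
proof (intro conjI ballI allI impI)
  show "{X. zero_object C X} \<subseteq> Obj C" using zero_object_Hom(1) by blast
  fix t assume t: "t \<in> Tri C"
  obtain f g h where fgh: "t = (f, g, h)" by (cases t)
  obtain A Z where h: "h \<in> Hom C Z (ShO C A)" using TriE t unfolding fgh by blast
  have "Src C h = Z" using h by (simp add: Hom_def)
  then have "Src C h \<in> Obj C" using Hom_Obj[OF h] by simp
  then show "case t of (f, g, h) \<Rightarrow> Src C f \<in> Obj C \<and> Src C g \<in> Obj C \<longrightarrow> Src C h \<in> Obj C"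
    unfolding fgh by simp
qed auto

lemma localizing_Obj: "localizing_subcategory U C (Obj C)"
  unfolding localizing_subcategory_def using triangulated_subcategory_Obj is_coproductD(1) by blast

lemma colocalizing_Obj: "colocalizing_subcategory U C (Obj C)"
  unfolding colocalizing_subcategory_def using triangulated_subcategory_Obj is_productD(1) by blast

lemma shift_stable_Obj: "shift_stable (Obj C)"
  unfolding shift_stable_def using isomorphic_refl shift_essentially_surjective ShO_Obj by blast

lemma localizing_zero: "localizing_subcategory U C {Z. zero_object C Z}"
proof -
  have "{X \<in> Obj C. \<forall>Y\<in>Obj C. orth X Y} = {Z. zero_object C Z}"
    using zero_object_iff_orth orth_zero(1) zero_object_Hom(1) by blast
  then show ?thesis using left_orthogonal_localizing[OF shift_stable_Obj, of U] by simp
qed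

lemma colocalizing_zero: "colocalizing_subcategory U C {Z. zero_object C Z}"
proof -
  have "{Y \<in> Obj C. \<forall>X\<in>Obj C. orth X Y} = {Z. zero_object C Z}"
    using zero_object_iff_orth orth_zero(2) zero_object_Hom(1) by blast
  then show ?thesis using right_orthogonal_colocalizing[OF shift_stable_Obj, of U] by simp
qed

lemma zero_in_localizing: "localizing_subcategory U C L \<Longrightarrow> {Z. zero_object C Z} \<subseteq> L"
  unfolding localizing_subcategory_def triangulated_subcategory_def by blast

lemma zero_in_colocalizing: "colocalizing_subcategory U C L \<Longrightarrow> {Z. zero_object C Z} \<subseteq> L"
  unfolding colocalizing_subcategory_def triangulated_subcategory_def by blast

lemma localizing_subset: "localizing_subcategory U C L \<Longrightarrow> L \<subseteq> Obj C"
  unfolding localizing_subcategory_def triangulated_subcategory_def by blast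

lemma colocalizing_subset: "colocalizing_subcategory U C L \<Longrightarrow> L \<subseteq> Obj C"
  unfolding colocalizing_subcategory_def triangulated_subcategory_def by blast

end

section \<open>Modules\<close>

locale small_tt_module = tt_module U T K M
  for U :: "'u set" and T :: "('o, 'm) tt_category" and K :: "('k, 'n) triangulated_category"
    and M :: "('o, 'm, 'k, 'n) tt_action" +
  assumes universe: "universe U"

sublocale small_tt_module \<subseteq> KS: small_compactly_generated U K
  by unfold_locales (rule universe)

context small_tt_module
begin

lemmas act_functor = exact_right

lemma act_Obj: "X \<in> Obj T \<Longrightarrow> A \<in> Obj K \<Longrightarrow> X \<ast>\<^bsub>M\<^esub> A \<in> Obj K"
  by (rule FO_Obj)

lemma act_iso_right:
  assumes X: "X \<in> Obj T" and i: "isomorphic K A B" shows "isomorphic K (X \<ast>\<^bsub>M\<^esub> A) (X \<ast>\<^bsub>M\<^esub> B)"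
proof -
  interpret F: triangulated_functor K K "ActO M X" "ActM M (Ide T X)" "ActShR M X" by (rule act_functor[OF X])
  show ?thesis using i F.FM_Iso unfolding isomorphic_def by blast
qed

lemma act_iso_left:
  assumes A: "A \<in> Obj K" and i: "isomorphic T X Y" shows "isomorphic K (X \<ast>\<^bsub>M\<^esub> A) (Y \<ast>\<^bsub>M\<^esub> A)"
proof -
  interpret F: triangulated_functor T K "\<lambda>X. ActO M X A" "\<lambda>f. ActM M f (Ide K A)" "\<lambda>X. ActShL M X A"
    by (rule exact_left[OF A])
  show ?thesis using i F.FM_Iso unfolding isomorphic_def by blast
qed

lemma act_zero_left:
  assumes A: "A \<in> Obj K" and X: "zero_object T X" shows "zero_object K (X \<ast>\<^bsub>M\<^esub> A)"
proof -
  interpret F: triangulated_functor T K "\<lambda>X. ActO M X A" "\<lambda>f. ActM M f (Ide K A)" "\<lambda>X. ActShL M X A"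
    by (rule exact_left[OF A])
  show ?thesis using F.FM_zero_object[OF X] .
qed

lemma act_zero_right:
  assumes X: "X \<in> Obj T" and A: "zero_object K A" shows "zero_object K (X \<ast>\<^bsub>M\<^esub> A)"
proof -
  interpret F: triangulated_functor K K "ActO M X" "ActM M (Ide T X)" "ActShR M X" by (rule act_functor[OF X])
  show ?thesis using F.FM_zero_object[OF A] .
qed

lemma act_assoc:
  assumes "X \<in> Obj T" "Y \<in> Obj T" "A \<in> Obj K"
  shows "isomorphic K ((X \<boxtimes>\<^bsub>T\<^esub> Y) \<ast>\<^bsub>M\<^esub> A) (X \<ast>\<^bsub>M\<^esub> (Y \<ast>\<^bsub>M\<^esub> A))"
  using ActAssoc_Iso[OF assms] unfolding isomorphic_def by blast

lemma act_swap:
  assumes X: "X \<in> Obj T" and Y: "Y \<in> Obj T" and A: "A \<in> Obj K"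
  shows "isomorphic K (X \<ast>\<^bsub>M\<^esub> (Y \<ast>\<^bsub>M\<^esub> A)) (Y \<ast>\<^bsub>M\<^esub> (X \<ast>\<^bsub>M\<^esub> A))"
proof -
  have "isomorphic T (X \<boxtimes>\<^bsub>T\<^esub> Y) (Y \<boxtimes>\<^bsub>T\<^esub> X)" using T.Braid_Iso[OF X Y] unfolding isomorphic_def by blast
  from act_iso_left[OF A this] show ?thesis
    using act_assoc[OF X Y A] act_assoc[OF Y X A] K.isomorphic_trans K.isomorphic_sym by blast
qed

text \<open>Brown representability shows that \<open>X * -\<close> has a right adjoint, so that the choice in the definition of
  \<open>[X, -]\<^sub>*\<close> yields one.\<close>

lemma rel_hom_cofree:
  assumes X: "X \<in> Obj T" and A: "A \<in> Obj K"
  obtains \<epsilon> where "cofree K K (ActO M X) (ActM M (Ide T X)) A (rel_hom T K M X A) \<epsilon>"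
proof -
  interpret F: triangulated_functor K K "ActO M X" "ActM M (Ide T X)" "ActShR M X" by (rule act_functor[OF X])
  have "preserves_coproducts U K K (ActO M X) (ActM M (Ide T X))"
    using act_coproducts X unfolding coproduct_preserving_bifunctor_def by blast
  then have "\<exists>G \<epsilon>. cofree K K (ActO M X) (ActM M (Ide T X)) A G \<epsilon>" if "A \<in> Obj K" for A
    using F.cofree_exists[OF KS.small_compactly_generated_axioms K.locally_small _ that] by blast
  from F.right_adjoint_exists[OF this]
  obtain GO GM where "is_right_adjoint K K (ActO M X) (ActM M (Ide T X)) GO GM" by blast
  then have "is_right_adjoint K K (ActO M X) (ActM M (Ide T X)) (fst (GO, GM)) (snd (GO, GM))" by simp
  then have "is_right_adjoint K K (ActO M X) (ActM M (Ide T X)) (fst (rel_hom_functor T K M X)) (snd (rel_hom_functor T K M X))"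
    unfolding rel_hom_functor_def by (rule someI)
  from F.cofree_of_right_adjoint[OF this A] show ?thesis using that unfolding rel_hom_def by blast
qed

lemma rel_hom_Obj: "X \<in> Obj T \<Longrightarrow> A \<in> Obj K \<Longrightarrow> rel_hom T K M X A \<in> Obj K"
  using rel_hom_cofree unfolding cofree_def by metis

lemma orth_rel_hom_iff:
  assumes X: "X \<in> Obj T" and A: "A \<in> Obj K" and B: "B \<in> Obj K"
  shows "K.orth B (rel_hom T K M X A) \<longleftrightarrow> K.orth (X \<ast>\<^bsub>M\<^esub> B) A"
proof -
  interpret F: triangulated_functor K K "ActO M X" "ActM M (Ide T X)" "ActShR M X" by (rule act_functor[OF X])
  obtain \<epsilon> where e: "cofree K K (ActO M X) (ActM M (Ide T X)) A (rel_hom T K M X A) \<epsilon>" using rel_hom_cofree[OF X A] .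
  show ?thesis by (rule F.cofree_orth_iff[OF e B])
qed

lemma rel_hom_zero_iff:
  assumes X: "X \<in> Obj T" and A: "A \<in> Obj K"
  shows "zero_object K (rel_hom T K M X A) \<longleftrightarrow> (\<forall>B\<in>Obj K. K.orth (X \<ast>\<^bsub>M\<^esub> B) A)"
proof
  assume "zero_object K (rel_hom T K M X A)"
  then show "\<forall>B\<in>Obj K. K.orth (X \<ast>\<^bsub>M\<^esub> B) A" using orth_rel_hom_iff[OF X A] K.orth_zero(2) by blast
next
  assume "\<forall>B\<in>Obj K. K.orth (X \<ast>\<^bsub>M\<^esub> B) A"
  then have "K.orth (rel_hom T K M X A) (rel_hom T K M X A)" using orth_rel_hom_iff[OF X A] rel_hom_Obj[OF X A] by blast
  then show "zero_object K (rel_hom T K M X A)" using K.zero_object_iff_orth rel_hom_Obj[OF X A] by blast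
qed

lemma act_zero_iff:
  assumes X: "X \<in> Obj T" and B: "B \<in> Obj K"
  shows "zero_object K (X \<ast>\<^bsub>M\<^esub> B) \<longleftrightarrow> (\<forall>A\<in>Obj K. K.orth B (rel_hom T K M X A))"
proof
  assume "zero_object K (X \<ast>\<^bsub>M\<^esub> B)"
  then show "\<forall>A\<in>Obj K. K.orth B (rel_hom T K M X A)" using orth_rel_hom_iff[OF X _ B] K.orth_zero(1) by blast
next
  assume "\<forall>A\<in>Obj K. K.orth B (rel_hom T K M X A)"
  then have "K.orth (X \<ast>\<^bsub>M\<^esub> B) (X \<ast>\<^bsub>M\<^esub> B)" using orth_rel_hom_iff[OF X _ B] act_Obj[OF X B] by blast
  then show "zero_object K (X \<ast>\<^bsub>M\<^esub> B)" using K.zero_object_iff_orth act_Obj[OF X B] by blast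
qed

lemma shift_stable_act:
  assumes X: "X \<in> Obj T" shows "K.shift_stable {X \<ast>\<^bsub>M\<^esub> B | B. B \<in> Obj K}"
proof -
  interpret F: triangulated_functor K K "ActO M X" "ActM M (Ide T X)" "ActShR M X" by (rule act_functor[OF X])
  have sh: "isomorphic K (X \<ast>\<^bsub>M\<^esub> ShO K B) (ShO K (X \<ast>\<^bsub>M\<^esub> B))" if "B \<in> Obj K" for B
    using F.theta_Iso[OF that] unfolding isomorphic_def by blast
  have "\<exists>B'\<in>Obj K. isomorphic K (ShO K (X \<ast>\<^bsub>M\<^esub> B')) (X \<ast>\<^bsub>M\<^esub> B)" if B: "B \<in> Obj K" for B
  proof -
    obtain B' where B': "B' \<in> Obj K" "isomorphic K (ShO K B') B" using K.shift_essentially_surjective[OF B] by blast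
    then show ?thesis using sh[OF B'(1)] act_iso_right[OF X B'(2)] K.isomorphic_sym K.isomorphic_trans by blast
  qed
  then show ?thesis unfolding K.shift_stable_def using act_Obj[OF X] sh K.ShO_Obj by blast
qed

lemma shift_stable_rel_hom:
  assumes X: "X \<in> Obj T" shows "K.shift_stable {rel_hom T K M X A | A. A \<in> Obj K}"
proof -
  interpret F: triangulated_functor K K "ActO M X" "ActM M (Ide T X)" "ActShR M X" by (rule act_functor[OF X])
  have sh: "isomorphic K (rel_hom T K M X (ShO K A)) (ShO K (rel_hom T K M X A))" if A: "A \<in> Obj K" for A
  proof -
    obtain \<epsilon> where e: "cofree K K (ActO M X) (ActM M (Ide T X)) A (rel_hom T K M X A) \<epsilon>" using rel_hom_cofree[OF X A] .
    obtain \<epsilon>' where e': "cofree K K (ActO M X) (ActM M (Ide T X)) (ShO K A) (rel_hom T K M X (ShO K A)) \<epsilon>'"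
      using rel_hom_cofree[OF X K.ShO_Obj[OF A]] .
    show ?thesis by (rule F.cofree_unique[OF e' F.cofree_ShO[OF e]])
  qed
  have iso: "isomorphic K (rel_hom T K M X A) (rel_hom T K M X B)" if i: "isomorphic K A B" for A B
  proof -
    have O1: "A \<in> Obj K" "B \<in> Obj K" using K.isomorphic_Obj[OF i] by auto
    obtain j where j: "j \<in> Iso K A B" using i unfolding isomorphic_def by blast
    obtain \<epsilon> where e: "cofree K K (ActO M X) (ActM M (Ide T X)) A (rel_hom T K M X A) \<epsilon>" using rel_hom_cofree[OF X O1(1)] .
    obtain \<epsilon>' where e': "cofree K K (ActO M X) (ActM M (Ide T X)) B (rel_hom T K M X B) \<epsilon>'" using rel_hom_cofree[OF X O1(2)] .
    show ?thesis by (rule F.cofree_unique[OF F.cofree_iso_target[OF e j] e'])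
  qed
  have "\<exists>A'\<in>Obj K. isomorphic K (ShO K (rel_hom T K M X A')) (rel_hom T K M X A)" if A: "A \<in> Obj K" for A
  proof -
    obtain A' where A': "A' \<in> Obj K" "isomorphic K (ShO K A') A" using K.shift_essentially_surjective[OF A] by blast
    then show ?thesis using sh[OF A'(1)] iso[OF A'(2)] K.isomorphic_sym K.isomorphic_trans by blast
  qed
  then show ?thesis unfolding K.shift_stable_def using rel_hom_Obj[OF X] sh K.ShO_Obj by blast
qed

text \<open>By adjunction the kernel of \<open>X * -\<close> is the left orthogonal of the image of \<open>[X, -]\<^sub>*\<close>; it is a submodule
  because the actions of \<open>X\<close> and \<open>Y\<close> commute up to isomorphism.\<close>

lemma act_kernel_localizing:
  assumes X: "X \<in> Obj T"
  shows "localizing_submodule U T K M {A \<in> Obj K. zero_object K (X \<ast>\<^bsub>M\<^esub> A)}" (is "localizing_submodule U T K M ?L")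
proof -
  have "?L = {B \<in> Obj K. \<forall>Y\<in>{rel_hom T K M X A | A. A \<in> Obj K}. K.orth B Y}"
    using act_zero_iff[OF X] by blast
  then have "localizing_subcategory U K ?L"
    using K.left_orthogonal_localizing[OF shift_stable_rel_hom[OF X], of U] by simp
  moreover have "Y \<ast>\<^bsub>M\<^esub> A \<in> ?L" if Y: "Y \<in> Obj T" and A: "A \<in> ?L" for Y A
  proof -
    have "zero_object K (Y \<ast>\<^bsub>M\<^esub> (X \<ast>\<^bsub>M\<^esub> A))" using act_zero_right[OF Y] A by blast
    then have "zero_object K (X \<ast>\<^bsub>M\<^esub> (Y \<ast>\<^bsub>M\<^esub> A))" using K.zero_object_iso act_swap[OF Y X] A by blast
    then show ?thesis using act_Obj[OF Y] A by blast
  qed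
  ultimately show ?thesis unfolding localizing_submodule_def by blast
qed

text \<open>Dually, the kernel of \<open>[X, -]\<^sub>*\<close> is the right orthogonal of the image of \<open>X * -\<close>.\<close>

lemma rel_hom_kernel_colocalizing:
  assumes X: "X \<in> Obj T"
  shows "colocalizing_hom_submodule U T K M {A \<in> Obj K. zero_object K (rel_hom T K M X A)}"
    (is "colocalizing_hom_submodule U T K M ?L")
proof -
  have "?L = {A \<in> Obj K. \<forall>Y\<in>{X \<ast>\<^bsub>M\<^esub> B | B. B \<in> Obj K}. K.orth Y A}"
    using rel_hom_zero_iff[OF X] by blast
  then have "colocalizing_subcategory U K ?L"
    using K.right_orthogonal_colocalizing[OF shift_stable_act[OF X], of U] by simp
  moreover have "rel_hom T K M Y A \<in> ?L" if Y: "Y \<in> Obj T" and A: "A \<in> ?L" for Y A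
  proof -
    have AO: "A \<in> Obj K" using A by blast
    have "K.orth (X \<ast>\<^bsub>M\<^esub> B) (rel_hom T K M Y A)" if B: "B \<in> Obj K" for B
    proof -
      have "K.orth (X \<ast>\<^bsub>M\<^esub> (Y \<ast>\<^bsub>M\<^esub> B)) A" using rel_hom_zero_iff[OF X AO] A act_Obj[OF Y B] by blast
      then have "K.orth (Y \<ast>\<^bsub>M\<^esub> (X \<ast>\<^bsub>M\<^esub> B)) A" using K.orth_iso_left act_swap[OF X Y B] by blast
      then show ?thesis using orth_rel_hom_iff[OF Y AO act_Obj[OF X B]] by blast
    qed
    then show ?thesis using rel_hom_zero_iff[OF X rel_hom_Obj[OF Y AO]] rel_hom_Obj[OF Y AO] by blast
  qed
  ultimately show ?thesis unfolding colocalizing_hom_submodule_def by blast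
qed

lemma localizing_submodule_Inter:
  assumes "\<L> \<noteq> {}" "\<And>L. L \<in> \<L> \<Longrightarrow> localizing_submodule U T K M L"
  shows "localizing_submodule U T K M (\<Inter>\<L>)"
  unfolding localizing_submodule_def
proof
  show "localizing_subcategory U K (\<Inter>\<L>)"
    by (rule K.localizing_Inter[OF assms(1)]) (use assms(2) in \<open>simp add: localizing_submodule_def\<close>)
  show "\<forall>X\<in>Obj T. \<forall>A\<in>\<Inter>\<L>. X \<ast>\<^bsub>M\<^esub> A \<in> \<Inter>\<L>" using assms(2) unfolding localizing_submodule_def by blast
qed

lemma colocalizing_hom_submodule_Inter:
  assumes "\<L> \<noteq> {}" "\<And>L. L \<in> \<L> \<Longrightarrow> colocalizing_hom_submodule U T K M L"
  shows "colocalizing_hom_submodule U T K M (\<Inter>\<L>)"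
  unfolding colocalizing_hom_submodule_def
proof
  show "colocalizing_subcategory U K (\<Inter>\<L>)"
    by (rule K.colocalizing_Inter[OF assms(1)]) (use assms(2) in \<open>simp add: colocalizing_hom_submodule_def\<close>)
  show "\<forall>X\<in>Obj T. \<forall>A\<in>\<Inter>\<L>. rel_hom T K M X A \<in> \<Inter>\<L>" using assms(2) unfolding colocalizing_hom_submodule_def by blast
qed

end

section \<open>Supports and cosupports in a module\<close>

locale good_tt_module = small_tt_module U T K M
  for U :: "'u set" and T :: "('o, 'm) tt_category" and K :: "('k, 'n) triangulated_category"
    and M :: "('o, 'm, 'k, 'n) tt_action" +
  fixes S :: "'s topology" and \<Gamma> :: "'s \<Rightarrow> 'o"
  assumes good: "good_support_cosupport_pair T S \<Gamma>"
begin

lemma \<Gamma>_Obj: "s \<in> topspace S \<Longrightarrow> \<Gamma> s \<in> Obj T"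
  using good unfolding good_support_cosupport_pair_def by blast

lemma \<Gamma>_orthogonal:
  assumes "s \<in> topspace S" "r \<in> topspace S" "s \<noteq> r" "A \<in> Obj K"
  shows "zero_object K (\<Gamma> s \<ast>\<^bsub>M\<^esub> (\<Gamma> r \<ast>\<^bsub>M\<^esub> A))"
proof -
  have "zero_object T (\<Gamma> s \<boxtimes>\<^bsub>T\<^esub> \<Gamma> r)" using good assms unfolding good_support_cosupport_pair_def by blast
  then show ?thesis
    using K.zero_object_iso act_zero_left[OF assms(4)] act_assoc[OF \<Gamma>_Obj \<Gamma>_Obj] assms by blast
qed

lemma \<Gamma>_idempotent:
  assumes s: "s \<in> topspace S" and A: "A \<in> Obj K"
  shows "isomorphic K (\<Gamma> s \<ast>\<^bsub>M\<^esub> (\<Gamma> s \<ast>\<^bsub>M\<^esub> A)) (\<Gamma> s \<ast>\<^bsub>M\<^esub> A)"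
proof -
  have "isomorphic T (\<Gamma> s \<boxtimes>\<^bsub>T\<^esub> \<Gamma> s) (\<Gamma> s)" using good s unfolding good_support_cosupport_pair_def by blast
  from act_iso_left[OF A this] show ?thesis
    using act_assoc[OF \<Gamma>_Obj[OF s] \<Gamma>_Obj[OF s] A] K.isomorphic_sym K.isomorphic_trans by blast
qed

lemma supp_act:
  assumes s: "s \<in> topspace S" and A: "A \<in> Obj K"
  shows "supp K M S \<Gamma> (\<Gamma> s \<ast>\<^bsub>M\<^esub> A) = {s} \<inter> supp K M S \<Gamma> A"
proof -
  have "zero_object K (\<Gamma> s \<ast>\<^bsub>M\<^esub> (\<Gamma> s \<ast>\<^bsub>M\<^esub> A)) \<longleftrightarrow> zero_object K (\<Gamma> s \<ast>\<^bsub>M\<^esub> A)"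
    using K.zero_object_iso \<Gamma>_idempotent[OF s A] K.isomorphic_sym by blast
  then show ?thesis using \<Gamma>_orthogonal[OF _ s _ A] s unfolding supp_def by blast
qed

lemma cosupp_iff:
  "A \<in> Obj K \<Longrightarrow> s \<in> cosupp T K M S \<Gamma> A \<longleftrightarrow> s \<in> topspace S \<and> (\<exists>B\<in>Obj K. \<not> K.orth (\<Gamma> s \<ast>\<^bsub>M\<^esub> B) A)"
  unfolding cosupp_def using rel_hom_zero_iff[OF \<Gamma>_Obj] by blast

text \<open>Through the adjunction, \<open>[\<Gamma>\<^sub>r, [\<Gamma>\<^sub>s, A]\<^sub>*]\<^sub>*\<close> is tested by morphisms from objects \<open>\<Gamma>\<^sub>s * (\<Gamma>\<^sub>r * B)\<close> to \<open>A\<close>;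
  these objects are zero for \<open>r \<noteq> s\<close> and \<open>\<Gamma>\<^sub>s * B\<close> for \<open>r = s\<close>.\<close>

lemma cosupp_rel_hom:
  assumes s: "s \<in> topspace S" and A: "A \<in> Obj K"
  shows "cosupp T K M S \<Gamma> (rel_hom T K M (\<Gamma> s) A) = {s} \<inter> cosupp T K M S \<Gamma> A"
proof -
  note sO = \<Gamma>_Obj[OF s]
  have eq: "K.orth (\<Gamma> r \<ast>\<^bsub>M\<^esub> B) (rel_hom T K M (\<Gamma> s) A) \<longleftrightarrow> K.orth (\<Gamma> s \<ast>\<^bsub>M\<^esub> (\<Gamma> r \<ast>\<^bsub>M\<^esub> B)) A"
    if "r \<in> topspace S" "B \<in> Obj K" for r B
    using orth_rel_hom_iff[OF sO A act_Obj[OF \<Gamma>_Obj]] that by blast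
  have same: "K.orth (\<Gamma> s \<ast>\<^bsub>M\<^esub> (\<Gamma> s \<ast>\<^bsub>M\<^esub> B)) A \<longleftrightarrow> K.orth (\<Gamma> s \<ast>\<^bsub>M\<^esub> B) A" if "B \<in> Obj K" for B
    using K.orth_iso_left \<Gamma>_idempotent[OF s that] K.isomorphic_sym by blast
  have diff: "K.orth (\<Gamma> s \<ast>\<^bsub>M\<^esub> (\<Gamma> r \<ast>\<^bsub>M\<^esub> B)) A" if "r \<in> topspace S" "B \<in> Obj K" "r \<noteq> s" for r B
    using \<Gamma>_orthogonal[OF s that(1) _ that(2)] that(3) K.orth_zero(1) by blast
  show ?thesis
  proof (rule Set.set_eqI)
    fix r
    show "r \<in> cosupp T K M S \<Gamma> (rel_hom T K M (\<Gamma> s) A) \<longleftrightarrow> r \<in> {s} \<inter> cosupp T K M S \<Gamma> A"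
      unfolding Int_iff cosupp_iff[OF A] cosupp_iff[OF rel_hom_Obj[OF sO A]]
      using eq same diff by blast
  qed
qed

abbreviation "max_supp \<equiv> cosupp T K M S \<Gamma> (BC_cogenerator U K)"

text \<open>\<open>[\<Gamma>\<^sub>s, I]\<^sub>* = 0\<close> says that no \<open>\<Gamma>\<^sub>s * B\<close> has a nonzero morphism to the cogenerator.\<close>

lemma max_supp_iff: "s \<in> max_supp \<longleftrightarrow> s \<in> topspace S \<and> (\<exists>B\<in>Obj K. \<not> zero_object K (\<Gamma> s \<ast>\<^bsub>M\<^esub> B))"
  unfolding cosupp_iff[OF KS.BC_cogenerator_Obj]
  using KS.BC_cogenerator_cogenerates act_Obj[OF \<Gamma>_Obj] K.orth_zero(1) by blast

lemma supp_subset_max: "A \<in> Obj K \<Longrightarrow> supp K M S \<Gamma> A \<subseteq> max_supp"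
  using max_supp_iff unfolding supp_def by blast

lemma cosupp_subset_max: "A \<in> Obj K \<Longrightarrow> cosupp T K M S \<Gamma> A \<subseteq> max_supp"
  using max_supp_iff cosupp_iff K.orth_zero(1) by blast

lemma tau_s_localizing: "localizing_submodule U T K M {A \<in> Obj K. supp K M S \<Gamma> A \<subseteq> W}"
proof -
  let ?\<L> = "insert (Obj K) ((\<lambda>s. {A \<in> Obj K. zero_object K (\<Gamma> s \<ast>\<^bsub>M\<^esub> A)}) ` (topspace S - W))"
  have "localizing_submodule U T K M (\<Inter>?\<L>)"
  proof (rule localizing_submodule_Inter)
    have "localizing_submodule U T K M (Obj K)"
      unfolding localizing_submodule_def using K.localizing_Obj act_Obj by blast
    then show "localizing_submodule U T K M L" if "L \<in> ?\<L>" for L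
      using that act_kernel_localizing[OF \<Gamma>_Obj] by blast
  qed blast
  moreover have "\<Inter>?\<L> = {A \<in> Obj K. supp K M S \<Gamma> A \<subseteq> W}" unfolding supp_def by auto
  ultimately show ?thesis by simp
qed

lemma tau_c_colocalizing: "colocalizing_hom_submodule U T K M {A \<in> Obj K. cosupp T K M S \<Gamma> A \<subseteq> W}"
proof -
  let ?\<L> = "insert (Obj K) ((\<lambda>s. {A \<in> Obj K. zero_object K (rel_hom T K M (\<Gamma> s) A)}) ` (topspace S - W))"
  have "colocalizing_hom_submodule U T K M (\<Inter>?\<L>)"
  proof (rule colocalizing_hom_submodule_Inter)
    have "colocalizing_hom_submodule U T K M (Obj K)"
      unfolding colocalizing_hom_submodule_def using K.colocalizing_Obj rel_hom_Obj by blast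
    then show "colocalizing_hom_submodule U T K M L" if "L \<in> ?\<L>" for L
      using that rel_hom_kernel_colocalizing[OF \<Gamma>_Obj] by blast
  qed blast
  moreover have "\<Inter>?\<L> = {A \<in> Obj K. cosupp T K M S \<Gamma> A \<subseteq> W}" unfolding cosupp_def by auto
  ultimately show ?thesis by simp
qed

lemma localizing_submodule_hull:
  assumes "X \<subseteq> Obj K" shows "localizing_submodule U T K M (localizing_submodule U T K M hull X)"
proof -
  have "localizing_submodule U T K M (Obj K)"
    unfolding localizing_submodule_def using K.localizing_Obj act_Obj by blast
  then show ?thesis unfolding hull_def by (intro localizing_submodule_Inter) (use assms in auto)
qed

lemma colocalizing_hom_submodule_hull:
  assumes "X \<subseteq> Obj K" shows "colocalizing_hom_submodule U T K M (colocalizing_hom_submodule U T K M hull X)"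
proof -
  have "colocalizing_hom_submodule U T K M (Obj K)"
    unfolding colocalizing_hom_submodule_def using K.colocalizing_Obj rel_hom_Obj by blast
  then show ?thesis unfolding hull_def by (intro colocalizing_hom_submodule_Inter) (use assms in auto)
qed

text \<open>Since \<open>[\<Gamma>\<^sub>s, -]\<^sub>*\<close> is exact and preserves products, the objects which it sends to a given
  colocalizing subcategory form a colocalizing subcategory; if this contains the cogenerator, it
  contains everything.\<close>

lemma rel_hom_in_coloc:
  assumes s: "s \<in> topspace S" and A: "A \<in> Obj K"
  shows "rel_hom T K M (\<Gamma> s) A \<in> coloc U T K M {rel_hom T K M (\<Gamma> s) (BC_cogenerator U K)}"
proof -
  let ?I = "BC_cogenerator U K" and ?X = "\<Gamma> s"
  note X = \<Gamma>_Obj[OF s]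
  let ?C = "coloc U T K M {rel_hom T K M ?X ?I}"
  interpret F: triangulated_functor K K "ActO M ?X" "ActM M (Ide T ?X)" "ActShR M ?X" by (rule act_functor[OF X])
  have "colocalizing_subcategory U K ?C"
    using colocalizing_hom_submodule_hull[of "{rel_hom T K M ?X ?I}"] rel_hom_Obj[OF X KS.BC_cogenerator_Obj]
    unfolding coloc_def colocalizing_hom_submodule_def by blast
  then have "colocalizing_subcategory U K {A \<in> Obj K. rel_hom T K M ?X A \<in> ?C}"
    by (intro F.right_adjoint_preimage_colocalizing) (metis rel_hom_cofree[OF X])
  moreover have "?I \<in> {A \<in> Obj K. rel_hom T K M ?X A \<in> ?C}"
    using KS.BC_cogenerator_Obj hull_subset[of "{rel_hom T K M ?X ?I}"] unfolding coloc_def by blast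
  ultimately have "{A \<in> Obj K. rel_hom T K M ?X A \<in> ?C} = Obj K" by (rule KS.colocalizing_BC_cogenerator)
  then show ?thesis using A by blast
qed

lemma localizing_support_theory:
  "support_theory (Obj K) (localizing_submodule U T K M) {Z. zero_object K Z} (topspace S)
     (supp K M S \<Gamma>) (\<lambda>s A. \<Gamma> s \<ast>\<^bsub>M\<^esub> A)
     (\<lambda>s. localizing_submodule U T K M hull {\<Gamma> s \<ast>\<^bsub>M\<^esub> A | A. A \<in> Obj K}) max_supp"
proof
  let ?sub = "localizing_submodule U T K M"
  show "L \<subseteq> Obj K" if "?sub L" for L using K.localizing_subset that unfolding localizing_submodule_def by blast
  show "?sub (\<Inter>\<L>)" if "\<L> \<noteq> {}" "\<And>L. L \<in> \<L> \<Longrightarrow> ?sub L" for \<L> by (rule localizing_submodule_Inter[OF that])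
  show "?sub (Obj K)" unfolding localizing_submodule_def using K.localizing_Obj act_Obj by blast
  show "?sub {Z. zero_object K Z}" unfolding localizing_submodule_def using K.localizing_zero act_zero_right by blast
  show "{Z. zero_object K Z} \<subseteq> L" if "?sub L" for L
    using that K.zero_in_localizing unfolding localizing_submodule_def by blast
  show "?sub {A \<in> Obj K. supp K M S \<Gamma> A \<subseteq> W}" for W by (rule tau_s_localizing)
  show "\<Gamma> s \<ast>\<^bsub>M\<^esub> A \<in> L" if "?sub L" "A \<in> L" "s \<in> topspace S" for L A s
    using that \<Gamma>_Obj unfolding localizing_submodule_def by blast
  show "s \<in> supp K M S \<Gamma> A \<longleftrightarrow> s \<in> topspace S \<and> \<Gamma> s \<ast>\<^bsub>M\<^esub> A \<notin> {Z. zero_object K Z}" for s A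
    unfolding supp_def by blast
  show "supp K M S \<Gamma> (\<Gamma> s \<ast>\<^bsub>M\<^esub> A) = {s} \<inter> supp K M S \<Gamma> A" if "A \<in> Obj K" "s \<in> topspace S" for s A
    by (rule supp_act[OF that(2,1)])
  show "supp K M S \<Gamma> A \<subseteq> max_supp" if "A \<in> Obj K" for A by (rule supp_subset_max[OF that])
  show "max_supp \<subseteq> topspace S" unfolding cosupp_def by blast
  fix s
  let ?X = "{\<Gamma> s \<ast>\<^bsub>M\<^esub> A | A. A \<in> Obj K}"
  have X: "?X \<subseteq> Obj K" if "s \<in> topspace S" using act_Obj[OF \<Gamma>_Obj[OF that]] by blast
  show "?sub (?sub hull ?X)" if "s \<in> topspace S" by (rule localizing_submodule_hull[OF X[OF that]])
  show piece: "\<Gamma> s \<ast>\<^bsub>M\<^esub> A \<in> ?sub hull ?X" if "s \<in> topspace S" "A \<in> Obj K" for A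
    using hull_subset[of ?X ?sub] that by blast
  show "supp K M S \<Gamma> A \<subseteq> {s}" if s: "s \<in> topspace S" and A: "A \<in> ?sub hull ?X" for A
  proof -
    have "?X \<subseteq> {A \<in> Obj K. supp K M S \<Gamma> A \<subseteq> {s}}" using X[OF s] supp_act[OF s] by blast
    then have "?sub hull ?X \<subseteq> {A \<in> Obj K. supp K M S \<Gamma> A \<subseteq> {s}}" by (rule hull_minimal) (rule tau_s_localizing)
    then show ?thesis using A by blast
  qed
  show "\<exists>A\<in>?sub hull ?X. s \<in> supp K M S \<Gamma> A" if "s \<in> max_supp"
  proof -
    obtain B where B: "s \<in> topspace S" "B \<in> Obj K" "\<not> zero_object K (\<Gamma> s \<ast>\<^bsub>M\<^esub> B)" using \<open>s \<in> max_supp\<close> max_supp_iff by blast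
    then have "s \<in> supp K M S \<Gamma> (\<Gamma> s \<ast>\<^bsub>M\<^esub> B)" using supp_act[OF B(1,2)] unfolding supp_def by blast
    then show ?thesis using piece[OF B(1,2)] by blast
  qed
qed

lemma colocalizing_support_theory:
  "support_theory (Obj K) (colocalizing_hom_submodule U T K M) {Z. zero_object K Z} (topspace S)
     (cosupp T K M S \<Gamma>) (\<lambda>s A. rel_hom T K M (\<Gamma> s) A)
     (\<lambda>s. colocalizing_hom_submodule U T K M hull {rel_hom T K M (\<Gamma> s) (BC_cogenerator U K)}) max_supp"
proof
  let ?sub = "colocalizing_hom_submodule U T K M" and ?I = "BC_cogenerator U K"
  note I = KS.BC_cogenerator_Obj
  show "L \<subseteq> Obj K" if "?sub L" for L using K.colocalizing_subset that unfolding colocalizing_hom_submodule_def by blast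
  show "?sub (\<Inter>\<L>)" if "\<L> \<noteq> {}" "\<And>L. L \<in> \<L> \<Longrightarrow> ?sub L" for \<L> by (rule colocalizing_hom_submodule_Inter[OF that])
  show "?sub (Obj K)" unfolding colocalizing_hom_submodule_def using K.colocalizing_Obj rel_hom_Obj by blast
  show "?sub {Z. zero_object K Z}"
    unfolding colocalizing_hom_submodule_def
    using K.colocalizing_zero rel_hom_zero_iff K.orth_zero(2) K.zero_object_Hom(1) by blast
  show "{Z. zero_object K Z} \<subseteq> L" if "?sub L" for L
    using that K.zero_in_colocalizing unfolding colocalizing_hom_submodule_def by blast
  show "?sub {A \<in> Obj K. cosupp T K M S \<Gamma> A \<subseteq> W}" for W by (rule tau_c_colocalizing)
  show "rel_hom T K M (\<Gamma> s) A \<in> L" if "?sub L" "A \<in> L" "s \<in> topspace S" for L A s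
    using that \<Gamma>_Obj unfolding colocalizing_hom_submodule_def by blast
  show "s \<in> cosupp T K M S \<Gamma> A \<longleftrightarrow> s \<in> topspace S \<and> rel_hom T K M (\<Gamma> s) A \<notin> {Z. zero_object K Z}" for s A
    unfolding cosupp_def by blast
  show "cosupp T K M S \<Gamma> (rel_hom T K M (\<Gamma> s) A) = {s} \<inter> cosupp T K M S \<Gamma> A" if "A \<in> Obj K" "s \<in> topspace S" for s A
    by (rule cosupp_rel_hom[OF that(2,1)])
  show "cosupp T K M S \<Gamma> A \<subseteq> max_supp" if "A \<in> Obj K" for A by (rule cosupp_subset_max[OF that])
  show "max_supp \<subseteq> topspace S" unfolding cosupp_def by blast
  fix s
  let ?X = "{rel_hom T K M (\<Gamma> s) ?I}"
  have X: "?X \<subseteq> Obj K" if "s \<in> topspace S" using rel_hom_Obj[OF \<Gamma>_Obj[OF that] I] by blast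
  show "?sub (?sub hull ?X)" if "s \<in> topspace S" by (rule colocalizing_hom_submodule_hull[OF X[OF that]])
  show "rel_hom T K M (\<Gamma> s) A \<in> ?sub hull ?X" if "s \<in> topspace S" "A \<in> Obj K" for A
    using rel_hom_in_coloc[OF that] unfolding coloc_def .
  show "cosupp T K M S \<Gamma> A \<subseteq> {s}" if s: "s \<in> topspace S" and A: "A \<in> ?sub hull ?X" for A
  proof -
    have "?X \<subseteq> {A \<in> Obj K. cosupp T K M S \<Gamma> A \<subseteq> {s}}" using X[OF s] cosupp_rel_hom[OF s I] by blast
    then have "?sub hull ?X \<subseteq> {A \<in> Obj K. cosupp T K M S \<Gamma> A \<subseteq> {s}}" by (rule hull_minimal) (rule tau_c_colocalizing)
    then show ?thesis using A by blast
  qed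
  show "\<exists>A\<in>?sub hull ?X. s \<in> cosupp T K M S \<Gamma> A" if s: "s \<in> max_supp"
  proof -
    have "s \<in> topspace S" using s unfolding cosupp_def by blast
    then have "s \<in> cosupp T K M S \<Gamma> (rel_hom T K M (\<Gamma> s) ?I)" using cosupp_rel_hom[OF _ I] s by blast
    then show ?thesis using hull_subset[of ?X ?sub] by blast
  qed
qed

lemma stratified_iff: "stratified U T K M S \<Gamma> \<longleftrightarrow> local_to_global U T K M S \<Gamma> \<and> minimality U T K M S \<Gamma>"
proof -
  note [simp] = support_theory.\<tau>_def[OF localizing_support_theory] support_theory.Supp_def[OF localizing_support_theory]
  have "tau_s K M S \<Gamma> = support_theory.\<tau> (Obj K) (supp K M S \<Gamma>)"
    "sigma_s K M S \<Gamma> = support_theory.Supp (supp K M S \<Gamma>)"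
    by (simp_all add: fun_eq_iff tau_s_def sigma_s_def)
  then show ?thesis
    unfolding stratified_def local_to_global_def minimality_def loc_def
    using support_theory.stratification_iff[OF localizing_support_theory] by simp
qed

lemma costratified_iff: "costratified U T K M S \<Gamma> \<longleftrightarrow> colocal_to_global U T K M S \<Gamma> \<and> cominimality U T K M S \<Gamma>"
proof -
  note [simp] = support_theory.\<tau>_def[OF colocalizing_support_theory] support_theory.Supp_def[OF colocalizing_support_theory]
  have "tau_c T K M S \<Gamma> = support_theory.\<tau> (Obj K) (cosupp T K M S \<Gamma>)"
    "sigma_c T K M S \<Gamma> = support_theory.Supp (cosupp T K M S \<Gamma>)"
    by (simp_all add: fun_eq_iff tau_c_def sigma_c_def)
  then show ?thesis
    unfolding costratified_def colocal_to_global_def cominimality_def coloc_def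
    using support_theory.stratification_iff[OF colocalizing_support_theory] by simp
qed

end

theorem theorem3p22:
  fixes U :: "'u set"
    and T :: "('o, 'm) tt_category"
    and K :: "('k, 'n) triangulated_category"
    and M :: "('o, 'm, 'k, 'n) tt_action"
    and S :: "'s topology"
    and \<Gamma> :: "'s \<Rightarrow> 'o"
  assumes "universe U"
    and "big_tt_category U T"
    and "tt_module U T K M"
    and "small U (topspace S)"
    and "good_support_cosupport_pair T S \<Gamma>"
  shows "(stratified U T K M S \<Gamma> \<longleftrightarrow>
            local_to_global U T K M S \<Gamma> \<and> minimality U T K M S \<Gamma>) \<and>
         (costratified U T K M S \<Gamma> \<longleftrightarrow>
            colocal_to_global U T K M S \<Gamma> \<and> cominimality U T K M S \<Gamma>)"
proof -
  interpret good_tt_module U T K M S \<Gamma>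
    using assms(1,3,5) by (simp add: good_tt_module_def good_tt_module_axioms_def small_tt_module_def small_tt_module_axioms_def)
  show ?thesis using stratified_iff costratified_iff by blast
qed

end
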